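(* Let $v$ be a subharmonic function on $\mathbb{C}$, $v\not\equiv-\infty$, of finite type at order $p>0$, with Riesz measure $\nu_v$, $0\notin\operatorname{supp}\nu_v$. Let $\mu=(\nu_v)^{\mathrm{bal}[[2p]]}_{\mathbb{R}^+}$ be the balayage of genus $[2p]$ of $\nu_v$ onto $\mathbb{R}^+$ and $\mu^{\mathbb{R}^+}(t)=\mu([0,t])$. Then $v$ has completely regular growth at order $p$ on the ray $\mathbb{R}^+$ if and only if there is a set $E\subset\mathbb{R}^+$ of zero relative linear measure such that the limit $$\lim_{x\to+\infty,\ x\notin E}x^{[p]+1-p}\ \mathrm{p.v.}\!\int_0^{+\infty}\frac1{x-t}\,\mu^{\mathbb{R}^+}(t)\,\frac{dt}{t^{[p]+1}}$$ exists and is finite (p.v. = Cauchy principal value at $t=x$).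
   Context: $\nu_v=\frac1{2\pi}\Delta v$. $v$ is of finite type at order $p$ if $\limsup_{r\to\infty}r^{-p}\max_{|z|=r}v(z)<\infty$. $E\subset\mathbb{R}^+$ has zero relative linear measure if $\lim_{r\to\infty}\frac1r\,\mathrm{meas}(E\cap[0,r])=0$. Completely regular growth at order $p$ on $\mathbb{R}^+$: there is such an $E$ with $\lim_{x\to+\infty,x\notin E}v(x)/x^p$ existing and finite. For $z=re^{i\theta}$, $\theta\in(0,2\pi)$: $\sqrt z=\sqrt re^{i\theta/2}$; for bounded Borel $B$, $\sqrt B=\{\pm\sqrt x:x\in B\cap\mathbb{R}^+\}$; with $q\in\mathbb{N}_0$, $\Omega^{[q]}(z,B)=\frac1\pi\int_{\sqrt B}\operatorname{Im}\frac1{t-\sqrt z}dt+\frac1\pi\int_{\sqrt B}\operatorname{Im}\frac{t^q-(\sqrt z)^q}{(\sqrt z)^q(t-\sqrt z)}dt$, and the balayage of genus $q$ onto $\mathbb{R}^+$ of a measure $\nu$ is $\nu^{\mathrm{bal}[q]}_{\mathbb{R}^+}(B)=\int_{\mathbb{C}\setminus\mathbb{R}^+}\Omega^{[q]}(z,B)d\nu(z)+\nu(B\cap\mathbb{R}^+)$. *)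

theory Defs
  imports "HOL-Analysis.Analysis"
begin

text \<open>Mean value of v over the circle of radius r around z, computed from the
  positive and negative parts (nonnegative integrals).\<close>
definition circle_mean :: "(complex \<Rightarrow> ereal) \<Rightarrow> complex \<Rightarrow> real \<Rightarrow> ereal" where
  "circle_mean v z r =
     (enn2ereal (\<integral>\<^sup>+ \<theta>. indicator {0..2*pi} \<theta> * e2ennreal (v (z + of_real r * cis \<theta>)) \<partial>lborel)
      - enn2ereal (\<integral>\<^sup>+ \<theta>. indicator {0..2*pi} \<theta> * e2ennreal (- v (z + of_real r * cis \<theta>)) \<partial>lborel))
     / ereal (2 * pi)"

definition subharmonic :: "(complex \<Rightarrow> ereal) \<Rightarrow> bool" where
  "subharmonic v \<longleftrightarrow>
     (\<forall>z. v z \<noteq> \<infinity>) \<and>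
     (\<forall>z. Limsup (at z) v \<le> v z) \<and>
     (\<forall>z r. r > 0 \<longrightarrow> v z \<le> circle_mean v z r)"

definition finite_type_order :: "(complex \<Rightarrow> ereal) \<Rightarrow> real \<Rightarrow> bool" where
  "finite_type_order v p \<longleftrightarrow>
     Limsup at_top (\<lambda>r::real. (SUP z\<in>sphere 0 r. v z) / ereal (r powr p)) < \<infinity>"

definition ddir :: "(complex \<Rightarrow> real) \<Rightarrow> complex \<Rightarrow> complex \<Rightarrow> real" where
  "ddir \<phi> e z = deriv (\<lambda>t::real. \<phi> (z + of_real t * e)) 0"

definition laplacian :: "(complex \<Rightarrow> real) \<Rightarrow> complex \<Rightarrow> real" where
  "laplacian \<phi> z = ddir (ddir \<phi> 1) 1 z + ddir (ddir \<phi> \<i>) \<i> z"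

definition test_fun :: "(complex \<Rightarrow> real) \<Rightarrow> bool" where
  "test_fun \<phi> \<longleftrightarrow>
     compact (closure {z. \<phi> z \<noteq> 0}) \<and>
     (\<exists>(D :: complex \<Rightarrow> complex \<Rightarrow>\<^sub>L real) (D2 :: complex \<Rightarrow> complex \<Rightarrow>\<^sub>L (complex \<Rightarrow>\<^sub>L real)).
        (\<forall>z. (\<phi> has_derivative blinfun_apply (D z)) (at z)) \<and>
        (\<forall>z. (D has_derivative blinfun_apply (D2 z)) (at z)) \<and>
        continuous_on UNIV D2)"

definition is_riesz_measure :: "(complex \<Rightarrow> ereal) \<Rightarrow> complex measure \<Rightarrow> bool" where
  "is_riesz_measure v \<nu> \<longleftrightarrow>
     sets \<nu> = sets borel \<and>
     (\<forall>K. compact K \<longrightarrow> emeasure \<nu> K < \<infinity>) \<and>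
     (\<forall>\<phi>. test_fun \<phi> \<longrightarrow>
        (\<integral>z. \<phi> z \<partial>\<nu>) = (1 / (2 * pi)) * (\<integral>z. real_of_ereal (v z) * laplacian \<phi> z \<partial>lborel))"

definition measure_support :: "complex measure \<Rightarrow> complex set" where
  "measure_support \<nu> = {z. \<forall>r>0. emeasure \<nu> (ball z r) > 0}"

definition Rplus :: "complex set" where
  "Rplus = complex_of_real ` {0..}"

text \<open>Branch of the square root: z = r e^{i theta}, theta in (0, 2 pi), gives sqrt r e^{i theta/2}.\<close>
definition sqrt_cut :: "complex \<Rightarrow> complex" where
  "sqrt_cut z = \<i> * csqrt (- z)"

definition sqrt_set :: "complex set \<Rightarrow> real set" where
  "sqrt_set B = {s. \<exists>x\<ge>0. complex_of_real x \<in> B \<and> (s = sqrt x \<or> s = - sqrt x)}"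

definition Omega :: "nat \<Rightarrow> complex \<Rightarrow> complex set \<Rightarrow> real" where
  "Omega q z B =
     (let w = sqrt_cut z in
       (1 / pi) * (LINT t:sqrt_set B|lborel. Im (1 / (complex_of_real t - w)))
     + (1 / pi) * (LINT t:sqrt_set B|lborel.
            Im ((complex_of_real t ^ q - w ^ q) / (w ^ q * (complex_of_real t - w)))))"

definition balayage :: "nat \<Rightarrow> complex measure \<Rightarrow> complex set \<Rightarrow> real" where
  "balayage q \<nu> B = (LINT z:(UNIV - Rplus)|\<nu>. Omega q z B) + measure \<nu> (B \<inter> Rplus)"

definition bal_dist :: "nat \<Rightarrow> complex measure \<Rightarrow> real \<Rightarrow> real" where
  "bal_dist q \<nu> t = balayage q \<nu> (complex_of_real ` {0..t})"

definition zero_rel_meas :: "real set \<Rightarrow> bool" where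
  "zero_rel_meas E \<longleftrightarrow> E \<subseteq> {0..} \<and> E \<in> sets lebesgue \<and>
     ((\<lambda>r. measure lebesgue (E \<inter> {0..r}) / r) \<longlongrightarrow> 0) at_top"

definition crg_ray :: "(complex \<Rightarrow> ereal) \<Rightarrow> real \<Rightarrow> bool" where
  "crg_ray v p \<longleftrightarrow> (\<exists>E L. zero_rel_meas E \<and>
     ((\<lambda>x. v (complex_of_real x) / ereal (x powr p)) \<longlongrightarrow> ereal L) (inf at_top (principal (- E))))"

definition pv_trunc :: "(real \<Rightarrow> real) \<Rightarrow> real \<Rightarrow> real \<Rightarrow> real" where
  "pv_trunc f x \<epsilon> = (LINT t:({0<..} - {x - \<epsilon>..x + \<epsilon>})|lborel. f t / (x - t))"

definition pv_exists :: "(real \<Rightarrow> real) \<Rightarrow> real \<Rightarrow> bool" where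
  "pv_exists f x \<longleftrightarrow> (\<exists>I. (pv_trunc f x \<longlongrightarrow> I) (at_right 0))"

definition pv_int :: "(real \<Rightarrow> real) \<Rightarrow> real \<Rightarrow> real" where
  "pv_int f x = Lim (at_right 0) (pv_trunc f x)"

end

theory Submission
  imports Defs "HOL-Real_Asymp.Real_Asymp"
begin

text \<open>Write \<open>k = [p]\<close> and \<open>q = [2p]\<close>. By the Riesz representation of functions of finite type, for almost every \<open>x > 0\<close> the
value \<open>v x\<close> is a polynomial in \<open>x\<close> of degree at most \<open>k \<le> p\<close> plus \<open>\<integral> ln \<bar>E(x/z, k)\<bar> d\<nu>(z)\<close>, where \<open>E\<close> is the
Weierstrass primary factor. For a single \<open>z\<close>, substituting \<open>\<tau> = sqrt t u\<close> in the kernel of the balayage and evaluating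
a Cauchy kernel integral shows that the principal value of the distribution function of \<open>\<Omega>\<^sup>[\<^sup>q\<^sup>](z, .)\<close> against
\<open>dt / (t^(k+1) (x - t))\<close> is \<open>x^(-k-1) ln \<bar>E(x/z, k)\<bar>\<close>. Exchanging the principal value with the integral over \<open>\<nu>\<close>
is justified for almost every \<open>x\<close>: the truncated principal values are dominated by an oscillation integral of the total
variation kernel which is locally integrable in \<open>x\<close>. Hence the two quantities in the theorem differ, off a null set, by a
polynomial divided by \<open>x^p\<close>, which converges, and a null set may be added to the exceptional set \<open>E\<close>.\<close>

section \<open>Radial means of subharmonic functions\<close>

text \<open>The balayage has genus \<open>[2p]\<close> while the principal value carries
  \<open>[p]\<close>. They fit because only the part of the kernel that is even in \<tau> survives
  on \<open>{- sqrt t..sqrt t}\<close>, and its degree \<open>(q + 1) div 2\<close> is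
  \<open>k\<close> or \<open>k + 1\<close>. After division by \<open>t ^ (k + 1)\<close> the two
  cases differ by a constant multiple of \<open>t powr (- (1 / 2))\<close>, whose principal value is
  0. One exponent \<alpha> with \<open>p < \<alpha> < (q + 1) / 2\<close> carries all estimates:
  \<open>cmod z powr (- \<alpha>)\<close> is integrable for the Riesz measure, the variation of the
  kernel up to \<open>t\<close> is bounded by a multiple of
  \<open>(t / cmod z) powr \<alpha>\<close>, and \<open>k < \<alpha> < k + 1\<close> makes
  \<open>t powr (\<alpha> - k - 1) / \<bar>x - t\<bar>\<close> integrable away from
  \<open>x\<close>. The representation of \<open>v\<close> is derived from the distributional
  identity of the Riesz measure, tested on a smoothed and truncated copy of the primary factor. Its
  Laplacian has three pieces: a mean of \<open>v\<close> near \<open>x\<close>, an annulus far out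
  that disappears in the limit, and an annulus near 0 that produces the polynomial.\<close>

lemma lborel_complex_eq:
  "(lborel :: complex measure) = distr (lborel \<Otimes>\<^sub>M lborel) borel (\<lambda>(x,y). Complex x y)"
proof (rule lborel_eqI)
  have m: "(\<lambda>(x,y). Complex x y) \<in> borel_measurable (lborel \<Otimes>\<^sub>M lborel)"
    unfolding Complex_eq split_def by measurable
  fix l u :: complex
  assume le: "\<And>b. b \<in> Basis \<Longrightarrow> l \<bullet> b \<le> u \<bullet> b"
  have "l \<bullet> 1 \<le> u \<bullet> 1" "l \<bullet> \<i> \<le> u \<bullet> \<i>"
    using le[of 1] le[of \<i>] by (auto simp: Basis_complex_def)
  hence le': "Re l \<le> Re u" "Im l \<le> Im u" by (auto simp: inner_complex_def)
  have "emeasure (distr (lborel \<Otimes>\<^sub>M lborel) borel (\<lambda>(x,y). Complex x y)) (box l u) =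
     emeasure (lborel \<Otimes>\<^sub>M lborel) ((\<lambda>(x,y). Complex x y) -` box l u \<inter> space (lborel \<Otimes>\<^sub>M lborel))"
    by (rule emeasure_distr) (use m in auto)
  also have "(\<lambda>(x,y). Complex x y) -` box l u \<inter> space (lborel \<Otimes>\<^sub>M lborel) = {Re l<..<Re u} \<times> {Im l<..<Im u}"
    by (auto simp: box_def Basis_complex_def inner_complex_def space_pair_measure)
  also have "emeasure (lborel \<Otimes>\<^sub>M lborel) ({Re l<..<Re u} \<times> {Im l<..<Im u}) = ennreal (\<Prod>b\<in>Basis. (u - l) \<bullet> b)"
    using le' by (subst lborel.emeasure_pair_measure_Times)
      (auto simp: Basis_complex_def inner_complex_def ennreal_mult)
  finally show "emeasure (distr (lborel \<Otimes>\<^sub>M lborel) borel (\<lambda>(x,y). Complex x y)) (box l u) = ennreal (\<Prod>b\<in>Basis. (u - l) \<bullet> b)" .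
qed simp

lemma nn_integral_lborel_complex:
  fixes f :: "complex \<Rightarrow> ennreal"
  assumes [measurable]: "f \<in> borel_measurable borel"
  shows "(\<integral>\<^sup>+ z. f z \<partial>lborel) = (\<integral>\<^sup>+ y. \<integral>\<^sup>+ x. f (Complex x y) \<partial>lborel \<partial>lborel)"
    and "(\<integral>\<^sup>+ z. f z \<partial>lborel) = (\<integral>\<^sup>+ x. \<integral>\<^sup>+ y. f (Complex x y) \<partial>lborel \<partial>lborel)"
proof -
  have m[measurable]: "(\<lambda>(x,y). Complex x y) \<in> borel_measurable (lborel \<Otimes>\<^sub>M lborel)"
    unfolding Complex_eq split_def by measurable
  have *: "(\<integral>\<^sup>+ z. f z \<partial>lborel) = (\<integral>\<^sup>+ xy. f (case xy of (x,y) \<Rightarrow> Complex x y) \<partial>(lborel \<Otimes>\<^sub>M lborel))"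
    by (subst lborel_complex_eq, subst nn_integral_distr) auto
  have m2: "(\<lambda>(x,y). f (Complex x y)) \<in> borel_measurable (lborel \<Otimes>\<^sub>M lborel)"
    using measurable_comp[OF m, of f borel] by (simp add: comp_def split_def)
  show "(\<integral>\<^sup>+ z. f z \<partial>lborel) = (\<integral>\<^sup>+ y. \<integral>\<^sup>+ x. f (Complex x y) \<partial>lborel \<partial>lborel)"
    unfolding * using lborel_pair.nn_integral_snd[OF m2] by (simp add: split_def)
  show "(\<integral>\<^sup>+ z. f z \<partial>lborel) = (\<integral>\<^sup>+ x. \<integral>\<^sup>+ y. f (Complex x y) \<partial>lborel \<partial>lborel)"
    unfolding * using lborel.nn_integral_fst[OF m2] by (simp add: split_def)
qed

section \<open>Translations, rotations and polar averaging for planar Lebesgue integrals\<close>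

lemma nn_integral_shift:
  fixes f :: "'a::euclidean_space \<Rightarrow> ennreal"
  assumes [measurable]: "f \<in> borel_measurable borel"
  shows "(\<integral>\<^sup>+ x. f (a + x) \<partial>lborel) = (\<integral>\<^sup>+ x. f x \<partial>lborel)"
  using nn_integral_distr[of "(+) a" lborel borel f] by (simp add: lborel_distr_plus)

text \<open>A rotation by \<theta> is a product of three shears, horizontal, vertical, horizontal,
  with parameters \<open>- tan (\<theta> / 2)\<close>, \<open>sin \<theta>\<close>,
  \<open>- tan (\<theta> / 2)\<close>. Each shear translates one coordinate for fixed value of the
  other, so Tonelli and translation invariance suffice. The half-angle tangent is \<open>t\<close>,
  and it is why \<open>w = -1\<close> is set aside.\<close>

lemma nn_integral_rotate_aux:
  fixes f :: "complex \<Rightarrow> ennreal"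
  assumes [measurable]: "f \<in> borel_measurable borel" and w: "cmod w = 1" "w \<noteq> -1"
  shows "(\<integral>\<^sup>+ z. f (w * z) \<partial>lborel) = (\<integral>\<^sup>+ z. f z \<partial>lborel)"
proof -
  define t where "t = Im w / (1 + Re w)"
  have w2: "(Re w)\<^sup>2 + (Im w)\<^sup>2 = 1" using w(1) by (metis cmod_power2 one_power2)
  have ne: "1 + Re w \<noteq> 0"
  proof
    assume "1 + Re w = 0"
    hence "Re w = -1" by simp
    moreover from this w2 have "Im w = 0" by simp
    ultimately show False using w(2) by (simp add: complex_eq_iff)
  qed
  have shX: "(\<integral>\<^sup>+ z. g (Complex (Re z + a * Im z) (Im z)) \<partial>lborel) = (\<integral>\<^sup>+ z. g z \<partial>lborel)"
    if [measurable]: "g \<in> borel_measurable borel" for g :: "complex \<Rightarrow> ennreal" and a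
  proof -
    have [measurable]: "(\<lambda>z. g (Complex (Re z + a * Im z) (Im z))) \<in> borel_measurable borel"
      unfolding Complex_eq by measurable
    have [measurable]: "(\<lambda>x. g (Complex x y)) \<in> borel_measurable borel" for y
      unfolding Complex_eq by measurable
    show ?thesis
      using nn_integral_shift[of "\<lambda>x. g (Complex x y)" "a * y" for y]
      by (simp add: nn_integral_lborel_complex(1) add.commute)
  qed
  have shY: "(\<integral>\<^sup>+ z. g (Complex (Re z) (Im z + a * Re z)) \<partial>lborel) = (\<integral>\<^sup>+ z. g z \<partial>lborel)"
    if [measurable]: "g \<in> borel_measurable borel" for g :: "complex \<Rightarrow> ennreal" and a
  proof -
    have [measurable]: "(\<lambda>z. g (Complex (Re z) (Im z + a * Re z))) \<in> borel_measurable borel"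
      unfolding Complex_eq by measurable
    have [measurable]: "(\<lambda>y. g (Complex x y)) \<in> borel_measurable borel" for x
      unfolding Complex_eq by measurable
    show ?thesis
      using nn_integral_shift[of "\<lambda>y. g (Complex x y)" "a * x" for x]
      by (simp add: nn_integral_lborel_complex(2) add.commute)
  qed
  define f1 where "f1 = (\<lambda>z. f (Complex (Re z + (-t) * Im z) (Im z)))"
  define f2 where "f2 = (\<lambda>z. f1 (Complex (Re z) (Im z + Im w * Re z)))"
  have m1: "f1 \<in> borel_measurable borel"
     unfolding f1_def Complex_eq by measurable
  have m2: "f2 \<in> borel_measurable borel"
     using m1 unfolding f2_def Complex_eq by measurable
  have "(\<integral>\<^sup>+ z. f z \<partial>lborel) = (\<integral>\<^sup>+ z. f1 z \<partial>lborel)"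
    unfolding f1_def by (rule shX[symmetric]) fact
  also have "\<dots> = (\<integral>\<^sup>+ z. f2 z \<partial>lborel)"
    unfolding f2_def by (rule shY[symmetric]) fact
  also have "\<dots> = (\<integral>\<^sup>+ z. f2 (Complex (Re z + (-t) * Im z) (Im z)) \<partial>lborel)"
    by (rule shX[symmetric]) fact
  also have "\<dots> = (\<integral>\<^sup>+ z. f ((Complex ((Re z + (-t) * Im z) + (-t) * (Im z + Im w * (Re z + (-t) * Im z))) (Im z + Im w * (Re z + (-t) * Im z)))) \<partial>lborel)"
    by (simp add: f1_def f2_def)
  also have "\<dots> = (\<integral>\<^sup>+ z. f (w * z) \<partial>lborel)"
  proof -
    have 1: "1 - Im w * t = Re w"
      using ne w2 unfolding t_def by (simp add: field_simps power2_eq_square)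
    have 2: "2 * t - Im w * t * t = Im w"
    proof -
      have "2 * t - Im w * t * t = t * (1 + (1 - Im w * t))" by (simp add: algebra_simps)
      also have "\<dots> = Im w" unfolding 1 using ne by (simp add: t_def)
      finally show ?thesis .
    qed
    have "Complex ((Re z + (-t) * Im z) + (-t) * (Im z + Im w * (Re z + (-t) * Im z))) (Im z + Im w * (Re z + (-t) * Im z)) = w * z" for z
    proof -
      have "(Re z + (-t) * Im z) + (-t) * (Im z + Im w * (Re z + (-t) * Im z)) = (1 - Im w * t) * Re z - (2 * t - Im w * t * t) * Im z"
        by (simp add: algebra_simps)
      moreover have "Im z + Im w * (Re z + (-t) * Im z) = Im w * Re z + (1 - Im w * t) * Im z"
        by (simp add: algebra_simps)
      ultimately show ?thesis unfolding 1 2 by (simp add: complex_eq_iff)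
    qed
    thus ?thesis by simp
  qed
  finally show ?thesis by simp
qed

lemma nn_integral_rotate:
  fixes f :: "complex \<Rightarrow> ennreal"
  assumes [measurable]: "f \<in> borel_measurable borel" and w: "cmod w = 1"
  shows "(\<integral>\<^sup>+ z. f (w * z) \<partial>lborel) = (\<integral>\<^sup>+ z. f z \<partial>lborel)"
proof (cases "w = -1")
  case True
  \<comment> \<open>The missing half turn is two quarter turns.\<close>
  have "(\<integral>\<^sup>+ z. f (w * z) \<partial>lborel) = (\<integral>\<^sup>+ z. f (\<i> * (\<i> * z)) \<partial>lborel)"
    by (simp add: True mult.assoc[symmetric])
  also have "\<dots> = (\<integral>\<^sup>+ z. f (\<i> * z) \<partial>lborel)"
    by (rule nn_integral_rotate_aux[of "\<lambda>z. f (\<i> * z)"]) (auto simp: complex_eq_iff)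
  also have "\<dots> = (\<integral>\<^sup>+ z. f z \<partial>lborel)"
    by (rule nn_integral_rotate_aux) (auto simp: complex_eq_iff)
  finally show ?thesis .
next
  case False thus ?thesis using nn_integral_rotate_aux assms by blast
qed

lemma nn_integral_periodic_shift:
  fixes g :: "real \<Rightarrow> ennreal"
  assumes [measurable]: "g \<in> borel_measurable borel"
    and per: "\<And>t. g (t + c) = g t" and a: "0 \<le> a" "a \<le> c"
  shows "(\<integral>\<^sup>+ t. indicator {0..c} t * g (a + t) \<partial>lborel) = (\<integral>\<^sup>+ t. indicator {0..c} t * g t \<partial>lborel)"
proof -
  have "(\<integral>\<^sup>+ t. indicator {0..c} t * g (a + t) \<partial>lborel) = (\<integral>\<^sup>+ t. indicator {a..a+c} (a+t) * g (a + t) \<partial>lborel)"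
    by (intro nn_integral_cong) (auto simp: indicator_def)
  also have "\<dots> = (\<integral>\<^sup>+ t. indicator {a..a+c} t * g t \<partial>lborel)"
    by (rule nn_integral_shift) simp
  also have "\<dots> = (\<integral>\<^sup>+ t. indicator {a..c} t * g t + indicator {c<..a+c} t * g t \<partial>lborel)"
    using a by (intro nn_integral_cong) (auto simp: indicator_def)
  also have "\<dots> = (\<integral>\<^sup>+ t. indicator {a..c} t * g t \<partial>lborel) + (\<integral>\<^sup>+ t. indicator {c<..a+c} t * g t \<partial>lborel)"
    by (rule nn_integral_add) simp_all
  also have "(\<integral>\<^sup>+ t. indicator {c<..a+c} t * g t \<partial>lborel) = (\<integral>\<^sup>+ t. indicator {c<..a+c} (c + t) * g (c + t) \<partial>lborel)"
    by (rule nn_integral_shift[symmetric]) simp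
  also have "\<dots> = (\<integral>\<^sup>+ t. indicator {0<..a} t * g t \<partial>lborel)"
    by (intro nn_integral_cong) (auto simp: indicator_def per add.commute[of c])
  also have "(\<integral>\<^sup>+ t. indicator {a..c} t * g t \<partial>lborel) + \<dots> = (\<integral>\<^sup>+ t. indicator {a..c} t * g t + indicator {0<..a} t * g t \<partial>lborel)"
    by (rule nn_integral_add[symmetric]) simp_all
  also have "\<dots> = (\<integral>\<^sup>+ t. indicator {0..c} t * g t \<partial>lborel)"
  proof (rule nn_integral_cong_AE)
    have "AE t in lborel. t \<noteq> 0 \<and> t \<noteq> a"
      using AE_lborel_singleton[of 0] AE_lborel_singleton[of a] by auto
    thus "AE t in lborel. indicator {a..c} t * g t + indicator {0<..a} t * g t = indicator {0..c} t * g t"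
      by eventually_elim (use a in \<open>auto simp: indicator_def\<close>)
  qed
  finally show ?thesis .
qed

text \<open>Polar averaging without a Jacobian: the integral does not change when \<open>z\<close>
  is rotated, so it may be averaged over all rotations. After Tonelli the inner integral runs once
  around the circle through \<open>z\<close>, starting at the angle \<open>Arg2pi z\<close>, and
  periodicity removes that starting angle.\<close>

lemma nn_integral_radial:
  fixes f :: "complex \<Rightarrow> ennreal" and h :: "real \<Rightarrow> ennreal"
  assumes [measurable]: "f \<in> borel_measurable borel" "h \<in> borel_measurable borel"
  shows "ennreal (2 * pi) * (\<integral>\<^sup>+ z. h (cmod z) * f (a + z) \<partial>lborel) =
    (\<integral>\<^sup>+ z. h (cmod z) * (\<integral>\<^sup>+ \<theta>. indicator {0..2*pi} \<theta> * f (a + of_real (cmod z) * cis \<theta>) \<partial>lborel) \<partial>lborel)"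
proof -
  have [measurable]: "cis \<in> borel_measurable borel"
    by (intro borel_measurable_continuous_onI continuous_intros)
  have rot: "(\<integral>\<^sup>+ z. h (cmod z) * f (a + cis \<theta> * z) \<partial>lborel) = (\<integral>\<^sup>+ z. h (cmod z) * f (a + z) \<partial>lborel)" for \<theta>
  proof -
    have "(\<integral>\<^sup>+ z. h (cmod (cis \<theta> * z)) * f (a + cis \<theta> * z) \<partial>lborel) = (\<integral>\<^sup>+ z. h (cmod z) * f (a + z) \<partial>lborel)"
      by (rule nn_integral_rotate) auto
    thus ?thesis by (simp add: norm_mult)
  qed
  have "ennreal (2 * pi) * (\<integral>\<^sup>+ z. h (cmod z) * f (a + z) \<partial>lborel) =
    (\<integral>\<^sup>+ \<theta>. indicator {0..2*pi} \<theta> * (\<integral>\<^sup>+ z. h (cmod z) * f (a + z) \<partial>lborel) \<partial>lborel)"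
    by (subst nn_integral_multc) auto
  also have "\<dots> = (\<integral>\<^sup>+ \<theta>. indicator {0..2*pi} \<theta> * (\<integral>\<^sup>+ z. h (cmod z) * f (a + cis \<theta> * z) \<partial>lborel) \<partial>lborel)"
    by (simp add: rot)
  also have "\<dots> = (\<integral>\<^sup>+ \<theta>. (\<integral>\<^sup>+ z. indicator {0..2*pi} \<theta> * (h (cmod z) * f (a + cis \<theta> * z)) \<partial>lborel) \<partial>lborel)"
    by (intro nn_integral_cong, subst nn_integral_cmult) auto
  also have "\<dots> = (\<integral>\<^sup>+ z. (\<integral>\<^sup>+ \<theta>. indicator {0..2*pi} \<theta> * (h (cmod z) * f (a + cis \<theta> * z)) \<partial>lborel) \<partial>lborel)"
    by (rule lborel_pair.Fubini') simp
  also have "\<dots> = (\<integral>\<^sup>+ z. h (cmod z) * (\<integral>\<^sup>+ \<theta>. indicator {0..2*pi} \<theta> * f (a + of_real (cmod z) * cis \<theta>) \<partial>lborel) \<partial>lborel)"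
  proof (rule nn_integral_cong)
    fix z :: complex
    define g where "g = (\<lambda>\<theta>. f (a + of_real (cmod z) * cis \<theta>))"
    have [measurable]: "g \<in> borel_measurable borel" unfolding g_def by measurable
    have z: "z = of_real (cmod z) * cis (Arg2pi z)"
      using Arg2pi_eq[of z] by (simp add: cis_conv_exp)
    have "(\<integral>\<^sup>+ \<theta>. indicator {0..2*pi} \<theta> * (h (cmod z) * f (a + cis \<theta> * z)) \<partial>lborel)
      = (\<integral>\<^sup>+ \<theta>. h (cmod z) * (indicator {0..2*pi} \<theta> * g (Arg2pi z + \<theta>)) \<partial>lborel)"
      by (intro nn_integral_cong, subst (2) z) (simp add: g_def cis_mult[symmetric] mult_ac)
    also have "\<dots> = h (cmod z) * (\<integral>\<^sup>+ \<theta>. (indicator {0..2*pi} \<theta> * g (Arg2pi z + \<theta>)) \<partial>lborel)"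
      by (rule nn_integral_cmult) simp
    also have "(\<integral>\<^sup>+ \<theta>. (indicator {0..2*pi} \<theta> * g (Arg2pi z + \<theta>)) \<partial>lborel) = (\<integral>\<^sup>+ \<theta>. (indicator {0..2*pi} \<theta> * g \<theta>) \<partial>lborel)"
      by (rule nn_integral_periodic_shift)
         (use Arg2pi_ge_0 Arg2pi_lt_2pi[of z] in \<open>auto simp: g_def cis_mult[symmetric] cis_2pi\<close>)
    finally show "(\<integral>\<^sup>+ \<theta>. indicator {0..2*pi} \<theta> * (h (cmod z) * f (a + cis \<theta> * z)) \<partial>lborel) = h (cmod z) * (\<integral>\<^sup>+ \<theta>. indicator {0..2*pi} \<theta> * f (a + of_real (cmod z) * cis \<theta>) \<partial>lborel)"
      by (simp add: g_def)
  qed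
  finally show ?thesis .
qed

section \<open>Semicontinuity and averaged sub-mean inequalities of subharmonic functions\<close>

lemma subharmonic_open_less:
  assumes "subharmonic v" shows "open {z. v z < c}"
proof (subst open_subopen, safe)
  fix z assume "v z < c"
  hence "Limsup (at z) v < c" using assms unfolding subharmonic_def by (meson order.strict_trans1)
  hence "eventually (\<lambda>w. v w < c) (at z)" by (rule Limsup_lessD)
  then obtain S where "open S" "z \<in> S" "\<And>w. w \<in> S \<Longrightarrow> w \<noteq> z \<Longrightarrow> v w < c"
    unfolding eventually_at_topological by blast
  thus "\<exists>T. open T \<and> z \<in> T \<and> T \<subseteq> {z. v z < c}"
    using \<open>v z < c\<close> by (intro exI[of _ S]) auto
qed

lemma subharmonic_borel:
  assumes "subharmonic v" shows "v \<in> borel_measurable borel"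
  by (rule borel_measurableI_less) (use subharmonic_open_less[OF assms] in auto)

lemma subharmonic_bdd_above:
  assumes "subharmonic v" "compact K"
  obtains M :: real where "M \<ge> 0" "\<And>z. z \<in> K \<Longrightarrow> v z \<le> ereal M"
proof -
  have "K \<subseteq> (\<Union>n::nat. {z. v z < ereal (real n)})"
  proof
    fix z assume "z \<in> K"
    have "v z \<noteq> \<infinity>" using assms(1) by (auto simp: subharmonic_def)
    then obtain n :: nat where "v z < ereal (real n)"
      using less_PInf_Ex_of_nat by auto
    thus "z \<in> (\<Union>n::nat. {z. v z < ereal (real n)})" by blast
  qed
  with assms(2) obtain C where C: "finite C" "K \<subseteq> (\<Union>n\<in>C. {z. v z < ereal (real n)})"
    using subharmonic_open_less[OF assms(1)]
    by (elim compactE_image[of K UNIV "\<lambda>n. {z. v z < ereal (real n)}"]) auto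
  show thesis
  proof (rule that)
    show "real (Max (insert 0 C)) \<ge> 0" by simp
    fix z assume "z \<in> K"
    then obtain n where n: "n \<in> C" "v z < ereal (real n)" using C by blast
    hence "n \<le> Max (insert 0 C)" using C(1) by simp
    thus "v z \<le> ereal (real (Max (insert 0 C)))"
      using n(2) by (meson ereal_less_eq(3) less_imp_le of_nat_mono order_trans)
  qed
qed

lemma integral_enn2real:
  assumes [measurable]: "f \<in> borel_measurable M" and fin: "(\<integral>\<^sup>+ x. f x \<partial>M) < \<infinity>"
  shows "integrable M (\<lambda>x. enn2real (f x))"
    and "(\<integral>x. enn2real (f x) \<partial>M) = enn2real (\<integral>\<^sup>+ x. f x \<partial>M)"
proof -
  have "AE x in M. f x \<noteq> \<infinity>"
    by (rule nn_integral_PInf_AE) (use fin in auto)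
  hence *: "(\<integral>\<^sup>+ x. ennreal (enn2real (f x)) \<partial>M) = (\<integral>\<^sup>+ x. f x \<partial>M)"
    by (intro nn_integral_cong_AE) (auto simp: less_top)
  show "integrable M (\<lambda>x. enn2real (f x))"
    by (rule integrableI_nonneg) (use fin * in auto)
  show "(\<integral>x. enn2real (f x) \<partial>M) = enn2real (\<integral>\<^sup>+ x. f x \<partial>M)"
    by (subst integral_eq_nn_integral) (auto simp: *)
qed

lemma real_of_ereal_split:
  "y \<noteq> \<infinity> \<Longrightarrow> real_of_ereal y = enn2real (e2ennreal y) - enn2real (e2ennreal (- y))"
proof (cases y)
  case (real r)
  thus ?thesis by (cases "r \<ge> 0") (simp_all add: ennreal_neg)
qed (auto simp: e2ennreal_neg)

text \<open>The sub-mean inequality with every negative term moved to the other side;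
  \<open>ennreal c\<close> and \<open>ennreal (- c)\<close> are the positive and negative parts of
  \<open>c\<close>. In this form it can be integrated over the radius before anything is known about
  the integrability of the negative part of \<open>v\<close>.\<close>

lemma circle_mean_ge_imp:
  fixes v :: "complex \<Rightarrow> ereal"
  assumes v: "subharmonic v" and c: "v z0 = ereal c" and r: "r > 0"
  shows "(\<integral>\<^sup>+ \<theta>. indicator {0..2*pi} \<theta> * e2ennreal (- v (z0 + of_real r * cis \<theta>)) \<partial>lborel) + ennreal (2 * pi) * ennreal c
    \<le> (\<integral>\<^sup>+ \<theta>. indicator {0..2*pi} \<theta> * e2ennreal (v (z0 + of_real r * cis \<theta>)) \<partial>lborel) + ennreal (2 * pi) * ennreal (- c)"
  (is "?m + _ \<le> ?p + _")
proof -
  have "compact (sphere z0 r)" by simp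
  then obtain M where M: "M \<ge> 0" "\<And>z. z \<in> sphere z0 r \<Longrightarrow> v z \<le> ereal M"
    using subharmonic_bdd_above[OF v] by metis
  have "?p \<le> (\<integral>\<^sup>+ \<theta>. ennreal M * indicator {0..2*pi} \<theta> \<partial>lborel)"
  proof (rule nn_integral_mono)
    fix \<theta> :: real
    have "z0 + of_real r * cis \<theta> \<in> sphere z0 r" using r by (simp add: dist_norm norm_mult)
    hence "e2ennreal (v (z0 + of_real r * cis \<theta>)) \<le> e2ennreal (ereal M)"
      by (intro e2ennreal_mono M)
    thus "indicator {0..2*pi} \<theta> * e2ennreal (v (z0 + of_real r * cis \<theta>)) \<le> ennreal M * indicator {0..2*pi} \<theta>"
      by (simp add: indicator_def)
  qed
  also have "\<dots> < \<infinity>" by (subst nn_integral_cmult) (auto simp: ennreal_mult_less_top)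
  finally obtain a where a: "?p = ennreal a" "a \<ge> 0" by (cases ?p rule: ennreal_cases) auto
  have le: "ereal c \<le> (enn2ereal ?p - enn2ereal ?m) / ereal (2 * pi)"
  proof -
    have "v z0 \<le> circle_mean v z0 r" using v r unfolding subharmonic_def by blast
    thus ?thesis unfolding circle_mean_def c .
  qed
  \<comment> \<open>\<open>?p\<close> is finite, so an infinite \<open>?m\<close> would make the
    circle mean minus infinity, below the finite value \<open>c\<close>.\<close>
  have "?m \<noteq> \<infinity>"
  proof
    assume "?m = \<infinity>"
    with le a show False by simp
  qed
  then obtain b where b: "?m = ennreal b" "b \<ge> 0" using ennreal_cases by auto
  have "c \<le> (a - b) / (2 * pi)"
    using le a b by (simp add: enn2ereal_ennreal)
  hence *: "b + 2 * pi * c \<le> a" by (simp add: field_simps)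
  show ?thesis
  proof (cases "c \<ge> 0")
    case True
    thus ?thesis unfolding a b using a b *
      by (auto simp: ennreal_mult[symmetric] ennreal_plus[symmetric] ennreal_neg simp del: ennreal_plus)
  next
    case False
    hence "0 \<le> - (2 * pi * c)" by (simp add: mult_nonneg_nonpos)
    thus ?thesis unfolding a b using False a b *
      by (auto simp: ennreal_mult[symmetric] ennreal_plus[symmetric] ennreal_neg simp del: ennreal_plus)
  qed
qed

text \<open>Integrates the circle inequality against a radial weight. The positive part of
  \<open>v\<close> is bounded on discs by compactness, so a single point with a finite value
  controls the negative part as well. The weight is taken to be the indicator of a disc for the
  growth estimates and \<open>chi\<close> for the smoothed means.\<close>

lemma subharmonic_radial_mean:
  fixes v :: "complex \<Rightarrow> ereal" and h :: "real \<Rightarrow> real"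
  assumes v: "subharmonic v" and c: "v z0 = ereal c"
    and h[measurable]: "h \<in> borel_measurable borel"
    and h0: "\<And>t. 0 \<le> h t" "\<And>t. h t \<le> H" "\<And>t. t > R \<Longrightarrow> h t = 0"
  shows "integrable lborel (\<lambda>z. h (cmod z) * real_of_ereal (v (z0 + z)))" (is ?A)
    and "c * (\<integral>z. h (cmod z) \<partial>lborel) \<le> (\<integral>z. h (cmod z) * real_of_ereal (v (z0 + z)) \<partial>lborel)" (is ?B)
    and "AE z in lborel. h (cmod z) > 0 \<longrightarrow> v (z0 + z) \<noteq> -\<infinity>" (is ?C)
proof -
  note [measurable] = subharmonic_borel[OF v]
  have [measurable]: "cis \<in> borel_measurable borel"
    by (intro borel_measurable_continuous_onI continuous_intros)
  define Ip where "Ip = (\<integral>\<^sup>+ z. ennreal (h (cmod z)) * e2ennreal (v (z0 + z)) \<partial>lborel)"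
  \<comment> \<open>Within this proof \<open>Im\<close> is the weighted integral of the negative
    part and hides the imaginary part.\<close>
  define Im where "Im = (\<integral>\<^sup>+ z. ennreal (h (cmod z)) * e2ennreal (- v (z0 + z)) \<partial>lborel)"
  define X where "X = (\<integral>\<^sup>+ z. ennreal (h (cmod z)) \<partial>(lborel :: complex measure))"
  obtain M where M: "M \<ge> 0" "\<And>z. z \<in> cball z0 R \<Longrightarrow> v z \<le> ereal M"
    using subharmonic_bdd_above[OF v compact_cball] by metis
  have ball: "emeasure lborel (cball (0::complex) R) < \<infinity>"
    by (rule emeasure_bounded_finite) simp
  have cint: "(\<integral>\<^sup>+ z. C * indicator (cball 0 R) z \<partial>(lborel :: complex measure)) < \<infinity>" if "C < \<infinity>" for C :: ennreal
  proof -
    have "(\<integral>\<^sup>+ z. C * indicator (cball 0 R) z \<partial>(lborel :: complex measure)) = C * emeasure lborel (cball (0::complex) R)"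
      by (rule nn_integral_cmult_indicator) simp
    also have "\<dots> < \<infinity>" using that ball by (metis ennreal_mult_less_top infinity_ennreal_def)
    finally show ?thesis .
  qed
  have "X \<le> (\<integral>\<^sup>+ z. ennreal H * indicator (cball 0 R) z \<partial>(lborel :: complex measure))"
    unfolding X_def
  proof (intro nn_integral_mono)
    fix z :: complex
    show "ennreal (h (cmod z)) \<le> ennreal H * indicator (cball 0 R) z"
      using h0(2)[of "cmod z"] h0(3)[of "cmod z"] by (cases "cmod z \<le> R") (auto intro: ennreal_leI)
  qed
  also have "\<dots> < \<infinity>" by (rule cint) (simp add: ennreal_mult_less_top)
  finally have X: "X < \<infinity>" .
  have "Ip \<le> (\<integral>\<^sup>+ z. (ennreal M * ennreal H) * indicator (cball 0 R) z \<partial>(lborel :: complex measure))"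
    unfolding Ip_def
  proof (intro nn_integral_mono)
    fix z :: complex
    show "ennreal (h (cmod z)) * e2ennreal (v (z0 + z)) \<le> (ennreal M * ennreal H) * indicator (cball 0 R) z"
    proof (cases "cmod z \<le> R")
      case True
      hence "e2ennreal (v (z0 + z)) \<le> e2ennreal (ereal M)"
        by (intro e2ennreal_mono M) (simp add: dist_norm)
      moreover have "ennreal (h (cmod z)) \<le> ennreal H" using h0 by (simp add: ennreal_leI)
      ultimately show ?thesis using True
        by (auto intro!: mult_mono simp: mult.commute)
    next
      case False thus ?thesis using h0(3)[of "cmod z"] by simp
    qed
  qed
  also have "\<dots> < \<infinity>" by (rule cint) (simp add: ennreal_mult_less_top)
  finally have Ip: "Ip < \<infinity>" .
  have rad: "ennreal (2 * pi) * (\<integral>\<^sup>+ z. ennreal (h (cmod z)) * f (z0 + z) \<partial>lborel) =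
    (\<integral>\<^sup>+ z. ennreal (h (cmod z)) * (\<integral>\<^sup>+ \<theta>. indicator {0..2*pi} \<theta> * f (z0 + of_real (cmod z) * cis \<theta>) \<partial>lborel) \<partial>lborel)"
    if [measurable]: "f \<in> borel_measurable borel" for f :: "complex \<Rightarrow> ennreal"
    by (rule nn_integral_radial[where h = "\<lambda>t. ennreal (h t)"]) measurable
  have m1: "(\<lambda>z. ennreal (h (cmod z)) * (\<integral>\<^sup>+ \<theta>. indicator {0..2*pi} \<theta> * f (z0 + of_real (cmod z) * cis \<theta>) \<partial>lborel)) \<in> borel_measurable (lborel :: complex measure)"
    if [measurable]: "f \<in> borel_measurable borel" for f :: "complex \<Rightarrow> ennreal"
    by measurable
  have [measurable]: "(\<lambda>z. e2ennreal (v z)) \<in> borel_measurable borel" "(\<lambda>z. e2ennreal (- v z)) \<in> borel_measurable borel"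
    by measurable
  have sumI: "ennreal (2 * pi) * (\<integral>\<^sup>+ z. ennreal (h (cmod z)) * f (z0 + z) \<partial>lborel) + ennreal (2 * pi) * d * X =
    (\<integral>\<^sup>+ z. ennreal (h (cmod z)) * (\<integral>\<^sup>+ \<theta>. indicator {0..2*pi} \<theta> * f (z0 + of_real (cmod z) * cis \<theta>) \<partial>lborel) + ennreal (h (cmod z)) * (ennreal (2 * pi) * d) \<partial>lborel)"
    if f: "f \<in> borel_measurable borel" for f :: "complex \<Rightarrow> ennreal" and d
  proof -
    have "(\<integral>\<^sup>+ z. ennreal (h (cmod z)) * (ennreal (2 * pi) * d) \<partial>(lborel :: complex measure)) = X * (ennreal (2 * pi) * d)"
      unfolding X_def by (rule nn_integral_multc) simp
    moreover have "(\<integral>\<^sup>+ z. ennreal (h (cmod z)) * (\<integral>\<^sup>+ \<theta>. indicator {0..2*pi} \<theta> * f (z0 + of_real (cmod z) * cis \<theta>) \<partial>lborel) + ennreal (h (cmod z)) * (ennreal (2 * pi) * d) \<partial>lborel)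
      = (\<integral>\<^sup>+ z. ennreal (h (cmod z)) * (\<integral>\<^sup>+ \<theta>. indicator {0..2*pi} \<theta> * f (z0 + of_real (cmod z) * cis \<theta>) \<partial>lborel) \<partial>lborel) + (\<integral>\<^sup>+ z. ennreal (h (cmod z)) * (ennreal (2 * pi) * d) \<partial>(lborel :: complex measure))"
      by (rule nn_integral_add[OF m1[OF f]]) simp
    ultimately show ?thesis by (simp only: rad[OF f] mult.commute[of X])
  qed
  have "ennreal (2 * pi) * Im + ennreal (2 * pi) * ennreal c * X =
    (\<integral>\<^sup>+ z. ennreal (h (cmod z)) * (\<integral>\<^sup>+ \<theta>. indicator {0..2*pi} \<theta> * e2ennreal (- v (z0 + of_real (cmod z) * cis \<theta>)) \<partial>lborel) + ennreal (h (cmod z)) * (ennreal (2 * pi) * ennreal c) \<partial>lborel)"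
    unfolding Im_def by (rule sumI) simp
  also have "\<dots> \<le> (\<integral>\<^sup>+ z. ennreal (h (cmod z)) * (\<integral>\<^sup>+ \<theta>. indicator {0..2*pi} \<theta> * e2ennreal (v (z0 + of_real (cmod z) * cis \<theta>)) \<partial>lborel) + ennreal (h (cmod z)) * (ennreal (2 * pi) * ennreal (-c)) \<partial>lborel)"
  proof (rule nn_integral_mono_AE)
    have "AE z in lborel. z \<noteq> (0::complex)" using AE_lborel_singleton by blast
    thus "AE z in lborel. ennreal (h (cmod z)) * (\<integral>\<^sup>+ \<theta>. indicator {0..2*pi} \<theta> * e2ennreal (- v (z0 + of_real (cmod z) * cis \<theta>)) \<partial>lborel) + ennreal (h (cmod z)) * (ennreal (2 * pi) * ennreal c)
      \<le> ennreal (h (cmod z)) * (\<integral>\<^sup>+ \<theta>. indicator {0..2*pi} \<theta> * e2ennreal (v (z0 + of_real (cmod z) * cis \<theta>)) \<partial>lborel) + ennreal (h (cmod z)) * (ennreal (2 * pi) * ennreal (-c))"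
    proof eventually_elim
      case (elim z)
      show ?case unfolding distrib_left[symmetric]
        by (rule mult_left_mono, rule circle_mean_ge_imp[OF v c]) (use elim in auto)
    qed
  qed
  also have "\<dots> = ennreal (2 * pi) * Ip + ennreal (2 * pi) * ennreal (-c) * X"
    unfolding Ip_def by (rule sumI[symmetric]) simp
  finally have main: "ennreal (2 * pi) * Im + ennreal (2 * pi) * ennreal c * X \<le> ennreal (2 * pi) * Ip + ennreal (2 * pi) * ennreal (-c) * X" .
  have "ennreal (2 * pi) * Ip + ennreal (2 * pi) * ennreal (-c) * X < \<infinity>"
    using X Ip by (auto simp: ennreal_mult_less_top)
  \<comment> \<open>Finiteness of the right-hand side is inherited by the negative part; only from
    here on may the inequality be read in the reals.\<close>
  with main have "ennreal (2 * pi) * Im < \<infinity>" by (meson le_iff_add le_less_trans order_trans)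
  hence Im: "Im < \<infinity>" using pi_gt_zero by (auto simp: ennreal_mult_less_top ennreal_eq_0_iff)
  have split: "h (cmod z) * real_of_ereal (v (z0 + z)) = enn2real (ennreal (h (cmod z)) * e2ennreal (v (z0 + z))) - enn2real (ennreal (h (cmod z)) * e2ennreal (- v (z0 + z)))" for z
  proof -
    have "v (z0 + z) \<noteq> \<infinity>" using v by (auto simp: subharmonic_def)
    hence "real_of_ereal (v (z0 + z)) = enn2real (e2ennreal (v (z0 + z))) - enn2real (e2ennreal (- v (z0 + z)))"
      by (rule real_of_ereal_split)
    thus ?thesis using h0(1)[of "cmod z"] by (simp add: enn2real_mult right_diff_distrib)
  qed
  have I1: "integrable lborel (\<lambda>z. enn2real (ennreal (h (cmod z)) * e2ennreal (v (z0 + z))))"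
    "(\<integral>z. enn2real (ennreal (h (cmod z)) * e2ennreal (v (z0 + z))) \<partial>lborel) = enn2real Ip"
    unfolding Ip_def by (rule integral_enn2real; use Ip in \<open>simp add: Ip_def\<close>)+
  have I2: "integrable lborel (\<lambda>z. enn2real (ennreal (h (cmod z)) * e2ennreal (- v (z0 + z))))"
    "(\<integral>z. enn2real (ennreal (h (cmod z)) * e2ennreal (- v (z0 + z))) \<partial>lborel) = enn2real Im"
    unfolding Im_def by (rule integral_enn2real; use Im in \<open>simp add: Im_def\<close>)+
  have I3: "(\<integral>z. h (cmod z) \<partial>(lborel :: complex measure)) = enn2real X"
    unfolding X_def by (rule integral_eq_nn_integral) (use h0 in auto)
  show ?A unfolding split by (intro Bochner_Integration.integrable_diff I1 I2)
  have "(\<integral>z. h (cmod z) * real_of_ereal (v (z0 + z)) \<partial>lborel) = enn2real Ip - enn2real Im"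
    unfolding split by (subst Bochner_Integration.integral_diff) (use I1 I2 in auto)
  moreover have "2 * pi * enn2real Im + 2 * pi * max 0 c * enn2real X \<le> 2 * pi * enn2real Ip + 2 * pi * max 0 (-c) * enn2real X"
  proof -
    obtain a b x where *: "Im = ennreal a" "a \<ge> 0" "Ip = ennreal b" "b \<ge> 0" "X = ennreal x" "x \<ge> 0"
      using Im Ip X by (metis ennreal_cases infinity_ennreal_def less_irrefl)
    define d e where "d = max 0 c" and "e = max 0 (-c)"
    have de: "d \<ge> 0" "e \<ge> 0" by (auto simp: d_def e_def)
    have "ennreal c = ennreal d" "ennreal (-c) = ennreal e"
      unfolding d_def e_def by (auto simp: max_def ennreal_neg)
    hence "ennreal (2 * pi * a + 2 * pi * d * x) \<le> ennreal (2 * pi * b + 2 * pi * e * x)"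
      using main * de by (simp add: ennreal_mult ennreal_plus)
    moreover have "0 \<le> 2 * pi * b + 2 * pi * e * x" using * de by simp
    ultimately show ?thesis using * by (simp add: d_def[symmetric] e_def[symmetric])
  qed
  hence "2 * pi * (enn2real Im + max 0 c * enn2real X) \<le> 2 * pi * (enn2real Ip + max 0 (-c) * enn2real X)"
    by (simp add: algebra_simps)
  hence "enn2real Im + max 0 c * enn2real X \<le> enn2real Ip + max 0 (-c) * enn2real X"
    by simp
  moreover have "max 0 c * enn2real X - max 0 (-c) * enn2real X = c * enn2real X"
    by (auto simp: max_def)
  ultimately show ?B unfolding I3 by linarith
  have "AE z in lborel. ennreal (h (cmod z)) * e2ennreal (- v (z0 + z)) \<noteq> \<infinity>"
    by (rule nn_integral_PInf_AE) (use Im in \<open>simp_all add: Im_def\<close>)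
  thus ?C
  proof eventually_elim
    case (elim z)
    show ?case
    proof (intro impI notI)
      assume h: "0 < h (cmod z)" and v: "v (z0 + z) = -\<infinity>"
      have "ennreal (h (cmod z)) * e2ennreal (- v (z0 + z)) = \<infinity>"
        unfolding v using h by (simp add: ennreal_mult_top)
      with elim show False by simp
    qed
  qed
qed

section \<open>Local L1 growth of functions of finite type\<close>

lemma cball_borel [measurable, simp]: "cball z r \<in> sets borel"
  by (simp add: borel_closed)

lemma ball_borel [measurable, simp]: "ball z r \<in> sets borel"
  by (simp add: borel_open)

lemma finite_type_growth:
  assumes v: "subharmonic v" and ft: "finite_type_order v p" and p: "p > 0"
  obtains C :: real where "C \<ge> 0" "\<And>z. v z \<le> ereal (C * (1 + cmod z) powr p)"
proof -
  obtain C0 :: real where "Limsup at_top (\<lambda>r::real. (SUP z\<in>sphere 0 r. v z) / ereal (r powr p)) < ereal C0"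
    using ft unfolding finite_type_order_def by (metis ereal_dense2)
  hence "eventually (\<lambda>r::real. (SUP z\<in>sphere 0 r. v z) / ereal (r powr p) < ereal C0) at_top"
    by (rule Limsup_lessD)
  then obtain R0 where R0: "\<And>r. r \<ge> R0 \<Longrightarrow> (SUP z\<in>sphere 0 r. v z) / ereal (r powr p) < ereal C0"
    unfolding eventually_at_top_linorder by blast
  define R where "R = max R0 1"
  obtain M where M: "M \<ge> 0" "\<And>z. z \<in> cball 0 R \<Longrightarrow> v z \<le> ereal M"
    using subharmonic_bdd_above[OF v compact_cball] by metis
  \<comment> \<open>\<open>M\<close> serves on the bounded disc about which the limsup says nothing,
    \<open>C0\<close> outside it. \<open>C0\<close> may be negative, hence the inner
    maximum.\<close>
  define C where "C = max M (max 0 C0)"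
  show thesis
  proof (rule that)
    show "C \<ge> 0" by (simp add: C_def)
    fix z :: complex
    show "v z \<le> ereal (C * (1 + cmod z) powr p)"
    proof (cases "cmod z \<le> R")
      case True
      have "1 powr p \<le> (1 + cmod z) powr p" using p by (intro powr_mono2) auto
      hence "M * 1 \<le> C * (1 + cmod z) powr p" using M(1) by (intro mult_mono) (auto simp: C_def)
      thus ?thesis using M(2)[of z] True by (auto intro: order_trans)
    next
      case False
      hence r: "cmod z \<ge> R0" "cmod z > 0" by (auto simp: R_def)
      have pos: "cmod z powr p > 0" using r by simp
      have "v z \<le> (SUP z\<in>sphere 0 (cmod z). v z)" by (rule SUP_upper) simp
      moreover have "(SUP z\<in>sphere 0 (cmod z). v z) \<le> ereal C0 * ereal (cmod z powr p)"
        using R0[OF r(1)] pos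
        by (cases "SUP z\<in>sphere 0 (cmod z). v z") (auto simp: pos_divide_less_eq)
      ultimately have "v z \<le> ereal (C0 * cmod z powr p)" by (auto intro: order_trans)
      also have "C0 * cmod z powr p \<le> C * (1 + cmod z) powr p"
        using p by (intro mult_mono powr_mono2) (auto simp: C_def)
      finally show ?thesis by simp
    qed
  qed
qed

lemma subharmonic_AE_finite:
  assumes v: "subharmonic v" and ex: "\<exists>z. v z \<noteq> -\<infinity>"
  shows "AE z in lborel. v z \<noteq> -\<infinity>"
proof -
  note [measurable] = subharmonic_borel[OF v]
  obtain z0 c where c: "v z0 = ereal c"
    using ex v unfolding subharmonic_def by (metis ereal_cases uminus_ereal.simps(2))
  have "AE z in lborel. indicat_real {..real n} (cmod z) > 0 \<longrightarrow> v (z0 + z) \<noteq> -\<infinity>" for n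
    by (rule subharmonic_radial_mean(3)[OF v c, of "indicator {..real n}" 1 "real n"]) auto
  hence "AE z in lborel. \<forall>n. indicat_real {..real n} (cmod z) > 0 \<longrightarrow> v (z0 + z) \<noteq> -\<infinity>"
    by (subst AE_all_countable) blast
  hence "AE z in lborel. v (z0 + z) \<noteq> -\<infinity>"
  proof eventually_elim
    case (elim z)
    obtain n :: nat where "cmod z \<le> real n" using real_arch_simple by blast
    thus ?case using elim by (auto simp: indicator_def)
  qed
  hence "AE z in distr lborel borel ((+) z0). v z \<noteq> -\<infinity>"
    by (subst AE_distr_iff) auto
  thus ?thesis unfolding lborel_distr_plus .
qed

text \<open>Finite type bounds \<open>v\<close> only from above. With \<open>u \<le> D\<close> on a
  disc one has \<open>\<bar>u\<bar> \<le> 2 * D - u\<close>, and the integral of \<open>u\<close>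
  over a disc about \<open>z0\<close> is at least \<open>c\<close> times the area. The discs are
  centred where \<open>v\<close> is known to be finite, which need not be the origin; enlarging the
  radius by \<open>cmod z0\<close> compares them with discs about 0.\<close>

lemma subharmonic_L1_growth:
  assumes v: "subharmonic v" and ex: "\<exists>z. v z \<noteq> -\<infinity>" and ft: "finite_type_order v p" and p: "p > 0"
  obtains C :: real where "C \<ge> 0" "\<And>R. integrable lborel (\<lambda>z. indicator (cball 0 R) z * real_of_ereal (v z))"
    "\<And>R. R \<ge> 1 \<Longrightarrow> (\<integral>z. indicator (cball 0 R) z * \<bar>real_of_ereal (v z)\<bar> \<partial>lborel) \<le> C * R powr (p + 2)"
proof -
  note [measurable] = subharmonic_borel[OF v]
  define u where "u = (\<lambda>z. real_of_ereal (v z))"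
  have [measurable]: "u \<in> borel_measurable borel" unfolding u_def by measurable
  obtain z0 c where c: "v z0 = ereal c"
    using ex v unfolding subharmonic_def by (metis ereal_cases uminus_ereal.simps(2))
  obtain A where A: "A \<ge> 0" "\<And>z. v z \<le> ereal (A * (1 + cmod z) powr p)"
    using finite_type_growth[OF v ft p] by metis
  have uA: "u z \<le> A * (1 + cmod z) powr p" for z
    using A(2)[of z] A(1) by (cases "v z") (auto simp: u_def)
  have shift: "(\<integral>z. f (z0 + z) \<partial>lborel) = (\<integral>z. f z \<partial>lborel)" if "f \<in> borel_measurable borel" for f :: "complex \<Rightarrow> real"
    using integral_distr[of "(+) z0" lborel borel f] that by (simp add: lborel_distr_plus)
  have shift_int: "integrable lborel (\<lambda>z. f (z0 + z)) \<longleftrightarrow> integrable lborel f" if "f \<in> borel_measurable borel" for f :: "complex \<Rightarrow> real"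
    using integrable_distr_eq[of "(+) z0" lborel borel f] that by (simp add: lborel_distr_plus)
  have area: "(\<integral>z. indicator {..R} (cmod z) \<partial>(lborel :: complex measure)) = measure lborel (cball 0 R :: complex set)" for R
  proof -
    have "(\<integral>z. indicator {..R} (cmod z) \<partial>(lborel :: complex measure)) = (\<integral>z. indicator (cball 0 R) z \<partial>(lborel :: complex measure))"
      by (intro Bochner_Integration.integral_cong) (auto simp: indicator_def)
    also have "\<dots> = measure lborel (cball 0 R :: complex set)" by simp
    finally show ?thesis .
  qed
  have area_eq: "measure lborel (cball 0 R :: complex set) = pi * R\<^sup>2" if "R \<ge> 0" for R
    using content_cball[OF that, of "0::complex"] by (simp add: unit_ball_vol_2)
  have bigint: "integrable lborel (\<lambda>z. indicator (cball z0 R) z * u z)"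
    and bigle: "R \<ge> 0 \<Longrightarrow> c * (pi * R\<^sup>2) \<le> (\<integral>z. indicator (cball z0 R) z * u z \<partial>lborel)" for R
  proof -
    have eq: "indicator {..R} (cmod z) = (indicator (cball z0 R) (z0 + z) :: real)" for z :: complex
      by (auto simp: indicator_def dist_norm)
    have *: "integrable lborel (\<lambda>z. indicator {..R} (cmod z) * u (z0 + z))"
      "c * (\<integral>z. indicator {..R} (cmod z) \<partial>(lborel :: complex measure)) \<le> (\<integral>z. indicator {..R} (cmod z) * u (z0 + z) \<partial>lborel)"
      unfolding u_def
      by (rule subharmonic_radial_mean[OF v c, of "indicator {..R}" 1 R]; auto)+
    have [measurable]: "(\<lambda>z. indicator (cball z0 R) z * u z) \<in> borel_measurable borel"
      by (intro borel_measurable_times borel_measurable_indicator) auto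
    from *(1) show "integrable lborel (\<lambda>z. indicator (cball z0 R) z * u z)"
      unfolding eq by (subst (asm) shift_int) auto
    show "c * (pi * R\<^sup>2) \<le> (\<integral>z. indicator (cball z0 R) z * u z \<partial>lborel)" if "R \<ge> 0"
      using *(2) unfolding area area_eq[OF that] unfolding eq by (subst (asm) shift) auto
  qed
  have sub: "cball 0 R \<subseteq> cball z0 (R + cmod z0)" for R
  proof
    fix z :: complex assume "z \<in> cball 0 R"
    thus "z \<in> cball z0 (R + cmod z0)" using norm_triangle_ineq4[of z0 z] by (simp add: dist_norm)
  qed
  have int: "integrable lborel (\<lambda>z. indicator (cball 0 R) z * u z)" for R
  proof (rule Bochner_Integration.integrable_bound[OF bigint[of "R + cmod z0"]])
    show "AE z in lborel. norm (indicator (cball 0 R) z * u z) \<le> norm (indicator (cball z0 (R + cmod z0)) z * u z)"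
      by (rule AE_I2) (use sub[of R] in \<open>auto simp: indicator_def subset_iff\<close>)
  qed simp
  define B where "B = 2 * A * (2 + 2 * cmod z0) powr p + \<bar>c\<bar>"
  define C where "C = B * pi * (1 + cmod z0)\<^sup>2"
  have B0: "B \<ge> 0" using A by (simp add: B_def)
  have "(\<integral>z. indicator (cball 0 R) z * \<bar>u z\<bar> \<partial>lborel) \<le> C * R powr (p + 2)" if R: "R \<ge> 1" for R
  proof -
    define r where "r = R + cmod z0"
    have r0: "r \<ge> 0" using R by (simp add: r_def)
    define D where "D = A * (1 + cmod z0 + r) powr p"
    have bI: "integrable lborel (indicator (cball z0 r) :: complex \<Rightarrow> real)"
      using emeasure_bounded_finite[OF bounded_cball, of z0 r] by (intro integrable_real_indicator) auto
    have "(\<integral>z. indicator (cball 0 R) z * \<bar>u z\<bar> \<partial>lborel) \<le> (\<integral>z. 2 * D * indicator (cball z0 r) z - indicator (cball z0 r) z * u z \<partial>lborel)"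
    proof (rule integral_mono)
      show "integrable lborel (\<lambda>z. indicator (cball 0 R) z * \<bar>u z\<bar>)"
        using integrable_abs[OF int[of R]] by (simp add: abs_mult)
      show "integrable lborel (\<lambda>z. 2 * D * indicator (cball z0 r) z - indicator (cball z0 r) z * u z)"
        using bI bigint by (intro Bochner_Integration.integrable_diff integrable_mult_right) auto
      fix z :: complex
      show "indicator (cball 0 R) z * \<bar>u z\<bar> \<le> 2 * D * indicator (cball z0 r) z - indicator (cball z0 r) z * u z"
      proof (cases "z \<in> cball z0 r")
        case True
        hence "cmod z \<le> cmod z0 + r" using norm_triangle_ineq[of z0 "z - z0"] by (simp add: dist_norm norm_minus_commute)
        hence "u z \<le> D" unfolding D_def using uA[of z] A p by (auto intro!: order_trans[OF uA] mult_left_mono powr_mono2)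
        moreover have "D \<ge> 0" using A by (simp add: D_def)
        ultimately have "\<bar>u z\<bar> \<le> 2 * D - u z" by auto
        moreover have "indicator (cball 0 R) z * \<bar>u z\<bar> \<le> \<bar>u z\<bar>" by (auto simp: indicator_def)
        ultimately show ?thesis using True by simp
      next
        case False
        hence "z \<notin> cball 0 R" using sub[of R] by (auto simp: r_def)
        thus ?thesis using False by simp
      qed
    qed
    also have "\<dots> = 2 * D * (\<integral>z. indicator (cball z0 r) z \<partial>lborel) - (\<integral>z. indicator (cball z0 r) z * u z \<partial>lborel)"
      using bI bigint by (subst Bochner_Integration.integral_diff) auto
    also have "(\<integral>z. indicator (cball z0 r) z \<partial>(lborel :: complex measure)) = pi * r\<^sup>2"
      using content_cball[OF r0, of "z0::complex"] by (simp add: unit_ball_vol_2)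
    also have "2 * D * (pi * r\<^sup>2) - (\<integral>z. indicator (cball z0 r) z * u z \<partial>lborel) \<le> (2 * D + \<bar>c\<bar>) * (pi * r\<^sup>2)"
    proof -
      have "- \<bar>c\<bar> * (pi * r\<^sup>2) \<le> c * (pi * r\<^sup>2)" by (intro mult_right_mono) auto
      with bigle[OF r0] show ?thesis by (simp add: algebra_simps)
    qed
    also have "\<dots> \<le> (B * R powr p) * (pi * ((1 + cmod z0) * R)\<^sup>2)"
    proof (intro mult_mono power_mono)
      have nz: "cmod z0 \<le> cmod z0 * R" using R by (simp add: mult_le_cancel_left1)
      show "r \<le> (1 + cmod z0) * R" using nz by (simp add: r_def algebra_simps)
      have "1 + cmod z0 + r \<le> (2 + 2 * cmod z0) * R" using nz R by (simp add: r_def algebra_simps)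
      hence "(1 + cmod z0 + r) powr p \<le> ((2 + 2 * cmod z0) * R) powr p" using p r0 by (intro powr_mono2) auto
      also have "\<dots> = (2 + 2 * cmod z0) powr p * R powr p" using R by (simp add: powr_mult)
      finally have "2 * D \<le> 2 * A * (2 + 2 * cmod z0) powr p * R powr p"
        using A by (simp add: D_def mult_left_mono mult.assoc)
      moreover have "1 \<le> R powr p" using R p by (simp add: ge_one_powr_ge_zero)
      hence "\<bar>c\<bar> \<le> \<bar>c\<bar> * R powr p" by (simp add: mult_le_cancel_left1)
      ultimately show "2 * D + \<bar>c\<bar> \<le> B * R powr p" by (simp add: B_def algebra_simps)
    qed (use r0 B0 in auto)
    also have "\<dots> = C * R powr (p + 2)"
      using R by (simp add: C_def powr_add power_mult_distrib)
    finally show ?thesis .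
  qed
  moreover have "C \<ge> 0" using B0 by (simp add: C_def)
  ultimately show thesis using int by (intro that[of C]) (auto simp: u_def)
qed

section \<open>Radial test functions\<close>

text \<open>An explicit certificate of class C2: \<open>P\<close>, \<open>Q\<close> are the first
  partial derivatives and \<open>A\<close>, \<open>B\<close>, \<open>C\<close> the second ones in
  the order xx, xy, yy. Certificates are built by calculus rules and display the Laplacian as
  \<open>A + C\<close>; the operator-valued derivatives that \<open>test_fun\<close> asks for are
  assembled once, at the end.\<close>

definition C2_on :: "complex set \<Rightarrow> (complex \<Rightarrow> real) \<Rightarrow> (complex \<Rightarrow> real) \<Rightarrow> (complex \<Rightarrow> real)
    \<Rightarrow> (complex \<Rightarrow> real) \<Rightarrow> (complex \<Rightarrow> real) \<Rightarrow> (complex \<Rightarrow> real) \<Rightarrow> bool" where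
  "C2_on U f P Q A B C \<longleftrightarrow> open U \<and>
     (\<forall>z\<in>U. (f has_derivative (\<lambda>h. Re h * P z + Im h * Q z)) (at z)) \<and>
     (\<forall>z\<in>U. (P has_derivative (\<lambda>h. Re h * A z + Im h * B z)) (at z)) \<and>
     (\<forall>z\<in>U. (Q has_derivative (\<lambda>h. Re h * B z + Im h * C z)) (at z)) \<and>
     continuous_on U A \<and> continuous_on U B \<and> continuous_on U C"

lemma C2_onD:
  assumes "C2_on U f P Q A B C"
  shows "open U"
    "z \<in> U \<Longrightarrow> (f has_derivative (\<lambda>h. Re h * P z + Im h * Q z)) (at z)"
    "z \<in> U \<Longrightarrow> (P has_derivative (\<lambda>h. Re h * A z + Im h * B z)) (at z)"
    "z \<in> U \<Longrightarrow> (Q has_derivative (\<lambda>h. Re h * B z + Im h * C z)) (at z)"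
    "continuous_on U A" "continuous_on U B" "continuous_on U C"
    "continuous_on U f" "continuous_on U P" "continuous_on U Q"
proof -
  note * = assms[unfolded C2_on_def]
  show "open U" "continuous_on U A" "continuous_on U B" "continuous_on U C"
    "z \<in> U \<Longrightarrow> (f has_derivative (\<lambda>h. Re h * P z + Im h * Q z)) (at z)"
    "z \<in> U \<Longrightarrow> (P has_derivative (\<lambda>h. Re h * A z + Im h * B z)) (at z)"
    "z \<in> U \<Longrightarrow> (Q has_derivative (\<lambda>h. Re h * B z + Im h * C z)) (at z)"
    using * by auto
  show "continuous_on U f" "continuous_on U P" "continuous_on U Q"
    using * by (meson continuous_at_imp_continuous_on has_derivative_continuous)+
qed

lemma C2_on_mult:
  assumes f: "C2_on U f P Q A B C" and g: "C2_on U g P' Q' A' B' C'"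
  shows "C2_on U (\<lambda>z. f z * g z) (\<lambda>z. P z * g z + f z * P' z) (\<lambda>z. Q z * g z + f z * Q' z)
    (\<lambda>z. A z * g z + 2 * (P z * P' z) + f z * A' z)
    (\<lambda>z. B z * g z + P z * Q' z + Q z * P' z + f z * B' z)
    (\<lambda>z. C z * g z + 2 * (Q z * Q' z) + f z * C' z)"
  unfolding C2_on_def
proof (intro conjI ballI)
  note d = has_derivative_add[OF has_derivative_mult has_derivative_mult, THEN has_derivative_eq_rhs]
  fix z assume z: "z \<in> U"
  note F = C2_onD(2-4)[OF f z] and G = C2_onD(2-4)[OF g z]
  show "((\<lambda>z. f z * g z) has_derivative (\<lambda>h. Re h * (P z * g z + f z * P' z) + Im h * (Q z * g z + f z * Q' z))) (at z)"
    by (rule has_derivative_mult[OF F(1) G(1), THEN has_derivative_eq_rhs]) (auto simp: fun_eq_iff algebra_simps)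
  show "((\<lambda>z. P z * g z + f z * P' z) has_derivative (\<lambda>h. Re h * (A z * g z + 2 * (P z * P' z) + f z * A' z)
      + Im h * (B z * g z + P z * Q' z + Q z * P' z + f z * B' z))) (at z)"
    by (rule d[OF F(2) G(1) F(1) G(2)]) (auto simp: fun_eq_iff algebra_simps)
  show "((\<lambda>z. Q z * g z + f z * Q' z) has_derivative (\<lambda>h. Re h * (B z * g z + P z * Q' z + Q z * P' z + f z * B' z)
      + Im h * (C z * g z + 2 * (Q z * Q' z) + f z * C' z))) (at z)"
    by (rule d[OF F(3) G(1) F(1) G(3)]) (auto simp: fun_eq_iff algebra_simps)
qed (intro continuous_intros C2_onD[OF f] C2_onD[OF g])+

lemma C2_on_add:
  assumes f: "C2_on U f P Q A B C" and g: "C2_on U g P' Q' A' B' C'"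
  shows "C2_on U (\<lambda>z. f z + g z) (\<lambda>z. P z + P' z) (\<lambda>z. Q z + Q' z)
    (\<lambda>z. A z + A' z) (\<lambda>z. B z + B' z) (\<lambda>z. C z + C' z)"
  unfolding C2_on_def
proof (intro conjI ballI)
  fix z assume z: "z \<in> U"
  note F = C2_onD(2-4)[OF f z] and G = C2_onD(2-4)[OF g z]
  show "((\<lambda>z. f z + g z) has_derivative (\<lambda>h. Re h * (P z + P' z) + Im h * (Q z + Q' z))) (at z)"
    by (rule has_derivative_add[OF F(1) G(1), THEN has_derivative_eq_rhs]) (auto simp: fun_eq_iff algebra_simps)
  show "((\<lambda>z. P z + P' z) has_derivative (\<lambda>h. Re h * (A z + A' z) + Im h * (B z + B' z))) (at z)"
    by (rule has_derivative_add[OF F(2) G(2), THEN has_derivative_eq_rhs]) (auto simp: fun_eq_iff algebra_simps)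
  show "((\<lambda>z. Q z + Q' z) has_derivative (\<lambda>h. Re h * (B z + B' z) + Im h * (C z + C' z))) (at z)"
    by (rule has_derivative_add[OF F(3) G(3), THEN has_derivative_eq_rhs]) (auto simp: fun_eq_iff algebra_simps)
qed (intro continuous_intros C2_onD[OF f] C2_onD[OF g])+

lemma C2_on_diff:
  assumes f: "C2_on U f P Q A B C" and g: "C2_on U g P' Q' A' B' C'"
  shows "C2_on U (\<lambda>z. f z - g z) (\<lambda>z. P z - P' z) (\<lambda>z. Q z - Q' z)
    (\<lambda>z. A z - A' z) (\<lambda>z. B z - B' z) (\<lambda>z. C z - C' z)"
  unfolding C2_on_def
proof (intro conjI ballI)
  fix z assume z: "z \<in> U"
  note F = C2_onD(2-4)[OF f z] and G = C2_onD(2-4)[OF g z]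
  show "((\<lambda>z. f z - g z) has_derivative (\<lambda>h. Re h * (P z - P' z) + Im h * (Q z - Q' z))) (at z)"
    by (rule has_derivative_diff[OF F(1) G(1), THEN has_derivative_eq_rhs]) (auto simp: fun_eq_iff algebra_simps)
  show "((\<lambda>z. P z - P' z) has_derivative (\<lambda>h. Re h * (A z - A' z) + Im h * (B z - B' z))) (at z)"
    by (rule has_derivative_diff[OF F(2) G(2), THEN has_derivative_eq_rhs]) (auto simp: fun_eq_iff algebra_simps)
  show "((\<lambda>z. Q z - Q' z) has_derivative (\<lambda>h. Re h * (B z - B' z) + Im h * (C z - C' z))) (at z)"
    by (rule has_derivative_diff[OF F(3) G(3), THEN has_derivative_eq_rhs]) (auto simp: fun_eq_iff algebra_simps)
qed (intro continuous_intros C2_onD[OF f] C2_onD[OF g])+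

lemma C2_on_subset: "C2_on U f P Q A B C \<Longrightarrow> open V \<Longrightarrow> V \<subseteq> U \<Longrightarrow> C2_on V f P Q A B C"
  unfolding C2_on_def by (auto intro: continuous_on_subset)

lemma C2_on_cong:
  assumes "C2_on U f P Q A B C" and eq: "\<And>z. z \<in> U \<Longrightarrow> g z = f z"
  shows "C2_on U g P Q A B C"
proof -
  note * = assms(1)[unfolded C2_on_def]
  have "(g has_derivative (\<lambda>h. Re h * P z + Im h * Q z)) (at z)" if "z \<in> U" for z
    by (rule has_derivative_transform_within_open[of f _ z UNIV U]) (use * eq that in auto)
  thus ?thesis using * unfolding C2_on_def by blast
qed

text \<open>For a differential of the form \<open>Re (g z * h)\<close> with \<open>g\<close>
  holomorphic, the Cauchy-Riemann equations express all second partials through \<open>g'\<close>.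
  The first and the last of them are opposite, so such a function enters later computations as
  harmonic.\<close>

lemma C2_on_Re:
  assumes "open U"
    and "\<And>z. z \<in> U \<Longrightarrow> (f has_derivative (\<lambda>h. Re (g z * h))) (at z)"
    and g: "\<And>z. z \<in> U \<Longrightarrow> (g has_field_derivative g' z) (at z)"
    and "continuous_on U g'"
  shows "C2_on U f (\<lambda>z. Re (g z)) (\<lambda>z. - Im (g z)) (\<lambda>z. Re (g' z)) (\<lambda>z. - Im (g' z)) (\<lambda>z. - Re (g' z))"
  unfolding C2_on_def
proof (intro conjI ballI)
  fix z assume z: "z \<in> U"
  show "(f has_derivative (\<lambda>h. Re h * Re (g z) + Im h * - Im (g z))) (at z)"
    using assms(2)[OF z] by (rule has_derivative_eq_rhs) (auto simp: fun_eq_iff)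
  have d: "(g has_derivative (\<lambda>h. g' z * h)) (at z)" using g[OF z] by (simp add: has_field_derivative_def)
  show "((\<lambda>z. Re (g z)) has_derivative (\<lambda>h. Re h * Re (g' z) + Im h * - Im (g' z))) (at z)"
    by (rule has_derivative_eq_rhs[OF has_derivative_Re[OF d]]) (auto simp: fun_eq_iff)
  show "((\<lambda>z. - Im (g z)) has_derivative (\<lambda>h. Re h * - Im (g' z) + Im h * - Re (g' z))) (at z)"
    by (rule has_derivative_eq_rhs[OF has_derivative_minus[OF has_derivative_Im[OF d]]]) (auto simp: fun_eq_iff)
qed (use assms in \<open>auto intro!: continuous_intros\<close>)

text \<open>Composition with the squared modulus avoids the singularity of \<open>cmod\<close> at
  the centre. The xx and yy entries add up to \<open>4 * F' s + 4 * s * F'' s\<close> at the squared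
  distance \<open>s\<close>, the planar Laplacian of a radial function.\<close>

lemma C2_on_radial:
  fixes F F' F'' :: "real \<Rightarrow> real"
  assumes F: "\<And>s. (F has_real_derivative F' s) (at s)" and F': "\<And>s. (F' has_real_derivative F'' s) (at s)"
    and F'': "continuous_on UNIV F''"
  shows "C2_on UNIV (\<lambda>z. F ((cmod (z - a))\<^sup>2)) (\<lambda>z. 2 * Re (z - a) * F' ((cmod (z - a))\<^sup>2)) (\<lambda>z. 2 * Im (z - a) * F' ((cmod (z - a))\<^sup>2))
    (\<lambda>z. 2 * F' ((cmod (z - a))\<^sup>2) + 4 * (Re (z - a))\<^sup>2 * F'' ((cmod (z - a))\<^sup>2))
    (\<lambda>z. 4 * Re (z - a) * Im (z - a) * F'' ((cmod (z - a))\<^sup>2))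
    (\<lambda>z. 2 * F' ((cmod (z - a))\<^sup>2) + 4 * (Im (z - a))\<^sup>2 * F'' ((cmod (z - a))\<^sup>2))"
proof -
  define N where "N = (\<lambda>z. (Re (z - a))\<^sup>2 + (Im (z - a))\<^sup>2)"
  have N: "(cmod (z - a))\<^sup>2 = N z" for z by (simp add: N_def cmod_power2)
  have dN: "(N has_derivative (\<lambda>h. 2 * Re (z - a) * Re h + 2 * Im (z - a) * Im h)) (at z)" for z
    unfolding N_def by (auto intro!: derivative_eq_intros simp: fun_eq_iff algebra_simps)
  have d: "((\<lambda>z. G (N z)) has_derivative (\<lambda>h. (2 * Re (z - a) * Re h + 2 * Im (z - a) * Im h) * G' (N z))) (at z)"
    if "\<And>s. (G has_real_derivative G' s) (at s)" for G G' z
    using has_derivative_compose[OF dN that[unfolded has_field_derivative_def]] by (simp add: mult.commute)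
  have cF'': "continuous_on UNIV (\<lambda>z. F'' (N z))"
    by (rule continuous_on_compose2[OF F'']) (auto simp: N_def intro!: continuous_intros)
  have cF': "continuous_on UNIV (\<lambda>z. F' (N z))"
    by (rule has_derivative_continuous_on, rule has_derivative_at_withinI, rule d[OF F'])
  have lR: "((\<lambda>z. 2 * Re (z - a)) has_derivative (\<lambda>h. 2 * Re h)) (at z)"
    and lI: "((\<lambda>z. 2 * Im (z - a)) has_derivative (\<lambda>h. 2 * Im h)) (at z)" for z
    by (auto intro!: derivative_eq_intros)
  show ?thesis unfolding N C2_on_def
  proof (intro conjI ballI)
    fix z
    show "((\<lambda>z. F (N z)) has_derivative (\<lambda>h. Re h * (2 * Re (z - a) * F' (N z)) + Im h * (2 * Im (z - a) * F' (N z)))) (at z)"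
      by (rule d[OF F, THEN has_derivative_eq_rhs]) (auto simp: fun_eq_iff algebra_simps)
    show "((\<lambda>z. 2 * Re (z - a) * F' (N z)) has_derivative
      (\<lambda>h. Re h * (2 * F' (N z) + 4 * (Re (z - a))\<^sup>2 * F'' (N z)) + Im h * (4 * Re (z - a) * Im (z - a) * F'' (N z)))) (at z)"
      by (rule has_derivative_mult[OF lR d[OF F'], THEN has_derivative_eq_rhs])
        (auto simp: fun_eq_iff algebra_simps power2_eq_square)
    show "((\<lambda>z. 2 * Im (z - a) * F' (N z)) has_derivative
      (\<lambda>h. Re h * (4 * Re (z - a) * Im (z - a) * F'' (N z)) + Im h * (2 * F' (N z) + 4 * (Im (z - a))\<^sup>2 * F'' (N z)))) (at z)"
      by (rule has_derivative_mult[OF lI d[OF F'], THEN has_derivative_eq_rhs])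
        (auto simp: fun_eq_iff algebra_simps power2_eq_square)
  qed (auto intro!: continuous_intros cF' cF'')
qed

lemma C2_on_unique:
  assumes "(f has_derivative (\<lambda>h. Re h * P + Im h * Q)) (at z)" "(f has_derivative (\<lambda>h. Re h * P' + Im h * Q')) (at z)"
  shows "P = P'" "Q = Q'"
proof -
  have eq: "(\<lambda>h. Re h * P + Im h * Q) = (\<lambda>h. Re h * P' + Im h * Q')"
    using has_derivative_unique assms by blast
  show "P = P'" "Q = Q'" using fun_cong[OF eq, of 1] fun_cong[OF eq, of \<i>] by auto
qed

text \<open>Needed because the test function \<open>phi\<close> has one formula near 0 and another
  off 0. Uniqueness of derivatives forces the two certificates to agree on the overlap, so they can
  be merged pointwise.\<close>

lemma C2_on_Un:
  assumes f: "C2_on U f P Q A B C" and g: "C2_on V f P' Q' A' B' C'"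
  shows "\<exists>P Q A B C. C2_on (U \<union> V) f P Q A B C"
proof -
  have oU: "open U" and oV: "open V" using C2_onD[OF f] C2_onD[OF g] by auto
  have PQ: "P z = P' z" "Q z = Q' z" if "z \<in> U" "z \<in> V" for z
    using C2_on_unique C2_onD(2)[OF f that(1)] C2_onD(2)[OF g that(2)] by blast+
  have ABC: "A z = A' z" "B z = B' z" "C z = C' z" if z: "z \<in> U" "z \<in> V" for z
  proof -
    have o: "open (U \<inter> V)" "z \<in> U \<inter> V" using oU oV z by auto
    have "(P' has_derivative (\<lambda>h. Re h * A z + Im h * B z)) (at z)"
      by (rule has_derivative_transform_within_open[OF C2_onD(3)[OF f z(1)] o]) (use PQ in auto)
    from C2_on_unique[OF this C2_onD(3)[OF g z(2)]] show "A z = A' z" "B z = B' z" by auto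
    have "(Q' has_derivative (\<lambda>h. Re h * B z + Im h * C z)) (at z)"
      by (rule has_derivative_transform_within_open[OF C2_onD(4)[OF f z(1)] o]) (use PQ in auto)
    from C2_on_unique[OF this C2_onD(4)[OF g z(2)]] show "C z = C' z" by auto
  qed
  define m where "m = (\<lambda>(p::complex \<Rightarrow> real) q z. if z \<in> U then p z else q z)"
  have mU: "m p q z = p z" if "z \<in> U" for p q z using that by (simp add: m_def)
  have mV: "m P P' z = P' z" "m Q Q' z = Q' z" "m A A' z = A' z" "m B B' z = B' z" "m C C' z = C' z" if "z \<in> V" for z
    using that PQ ABC by (auto simp: m_def)
  have 1: "C2_on U f (m P P') (m Q Q') (m A A') (m B B') (m C C')"
    using f unfolding C2_on_def
    by (intro conjI ballI) (auto simp: mU cong: continuous_on_cong intro: has_derivative_transform_within_open[where s=U])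
  have 2: "C2_on V f (m P P') (m Q Q') (m A A') (m B B') (m C C')"
    using g unfolding C2_on_def
    by (intro conjI ballI) (auto simp: mV cong: continuous_on_cong intro: has_derivative_transform_within_open[where s=V])
  have "C2_on (U \<union> V) f (m P P') (m Q Q') (m A A') (m B B') (m C C')"
    using 1 2 oU oV unfolding C2_on_def by (auto intro!: continuous_on_open_Un)
  thus ?thesis by blast
qed

lemma C2_on_laplacian:
  assumes f: "C2_on U f P Q A B C" and z: "z \<in> U"
  shows "laplacian f z = A z + C z"
proof -
  have oU: "open U" using C2_onD[OF f] by auto
  have dd: "ddir g e z = Re e * p + Im e * q" if "(g has_derivative (\<lambda>h. Re h * p + Im h * q)) (at z)" for g e z p q
  proof -
    have "((\<lambda>t::real. z + of_real t * e) has_derivative (\<lambda>h. of_real h * e)) (at 0)"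
      by (auto intro!: derivative_eq_intros)
    from has_derivative_compose[OF this, of g "\<lambda>h. Re h * p + Im h * q"] that
    have "((\<lambda>t::real. g (z + of_real t * e)) has_derivative (\<lambda>h. Re (of_real h * e) * p + Im (of_real h * e) * q)) (at 0)"
      by simp
    hence "((\<lambda>t::real. g (z + of_real t * e)) has_real_derivative (Re e * p + Im e * q)) (at 0)"
      unfolding has_field_derivative_def by (rule has_derivative_eq_rhs) (auto simp: fun_eq_iff algebra_simps)
    thus ?thesis unfolding ddir_def by (rule DERIV_imp_deriv)
  qed
  have 1: "(ddir f 1 has_derivative (\<lambda>h. Re h * A z + Im h * B z)) (at z)"
    by (rule has_derivative_transform_within_open[OF C2_onD(3)[OF f z] oU z])
      (simp add: dd[OF C2_onD(2)[OF f]])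
  have 2: "(ddir f \<i> has_derivative (\<lambda>h. Re h * B z + Im h * C z)) (at z)"
    by (rule has_derivative_transform_within_open[OF C2_onD(4)[OF f z] oU z])
      (simp add: dd[OF C2_onD(2)[OF f]])
  show ?thesis unfolding laplacian_def using dd[OF 1, of 1] dd[OF 2, of \<i>] by simp
qed

lemma C2_on_test_fun:
  assumes f: "C2_on UNIV f P Q A B C" and K: "compact K" "\<And>z. z \<notin> K \<Longrightarrow> f z = 0"
  shows "test_fun f"
  unfolding test_fun_def
proof
  have "closure {z. f z \<noteq> 0} \<subseteq> K"
    using K by (intro closure_minimal) (auto intro: compact_imp_closed)
  thus "compact (closure {z. f z \<noteq> 0})"
    using K(1) by (metis closed_closure compact_Int_closed inf.absorb_iff2 inf_commute)
next
  define r m where "r = Blinfun Re" and "m = Blinfun Im"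
  have [simp]: "blinfun_apply r = Re" "blinfun_apply m = Im"
    unfolding r_def m_def by (simp_all add: bounded_linear_Blinfun_apply bounded_linear_Re bounded_linear_Im)
  define D where "D = (\<lambda>z. P z *\<^sub>R r + Q z *\<^sub>R m)"
  \<comment> \<open>\<open>T a b\<close> is the rank one operator that sends \<open>h\<close> to
    \<open>b h\<close> times the functional \<open>a\<close>; the Hessian is a combination of four
    of these.\<close>
  define T where "T = (\<lambda>(a::complex \<Rightarrow>\<^sub>L real) (b::complex \<Rightarrow>\<^sub>L real). blinfun_scaleR_left a o\<^sub>L b)"
  define D2 where "D2 = (\<lambda>z. A z *\<^sub>R T r r + B z *\<^sub>R T r m + B z *\<^sub>R T m r + C z *\<^sub>R T m m)"
  have 1: "(f has_derivative blinfun_apply (D z)) (at z)" for z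
    by (rule has_derivative_eq_rhs[OF C2_onD(2)[OF f]])
      (auto simp: D_def fun_eq_iff blinfun.add_left blinfun.scaleR_left)
  have 2: "(D has_derivative blinfun_apply (D2 z)) (at z)" for z
    unfolding D_def
    by (rule has_derivative_eq_rhs[OF has_derivative_add[OF has_derivative_scaleR_left[OF C2_onD(3)[OF f]] has_derivative_scaleR_left[OF C2_onD(4)[OF f]]]])
      (auto simp: D2_def T_def fun_eq_iff blinfun.add_left blinfun.scaleR_left scaleR_add_left algebra_simps)
  have 3: "continuous_on UNIV D2"
    unfolding D2_def by (intro continuous_intros C2_onD[OF f])
  show "\<exists>(D :: complex \<Rightarrow> complex \<Rightarrow>\<^sub>L real) (D2 :: complex \<Rightarrow> complex \<Rightarrow>\<^sub>L (complex \<Rightarrow>\<^sub>L real)).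
        (\<forall>z. (f has_derivative blinfun_apply (D z)) (at z)) \<and>
        (\<forall>z. (D has_derivative blinfun_apply (D2 z)) (at z)) \<and>
        continuous_on UNIV D2"
    using 1 2 3 by blast
qed

section \<open>Piecewise polynomial cutoffs and a C2 truncation of the logarithm\<close>

lemma DERIV_glue:
  fixes f g f' g' :: "real \<Rightarrow> real"
  assumes f: "\<And>s. s \<le> a \<Longrightarrow> (f has_real_derivative f' s) (at s)"
    and g: "\<And>s. s \<ge> a \<Longrightarrow> (g has_real_derivative g' s) (at s)"
    and eq: "f a = g a" "f' a = g' a"
  shows "((\<lambda>s. if s < a then f s else g s) has_real_derivative (if s < a then f' s else g' s)) (at s)"
proof -
  let ?F = "\<lambda>s. if s < a then f s else g s"
  consider "s < a" | "s > a" | "s = a" by linarith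
  thus ?thesis
  proof cases
    case 1
    have "(?F has_real_derivative f' s) (at s)"
      by (rule has_field_derivative_transform_within_open[OF f[of s], of "{..<a}"]) (use 1 in auto)
    thus ?thesis using 1 by simp
  next
    case 2
    have "(?F has_real_derivative g' s) (at s)"
      by (rule has_field_derivative_transform_within_open[OF g[of s], of "{a<..}"]) (use 2 in auto)
    thus ?thesis using 2 by simp
  next
    case 3
    have l: "((\<lambda>t. (?F t - ?F a) / (t - a)) \<longlongrightarrow> g' a) (at_left a)"
    proof (rule Lim_transform_eventually)
      show "((\<lambda>t. (f t - f a) / (t - a)) \<longlongrightarrow> g' a) (at_left a)"
        using f[of a] eq unfolding has_field_derivative_iff by (auto intro: filterlim_at_split[THEN iffD1, THEN conjunct1])
      show "\<forall>\<^sub>F t in at_left a. (f t - f a) / (t - a) = (?F t - ?F a) / (t - a)"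
        by (auto simp: eventually_at_filter eq)
    qed
    have r: "((\<lambda>t. (?F t - ?F a) / (t - a)) \<longlongrightarrow> g' a) (at_right a)"
    proof (rule Lim_transform_eventually)
      show "((\<lambda>t. (g t - g a) / (t - a)) \<longlongrightarrow> g' a) (at_right a)"
        using g[of a] eq unfolding has_field_derivative_iff by (auto intro: filterlim_at_split[THEN iffD1, THEN conjunct2])
      show "\<forall>\<^sub>F t in at_right a. (g t - g a) / (t - a) = (?F t - ?F a) / (t - a)"
        by (auto simp: eventually_at_filter eq)
    qed
    show ?thesis using filterlim_at_split[THEN iffD2, OF conjI, OF l r] 3
      by (simp add: has_field_derivative_iff)
  qed
qed

definition pcube :: "real \<Rightarrow> real" where "pcube s = (if s < 0 then 0 else s ^ 3)"
definition pcube' :: "real \<Rightarrow> real" where "pcube' s = (if s < 0 then 0 else 3 * s ^ 2)"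
definition pcube'' :: "real \<Rightarrow> real" where "pcube'' s = (if s < 0 then 0 else 6 * s)"

lemma pcube_deriv:
  "(pcube has_real_derivative pcube' s) (at s)" "(pcube' has_real_derivative pcube'' s) (at s)"
  unfolding pcube_def pcube'_def pcube''_def
  by (rule DERIV_glue; auto intro!: derivative_eq_intros)+

text \<open>The cube of a positive part is C2, which is all that \<open>test_fun\<close> requires,
  so no exponential bump is needed. Nesting two of them gives 1 up to \<open>s = 1\<close>, where
  the inner cube vanishes, and 0 from \<open>s = 2\<close> on, where the inner cube has reached
  1.\<close>

definition cutoff :: "real \<Rightarrow> real" where "cutoff s = pcube (1 - pcube (s - 1))"
definition cutoff' :: "real \<Rightarrow> real" where "cutoff' s = - pcube' (1 - pcube (s - 1)) * pcube' (s - 1)"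
definition cutoff'' :: "real \<Rightarrow> real" where
  "cutoff'' s = pcube'' (1 - pcube (s - 1)) * (pcube' (s - 1))\<^sup>2 - pcube' (1 - pcube (s - 1)) * pcube'' (s - 1)"

lemma cutoff_deriv:
  "(cutoff has_real_derivative cutoff' s) (at s)" "(cutoff' has_real_derivative cutoff'' s) (at s)"
proof -
  have 0: "((\<lambda>s. s - 1) has_real_derivative 1) (at s)" for s :: real by (auto intro!: derivative_eq_intros)
  have 1: "((\<lambda>s. 1 - pcube (s - 1)) has_real_derivative - pcube' (s - 1)) (at s)" for s
    using DERIV_diff[OF DERIV_const[of 1] DERIV_chain2[OF pcube_deriv(1) 0]] by simp
  show "(cutoff has_real_derivative cutoff' s) (at s)"
    unfolding cutoff_def cutoff'_def using DERIV_chain2[OF pcube_deriv(1) 1, of s] by simp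
  have 2: "((\<lambda>s. pcube' (s - 1)) has_real_derivative pcube'' (s - 1)) (at s)"
    using DERIV_chain2[OF pcube_deriv(2) 0] by simp
  show "(cutoff' has_real_derivative cutoff'' s) (at s)"
    unfolding cutoff'_def
    by (rule DERIV_cong[OF DERIV_mult[OF DERIV_minus[OF DERIV_chain2[OF pcube_deriv(2) 1]] 2]])
      (simp add: cutoff''_def power2_eq_square algebra_simps)
qed

lemma cutoff_cont: "continuous_on A cutoff" "continuous_on A cutoff'" "continuous_on A cutoff''"
proof -
  have c: "continuous_on A (\<lambda>x. f (g x))" if "continuous_on UNIV f" "continuous_on A g" for f g and A :: "real set" and B :: "real set"
    using continuous_on_compose2[OF that(1,2)] by auto
  have p: "continuous_on UNIV pcube" "continuous_on UNIV pcube'"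
    using pcube_deriv by (meson DERIV_isCont continuous_at_imp_continuous_on)+
  have eq: "pcube'' = (\<lambda>s. 6 * max 0 s)" by (auto simp: pcube''_def fun_eq_iff)
  show "continuous_on A cutoff" "continuous_on A cutoff'"
    using cutoff_deriv by (meson DERIV_isCont continuous_at_imp_continuous_on)+
  show "continuous_on A cutoff''" unfolding cutoff''_def eq
    by (intro continuous_intros c[OF p(1)] c[OF p(2)])
qed

lemma cutoff_simps:
  "s \<le> 1 \<Longrightarrow> cutoff s = 1" "s \<le> 1 \<Longrightarrow> cutoff' s = 0" "s \<le> 1 \<Longrightarrow> cutoff'' s = 0"
  "s \<ge> 2 \<Longrightarrow> cutoff s = 0" "s \<ge> 2 \<Longrightarrow> cutoff' s = 0" "s \<ge> 2 \<Longrightarrow> cutoff'' s = 0"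
proof -
  assume s: "s \<ge> 2"
  hence "pcube (s - 1) \<ge> 1" by (simp add: pcube_def one_le_power)
  thus "cutoff s = 0" "cutoff' s = 0" "cutoff'' s = 0"
    by (auto simp: cutoff_def cutoff'_def cutoff''_def pcube_def[of "1 - _"] pcube'_def[of "1 - _"] pcube''_def[of "1 - _"])
qed (auto simp: cutoff_def cutoff'_def cutoff''_def pcube_def pcube'_def pcube''_def)

lemma cutoff_range: "0 \<le> cutoff s" "cutoff s \<le> 1"
proof -
  show "0 \<le> cutoff s" by (simp add: cutoff_def pcube_def)
  have "pcube t \<ge> 0" for t by (simp add: pcube_def)
  hence "1 - pcube (s - 1) \<le> 1" by simp
  thus "cutoff s \<le> 1" unfolding cutoff_def pcube_def[of "1 - _"] by (auto intro!: power_le_one)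
qed

lemma cutoff_bounded:
  obtains M where "M \<ge> 0" "\<And>s. \<bar>cutoff' s\<bar> \<le> M" "\<And>s. \<bar>cutoff'' s\<bar> \<le> M"
proof -
  have "compact (cutoff' ` {1..2})" "compact (cutoff'' ` {1..2})"
    by (intro compact_continuous_image cutoff_cont compact_Icc)+
  then obtain a b where a: "\<And>s. s \<in> {1..2} \<Longrightarrow> \<bar>cutoff' s\<bar> \<le> a" and b: "\<And>s. s \<in> {1..2} \<Longrightarrow> \<bar>cutoff'' s\<bar> \<le> b"
    by (force dest!: compact_imp_bounded simp: bounded_iff)
  show thesis
  proof (rule that[of "\<bar>a\<bar> + \<bar>b\<bar>"])
    fix s
    have "s \<in> {1..2} \<or> cutoff' s = 0 \<and> cutoff'' s = 0"
      using cutoff_simps[of s] by (cases "s \<le> 1"; cases "s \<ge> 2") auto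
    thus "\<bar>cutoff' s\<bar> \<le> \<bar>a\<bar> + \<bar>b\<bar>" "\<bar>cutoff'' s\<bar> \<le> \<bar>a\<bar> + \<bar>b\<bar>"
      using a[of s] b[of s] by auto
  qed simp
qed

text \<open>A truncation of \<open>ln s / 2\<close> whose composite with \<open>\<bar>z\<bar>\<^sup>2\<close> is subharmonic: \<open>s * regln' s\<close> is nondecreasing.\<close>
definition regln :: "real \<Rightarrow> real" where "regln s = (if s < 1 then (s - 1) / 2 - (s - 1)\<^sup>2 / 4 else ln s / 2)"
definition regln' :: "real \<Rightarrow> real" where "regln' s = (if s < 1 then 1 - s / 2 else 1 / (2 * s))"
definition regln'' :: "real \<Rightarrow> real" where "regln'' s = (if s < 1 then - 1 / 2 else - 1 / (2 * s\<^sup>2))"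

lemma regln_deriv:
  "(regln has_real_derivative regln' s) (at s)" "(regln' has_real_derivative regln'' s) (at s)"
  unfolding regln_def regln'_def regln''_def
  by (rule DERIV_glue; auto intro!: derivative_eq_intros simp: field_simps power2_eq_square)+

lemma regln''_cont: "continuous_on A regln''"
proof -
  have eq: "regln'' = (\<lambda>s. - 1 / (2 * (max 1 s)\<^sup>2))" by (auto simp: regln''_def fun_eq_iff max_def)
  show ?thesis unfolding eq by (intro continuous_intros) auto
qed

text \<open>This sandwich later supplies the dominating function when the smoothing radius tends to
  0. On the interval from \<open>s\<close> to 1 the difference to \<open>ln s / 2\<close> has
  derivative \<open>- ((t - 1)\<^sup>2 / (2 * t))\<close>, a negative square, and it vanishes at
  1.\<close>

lemma regln_bounds:
  assumes "0 < s"
  shows "ln s / 2 \<le> regln s" "s \<le> 1 \<Longrightarrow> regln s \<le> 0"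
proof -
  show "regln s \<le> 0" if s: "s \<le> 1"
  proof (cases "s = 1")
    case False
    have "(s - 1) / 2 \<le> 0" "0 \<le> (s - 1)\<^sup>2 / 4" using s by auto
    hence "(s - 1) / 2 - (s - 1)\<^sup>2 / 4 \<le> 0" by linarith
    thus ?thesis using s False by (simp only: regln_def if_P)
  qed (simp add: regln_def)
  show "ln s / 2 \<le> regln s"
  proof (cases "s < 1")
    case True
    have "regln 1 - ln 1 / 2 \<le> regln s - ln s / 2"
    proof (rule DERIV_nonpos_imp_nonincreasing[where f = "\<lambda>s. regln s - ln s / 2"])
      show "s \<le> 1" using True by simp
      fix t assume t: "s \<le> t" "t \<le> 1"
      have "((\<lambda>s. regln s - ln s / 2) has_real_derivative regln' t - 1 / (2 * t)) (at t)"
        using t assms by (auto intro!: derivative_eq_intros regln_deriv)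
      moreover have "regln' t - 1 / (2 * t) = - ((t - 1)\<^sup>2 / (2 * t))"
        using t assms by (auto simp: regln'_def field_simps power2_eq_square)
      ultimately show "\<exists>y. ((\<lambda>s. regln s - ln s / 2) has_real_derivative y) (at t) \<and> y \<le> 0"
        using t assms by (intro exI[of _ "- ((t - 1)\<^sup>2 / (2 * t))"]) auto
    qed
    thus ?thesis by (simp add: regln_def[of 1])
  qed (simp add: regln_def)
qed

text \<open>\<open>eta R\<close> is the cutoff scaled to radius \<open>R\<close>;
  \<open>eta1\<close> and \<open>eta2\<close> are its first and second derivatives in the variable
  \<open>(cmod z)\<^sup>2\<close>, and \<open>etaL\<close> is its Laplacian.\<close>

definition eta :: "real \<Rightarrow> complex \<Rightarrow> real" where "eta R z = cutoff ((cmod z)\<^sup>2 / R\<^sup>2)"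
definition eta1 :: "real \<Rightarrow> complex \<Rightarrow> real" where "eta1 R z = cutoff' ((cmod z)\<^sup>2 / R\<^sup>2) / R\<^sup>2"
definition eta2 :: "real \<Rightarrow> complex \<Rightarrow> real" where "eta2 R z = cutoff'' ((cmod z)\<^sup>2 / R\<^sup>2) / R ^ 4"
definition etaL :: "real \<Rightarrow> complex \<Rightarrow> real" where "etaL R z = 4 * eta1 R z + 4 * (cmod z)\<^sup>2 * eta2 R z"

lemma eta_C2:
  assumes "R > 0"
  shows "C2_on UNIV (eta R) (\<lambda>z. 2 * Re z * eta1 R z) (\<lambda>z. 2 * Im z * eta1 R z)
    (\<lambda>z. 2 * eta1 R z + 4 * (Re z)\<^sup>2 * eta2 R z) (\<lambda>z. 4 * Re z * Im z * eta2 R z)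
    (\<lambda>z. 2 * eta1 R z + 4 * (Im z)\<^sup>2 * eta2 R z)"
proof -
  have ds: "((\<lambda>s. s / R\<^sup>2) has_real_derivative 1 / R\<^sup>2) (at s)" for s
    by (rule DERIV_cdivide) simp
  have 1: "((\<lambda>s. cutoff (s / R\<^sup>2)) has_real_derivative cutoff' (s / R\<^sup>2) / R\<^sup>2) (at s)" for s
    using DERIV_chain2[OF cutoff_deriv(1) ds] by simp
  have 2: "((\<lambda>s. cutoff' (s / R\<^sup>2) / R\<^sup>2) has_real_derivative cutoff'' (s / R\<^sup>2) / R ^ 4) (at s)" for s
    using DERIV_cdivide[OF DERIV_chain2[OF cutoff_deriv(2) ds], of "R\<^sup>2" s]
    by (simp add: power4_eq_xxxx power2_eq_square mult.assoc)
  have 3: "continuous_on UNIV (\<lambda>s. cutoff'' (s / R\<^sup>2) / R ^ 4)"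
    using assms by (intro continuous_intros continuous_on_compose2[OF cutoff_cont(3)[of UNIV]]) auto
  show ?thesis
    using C2_on_radial[OF 1 2 3, of 0] by (simp add: eta_def[abs_def] eta1_def eta2_def)
qed

lemma etaL_alt: "(2 * eta1 R z + 4 * (Re z)\<^sup>2 * eta2 R z) + (2 * eta1 R z + 4 * (Im z)\<^sup>2 * eta2 R z) = etaL R z"
  by (simp add: etaL_def cmod_power2 algebra_simps)

lemma eta_inside:
  assumes "R > 0" "cmod z \<le> R"
  shows "eta R z = 1" "eta1 R z = 0" "eta2 R z = 0" "etaL R z = 0"
proof -
  have "(cmod z)\<^sup>2 / R\<^sup>2 \<le> 1" using assms by (simp add: power_mono)
  thus "eta R z = 1" "eta1 R z = 0" "eta2 R z = 0" "etaL R z = 0"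
    by (auto simp: eta_def eta1_def eta2_def etaL_def cutoff_simps)
qed

lemma eta_outside:
  assumes "R > 0" "cmod z \<ge> 2 * R"
  shows "eta R z = 0" "eta1 R z = 0" "eta2 R z = 0" "etaL R z = 0"
proof -
  have "(2 * R)\<^sup>2 \<le> (cmod z)\<^sup>2" using assms by (intro power_mono) auto
  moreover have "(2 * R)\<^sup>2 = 4 * R\<^sup>2" by (simp add: power_mult_distrib)
  ultimately have "2 * R\<^sup>2 \<le> (cmod z)\<^sup>2" using zero_le_power2[of R] by linarith
  hence "(cmod z)\<^sup>2 / R\<^sup>2 \<ge> 2" using assms by (simp add: pos_le_divide_eq)
  thus "eta R z = 0" "eta1 R z = 0" "eta2 R z = 0" "etaL R z = 0"
    by (auto simp: eta_def eta1_def eta2_def etaL_def cutoff_simps)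
qed

lemma eta_range: "0 \<le> eta R z" "eta R z \<le> 1"
  by (auto simp: eta_def cutoff_range)

lemma eta_bounded:
  obtains M where "M \<ge> 0" "\<And>R z. R > 0 \<Longrightarrow> \<bar>eta1 R z\<bar> \<le> M / R\<^sup>2" "\<And>R z. R > 0 \<Longrightarrow> \<bar>etaL R z\<bar> \<le> M / R\<^sup>2"
proof -
  obtain M where M: "M \<ge> 0" "\<And>s. \<bar>cutoff' s\<bar> \<le> M" "\<And>s. \<bar>cutoff'' s\<bar> \<le> M"
    using cutoff_bounded by metis
  have 1: "\<bar>eta1 R z\<bar> \<le> M / R\<^sup>2" if "R > 0" for R z
    using M(2) that by (simp add: eta1_def divide_right_mono)
  \<comment> \<open>20 is 4 + 16: the term \<open>4 * eta1\<close> contributes 4, and where the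
    cutoff is not yet 0 the factor \<open>4 * (cmod z)\<^sup>2\<close> is at most
    \<open>16 * R\<^sup>2\<close>.\<close>
  have L: "\<bar>etaL R z\<bar> \<le> 20 * M / R\<^sup>2" if R: "R > 0" for R z
  proof (cases "cmod z \<ge> 2 * R")
    case False
    have "(cmod z)\<^sup>2 \<le> (2 * R)\<^sup>2" using False by (intro power_mono) auto
    hence "(cmod z)\<^sup>2 * \<bar>eta2 R z\<bar> \<le> (4 * R\<^sup>2) * (M / R ^ 4)"
      using M(3)[of "(cmod z)\<^sup>2 / R\<^sup>2"] R by (intro mult_mono) (auto simp: eta2_def divide_right_mono power2_eq_square)
    also have "\<dots> = 4 * (M / R\<^sup>2)" using R by (simp add: power4_eq_xxxx power2_eq_square)
    finally have "\<bar>4 * (cmod z)\<^sup>2 * eta2 R z\<bar> \<le> 16 * (M / R\<^sup>2)" by (simp add: abs_mult)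
    moreover have "\<bar>4 * eta1 R z\<bar> \<le> 4 * (M / R\<^sup>2)" using 1[OF R, of z] by simp
    ultimately show ?thesis unfolding etaL_def by linarith
  qed (use M R in \<open>simp add: eta_outside\<close>)
  show thesis
  proof (rule that[of "20 * M"])
    show "\<bar>eta1 R z\<bar> \<le> 20 * M / R\<^sup>2" if R: "R > 0" for R z
    proof -
      have "M / R\<^sup>2 \<le> 20 * M / R\<^sup>2" using M R by (simp add: divide_right_mono)
      thus ?thesis using 1[OF R, of z] by linarith
    qed
  qed (use M L in auto)
qed

lemma eta_borel [measurable]:
  "eta R \<in> borel_measurable borel" "eta1 R \<in> borel_measurable borel" "eta2 R \<in> borel_measurable borel" "etaL R \<in> borel_measurable borel"
proof -
  have [measurable]: "cutoff \<in> borel_measurable borel" "cutoff' \<in> borel_measurable borel" "cutoff'' \<in> borel_measurable borel"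
    by (intro borel_measurable_continuous_onI cutoff_cont)+
  show a: "eta R \<in> borel_measurable borel" "eta1 R \<in> borel_measurable borel" "eta2 R \<in> borel_measurable borel"
    unfolding eta_def[abs_def] eta1_def[abs_def] eta2_def[abs_def] by measurable
  note [measurable] = a
  show "etaL R \<in> borel_measurable borel" unfolding etaL_def[abs_def] by measurable
qed

lemma eta_test_fun: "R > 0 \<Longrightarrow> test_fun (eta R)" "R > 0 \<Longrightarrow> laplacian (eta R) z = etaL R z"
proof -
  assume R: "R > 0"
  show "test_fun (eta R)"
    by (rule C2_on_test_fun[OF eta_C2[OF R] compact_cball[of 0 "2 * R"]]) (auto intro!: eta_outside R)
  show "laplacian (eta R) z = etaL R z"
    using C2_on_laplacian[OF eta_C2[OF R], of z] etaL_alt[of R z] by simp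
qed

text \<open>A radial probability density on the disc of radius \<open>d\<close>. The parabolic
  profile is not a free choice: it is \<open>1 / (2 * pi)\<close> times the Laplacian of the
  logarithm smoothed by \<open>regln\<close>.\<close>

definition chi :: "real \<Rightarrow> real \<Rightarrow> real" where
  "chi d t = 2 / (pi * d\<^sup>2) * max 0 (1 - t\<^sup>2 / d\<^sup>2)"

text \<open>Layer-cake computation: the set where \<open>1 - (cmod z)\<^sup>2 / d\<^sup>2\<close> is
  at least \<open>u\<close> is a disc of area \<open>pi * d\<^sup>2 * (1 - u)\<close>, and
  integrating over \<open>u\<close> in \<open>{0..1}\<close> gives half of
  \<open>pi * d\<^sup>2\<close>.\<close>

lemma chi_integral:
  assumes d: "d > 0"
  shows "(\<integral>z. chi d (cmod z) \<partial>(lborel :: complex measure)) = 1"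
proof -
  have "(\<integral>\<^sup>+ z. ennreal (max 0 (1 - (cmod z)\<^sup>2 / d\<^sup>2)) \<partial>(lborel :: complex measure)) =
    (\<integral>\<^sup>+ z. \<integral>\<^sup>+ u. indicator {0..1} u * indicator {..1 - u} ((cmod z)\<^sup>2 / d\<^sup>2) \<partial>lborel \<partial>(lborel :: complex measure))"
  proof (rule nn_integral_cong)
    fix z :: complex
    define a where "a = (cmod z)\<^sup>2 / d\<^sup>2"
    have a0: "a \<ge> 0" by (simp add: a_def)
    have "(\<integral>\<^sup>+ u. indicator {0..1} u * indicator {..1 - u} a \<partial>lborel) = (\<integral>\<^sup>+ u. indicator {0..1 - a} u \<partial>lborel)"
      using a0 by (intro nn_integral_cong) (auto simp: indicator_def)
    also have "\<dots> = ennreal (max 0 (1 - a))"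
      by (cases "a \<le> 1") (auto simp: max_def)
    finally show "ennreal (max 0 (1 - (cmod z)\<^sup>2 / d\<^sup>2)) = (\<integral>\<^sup>+ u. indicator {0..1} u * indicator {..1 - u} ((cmod z)\<^sup>2 / d\<^sup>2) \<partial>lborel)"
      by (simp add: a_def)
  qed
  also have "\<dots> = (\<integral>\<^sup>+ u. \<integral>\<^sup>+ z. indicator {0..1} u * indicator {..1 - u} ((cmod z)\<^sup>2 / d\<^sup>2) \<partial>(lborel :: complex measure) \<partial>lborel)"
    by (rule lborel_pair.Fubini'[symmetric]) (unfold split_def indicator_def atMost_iff, measurable)
  also have "\<dots> = (\<integral>\<^sup>+ u. ennreal (pi * d\<^sup>2 * (1 - u)) * indicator {0..1} u \<partial>lborel)"
  proof (rule nn_integral_cong)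
    fix u :: real
    show "(\<integral>\<^sup>+ z. indicator {0..1} u * indicator {..1 - u} ((cmod z)\<^sup>2 / d\<^sup>2) \<partial>(lborel :: complex measure)) = ennreal (pi * d\<^sup>2 * (1 - u)) * indicator {0..1} u"
    proof (cases "u \<in> {0..1}")
      case True
      have eq: "indicator {..1 - u} ((cmod z)\<^sup>2 / d\<^sup>2) = (indicator (cball 0 (d * sqrt (1 - u))) z :: ennreal)" for z :: complex
      proof -
        have "(cmod z)\<^sup>2 / d\<^sup>2 \<le> 1 - u \<longleftrightarrow> (cmod z)\<^sup>2 \<le> (d * sqrt (1 - u))\<^sup>2"
          using d True by (simp add: field_simps power_mult_distrib)
        also have "\<dots> \<longleftrightarrow> cmod z \<le> d * sqrt (1 - u)"
          using d True by (intro power2_le_iff_abs_le[THEN trans]) auto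
        finally show ?thesis by (simp add: indicator_def)
      qed
      have r: "d * sqrt (1 - u) \<ge> 0" using True d by simp
      show ?thesis unfolding eq using True emeasure_cball[OF r, of "0::complex"] d
        by (simp add: unit_ball_vol_2 power_mult_distrib mult.assoc)
    qed simp
  qed
  also have "\<dots> = ennreal ((\<lambda>u. pi * d\<^sup>2 * (u - u\<^sup>2 / 2)) 1 - (\<lambda>u. pi * d\<^sup>2 * (u - u\<^sup>2 / 2)) 0)"
    by (rule nn_integral_FTC_Icc) (use d in \<open>auto intro!: derivative_eq_intros\<close>)
  also have "(\<lambda>u. pi * d\<^sup>2 * (u - u\<^sup>2 / 2)) 1 - (\<lambda>u. pi * d\<^sup>2 * (u - u\<^sup>2 / 2)) 0 = pi * d\<^sup>2 / 2"
    by simp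
  finally have "(\<integral>z. max 0 (1 - (cmod z)\<^sup>2 / d\<^sup>2) \<partial>(lborel :: complex measure)) = pi * d\<^sup>2 / 2"
    by (subst integral_eq_nn_integral) auto
  thus ?thesis using d by (simp add: chi_def)
qed

lemma chi_props:
  assumes "d > 0"
  shows "0 \<le> chi d t" "chi d t \<le> 2 / (pi * d\<^sup>2)" "\<bar>t\<bar> \<ge> d \<Longrightarrow> chi d t = 0"
proof -
  show "0 \<le> chi d t" using assms by (simp add: chi_def)
  show "chi d t \<le> 2 / (pi * d\<^sup>2)"
    unfolding chi_def using assms by (intro mult_left_le) (auto simp: max_def)
  assume "\<bar>t\<bar> \<ge> d"
  hence "d\<^sup>2 \<le> t\<^sup>2" using assms by (metis abs_le_square_iff abs_of_pos)
  thus "chi d t = 0" using assms by (simp add: chi_def)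
qed

lemma chi_borel [measurable]: "chi d \<in> borel_measurable borel"
  unfolding chi_def[abs_def] by measurable

section \<open>Primary factors\<close>

lemma Re_of_real_mult: "Re (of_real r * z) = r * Re z" "Re (z * of_real r) = r * Re z"
  by simp_all

text \<open>The part of the logarithm of the primary factor that stays smooth at
  \<open>z = x\<close>; its only singularity is at 0. Splitting it off allows the singularities at
  \<open>x\<close> and at 0 to be treated by different truncations. \<open>grest\<close> is its
  complex gradient.\<close>

definition rest :: "nat \<Rightarrow> real \<Rightarrow> complex \<Rightarrow> real" where
  "rest k x z = (\<Sum>j=1..k. x ^ j * Re (1 / z ^ j) / real j) - ln (cmod z)"

definition grest :: "nat \<Rightarrow> real \<Rightarrow> complex \<Rightarrow> complex" where
  "grest k x z = - (\<Sum>j=0..k. of_real (x ^ j) * (1 / z ^ Suc j))"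

text \<open>\<open>Kern k x z = ln \<bar>E(x/z, k)\<bar>\<close> with \<open>E\<close> the Weierstrass primary factor of genus \<open>k\<close>, for \<open>z \<noteq> 0\<close>;
  the complex gradient of \<open>Kern k x\<close> is \<open>gKern k x\<close>.\<close>
definition Kern :: "nat \<Rightarrow> real \<Rightarrow> complex \<Rightarrow> real" where
  "Kern k x z = ln (cmod (z - of_real x)) + rest k x z"

definition gKern :: "nat \<Rightarrow> real \<Rightarrow> complex \<Rightarrow> complex" where
  "gKern k x z = 1 / (z - of_real x) + grest k x z"

lemma inverse_power_deriv:
  fixes z :: complex
  assumes "z \<noteq> 0"
  shows "((\<lambda>z. 1 / z ^ j) has_field_derivative - of_nat j / z ^ Suc j) (at z)"
proof (induction j)
  case (Suc j)
  have "((\<lambda>z. 1 / z ^ j * (1 / z)) has_field_derivative (- of_nat j / z ^ Suc j) * (1 / z) + (- 1 / z\<^sup>2) * (1 / z ^ j)) (at z)"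
    using assms by (intro DERIV_mult Suc) (auto intro!: derivative_eq_intros simp: power2_eq_square)
  also have "(- of_nat j / z ^ Suc j) * (1 / z) + (- 1 / z\<^sup>2) * (1 / z ^ j) = - of_nat (Suc j) / z ^ Suc (Suc j)"
    using assms by (simp add: field_simps power2_eq_square)
  finally show ?case by (simp add: mult.commute)
qed simp

text \<open>The geometric sum telescopes: each further term of the primary factor removes the
  leading term at infinity and gains one power of decay.\<close>

lemma gKern_eq:
  assumes "z \<noteq> 0" "z \<noteq> of_real x"
  shows "gKern k x z = of_real (x ^ Suc k) / (z ^ Suc k * (z - of_real x))"
proof -
  have frac: "c / (d * (z - e)) - c / (d * z) = c * e / (d * z * (z - e))" if "d \<noteq> 0" "z \<noteq> e" for c d e :: complex
    using that assms by (simp add: field_simps)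
  show ?thesis
  proof (induction k)
  case 0
  show ?case using assms by (simp add: gKern_def grest_def field_simps)
next
  case (Suc k)
  have "gKern (Suc k) x z = gKern k x z - of_real (x ^ Suc k) / z ^ Suc (Suc k)"
    by (simp add: gKern_def grest_def)
  also have "\<dots> = of_real (x ^ Suc k) / (z ^ Suc k * (z - of_real x)) - of_real (x ^ Suc k) / (z ^ Suc k * z)"
    unfolding Suc by (simp add: mult.commute)
  also have "\<dots> = of_real (x ^ Suc k) * of_real x / (z ^ Suc k * z * (z - of_real x))"
    by (rule frac) (use assms in auto)
  finally show ?case by (simp add: mult_ac)
  qed
qed

lemma ln_cmod_derivative:
  assumes "z \<noteq> a"
  shows "((\<lambda>z. ln (cmod (z - a))) has_derivative (\<lambda>h. Re (1 / (z - a) * h))) (at z)"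
proof -
  have pos: "(Re (z - a))\<^sup>2 + (Im (z - a))\<^sup>2 > 0"
    unfolding cmod_power2[symmetric] using assms by simp
  have Re_w: "Re (1 / w * h) = (Re w * Re h + Im w * Im h) / ((Re w)\<^sup>2 + (Im w)\<^sup>2)" for w h
    by (simp add: Re_divide mult.commute)
  have alg: "inverse n * (2 * p * r + 2 * q * s) * (1 / 2) = (p * r + q * s) / n" for n p q r s :: real
  proof -
    have "inverse n * (2 * p * r + 2 * q * s) * (1 / 2) = inverse n * (p * r + q * s)" by simp
    thus ?thesis by (simp only: divide_inverse mult.commute)
  qed
  have N: "((\<lambda>z. (Re (z - a))\<^sup>2 + (Im (z - a))\<^sup>2) has_derivative (\<lambda>h. 2 * Re (z - a) * Re h + 2 * Im (z - a) * Im h)) (at z)"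
    by (auto intro!: derivative_eq_intros simp: fun_eq_iff algebra_simps)
  have "((\<lambda>z. ln ((Re (z - a))\<^sup>2 + (Im (z - a))\<^sup>2) * (1 / 2)) has_derivative (\<lambda>h. Re (1 / (z - a) * h))) (at z)"
    by (rule has_derivative_eq_rhs[OF has_derivative_mult_left[OF has_derivative_compose[OF N DERIV_ln[OF pos, unfolded has_field_derivative_def]]]])
      (simp only: Re_w alg)
  moreover have "ln ((Re (z - a))\<^sup>2 + (Im (z - a))\<^sup>2) * (1 / 2) = ln (cmod (z - a))" for z
    using ln_realpow[of "cmod (z - a)" 2] unfolding cmod_power2[symmetric] by (cases "z = a") auto
  ultimately show ?thesis by simp
qed

lemma rest_derivative:
  assumes "z \<noteq> 0"
  shows "(rest k x has_derivative (\<lambda>h. Re (grest k x z * h))) (at z)"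
proof -
  have 1: "((\<lambda>z. Re (1 / z ^ j)) has_derivative (\<lambda>h. Re (- of_nat j / z ^ Suc j * h))) (at z)" for j
    using inverse_power_deriv[OF assms, of j] unfolding has_field_derivative_def by (rule has_derivative_Re)
  have 2: "((\<lambda>z. x ^ j * Re (1 / z ^ j) / real j) has_derivative (\<lambda>h. x ^ j * Re (- of_nat j / z ^ Suc j * h) / real j)) (at z)" for j
    using has_derivative_mult_right[OF 1[of j], of "x ^ j / real j"] by simp
  have "(rest k x has_derivative (\<lambda>h. (\<Sum>j=1..k. x ^ j * Re (- of_nat j / z ^ Suc j * h) / real j) - Re (1 / (z - 0) * h))) (at z)"
    unfolding rest_def[abs_def]
    by (intro has_derivative_diff has_derivative_sum 2)
       (use ln_cmod_derivative[of z 0] assms in auto)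
  moreover have "(\<Sum>j=1..k. x ^ j * Re (- of_nat j / z ^ Suc j * h) / real j) - Re (1 / (z - 0) * h) = Re (grest k x z * h)" for h
  proof -
    have g: "grest k x z = - (1 / z) - (\<Sum>j=1..k. of_real (x ^ j) * (1 / z ^ Suc j))"
      by (simp add: grest_def sum.atLeast_Suc_atMost)
    have "grest k x z * h = - (1 / z * h) - (\<Sum>j=1..k. of_real (x ^ j) * (1 / z ^ Suc j) * h)"
      unfolding g left_diff_distrib sum_distrib_right by simp
    hence "Re (grest k x z * h) = - Re (1 / z * h) - (\<Sum>j=1..k. Re (of_real (x ^ j) * (1 / z ^ Suc j) * h))"
      by simp
    moreover have "x ^ j * Re (- of_nat j / z ^ Suc j * h) / real j = - Re (of_real (x ^ j) * (1 / z ^ Suc j) * h)" if "j \<in> {1..k}" for j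
    proof -
      have "- of_nat j / z ^ Suc j * h = of_real (real j) * - (1 / z ^ Suc j * h)" by simp
      hence "Re (- of_nat j / z ^ Suc j * h) = real j * - Re (1 / z ^ Suc j * h)" by (simp only: Re_of_real_mult) simp
      moreover have "Re (of_real (x ^ j) * (1 / z ^ Suc j) * h) = x ^ j * Re (1 / z ^ Suc j * h)"
        by (simp only: mult.assoc Re_of_real_mult)
      ultimately show ?thesis using that by simp
    qed
    ultimately show ?thesis by (simp add: sum_negf)
  qed
  ultimately show ?thesis by simp
qed

lemma rest_C2:
  obtains g' where "C2_on (- {0}) (rest k x) (\<lambda>z. Re (grest k x z)) (\<lambda>z. - Im (grest k x z)) (\<lambda>z. Re (g' z)) (\<lambda>z. - Im (g' z)) (\<lambda>z. - Re (g' z))"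
proof (rule that, rule C2_on_Re)
  show "(rest k x has_derivative (\<lambda>h. Re (grest k x z * h))) (at z)" if "z \<in> - {0}" for z
    using rest_derivative that by auto
  let ?g' = "\<lambda>z::complex. \<Sum>j=0..k. of_real (x ^ j) * (of_nat (Suc j) / z ^ Suc (Suc j))"
  show "(grest k x has_field_derivative ?g' z) (at z)" if "z \<in> - {0}" for z
  proof -
    have "((\<lambda>z. of_real (x ^ j) * (1 / z ^ Suc j)) has_field_derivative of_real (x ^ j) * (- of_nat (Suc j) / z ^ Suc (Suc j))) (at z)" for j
      by (intro DERIV_cmult inverse_power_deriv) (use that in auto)
    hence "(grest k x has_field_derivative - (\<Sum>j=0..k. of_real (x ^ j) * (- of_nat (Suc j) / z ^ Suc (Suc j)))) (at z)"
      unfolding grest_def[abs_def] by (intro DERIV_minus DERIV_sum)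
    thus ?thesis by (simp add: sum_negf[symmetric] del: of_nat_Suc)
  qed
  show "continuous_on (- {0}) ?g'" by (intro continuous_intros) auto
qed auto

lemma geometric_remainder:
  fixes y z :: complex
  assumes z: "z \<noteq> 0" "z \<noteq> y"
  shows "- (1 / (z - y)) + (\<Sum>j=1..k. y ^ (j - 1) * (1 / z ^ j)) = y ^ k / (z ^ k * (y - z))"
proof (induction k)
  case 0
  show ?case using z by (simp add: field_simps)
next
  case (Suc k)
  have frac: "c / (d * (y - z)) + c / (z * d) = y * c / (z * d * (y - z))" if "d \<noteq> 0" for c d
    using that z by (simp add: field_simps)
  have "- (1 / (z - y)) + (\<Sum>j=1..Suc k. y ^ (j - 1) * (1 / z ^ j)) = y ^ k / (z ^ k * (y - z)) + y ^ k / (z * z ^ k)"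
    using Suc.IH by simp
  thus ?case using frac[of "z ^ k" "y ^ k"] z by simp
qed

text \<open>Moving the point of the ray from 0, where \<open>Kern\<close> vanishes, to
  \<open>x\<close> expresses \<open>Kern\<close> through a single rational function. Both the decay
  bound and the unit-interval formula \<open>Kern_unit_integral\<close> rest on this
  derivative.\<close>

lemma Kern_DERIV:
  assumes z: "z \<noteq> 0" "z \<noteq> of_real (t * x)"
  shows "((\<lambda>t. Kern k (t * x) z) has_real_derivative Re (of_real (x * (t * x) ^ k) / (z ^ k * (of_real (t * x) - z)))) (at t)"
proof -
  have *: "h * (x * Re (- w)) = Re (w * - of_real (h * x))" for h w by simp
  have i: "((\<lambda>t::real. z - of_real (t * x)) has_derivative (\<lambda>h. - of_real (h * x))) (at t)"
    by (auto intro!: derivative_eq_intros)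
  have "((\<lambda>t. ln (cmod ((z - of_real (t * x)) - 0))) has_derivative (\<lambda>h. Re (1 / ((z - of_real (t * x)) - 0) * - of_real (h * x)))) (at t)"
    by (rule has_derivative_compose[OF i ln_cmod_derivative]) (use z in auto)
  hence 1: "((\<lambda>t::real. ln (cmod (z - of_real (t * x)))) has_real_derivative x * Re (- (1 / (z - of_real (t * x))))) (at t)"
    unfolding diff_zero
    by (rule has_derivative_imp_has_field_derivative) (simp only: *)
  have 2: "((\<lambda>t. (t * x) ^ j * Re (1 / z ^ j) / real j) has_real_derivative x * ((t * x) ^ (j - 1) * Re (1 / z ^ j))) (at t)" if "j \<in> {1..k}" for j
    using that by (cases j) (auto intro!: derivative_eq_intros simp del: power_Suc)
  have "((\<lambda>t. Kern k (t * x) z) has_real_derivative x * Re (- (1 / (z - of_real (t * x)))) + ((\<Sum>j=1..k. x * ((t * x) ^ (j - 1) * Re (1 / z ^ j))) - 0)) (at t)"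
    unfolding Kern_def rest_def
    by (intro DERIV_add DERIV_diff DERIV_sum 1 2 DERIV_const)
  also have "x * Re (- (1 / (z - of_real (t * x)))) + ((\<Sum>j=1..k. x * ((t * x) ^ (j - 1) * Re (1 / z ^ j))) - 0) =
    x * Re (- (1 / (z - of_real (t * x))) + (\<Sum>j=1..k. of_real (t * x) ^ (j - 1) * (1 / z ^ j)))"
    by (simp only: sum_distrib_left[symmetric] plus_complex.sel Re_sum of_real_power[symmetric] Re_of_real_mult distrib_left diff_zero)
  also have "\<dots> = Re (of_real x * (of_real (t * x) ^ k / (z ^ k * (of_real (t * x) - z))))"
    unfolding geometric_remainder[OF z] by (simp only: Re_of_real_mult)
  also have "\<dots> = Re (of_real (x * (t * x) ^ k) / (z ^ k * (of_real (t * x) - z)))"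
    by simp
  finally show ?thesis .
qed

lemma Kern_0 [simp]: "Kern k 0 z = 0"
  by (auto simp: Kern_def rest_def intro!: sum.neutral)

text \<open>Mean value theorem on the segment from 0 to \<open>x\<close>: every point of the segment
  stays at distance at least \<open>cmod z / 2\<close> from \<open>z\<close>, and this is where the
  factor 2 comes from.\<close>

lemma Kern_bound:
  assumes x: "x > 0" and z: "cmod z \<ge> 2 * x"
  shows "\<bar>Kern k x z\<bar> \<le> 2 * x ^ Suc k / cmod z ^ Suc k"
proof -
  have z0: "cmod z > 0" "z \<noteq> 0" using x z by auto
  have nz: "z \<noteq> of_real (t * x)" if "0 \<le> t" "t \<le> 1" for t
  proof
    assume "z = of_real (t * x)"
    hence "cmod z = t * x" using that x by (simp only: norm_of_real) simp
    also have "\<dots> \<le> 1 * x" using that x by (intro mult_right_mono) auto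
    finally show False using x z by simp
  qed
  have "\<exists>t. t > 0 \<and> t < 1 \<and> Kern k (1 * x) z - Kern k (0 * x) z = (1 - 0) * Re (of_real (x * (t * x) ^ k) / (z ^ k * (of_real (t * x) - z)))"
    by (rule MVT2, simp, rule Kern_DERIV) (use z0 nz in auto)
  then obtain t where t: "t > 0" "t < 1" "Kern k x z = Re (of_real (x * (t * x) ^ k) / (z ^ k * (of_real (t * x) - z)))"
    by auto
  have tx: "t * x \<le> 1 * x" "0 \<le> t * x" using t x by (auto intro!: mult_right_mono)
  have "\<bar>Kern k x z\<bar> \<le> cmod (of_real (x * (t * x) ^ k) / (z ^ k * (of_real (t * x) - z)))"
    unfolding t(3) by (rule abs_Re_le_cmod)
  also have "\<dots> = (x * (t * x) ^ k) / (cmod z ^ k * cmod (of_real (t * x) - z))"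
    using x t by (simp only: norm_divide norm_mult norm_power norm_of_real) (simp add: abs_mult)
  also have "\<dots> \<le> (x * x ^ k) / (cmod z ^ k * (cmod z / 2))"
  proof (intro frac_le mult_mono power_mono mult_left_mono)
    have "cmod z - t * x \<le> cmod (of_real (t * x) - z)"
      using norm_triangle_ineq2[of z "of_real (t * x)"] x t by (simp add: norm_minus_commute norm_mult)
    thus "cmod z / 2 \<le> cmod (of_real (t * x) - z)" using tx z by simp
  qed (use x tx z0 in auto)
  finally show ?thesis by (simp add: mult_ac)
qed

text \<open>The logarithm of the distance to \<open>x\<close>, smoothed inside the disc of radius
  \<open>d\<close>; adding \<open>ln d\<close> makes it coincide with the true logarithm outside.
  \<open>regL1\<close> and \<open>regL2\<close> are its derivatives in the squared distance.\<close>

definition regL :: "real \<Rightarrow> real \<Rightarrow> complex \<Rightarrow> real" where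
  "regL d x z = regln ((cmod (z - of_real x))\<^sup>2 / d\<^sup>2) + ln d"
definition regL1 :: "real \<Rightarrow> real \<Rightarrow> complex \<Rightarrow> real" where
  "regL1 d x z = regln' ((cmod (z - of_real x))\<^sup>2 / d\<^sup>2) / d\<^sup>2"
definition regL2 :: "real \<Rightarrow> real \<Rightarrow> complex \<Rightarrow> real" where
  "regL2 d x z = regln'' ((cmod (z - of_real x))\<^sup>2 / d\<^sup>2) / d ^ 4"

lemma regL_C2:
  assumes "d > 0"
  shows "C2_on UNIV (regL d x) (\<lambda>z. 2 * Re (z - of_real x) * regL1 d x z) (\<lambda>z. 2 * Im (z - of_real x) * regL1 d x z)
    (\<lambda>z. 2 * regL1 d x z + 4 * (Re (z - of_real x))\<^sup>2 * regL2 d x z) (\<lambda>z. 4 * Re (z - of_real x) * Im (z - of_real x) * regL2 d x z)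
    (\<lambda>z. 2 * regL1 d x z + 4 * (Im (z - of_real x))\<^sup>2 * regL2 d x z)"
proof -
  have ds: "((\<lambda>s. s / d\<^sup>2) has_real_derivative 1 / d\<^sup>2) (at s)" for s
    by (rule DERIV_cdivide) simp
  have 1: "((\<lambda>s. regln (s / d\<^sup>2) + ln d) has_real_derivative regln' (s / d\<^sup>2) / d\<^sup>2) (at s)" for s
    using DERIV_add[OF DERIV_chain2[OF regln_deriv(1) ds] DERIV_const[of "ln d"]] by simp
  have 2: "((\<lambda>s. regln' (s / d\<^sup>2) / d\<^sup>2) has_real_derivative regln'' (s / d\<^sup>2) / d ^ 4) (at s)" for s
    using DERIV_cdivide[OF DERIV_chain2[OF regln_deriv(2) ds], of "d\<^sup>2" s]
    by (simp add: power4_eq_xxxx power2_eq_square mult.assoc)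
  have 3: "continuous_on UNIV (\<lambda>s. regln'' (s / d\<^sup>2) / d ^ 4)"
    using assms by (intro continuous_intros continuous_on_compose2[OF regln''_cont[of UNIV]]) auto
  show ?thesis
    using C2_on_radial[OF 1 2 3, of "of_real x"] by (simp add: regL_def[abs_def] regL1_def regL2_def)
qed

lemma regL_far:
  assumes d: "d > 0" and z: "cmod (z - of_real x) \<ge> d"
  shows "regL d x z = ln (cmod (z - of_real x))" "regL1 d x z = 1 / (2 * (cmod (z - of_real x))\<^sup>2)"
proof -
  define m where "m = cmod (z - of_real x)"
  have m: "m \<ge> d" "m > 0" using assms by (auto simp: m_def)
  have "d\<^sup>2 \<le> m\<^sup>2" using m d by (intro power_mono) auto
  hence "\<not> m\<^sup>2 / d\<^sup>2 < 1" using d by simp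
  thus "regL d x z = ln (cmod (z - of_real x))" "regL1 d x z = 1 / (2 * (cmod (z - of_real x))\<^sup>2)"
    unfolding regL_def regL1_def m_def[symmetric] regln_def regln'_def using m d
    by (simp_all add: ln_div ln_realpow field_simps)
qed

text \<open>Outside the disc the logarithm is harmonic and both sides are 0. Inside, the radial
  Laplacian of the quadratic piece of \<open>regln\<close> is exactly the parabola of
  \<open>chi\<close>.\<close>

lemma regL_laplacian:
  assumes d: "d > 0"
  shows "4 * regL1 d x z + 4 * (cmod (z - of_real x))\<^sup>2 * regL2 d x z = 2 * pi * chi d (cmod (z - of_real x))"
proof -
  define m where "m = (cmod (z - of_real x))\<^sup>2"
  have m: "m \<ge> 0" by (simp add: m_def)
  show ?thesis
  proof (cases "m / d\<^sup>2 < 1")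
    case True
    hence "2 * pi * chi d (cmod (z - of_real x)) = 4 / d\<^sup>2 * (1 - m / d\<^sup>2)"
      unfolding chi_def m_def[symmetric] by simp
    moreover have "4 * regL1 d x z + 4 * m * regL2 d x z = 4 / d\<^sup>2 * (1 - m / d\<^sup>2)"
      unfolding regL1_def regL2_def m_def[symmetric] regln'_def regln''_def using True d
      by (simp add: field_simps power2_eq_square power4_eq_xxxx)
    ultimately show ?thesis by (simp add: m_def)
  next
    case False
    hence "m \<noteq> 0" by auto
    have "2 * pi * chi d (cmod (z - of_real x)) = 0"
      unfolding chi_def m_def[symmetric] using False by simp
    moreover have "4 * regL1 d x z + 4 * m * regL2 d x z = 0"
      unfolding regL1_def regL2_def m_def[symmetric] regln'_def regln''_def using False d \<open>m \<noteq> 0\<close>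
      by (simp add: field_simps power2_eq_square power4_eq_xxxx)
    ultimately show ?thesis by (simp add: m_def)
  qed
qed

text \<open>What remains of the Laplacian of \<open>eta R\<close> times \<open>Kern\<close> on the
  annulus where \<open>eta R\<close> varies. \<open>Kern\<close> is harmonic there, so only the
  Laplacian of the cutoff and the mixed gradient term are left; in complex notation the latter is
  the term with \<open>Re (z * gKern k x z)\<close>. \<open>near\<close> is the analogue for
  \<open>rest\<close> and the inner cutoff.\<close>

definition far :: "nat \<Rightarrow> real \<Rightarrow> real \<Rightarrow> complex \<Rightarrow> real" where
  "far k x R z = etaL R z * Kern k x z + 4 * eta1 R z * Re (z * gKern k x z)"

definition near :: "nat \<Rightarrow> real \<Rightarrow> real \<Rightarrow> complex \<Rightarrow> real" where
  "near k x r z = etaL r z * rest k x z + 4 * eta1 r z * Re (z * grest k x z)"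

text \<open>A C2 stand-in for \<open>Kern\<close> with compact support: the logarithm at
  \<open>x\<close> is smoothed at scale \<open>d\<close>, the singularity at 0 is removed at scale
  \<open>r\<close>, and the tail is cut at scale \<open>R\<close>.\<close>

definition phi :: "nat \<Rightarrow> real \<Rightarrow> real \<Rightarrow> real \<Rightarrow> real \<Rightarrow> complex \<Rightarrow> real" where
  "phi k x d r R z = eta R z * regL d x z + (eta R z - eta r z) * rest k x z"

lemma phi_test:
  assumes d: "0 < d" and r: "0 < r" "r \<le> R" and x: "x > 0" "x + d \<le> R"
  shows "test_fun (phi k x d r R)"
    and "z \<noteq> 0 \<Longrightarrow> laplacian (phi k x d r R) z = 2 * pi * chi d (cmod (z - of_real x)) + far k x R z - near k x r z"
proof -
  have R: "R > 0" using r by simp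
  obtain g' where g': "C2_on (- {0}) (rest k x) (\<lambda>z. Re (grest k x z)) (\<lambda>z. - Im (grest k x z)) (\<lambda>z. Re (g' z)) (\<lambda>z. - Im (g' z)) (\<lambda>z. - Re (g' z))"
    using rest_C2 by metis
  have o: "open (- {0::complex})" by auto
  note C1 = C2_on_mult[OF eta_C2[OF R] regL_C2[OF d, of x]]
  note C2 = C2_on_mult[OF C2_on_subset[OF C2_on_diff[OF eta_C2[OF R] eta_C2[OF r(1)]] o subset_UNIV] g']
  note C = C2_on_add[OF C2_on_subset[OF C1 o subset_UNIV] C2]
  have phi_eq: "phi k x d r R = (\<lambda>z. eta R z * regL d x z + (eta R z - eta r z) * rest k x z)"
    by (simp add: phi_def[abs_def])
  \<comment> \<open>Near 0 both cutoffs equal 1, so the factor in front of the singular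
    \<open>rest\<close> vanishes identically. This gives a certificate across the origin, to be
    glued with the one off the origin.\<close>
  have "phi k x d r R z = eta R z * regL d x z" if "z \<in> ball 0 r" for z
    using that r R by (simp add: phi_def eta_inside)
  note B = C2_on_cong[OF C2_on_subset[OF C1 open_ball subset_UNIV] this]
  from C2_on_Un[OF B C[folded phi_eq]] obtain P Q A B C' where
    "C2_on (ball 0 r \<union> - {0}) (phi k x d r R) P Q A B C'" by blast
  moreover have "ball 0 r \<union> - {0::complex} = UNIV" using r by auto
  ultimately have "C2_on UNIV (phi k x d r R) P Q A B C'" by simp
  thus "test_fun (phi k x d r R)"
  proof (rule C2_on_test_fun[OF _ compact_cball[of 0 "2 * R"]])
    show "phi k x d r R z = 0" if "z \<notin> cball 0 (2 * R)" for z
      using that r R by (simp add: phi_def eta_outside)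
  qed
  assume z: "z \<noteq> 0"
  define a b where "a = Re z" and "b = Im z"
  define G where "G = grest k x z"
  have sq: "(Re (z - of_real x))\<^sup>2 + (Im (z - of_real x))\<^sup>2 = (cmod (z - of_real x))\<^sup>2" by (simp add: cmod_power2)
  have "laplacian (phi k x d r R) z =
     (2 * eta1 R z + 4 * (Re z)\<^sup>2 * eta2 R z + (2 * eta1 R z + 4 * (Im z)\<^sup>2 * eta2 R z)) * regL d x z
     + 8 * eta1 R z * regL1 d x z * (Re z * Re (z - of_real x) + Im z * Im (z - of_real x))
     + eta R z * (4 * regL1 d x z + 4 * ((Re (z - of_real x))\<^sup>2 + (Im (z - of_real x))\<^sup>2) * regL2 d x z)
     + ((2 * eta1 R z + 4 * (Re z)\<^sup>2 * eta2 R z + (2 * eta1 R z + 4 * (Im z)\<^sup>2 * eta2 R z)) -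
        (2 * eta1 r z + 4 * (Re z)\<^sup>2 * eta2 r z + (2 * eta1 r z + 4 * (Im z)\<^sup>2 * eta2 r z))) * rest k x z
     + 4 * (eta1 R z - eta1 r z) * Re (z * G)"
    unfolding G_def
    by (subst C2_on_laplacian[OF C[folded phi_eq]]) (use z in \<open>simp_all add: algebra_simps\<close>)
  also have "\<dots> = etaL R z * regL d x z + 8 * eta1 R z * regL1 d x z * (Re z * Re (z - of_real x) + Im z * Im (z - of_real x))
     + eta R z * (2 * pi * chi d (cmod (z - of_real x))) + (etaL R z - etaL r z) * rest k x z + 4 * (eta1 R z - eta1 r z) * Re (z * G)"
    unfolding etaL_alt sq regL_laplacian[OF d] ..
  \<comment> \<open>\<open>chi\<close> lives within distance \<open>d\<close> of \<open>x\<close>,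
    and \<open>x + d \<le> R\<close> puts that disc where \<open>eta R\<close> is 1.\<close>
  also have "eta R z * (2 * pi * chi d (cmod (z - of_real x))) = 2 * pi * chi d (cmod (z - of_real x))"
  proof (cases "cmod (z - of_real x) \<ge> d")
    case False
    have "cmod z \<le> R" using False norm_triangle_ineq[of "z - of_real x" "of_real x"] x by simp
    thus ?thesis using R by (simp add: eta_inside)
  qed (use chi_props(3)[OF d, of "cmod (z - of_real x)"] in auto)
  also have "etaL R z * regL d x z + 8 * eta1 R z * regL1 d x z * (Re z * Re (z - of_real x) + Im z * Im (z - of_real x))
     + 2 * pi * chi d (cmod (z - of_real x)) + (etaL R z - etaL r z) * rest k x z + 4 * (eta1 R z - eta1 r z) * Re (z * G)
    = 2 * pi * chi d (cmod (z - of_real x)) + far k x R z - near k x r z"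
  \<comment> \<open>Inside radius \<open>R\<close> the derivatives of \<open>eta R\<close> vanish.
    Outside, \<open>z\<close> is farther than \<open>d\<close> from \<open>x\<close>, so
    \<open>regL\<close> is the true logarithm and combines with \<open>rest\<close> to
    \<open>Kern\<close>.\<close>
  proof (cases "cmod z \<le> R")
    case True
    thus ?thesis by (simp add: eta_inside[OF R] far_def near_def G_def)
  next
    case False
    have m: "cmod (z - of_real x) \<ge> d" using False norm_triangle_ineq2[of z "of_real x"] x by simp
    hence m0: "cmod (z - of_real x) > 0" using d by linarith
    define w where "w = z - of_real x"
    have w0: "(cmod w)\<^sup>2 > 0" using m0 by (simp add: w_def)
    have "Re (z / w) = (Re z * Re w + Im z * Im w) / (cmod w)\<^sup>2"
      by (simp add: Re_divide cmod_power2)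
    hence e: "8 * eta1 R z * (1 / (2 * (cmod w)\<^sup>2)) * (Re z * Re w + Im z * Im w) = 4 * eta1 R z * Re (z / w)"
      by simp
    have g: "Re (z * gKern k x z) = Re (z / w) + Re (z * G)"
      by (simp add: gKern_def G_def w_def algebra_simps)
    show ?thesis
      unfolding regL_far[OF d m] far_def near_def g Kern_def w_def[symmetric] e G_def[symmetric]
      by (simp add: algebra_simps)
  qed
  finally show "laplacian (phi k x d r R) z = 2 * pi * chi d (cmod (z - of_real x)) + far k x R z - near k x r z" .
qed

section \<open>Growth of the Riesz measure\<close>

lemma riesz_test:
  assumes "is_riesz_measure v \<nu>" "test_fun f"
  shows "(\<integral>z. f z \<partial>\<nu>) = (1 / (2 * pi)) * (\<integral>z. real_of_ereal (v z) * laplacian f z \<partial>lborel)"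
proof -
  have "\<forall>f. test_fun f \<longrightarrow> (\<integral>z. f z \<partial>\<nu>) = (1 / (2 * pi)) * (\<integral>z. real_of_ereal (v z) * laplacian f z \<partial>lborel)"
    using assms(1) unfolding is_riesz_measure_def by (elim conjE)
  thus ?thesis using assms(2) by (elim allE[of _ f] impE)
qed

lemma riesz_sets: "is_riesz_measure v \<nu> \<Longrightarrow> sets \<nu> = sets borel" "is_riesz_measure v \<nu> \<Longrightarrow> space \<nu> = UNIV"
  "is_riesz_measure v \<nu> \<Longrightarrow> emeasure \<nu> (cball 0 R) < \<infinity>"
proof -
  assume rm: "is_riesz_measure v \<nu>"
  show 1: "sets \<nu> = sets borel" using rm by (simp add: is_riesz_measure_def)
  show "space \<nu> = UNIV" using sets_eq_imp_space_eq[OF 1] by simp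
  have "\<forall>K. compact K \<longrightarrow> emeasure \<nu> K < \<infinity>" using rm unfolding is_riesz_measure_def by (elim conjE)
  thus "emeasure \<nu> (cball 0 R) < \<infinity>" using compact_cball by blast
qed

lemma riesz_sigma_finite:
  assumes "is_riesz_measure v \<nu>" shows "sigma_finite_measure \<nu>"
proof
  let ?A = "range (\<lambda>n::nat. cball (0::complex) (real n))"
  have "\<Union>?A = UNIV"
  proof (intro set_eqI iffI UNIV_I)
    fix z :: complex
    obtain n :: nat where "cmod z \<le> real n" using real_arch_simple by blast
    thus "z \<in> \<Union>?A" by auto
  qed
  moreover have "?A \<subseteq> sets \<nu>" using riesz_sets[OF assms] by auto
  moreover have "\<forall>a\<in>?A. emeasure \<nu> a \<noteq> \<infinity>"
  proof
    fix a assume "a \<in> ?A"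
    then obtain n where "a = cball 0 (real n)" by blast
    thus "emeasure \<nu> a \<noteq> \<infinity>" using riesz_sets(3)[OF assms, of "real n"] by simp
  qed
  ultimately show "\<exists>A. countable A \<and> A \<subseteq> sets \<nu> \<and> \<Union> A = space \<nu> \<and> (\<forall>a\<in>A. emeasure \<nu> a \<noteq> \<infinity>)"
    unfolding riesz_sets(2)[OF assms] by (intro exI[of _ ?A] conjI countable_image) simp_all
qed

lemma integrable_bounded_mult:
  fixes u g :: "complex \<Rightarrow> real"
  assumes int: "integrable lborel (\<lambda>z. indicator (cball 0 R) z * u z)" and [measurable]: "g \<in> borel_measurable borel"
    and g: "\<And>z. z \<notin> cball 0 R \<Longrightarrow> g z = 0" "\<And>z. z \<in> cball 0 R \<Longrightarrow> \<bar>g z\<bar> \<le> B"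
  shows "integrable lborel (\<lambda>z. u z * g z)"
    and "\<bar>\<integral>z. u z * g z \<partial>lborel\<bar> \<le> B * (\<integral>z. indicator (cball 0 R) z * \<bar>u z\<bar> \<partial>lborel)"
proof -
  have iabs: "integrable lborel (\<lambda>z. indicator (cball 0 R) z * \<bar>u z\<bar>)"
    using integrable_abs[OF int] by (simp add: abs_mult)
  have eq: "u z * g z = (indicator (cball 0 R) z * u z) * g z" for z
    using g(1)[of z] by (cases "z \<in> cball 0 R") auto
  have le: "\<bar>u z * g z\<bar> \<le> B * (indicator (cball 0 R) z * \<bar>u z\<bar>)" for z
    using g(1)[of z] g(2)[of z] by (cases "z \<in> cball 0 R") (auto simp: abs_mult mult.commute[of "\<bar>u z\<bar>"] intro!: mult_right_mono)
  have [measurable]: "(\<lambda>z. (indicator (cball 0 R) z * u z) * g z) \<in> borel_measurable lborel"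
    by (rule borel_measurable_times[OF borel_measurable_integrable[OF int]]) simp
  show i: "integrable lborel (\<lambda>z. u z * g z)"
  proof (rule Bochner_Integration.integrable_bound)
    show "integrable lborel (\<lambda>z. B * (indicator (cball 0 R) z * \<bar>u z\<bar>))"
      by (intro integrable_mult_right iabs)
    show "(\<lambda>z. u z * g z) \<in> borel_measurable lborel" unfolding eq by measurable
    show "AE z in lborel. norm (u z * g z) \<le> norm (B * (indicator (cball 0 R) z * \<bar>u z\<bar>))"
    proof (rule AE_I2)
      fix z :: complex
      show "norm (u z * g z) \<le> norm (B * (indicator (cball 0 R) z * \<bar>u z\<bar>))"
        using le[of z] by (simp only: real_norm_def)
    qed
  qed
  have "\<bar>\<integral>z. u z * g z \<partial>lborel\<bar> \<le> (\<integral>z. \<bar>u z * g z\<bar> \<partial>lborel)" by (rule integral_abs_bound)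
  also have "\<dots> \<le> (\<integral>z. B * (indicator (cball 0 R) z * \<bar>u z\<bar>) \<partial>lborel)"
    by (rule integral_mono) (use i iabs le in auto)
  finally show "\<bar>\<integral>z. u z * g z \<partial>lborel\<bar> \<le> B * (\<integral>z. indicator (cball 0 R) z * \<bar>u z\<bar> \<partial>lborel)" by simp
qed

text \<open>\<open>eta R\<close> dominates the indicator of the disc. Its Laplacian has size
  \<open>R powr (- 2)\<close> and is tested against an L1 norm of size
  \<open>R powr (p + 2)\<close>, which leaves \<open>R powr p\<close>.\<close>

lemma riesz_growth:
  assumes v: "subharmonic v" "\<exists>z. v z \<noteq> -\<infinity>" "finite_type_order v p" "p > 0"
    and rm: "is_riesz_measure v \<nu>"
  obtains C where "C \<ge> 0" "\<And>R. R \<ge> 1 \<Longrightarrow> emeasure \<nu> (cball 0 R) \<le> ennreal (C * R powr p)"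
proof -
  define u where "u = (\<lambda>z. real_of_ereal (v z))"
  obtain C where C: "C \<ge> 0" "\<And>R. integrable lborel (\<lambda>z. indicator (cball 0 R) z * u z)"
    "\<And>R. R \<ge> 1 \<Longrightarrow> (\<integral>z. indicator (cball 0 R) z * \<bar>u z\<bar> \<partial>lborel) \<le> C * R powr (p + 2)"
    using subharmonic_L1_growth[OF v] unfolding u_def by metis
  obtain M where M: "M \<ge> 0" "\<And>R z. R > 0 \<Longrightarrow> \<bar>etaL R z\<bar> \<le> M / R\<^sup>2"
    using eta_bounded by metis
  define C' where "C' = 1 / (2 * pi) * M * C * 2 powr (p + 2)"
  have "emeasure \<nu> (cball 0 R) \<le> ennreal (C' * R powr p)" if R: "R \<ge> 1" for R
  proof -
    have R0: "R > 0" using R by simp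
    have [measurable]: "eta R \<in> borel_measurable \<nu>"
      using eta_borel(1)[of R] measurable_cong_sets[OF riesz_sets(1)[OF rm] refl] by blast
    have [measurable]: "cball 0 r \<in> sets \<nu>" for r using riesz_sets(1)[OF rm] by simp
    have i1: "integrable \<nu> (indicator (cball 0 r) :: complex \<Rightarrow> real)" for r
      using riesz_sets(3)[OF rm, of r] by (intro integrable_real_indicator) auto
    have ie: "integrable \<nu> (eta R)"
    proof (rule Bochner_Integration.integrable_bound[OF i1[of "2 * R"]])
      show "AE z in \<nu>. norm (eta R z) \<le> norm (indicat_real (cball 0 (2 * R)) z)"
      proof (rule AE_I2)
        fix z show "norm (eta R z) \<le> norm (indicat_real (cball 0 (2 * R)) z)"
          using eta_range[of R z] eta_outside(1)[OF R0, of z] by (cases "cmod z \<le> 2 * R") auto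
      qed
    qed simp
    have "emeasure \<nu> (cball 0 R) = ennreal (measure \<nu> (cball 0 R))"
      using riesz_sets(3)[OF rm, of R] by (intro emeasure_eq_ennreal_measure) auto
    also have "measure \<nu> (cball 0 R) = (\<integral>z. indicator (cball 0 R) z \<partial>\<nu>)"
      using riesz_sets(2)[OF rm] by simp
    also have "(\<integral>z. indicator (cball 0 R) z \<partial>\<nu>) \<le> (\<integral>z. eta R z \<partial>\<nu>)"
    proof (rule integral_mono[OF i1 ie])
      fix z show "indicat_real (cball 0 R) z \<le> eta R z"
        using eta_range[of R z] eta_inside(1)[OF R0, of z] by (auto simp: indicator_def)
    qed
    also have "\<dots> = (1 / (2 * pi)) * (\<integral>z. u z * etaL R z \<partial>lborel)"
      using riesz_test[OF rm eta_test_fun(1)[OF R0]] by (simp add: eta_test_fun(2)[OF R0] u_def)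
    also have "\<dots> \<le> (1 / (2 * pi)) * ((M / R\<^sup>2) * (C * (2 * R) powr (p + 2)))"
    proof (rule mult_left_mono)
      have "\<bar>\<integral>z. u z * etaL R z \<partial>lborel\<bar> \<le> M / R\<^sup>2 * (\<integral>z. indicator (cball 0 (2 * R)) z * \<bar>u z\<bar> \<partial>lborel)"
        by (rule integrable_bounded_mult(2)[OF C(2)]) (use M(2)[OF R0] eta_outside(4)[OF R0] in auto)
      also have "\<dots> \<le> M / R\<^sup>2 * (C * (2 * R) powr (p + 2))"
        using C(3)[of "2 * R"] R M by (intro mult_left_mono) auto
      finally show "(\<integral>z. u z * etaL R z \<partial>lborel) \<le> M / R\<^sup>2 * (C * (2 * R) powr (p + 2))" by linarith
    qed simp
    also have "\<dots> = C' * R powr p"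
      using R0 by (simp add: C'_def powr_mult powr_add)
    finally show ?thesis by (simp add: ennreal_leI)
  qed
  moreover have "C' \<ge> 0" using M C by (simp add: C'_def)
  ultimately show thesis by (intro that[of C']) auto
qed

text \<open>Dyadic shells, starting from a radius below which there is no mass. The shell of index
  \<open>n\<close> contributes at most a multiple of \<open>2 powr (n * (p - \<alpha>))\<close>, so
  the sum is dominated by a geometric series.\<close>

lemma nn_integral_powr_finite:
  fixes \<nu> :: "complex measure"
  assumes sets[measurable_cong]: "sets \<nu> = sets borel" and C: "\<And>R. R \<ge> 1 \<Longrightarrow> emeasure \<nu> (cball 0 R) \<le> ennreal (C * R powr p)"
    and C0: "C \<ge> 0" and p: "0 < p" "p < \<alpha>" and r0: "r0 > 0" "emeasure \<nu> (ball 0 r0) = 0"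
  shows "(\<integral>\<^sup>+ z. ennreal (cmod z powr (-\<alpha>)) \<partial>\<nu>) < \<infinity>"
proof -
  \<comment> \<open>The growth bound is available for radii at least 1 only; with
    \<open>r \<le> 1\<close> the disc of radius \<open>2 ^ Suc n * r\<close> fits into the one of
    radius \<open>2 ^ Suc n\<close>, where it applies.\<close>
  define r where "r = min r0 1"
  have r: "0 < r" "r \<le> 1" "r \<le> r0" using r0 by (auto simp: r_def)
  define K where "K = r powr (-\<alpha>) * C * 2 powr p"
  define q where "q = 2 powr (p - \<alpha>)"
  have q: "0 < q" "q < 1" using p by (auto simp: q_def powr_less_one)
  have space: "space \<nu> = UNIV" using sets_eq_imp_space_eq[OF sets] by simp
  have "AE z in \<nu>. z \<notin> ball 0 r0"
    by (rule AE_I'[of "ball 0 r0"]) (auto simp: null_sets_def r0 sets)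
  hence "(\<integral>\<^sup>+ z. ennreal (cmod z powr (-\<alpha>)) \<partial>\<nu>) \<le> (\<integral>\<^sup>+ z. (\<Sum>n. ennreal ((2 ^ n * r) powr (-\<alpha>)) * indicator (cball 0 (2 ^ Suc n * r)) z) \<partial>\<nu>)"
  proof (intro nn_integral_mono_AE, eventually_elim)
    case (elim z)
    hence z: "cmod z \<ge> r" using r by simp
    define m where "m = nat \<lfloor>log 2 (cmod z / r)\<rfloor>"
    have "cmod z / r \<ge> 1" using z r by (simp add: le_divide_eq)
    hence l0: "log 2 (cmod z / r) \<ge> 0" and pos: "cmod z / r > 0" by (auto simp del: divide_le_eq_1 le_divide_eq_1)
    have "real m \<le> log 2 (cmod z / r)" using l0 by (simp add: m_def)
    hence "2 powr real m \<le> cmod z / r" using pos by (simp add: le_log_iff)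
    hence lo: "2 ^ m * r \<le> cmod z" using r by (simp add: powr_realpow le_divide_eq)
    have "log 2 (cmod z / r) < real m + 1" using l0 by (simp add: m_def)
    hence "cmod z / r < 2 powr (real m + 1)" using pos by (simp add: log_less_iff)
    hence hi: "cmod z \<le> 2 ^ Suc m * r" using r by (simp add: powr_add powr_realpow divide_less_eq mult_ac)
    have "cmod z powr (-\<alpha>) \<le> (2 ^ m * r) powr (-\<alpha>)"
      using lo r p by (intro powr_mono2') auto
    hence "ennreal (cmod z powr (-\<alpha>)) \<le> ennreal ((2 ^ m * r) powr (-\<alpha>)) * indicator (cball 0 (2 ^ Suc m * r)) z"
      using hi by (simp add: ennreal_leI)
    also have "\<dots> \<le> (\<Sum>n. ennreal ((2 ^ n * r) powr (-\<alpha>)) * indicator (cball 0 (2 ^ Suc n * r)) z)"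
    proof -
      define f where "f = (\<lambda>n. ennreal ((2 ^ n * r) powr (-\<alpha>)) * indicator (cball 0 (2 ^ Suc n * r)) z)"
      have "f m \<le> suminf f" using sum_le_suminf[of f "{m}"] by simp
      thus ?thesis by (simp only: f_def)
    qed
    finally show ?case .
  qed
  also have "\<dots> = (\<Sum>n. \<integral>\<^sup>+ z. ennreal ((2 ^ n * r) powr (-\<alpha>)) * indicator (cball 0 (2 ^ Suc n * r)) z \<partial>\<nu>)"
    by (rule nn_integral_suminf) measurable
  also have "\<dots> \<le> (\<Sum>n. ennreal (K * q ^ n))"
  proof (intro suminf_le)
    fix n :: nat
    have "(\<integral>\<^sup>+ z. ennreal ((2 ^ n * r) powr (-\<alpha>)) * indicator (cball 0 (2 ^ Suc n * r)) z \<partial>\<nu>) = ennreal ((2 ^ n * r) powr (-\<alpha>)) * emeasure \<nu> (cball 0 (2 ^ Suc n * r))"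
      by (rule nn_integral_cmult_indicator) (simp add: sets)
    also have "\<dots> \<le> ennreal ((2 ^ n * r) powr (-\<alpha>)) * emeasure \<nu> (cball 0 (2 ^ Suc n))"
    proof (intro mult_left_mono emeasure_mono)
      have "2 ^ Suc n * r \<le> 2 ^ Suc n" using r by (intro mult_left_le) auto
      thus "cball 0 (2 ^ Suc n * r) \<subseteq> (cball 0 (2 ^ Suc n) :: complex set)" by (rule subset_cball)
    qed (auto simp: sets)
    also have "\<dots> \<le> ennreal ((2 ^ n * r) powr (-\<alpha>)) * ennreal (C * (2 ^ Suc n) powr p)"
      by (intro mult_left_mono C) (auto intro: one_le_power simp del: power_Suc)
    also have "\<dots> = ennreal ((2 ^ n * r) powr (-\<alpha>) * (C * (2 ^ Suc n) powr p))"
      using C0 by (simp add: ennreal_mult)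
    also have "(2 ^ n * r) powr (-\<alpha>) * (C * (2 ^ Suc n) powr p) = K * q ^ n"
    proof -
      have "(2 ^ n * r) powr (-\<alpha>) = 2 powr (real n * (-\<alpha>)) * r powr (-\<alpha>)"
        using r by (simp add: powr_mult powr_realpow[symmetric] powr_powr)
      moreover have "(2 ^ Suc n) powr p = 2 powr p * 2 powr (real n * p)"
        by (simp add: powr_mult powr_realpow[symmetric] powr_powr)
      moreover have "q ^ n = 2 powr (real n * p) * 2 powr (real n * (-\<alpha>))"
        using q by (simp add: q_def powr_realpow[symmetric] powr_powr powr_add[symmetric] algebra_simps)
      ultimately show ?thesis by (simp add: K_def)
    qed
    finally show "(\<integral>\<^sup>+ z. ennreal ((2 ^ n * r) powr (-\<alpha>)) * indicator (cball 0 (2 ^ Suc n * r)) z \<partial>\<nu>) \<le> ennreal (K * q ^ n)" .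
  qed auto
  also have "\<dots> < \<infinity>"
  proof -
    have "summable (\<lambda>n. K * q ^ n)" using q by (intro summable_mult summable_geometric) auto
    hence "(\<Sum>n. ennreal (K * q ^ n)) \<noteq> top"
      using q C0 by (intro ennreal_suminf_neq_top) (auto simp: K_def)
    thus ?thesis by (simp add: less_top)
  qed
  finally show ?thesis .
qed

section \<open>Representation on the positive ray\<close>

text \<open>The coefficient of \<open>x ^ j\<close> in \<open>near\<close>. It does not involve
  \<open>x\<close>, which is why integrating it against \<open>v\<close> yields the coefficients of
  one polynomial valid on the whole ray.\<close>

definition nearc :: "real \<Rightarrow> nat \<Rightarrow> complex \<Rightarrow> real" where
  "nearc r j z = (if j = 0 then - etaL r z * ln (cmod z) - 4 * eta1 r z
     else (etaL r z / real j - 4 * eta1 r z) * Re (1 / z ^ j))"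

lemma near_eq:
  assumes "r > 0"
  shows "near k x r z = (\<Sum>j\<le>k. x ^ j * nearc r j z)"
proof (cases "z = 0")
  case True
  have e: "etaL r 0 = 0" "eta1 r 0 = 0" using assms by (simp_all add: eta_inside)
  hence "nearc r j 0 = 0" for j by (simp add: nearc_def)
  thus ?thesis using e True by (simp add: near_def)
next
  case False
  have "z * grest k x z = - (\<Sum>j=0..k. of_real (x ^ j) * (1 / z ^ j))"
    using False by (simp add: grest_def sum_distrib_left)
  hence "Re (z * grest k x z) = - (\<Sum>j=0..k. x ^ j * Re (1 / z ^ j))"
    by (simp only: uminus_complex.sel Re_sum Re_of_real_mult)
  hence R: "Re (z * grest k x z) = - (1 + (\<Sum>j=1..k. x ^ j * Re (1 / z ^ j)))"
    by (simp only: sum.atLeast_Suc_atMost[OF le0]) simp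
  have "near k x r z = etaL r z * ((\<Sum>j=1..k. x ^ j * Re (1 / z ^ j) / real j) - ln (cmod z)) - 4 * eta1 r z * (1 + (\<Sum>j=1..k. x ^ j * Re (1 / z ^ j)))"
    unfolding near_def rest_def R mult_minus_right by linarith
  also have "\<dots> = nearc r 0 z + (\<Sum>j=1..k. x ^ j * nearc r j z)"
  proof -
    have "(\<Sum>j=1..k. x ^ j * nearc r j z) = (\<Sum>j=1..k. etaL r z * (x ^ j * Re (1 / z ^ j) / real j) - 4 * eta1 r z * (x ^ j * Re (1 / z ^ j)))"
      by (intro sum.cong refl) (simp add: nearc_def left_diff_distrib right_diff_distrib)
    also have "\<dots> = etaL r z * (\<Sum>j=1..k. x ^ j * Re (1 / z ^ j) / real j) - 4 * eta1 r z * (\<Sum>j=1..k. x ^ j * Re (1 / z ^ j))"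
      by (simp only: sum_subtractf sum_distrib_left)
    finally show ?thesis by (simp add: nearc_def right_diff_distrib distrib_left)
  qed
  also have "\<dots> = (\<Sum>j\<le>k. x ^ j * nearc r j z)"
    by (simp add: atMost_atLeast0 sum.atLeast_Suc_atMost)
  finally show ?thesis .
qed

lemma nearc_borel [measurable]: "nearc r j \<in> borel_measurable borel"
  unfolding nearc_def[abs_def] by measurable

lemma nearc_bounded:
  assumes r: "r > 0"
  obtains B where "\<And>z. \<bar>nearc r j z\<bar> \<le> B"
proof -
  obtain M where M: "M \<ge> 0" "\<And>R z. R > 0 \<Longrightarrow> \<bar>eta1 R z\<bar> \<le> M / R\<^sup>2" "\<And>R z. R > 0 \<Longrightarrow> \<bar>etaL R z\<bar> \<le> M / R\<^sup>2"
    using eta_bounded by metis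
  define m where "m = M / r\<^sup>2"
  have m: "m \<ge> 0" "\<bar>eta1 r z\<bar> \<le> m" "\<bar>etaL r z\<bar> \<le> m" for z using M r by (auto simp: m_def)
  define L where "L = \<bar>ln r\<bar> + \<bar>ln (2 * r)\<bar>"
  define B where "B = m * L + 4 * m + (m + 4 * m) * (1 / r ^ j)"
  have "\<bar>nearc r j z\<bar> \<le> B" for z
  proof (cases "r \<le> cmod z \<and> cmod z \<le> 2 * r")
    case False
    hence "nearc r j z = 0"
      using eta_inside[OF r, of z] eta_outside[OF r, of z] by (auto simp: nearc_def)
    moreover have "B \<ge> 0" using m(1) r by (auto simp: B_def L_def intro!: add_nonneg_nonneg)
    ultimately show ?thesis by simp
  next
    case True
    have l: "\<bar>ln (cmod z)\<bar> \<le> L"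
    proof -
      have "ln r \<le> ln (cmod z)" "ln (cmod z) \<le> ln (2 * r)" using True r by (auto intro!: ln_mono)
      thus ?thesis unfolding L_def by linarith
    qed
    have i: "\<bar>Re (1 / z ^ j)\<bar> \<le> 1 / r ^ j"
    proof -
      have "\<bar>Re (1 / z ^ j)\<bar> \<le> cmod (1 / z ^ j)" by (rule abs_Re_le_cmod)
      also have "\<dots> = 1 / cmod z ^ j" by (simp add: norm_divide norm_power)
      also have "\<dots> \<le> 1 / r ^ j" using True r by (intro frac_le power_mono) auto
      finally show ?thesis .
    qed
    show ?thesis
    proof (cases "j = 0")
      case True
      have "\<bar>etaL r z * ln (cmod z)\<bar> \<le> m * L" unfolding abs_mult using m l by (intro mult_mono) auto
      hence "\<bar>nearc r j z\<bar> \<le> m * L + 4 * m" using m(2)[of z] True by (auto simp: nearc_def)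
      moreover have "0 \<le> (m + 4 * m) * (1 / r ^ j)" using m(1) r by simp
      ultimately show ?thesis by (simp add: B_def)
    next
      case False
      have "\<bar>etaL r z / real j\<bar> \<le> \<bar>etaL r z\<bar>" using False by (simp add: divide_le_eq mult_le_cancel_left1)
      hence "\<bar>etaL r z / real j - 4 * eta1 r z\<bar> \<le> m + 4 * m" using m(2,3)[of z] by linarith
      hence "\<bar>nearc r j z\<bar> \<le> (m + 4 * m) * (1 / r ^ j)" using False i m(1)
        unfolding nearc_def by (simp only: if_False abs_mult) (intro mult_mono, auto)
      moreover have "0 \<le> m * L + 4 * m" using m(1) by (auto simp: L_def)
      ultimately show ?thesis by (simp add: B_def)
    qed
  qed
  thus thesis by (rule that)
qed

lemma rest_borel [measurable]: "rest k x \<in> borel_measurable borel"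
  unfolding rest_def[abs_def] by measurable

lemma Kern_borel [measurable]: "Kern k x \<in> borel_measurable borel"
  unfolding Kern_def[abs_def] by measurable

lemma far_borel [measurable]: "far k x R \<in> borel_measurable borel"
  unfolding far_def[abs_def] gKern_def grest_def by measurable

text \<open>Off the disc of radius \<open>R\<close> the point \<open>x\<close> is at distance at
  least \<open>cmod z / 2\<close>, so \<open>Kern\<close> and \<open>z * gKern\<close> are both at
  most \<open>2 * x ^ Suc k / R ^ Suc k\<close> in size. The weights 1 and 4 of the two terms of
  \<open>far\<close> turn the 2 into 10.\<close>

lemma far_bound:
  assumes x: "x > 0" and R: "R \<ge> 2 * x" and M: "M \<ge> 0" "\<And>z. \<bar>eta1 R z\<bar> \<le> M / R\<^sup>2" "\<And>z. \<bar>etaL R z\<bar> \<le> M / R\<^sup>2"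
  shows "\<bar>far k x R z\<bar> \<le> 10 * M * x ^ Suc k / (R\<^sup>2 * R ^ Suc k)"
proof (cases "cmod z \<le> R")
  case True
  have "R > 0" using x R by simp
  thus ?thesis using True x M by (simp add: far_def eta_inside)
next
  case False
  have R0: "R > 0" using x R by simp
  have z0: "z \<noteq> 0" "cmod z > 0" using False R0 by auto
  have zx: "cmod (z - of_real x) \<ge> cmod z / 2"
    using norm_triangle_ineq2[of z "of_real x"] False R x by simp
  hence zx0: "z \<noteq> of_real x" using z0 by auto
  have "\<bar>Kern k x z\<bar> \<le> 2 * x ^ Suc k / cmod z ^ Suc k"
    using False R x by (intro Kern_bound) auto
  also have "\<dots> \<le> 2 * x ^ Suc k / R ^ Suc k"
    using False R0 x by (intro frac_le power_mono) auto
  finally have K: "\<bar>Kern k x z\<bar> \<le> 2 * x ^ Suc k / R ^ Suc k" .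
  have "z * gKern k x z = of_real (x ^ Suc k) / (z ^ k * (z - of_real x))"
    unfolding gKern_eq[OF z0(1) zx0] using z0 by simp
  hence "\<bar>Re (z * gKern k x z)\<bar> \<le> cmod (of_real (x ^ Suc k) / (z ^ k * (z - of_real x)))"
    by (metis abs_Re_le_cmod)
  also have "\<dots> = x ^ Suc k / (cmod z ^ k * cmod (z - of_real x))"
    using x by (simp add: norm_divide norm_mult norm_power)
  also have "\<dots> \<le> x ^ Suc k / (R ^ k * (R / 2))"
    using False R0 x zx by (intro frac_le mult_mono power_mono) auto
  finally have G: "\<bar>Re (z * gKern k x z)\<bar> \<le> 2 * x ^ Suc k / R ^ Suc k" by (simp add: mult_ac)
  have "\<bar>etaL R z * Kern k x z\<bar> \<le> M / R\<^sup>2 * (2 * x ^ Suc k / R ^ Suc k)"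
    unfolding abs_mult using M K by (intro mult_mono) auto
  moreover have "\<bar>eta1 R z * Re (z * gKern k x z)\<bar> \<le> M / R\<^sup>2 * (2 * x ^ Suc k / R ^ Suc k)"
    unfolding abs_mult using M G by (intro mult_mono) auto
  ultimately have "\<bar>far k x R z\<bar> \<le> 5 * (M / R\<^sup>2 * (2 * x ^ Suc k / R ^ Suc k))"
    unfolding far_def by linarith
  thus ?thesis by (simp add: mult_ac)
qed

text \<open>The upper bound 0 uses \<open>ln d \<le> 0\<close>. Together the two bounds keep the
  smoothed sum \<open>regL + rest\<close> between \<open>Kern\<close> and \<open>rest\<close> inside
  the smoothing disc.\<close>

lemma regL_bounds:
  assumes d: "0 < d" "d \<le> 1" and z: "z \<noteq> of_real x" "cmod (z - of_real x) \<le> d"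
  shows "ln (cmod (z - of_real x)) \<le> regL d x z" "regL d x z \<le> 0"
proof -
  define m where "m = cmod (z - of_real x)"
  have m: "m > 0" "m \<le> d" using z by (auto simp: m_def)
  define s where "s = m\<^sup>2 / d\<^sup>2"
  have s: "0 < s" "s \<le> 1" using m d by (auto simp: s_def intro!: power_mono)
  have ls: "ln s / 2 = ln m - ln d" using m d by (simp add: s_def ln_div ln_realpow diff_divide_distrib)
  have ld: "ln d \<le> 0" using d by simp
  show "ln (cmod (z - of_real x)) \<le> regL d x z" "regL d x z \<le> 0"
    using regln_bounds[OF s(1)] s(2) ls ld unfolding regL_def m_def[symmetric] s_def[symmetric] by linarith+
qed

section \<open>Point values as limits of smoothed means\<close>

lemma subharmonic_le_chi_mean:
  assumes v: "subharmonic v" and d: "d > 0"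
  shows "v a \<le> ereal (\<integral>z. real_of_ereal (v z) * chi d (cmod (z - a)) \<partial>lborel)"
proof (cases "v a")
  case (real c)
  note [measurable] = subharmonic_borel[OF v]
  have "c * (\<integral>z. chi d (cmod z) \<partial>(lborel :: complex measure)) \<le> (\<integral>z. chi d (cmod z) * real_of_ereal (v (a + z)) \<partial>lborel)"
    by (rule subharmonic_radial_mean(2)[OF v real, of "chi d" "2 / (pi * d\<^sup>2)" d]) (use chi_props[OF d] in auto)
  also have "\<dots> = (\<integral>z. (\<lambda>w. real_of_ereal (v w) * chi d (cmod (w - a))) (a + z) \<partial>lborel)"
    by (simp add: mult.commute)
  also have "\<dots> = (\<integral>z. real_of_ereal (v z) * chi d (cmod (z - a)) \<partial>distr lborel borel ((+) a))"
    by (rule integral_distr[symmetric]) auto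
  finally show ?thesis unfolding lborel_distr_plus chi_integral[OF d] by (simp add: real)
qed (use v in \<open>auto simp: subharmonic_def\<close>)

lemma chi_mean_le:
  assumes v: "subharmonic v" and ae: "AE z in lborel. v z \<noteq> -\<infinity>" and d: "d > 0"
    and int: "integrable lborel (\<lambda>z. real_of_ereal (v z) * chi d (cmod (z - a)))"
    and le: "\<And>z. cmod (z - a) < d \<Longrightarrow> v z \<le> ereal b"
  shows "(\<integral>z. real_of_ereal (v z) * chi d (cmod (z - a)) \<partial>lborel) \<le> b"
proof -
  have ci: "(\<integral>z. chi d (cmod (z - a)) \<partial>lborel) = 1"
  proof -
    have "(\<integral>z. chi d (cmod (z - a)) \<partial>lborel) = (\<integral>z. chi d (cmod (z - a)) \<partial>distr lborel borel ((+) a))"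
      by (simp only: lborel_distr_plus)
    also have "\<dots> = (\<integral>z. chi d (cmod ((a + z) - a)) \<partial>lborel)"
      by (rule integral_distr) auto
    finally show ?thesis using chi_integral[OF d] by simp
  qed
  have "integrable lborel (\<lambda>z. chi d (cmod (z - a)))"
    using ci not_integrable_integral_eq by fastforce
  hence ib: "integrable lborel (\<lambda>z. b * chi d (cmod (z - a)))" by (intro integrable_mult_right)
  have "(\<integral>z. real_of_ereal (v z) * chi d (cmod (z - a)) \<partial>lborel) \<le> (\<integral>z. b * chi d (cmod (z - a)) \<partial>lborel)"
  proof (rule integral_mono_AE[OF int ib])
    show "AE z in lborel. real_of_ereal (v z) * chi d (cmod (z - a)) \<le> b * chi d (cmod (z - a))"
      using ae
    proof eventually_elim
      case (elim z)
      show ?case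
      proof (cases "cmod (z - a) < d")
        case True
        have "real_of_ereal (v z) \<le> b" using le[OF True] elim v by (cases "v z") (auto simp: subharmonic_def)
        thus ?thesis using chi_props(1)[OF d] by (intro mult_right_mono) auto
      qed (use chi_props(3)[OF d, of "cmod (z - a)"] in auto)
    qed
  qed
  also have "\<dots> = b" using ci by simp
  finally show ?thesis .
qed

text \<open>Smoothed means recover \<open>v\<close> at every single point. The sub-mean property
  keeps \<open>v a\<close> below each mean; upper semicontinuity keeps \<open>v\<close> below any
  number exceeding \<open>v a\<close> on a small disc, hence the means as well.\<close>

lemma subharmonic_eq_lim_chi_mean:
  assumes v: "subharmonic v" and ae: "AE z in lborel. v z \<noteq> -\<infinity>"
    and d: "\<And>n. d n > 0" "d \<longlonglongrightarrow> 0"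
    and int: "\<And>n. integrable lborel (\<lambda>z. real_of_ereal (v z) * chi (d n) (cmod (z - a)))"
    and lim: "(\<lambda>n. \<integral>z. real_of_ereal (v z) * chi (d n) (cmod (z - a)) \<partial>lborel) \<longlonglongrightarrow> l"
  shows "v a = ereal l"
proof (rule antisym)
  have "(\<lambda>n. ereal (\<integral>z. real_of_ereal (v z) * chi (d n) (cmod (z - a)) \<partial>lborel)) \<longlonglongrightarrow> ereal l"
    using lim by simp
  thus "v a \<le> ereal l"
    by (rule LIMSEQ_le_const) (use subharmonic_le_chi_mean[OF v d(1)] in auto)
  show "ereal l \<le> v a"
  proof (rule ereal_le_real)
    fix b assume b: "v a \<le> ereal b"
    have "l \<le> b"
    proof (rule field_le_epsilon)
      fix e :: real assume e: "e > 0"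
      have "v a < ereal (b + e)" using b e by (auto intro: le_less_trans)
      then obtain \<delta> where \<delta>: "\<delta> > 0" "ball a \<delta> \<subseteq> {z. v z < ereal (b + e)}"
        using subharmonic_open_less[OF v, of "ereal (b + e)"] by (auto simp: open_contains_ball)
      have "\<forall>\<^sub>F n in sequentially. d n < \<delta>" using d(2) \<delta>(1) by (rule order_tendstoD)
      hence "\<forall>\<^sub>F n in sequentially. (\<integral>z. real_of_ereal (v z) * chi (d n) (cmod (z - a)) \<partial>lborel) \<le> b + e"
      proof eventually_elim
        case (elim n)
        show ?case
        proof (rule chi_mean_le[OF v ae d(1) int])
          fix z assume "cmod (z - a) < d n"
          hence "z \<in> ball a \<delta>" using elim by (simp add: dist_norm norm_minus_commute)
          thus "v z \<le> ereal (b + e)" using \<delta>(2) by (auto dest!: subsetD)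
        qed
      qed
      thus "l \<le> b + e" by (rule tendsto_upperbound[OF lim]) simp
    qed
    thus "ereal l \<le> ereal b" by simp
  qed
qed

text \<open>The Riesz identity is tested on \<open>phi\<close> while the smoothing radius tends to 0
  and the outer radius to infinity. The \<open>chi\<close> part converges to \<open>v x\<close>, the
  outer annulus dies because \<open>p < k + 1\<close>, and the inner annulus leaves the polynomial.
  Absence of an atom at \<open>x\<close> makes the measure blind to \<open>z = x\<close>, where the
  convention \<open>ln 0 = 0\<close> gives \<open>Kern\<close> a meaningless value.\<close>

theorem representation:
  assumes v: "subharmonic v" "\<exists>z. v z \<noteq> -\<infinity>" "finite_type_order v p" "p > 0"
    and rm: "is_riesz_measure v \<nu>" and r0: "r0 > 0" "emeasure \<nu> (ball 0 r0) = 0" and k: "p < real (Suc k)"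
  obtains c :: "nat \<Rightarrow> real" where "\<And>x. x > 0 \<Longrightarrow> integrable \<nu> (Kern k x) \<Longrightarrow> emeasure \<nu> {of_real x} = 0 \<Longrightarrow>
     v (of_real x) = ereal ((\<integral>z. Kern k x z \<partial>\<nu>) + (\<Sum>j\<le>k. x ^ j * c j))"
proof -
  define u where "u = (\<lambda>z. real_of_ereal (v z))"
  obtain C where C: "C \<ge> 0" "\<And>R. integrable lborel (\<lambda>z. indicator (cball 0 R) z * u z)"
    "\<And>R. R \<ge> 1 \<Longrightarrow> (\<integral>z. indicator (cball 0 R) z * \<bar>u z\<bar> \<partial>lborel) \<le> C * R powr (p + 2)"
    using subharmonic_L1_growth[OF v] unfolding u_def by metis
  obtain M where M: "M \<ge> 0" "\<And>R z. R > 0 \<Longrightarrow> \<bar>eta1 R z\<bar> \<le> M / R\<^sup>2" "\<And>R z. R > 0 \<Longrightarrow> \<bar>etaL R z\<bar> \<le> M / R\<^sup>2"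
    using eta_bounded by metis
  note [measurable_cong] = riesz_sets(1)[OF rm]
  \<comment> \<open>The inner cutoff vanishes from radius \<open>2 * r = r0\<close> on. It is thus
    invisible to \<open>\<nu>\<close>, while the Lebesgue integral of its Laplacian against
    \<open>v\<close> still contributes.\<close>
  define r where "r = r0 / 2"
  have r: "r > 0" using r0 by (simp add: r_def)
  have near_int: "integrable lborel (\<lambda>z. u z * nearc r j z)" for j
  proof -
    obtain B where B: "\<And>z. \<bar>nearc r j z\<bar> \<le> B" using nearc_bounded[OF r] by metis
    show ?thesis
    proof (rule integrable_bounded_mult(1)[OF C(2)[of "2 * r"] _ _ B])
      fix z :: complex assume "z \<notin> cball 0 (2 * r)"
      hence "cmod z \<ge> 2 * r" by simp
      thus "nearc r j z = 0" using eta_outside[OF r, of z] by (simp add: nearc_def)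
    qed simp
  qed
  define c where "c = (\<lambda>j. 1 / (2 * pi) * (\<integral>z. u z * nearc r j z \<partial>lborel))"
  have "v (of_real x) = ereal ((\<integral>z. Kern k x z \<partial>\<nu>) + (\<Sum>j\<le>k. x ^ j * c j))"
    if x: "x > 0" and Ki: "integrable \<nu> (Kern k x)" and atom: "emeasure \<nu> {of_real x} = 0" for x
  proof -
    \<comment> \<open>The bound \<open>x / 2\<close> keeps the smoothing disc away from the
      singularity of \<open>rest\<close> at 0; the bound 1 is the one required by
      \<open>regL_bounds\<close>.\<close>
    define d where "d = (\<lambda>n. min 1 (x / 2) / real (Suc n))"
    define R where "R = (\<lambda>n. 2 * x + 1 + r0 + real n)"
    have dn: "0 < d n" "d n \<le> 1" "d n \<le> x / 2" for n
    proof -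
      show "0 < d n" using x by (simp add: d_def)
      have "d n \<le> min 1 (x / 2)" using x divide_left_mono[of 1 "real (Suc n)" "min 1 (x / 2)"] by (simp add: d_def)
      thus "d n \<le> 1" "d n \<le> x / 2" by auto
    qed
    have dlim: "d \<longlonglongrightarrow> 0"
      unfolding d_def by (rule LIMSEQ_Suc, rule lim_const_over_n)
    have Rn: "R n > 0" "r \<le> R n" "x + d n \<le> R n" "2 * x \<le> R n" "1 \<le> R n" for n
      using x r0 dn[of n] by (auto simp: R_def r_def)
    have chi_int: "integrable lborel (\<lambda>z. u z * chi (d n) (cmod (z - of_real x)))" for n
    proof (rule integrable_bounded_mult(1)[OF C(2)[of "x + d n"], where B = "2 / (pi * (d n)\<^sup>2)"])
      fix z :: complex assume "z \<notin> cball 0 (x + d n)"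
      hence "d n \<le> cmod (z - of_real x)" using norm_triangle_ineq[of "z - of_real x" "of_real x"] x by simp
      thus "chi (d n) (cmod (z - of_real x)) = 0" using chi_props(3)[OF dn(1)[of n]] by simp
    next
      fix z :: complex
      show "\<bar>chi (d n) (cmod (z - of_real x))\<bar> \<le> 2 / (pi * (d n)\<^sup>2)"
        using chi_props(1,2)[OF dn(1)[of n], of "cmod (z - of_real x)"] by simp
    qed simp
    define F where "F = (\<lambda>n. 10 * M * x ^ Suc k / ((R n)\<^sup>2 * R n ^ Suc k))"
    have far0: "far k x (R n) z = 0" if "z \<notin> cball 0 (2 * R n)" for z n
      using that eta_outside[OF Rn(1)[of n], of z] by (simp add: far_def)
    have farB: "\<bar>far k x (R n) z\<bar> \<le> F n" for z n
      unfolding F_def by (rule far_bound[OF x Rn(4) M(1)]) (use M Rn in auto)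
    have regL_borel [measurable]: "regL (d n) x \<in> borel_measurable borel" for n
      using C2_onD(8)[OF regL_C2[OF dn(1)[of n], of x]] by (rule borel_measurable_continuous_onI)
    have far_int: "integrable lborel (\<lambda>z. u z * far k x (R n) z)"
      "\<bar>\<integral>z. u z * far k x (R n) z \<partial>lborel\<bar> \<le> F n * (\<integral>z. indicator (cball 0 (2 * R n)) z * \<bar>u z\<bar> \<partial>lborel)" for n
      by (rule integrable_bounded_mult[OF C(2)[of "2 * R n"] far_borel far0 farB]; assumption)+
    define a where "a = (\<lambda>n. \<integral>z. u z * chi (d n) (cmod (z - of_real x)) \<partial>lborel)"
    define T where "T = (\<lambda>n z. eta (R n) z * (regL (d n) x z + rest k x z))"
    \<comment> \<open>The Riesz identity for \<open>phi\<close>. On the left the inner cutoff has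
      been dropped, which changes nothing where \<open>\<nu>\<close> has mass.\<close>
    have key: "(\<integral>z. T n z \<partial>\<nu>) = a n + 1 / (2 * pi) * (\<integral>z. u z * far k x (R n) z \<partial>lborel) - (\<Sum>j\<le>k. x ^ j * c j)" for n
    proof -
      note ph = phi_test[OF dn(1)[of n] r Rn(2)[of n] x Rn(3)[of n], where k = k]
      have "AE z in \<nu>. z \<notin> ball 0 r0"
        by (rule AE_I'[of "ball 0 r0"]) (auto simp: null_sets_def r0 riesz_sets(1)[OF rm])
      hence "(\<integral>z. T n z \<partial>\<nu>) = (\<integral>z. phi k x (d n) r (R n) z \<partial>\<nu>)"
      proof (intro integral_cong_AE)
        show "T n \<in> borel_measurable \<nu>" "phi k x (d n) r (R n) \<in> borel_measurable \<nu>"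
          unfolding T_def phi_def[abs_def] by measurable
      next
        show "AE z in \<nu>. T n z = phi k x (d n) r (R n) z" if "AE z in \<nu>. z \<notin> ball 0 r0"
          using that
        proof eventually_elim
          case (elim z)
          hence "cmod z \<ge> 2 * r" by (simp add: r_def)
          thus ?case using eta_outside[OF r, of z] by (simp add: T_def phi_def algebra_simps)
        qed
      qed
      also have "\<dots> = 1 / (2 * pi) * (\<integral>z. u z * laplacian (phi k x (d n) r (R n)) z \<partial>lborel)"
        unfolding u_def by (rule riesz_test[OF rm ph(1)])
      also have "(\<integral>z. u z * laplacian (phi k x (d n) r (R n)) z \<partial>lborel) =
        (\<integral>z. 2 * pi * (u z * chi (d n) (cmod (z - of_real x))) + u z * far k x (R n) z - (\<Sum>j\<le>k. x ^ j * (u z * nearc r j z)) \<partial>lborel)"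
      proof (rule integral_discrete_difference[of "{0}"])
        fix z :: complex assume "z \<notin> {0}"
        hence "laplacian (phi k x (d n) r (R n)) z = 2 * pi * chi (d n) (cmod (z - of_real x)) + far k x (R n) z - (\<Sum>j\<le>k. x ^ j * nearc r j z)"
          using ph(2)[where z = z] near_eq[OF r, where k = k and x = x and z = z] by simp
        thus "u z * laplacian (phi k x (d n) r (R n)) z = 2 * pi * (u z * chi (d n) (cmod (z - of_real x))) + u z * far k x (R n) z - (\<Sum>j\<le>k. x ^ j * (u z * nearc r j z))"
          by (simp only: distrib_left right_diff_distrib sum_distrib_left mult.left_commute[of "u z"])
      qed auto
      also have "\<dots> = 2 * pi * a n + (\<integral>z. u z * far k x (R n) z \<partial>lborel) - (\<Sum>j\<le>k. x ^ j * (\<integral>z. u z * nearc r j z \<partial>lborel))"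
      proof -
        have i: "integrable lborel (\<lambda>z. 2 * pi * (u z * chi (d n) (cmod (z - of_real x))))"
          "integrable lborel (\<lambda>z. u z * far k x (R n) z)" "integrable lborel (\<lambda>z. x ^ j * (u z * nearc r j z))" for j
          using integrable_mult_right[OF chi_int[of n], of "2 * pi"] far_int(1)[of n] integrable_mult_right[OF near_int[of j], of "x ^ j"]
          by simp_all
        show ?thesis
          unfolding Bochner_Integration.integral_diff[OF Bochner_Integration.integrable_add[OF i(1,2)] Bochner_Integration.integrable_sum[OF i(3)]]
            Bochner_Integration.integral_add[OF i(1,2)] Bochner_Integration.integral_sum[OF i(3)] integral_mult_right_zero a_def ..
      qed
      also have "1 / (2 * pi) * (2 * pi * a n + (\<integral>z. u z * far k x (R n) z \<partial>lborel) - (\<Sum>j\<le>k. x ^ j * (\<integral>z. u z * nearc r j z \<partial>lborel)))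
        = a n + 1 / (2 * pi) * (\<integral>z. u z * far k x (R n) z \<partial>lborel) - (\<Sum>j\<le>k. x ^ j * c j)"
        by (simp only: c_def distrib_left right_diff_distrib sum_distrib_left mult.left_commute[of "1 / (2 * pi)"]) simp
      finally show ?thesis .
    qed
    \<comment> \<open>\<open>F n\<close> decays like the power \<open>- (k + 3)\<close> of
      \<open>R n\<close> and the L1 norm grows like the power \<open>p + 2\<close>; the sum
      \<open>p - (k + 1)\<close> of the exponents is negative.\<close>
    have far_lim: "(\<lambda>n. \<integral>z. u z * far k x (R n) z \<partial>lborel) \<longlonglongrightarrow> 0"
    proof (rule Lim_null_comparison)
      define K where "K = 10 * M * x ^ Suc k * C * 2 powr (p + 2)"
      show "\<forall>\<^sub>F n in sequentially. norm (\<integral>z. u z * far k x (R n) z \<partial>lborel) \<le> K * R n powr (p - real (Suc k))"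
      proof (intro always_eventually allI)
        fix n
        have F0: "F n \<ge> 0" using M x Rn(1)[of n] by (simp add: F_def)
        have "norm (\<integral>z. u z * far k x (R n) z \<partial>lborel) \<le> F n * (\<integral>z. indicator (cball 0 (2 * R n)) z * \<bar>u z\<bar> \<partial>lborel)"
          using far_int(2)[of n] by simp
        also have "\<dots> \<le> F n * (C * (2 * R n) powr (p + 2))"
          using Rn(5)[of n] by (intro mult_left_mono C F0) auto
        also have "\<dots> = K * (R n powr (p + 2) / ((R n)\<^sup>2 * R n ^ Suc k))"
          using Rn(1)[of n] by (simp add: F_def K_def powr_mult)
        also have "R n powr (p + 2) / ((R n)\<^sup>2 * R n ^ Suc k) = R n powr (p - real (Suc k))"
        proof -
          have e: "(R n)\<^sup>2 * R n ^ Suc k = R n powr (2 + real (Suc k))"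
            using Rn(1)[of n] by (simp add: powr_add powr_realpow del: of_nat_Suc power_Suc)
          show ?thesis unfolding e powr_diff[symmetric] by (rule arg_cong[where f = "\<lambda>s. R n powr s"]) simp
        qed
        finally show "norm (\<integral>z. u z * far k x (R n) z \<partial>lborel) \<le> K * R n powr (p - real (Suc k))" .
      qed
      have "filterlim R at_top sequentially"
        unfolding R_def by (rule filterlim_tendsto_add_at_top[OF tendsto_const filterlim_real_sequentially])
      hence "(\<lambda>n. R n powr (p - real (Suc k))) \<longlonglongrightarrow> 0"
        by (rule tendsto_neg_powr[rotated]) (use k in simp)
      thus "(\<lambda>n. K * R n powr (p - real (Suc k))) \<longlonglongrightarrow> 0" by (rule tendsto_mult_right_zero)
    qed
    have T_lim: "(\<lambda>n. \<integral>z. T n z \<partial>\<nu>) \<longlonglongrightarrow> (\<integral>z. Kern k x z \<partial>\<nu>)"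
    proof -
      obtain g' where "C2_on (- {0}) (rest k x) (\<lambda>z. Re (grest k x z)) (\<lambda>z. - Im (grest k x z)) (\<lambda>z. Re (g' z)) (\<lambda>z. - Im (g' z)) (\<lambda>z. - Re (g' z))"
        using rest_C2 by metis
      hence "continuous_on (- {0}) (rest k x)" by (rule C2_onD(8))
      moreover have "cball (of_real x) (x / 2) \<subseteq> - {0::complex}" using x by auto
      ultimately have "compact (rest k x ` cball (of_real x) (x / 2))"
        by (intro compact_continuous_image compact_cball) (rule continuous_on_subset)
      then obtain B where B: "\<And>z. z \<in> cball (of_real x) (x / 2) \<Longrightarrow> \<bar>rest k x z\<bar> \<le> B"
        by (force dest!: compact_imp_bounded simp: bounded_iff)
      have aeq: "AE z in \<nu>. z \<noteq> of_real x"
        by (rule AE_I'[of "{of_real x}"]) (auto simp: null_sets_def atom riesz_sets(1)[OF rm])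
      have ci: "integrable \<nu> (indicator (cball (of_real x) (x / 2)) :: complex \<Rightarrow> real)"
      proof (rule integrable_real_indicator)
        have "cball (of_real x) (x / 2) \<subseteq> (cball 0 (2 * x) :: complex set)"
        proof
          fix z :: complex assume "z \<in> cball (of_real x) (x / 2)"
          thus "z \<in> cball 0 (2 * x)"
            using norm_triangle_ineq[of "z - of_real x" "of_real x"] x by (simp add: dist_norm norm_minus_commute)
        qed
        hence "emeasure \<nu> (cball (of_real x) (x / 2)) \<le> emeasure \<nu> (cball 0 (2 * x))"
          by (intro emeasure_mono) (auto simp: riesz_sets(1)[OF rm])
        thus "emeasure \<nu> (cball (of_real x) (x / 2)) < \<infinity>" using riesz_sets(3)[OF rm, of "2 * x"] by (rule le_less_trans)
      qed (simp add: riesz_sets(1)[OF rm])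
      show ?thesis
      proof (rule integral_dominated_convergence[where w = "\<lambda>z. \<bar>Kern k x z\<bar> + B * indicator (cball (of_real x) (x / 2)) z"])
        show "Kern k x \<in> borel_measurable \<nu>" by measurable
        show "T n \<in> borel_measurable \<nu>" for n unfolding T_def by measurable
        show "integrable \<nu> (\<lambda>z. \<bar>Kern k x z\<bar> + B * indicator (cball (of_real x) (x / 2)) z)"
          using Ki ci by (intro Bochner_Integration.integrable_add integrable_abs integrable_mult_right)
        show "AE z in \<nu>. (\<lambda>n. T n z) \<longlonglongrightarrow> Kern k x z"
          using aeq
        proof eventually_elim
          case (elim z)
          hence "cmod (z - of_real x) > 0" by simp
          hence "\<forall>\<^sub>F n in sequentially. d n < cmod (z - of_real x)" by (rule order_tendstoD(2)[OF dlim])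
          moreover have "\<forall>\<^sub>F n in sequentially. cmod z \<le> real n"
            using filterlim_real_sequentially by (simp add: filterlim_at_top)
          ultimately have "\<forall>\<^sub>F n in sequentially. T n z = Kern k x z"
          proof eventually_elim
            case (elim n)
            have "cmod z \<le> R n" using elim x r0 by (simp add: R_def)
            thus ?case using elim regL_far(1)[OF dn(1)[of n], of z x] eta_inside(1)[OF Rn(1)[of n], of z]
              by (simp add: T_def Kern_def)
          qed
          thus ?case by (rule tendsto_eventually)
        qed
        show "AE z in \<nu>. norm (T n z) \<le> \<bar>Kern k x z\<bar> + B * indicator (cball (of_real x) (x / 2)) z" for n
          using aeq
        proof eventually_elim
          case (elim z)
          \<comment> \<open>Outside the smoothing disc the sum is \<open>Kern\<close> itself. Inside
            it lies between \<open>Kern\<close> and \<open>rest\<close>, and \<open>rest\<close> is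
            bounded by \<open>B\<close> near \<open>x\<close>; so the bound does not depend on
            \<open>n\<close>.\<close>
          have "\<bar>regL (d n) x z + rest k x z\<bar> \<le> \<bar>Kern k x z\<bar> + B * indicator (cball (of_real x) (x / 2)) z"
          proof (cases "cmod (z - of_real x) \<ge> d n")
            case True
            have "B \<ge> 0" using B[of "of_real x"] x by force
            thus ?thesis using regL_far(1)[OF dn(1)[of n] True] by (simp add: Kern_def)
          next
            case False
            hence z: "z \<in> cball (of_real x) (x / 2)" using dn(3)[of n] by (simp add: dist_norm norm_minus_commute)
            have "ln (cmod (z - of_real x)) \<le> regL (d n) x z" "regL (d n) x z \<le> 0"
              using regL_bounds[OF dn(1,2) elim] False by auto
            thus ?thesis using B[OF z] z unfolding Kern_def by simp
          qed
          moreover have "norm (T n z) \<le> 1 * \<bar>regL (d n) x z + rest k x z\<bar>"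
            unfolding T_def real_norm_def abs_mult using eta_range[of "R n" z] by (intro mult_right_mono) auto
          ultimately show ?case by simp
        qed
      qed
    qed
    have "a n = (\<integral>z. T n z \<partial>\<nu>) - 1 / (2 * pi) * (\<integral>z. u z * far k x (R n) z \<partial>lborel) + (\<Sum>j\<le>k. x ^ j * c j)" for n
      using key[of n] by simp
    hence "a = (\<lambda>n. (\<integral>z. T n z \<partial>\<nu>) - 1 / (2 * pi) * (\<integral>z. u z * far k x (R n) z \<partial>lborel) + (\<Sum>j\<le>k. x ^ j * c j))"
      by (rule ext)
    moreover have "(\<lambda>n. (\<integral>z. T n z \<partial>\<nu>) - 1 / (2 * pi) * (\<integral>z. u z * far k x (R n) z \<partial>lborel) + (\<Sum>j\<le>k. x ^ j * c j))
      \<longlonglongrightarrow> (\<integral>z. Kern k x z \<partial>\<nu>) - 1 / (2 * pi) * 0 + (\<Sum>j\<le>k. x ^ j * c j)"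
      by (intro tendsto_intros T_lim far_lim)
    ultimately have "a \<longlonglongrightarrow> (\<integral>z. Kern k x z \<partial>\<nu>) + (\<Sum>j\<le>k. x ^ j * c j)" by simp
    thus ?thesis
      using subharmonic_eq_lim_chi_mean[OF v(1) subharmonic_AE_finite[OF v(1,2)] dn(1) dlim chi_int[unfolded u_def]]
      unfolding a_def u_def by blast
  qed
  thus thesis by (rule that)
qed

section \<open>Principal values under the integral sign\<close>

abbreviation pv_dom :: "real \<Rightarrow> real \<Rightarrow> real set" where "pv_dom x \<epsilon> \<equiv> {0<..} - {x - \<epsilon>..x + \<epsilon>}"

section \<open>Bounds for truncated principal values that are uniform in the truncation\<close>

lemma pv_trunc_eq: "pv_trunc f x \<epsilon> = (\<integral>t. indicator (pv_dom x \<epsilon>) t * (f t / (x - t)) \<partial>lborel)"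
  by (simp add: pv_trunc_def set_lebesgue_integral_def)

lemma pv_weight_finite:
  assumes \<beta>: "0 < \<beta>" "\<beta> < 1" and \<epsilon>: "0 < \<epsilon>" "\<epsilon> < x"
  shows "(\<integral>\<^sup>+t. indicator (pv_dom x \<epsilon>) t * ennreal (t powr (\<beta> - 1) / \<bar>x - t\<bar>) \<partial>lborel) < \<infinity>"
proof -
  \<comment> \<open>The supremum of \<open>t / (t - x)\<close> over
    \<open>t > x + \<epsilon>\<close>. Trading that factor turns the weight beyond \<open>x\<close>
    into \<open>t powr (\<beta> - 2)\<close>, which is integrable at infinity.\<close>
  define c where "c = (x + \<epsilon>) / \<epsilon>"
  have c: "c \<ge> 0" using \<epsilon> by (simp add: c_def)
  have "(\<integral>\<^sup>+t. indicator (pv_dom x \<epsilon>) t * ennreal (t powr (\<beta> - 1) / \<bar>x - t\<bar>) \<partial>lborel) \<le>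
    (\<integral>\<^sup>+t. ennreal (1 / \<epsilon>) * (ennreal (t powr (\<beta> - 1)) * indicator {0..x} t) + ennreal c * (ennreal (t powr (\<beta> - 2)) * indicator {x..} t) \<partial>lborel)"
  proof (rule nn_integral_mono)
    fix t :: real
    consider "t \<notin> pv_dom x \<epsilon>" | "0 < t" "t < x - \<epsilon>" | "t > x + \<epsilon>" using \<epsilon> by force
    thus "indicator (pv_dom x \<epsilon>) t * ennreal (t powr (\<beta> - 1) / \<bar>x - t\<bar>) \<le> ennreal (1 / \<epsilon>) * (ennreal (t powr (\<beta> - 1)) * indicator {0..x} t) + ennreal c * (ennreal (t powr (\<beta> - 2)) * indicator {x..} t)"
    proof cases
      case 1
      thus ?thesis by simp
    next
      case 2
      have "t powr (\<beta> - 1) / \<bar>x - t\<bar> \<le> t powr (\<beta> - 1) / \<epsilon>" using 2 \<epsilon> by (intro divide_left_mono) auto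
      hence "ennreal (t powr (\<beta> - 1) / \<bar>x - t\<bar>) \<le> ennreal (1 / \<epsilon>) * ennreal (t powr (\<beta> - 1))"
        using \<epsilon> by (simp add: ennreal_mult[symmetric] ennreal_leI)
      thus ?thesis using 2 \<epsilon> by (simp add: indicator_def)
    next
      case 3
      have "t * \<epsilon> \<le> (x + \<epsilon>) * (t - x)" using 3 \<epsilon> mult_left_mono[of "x + \<epsilon>" t x] by (simp add: algebra_simps)
      hence "t / (t - x) \<le> c" using 3 \<epsilon> by (simp add: c_def field_simps)
      hence "t powr (\<beta> - 2) * (t / (t - x)) \<le> t powr (\<beta> - 2) * c" by (intro mult_left_mono) auto
      moreover have "t powr (\<beta> - 1) = t powr (\<beta> - 2) * t"
        using 3 \<epsilon> powr_add[of t "\<beta> - 2" 1] by simp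
      ultimately have "t powr (\<beta> - 1) / \<bar>x - t\<bar> \<le> c * t powr (\<beta> - 2)"
        using 3 \<epsilon> by (simp add: mult.commute)
      hence "ennreal (t powr (\<beta> - 1) / \<bar>x - t\<bar>) \<le> ennreal c * ennreal (t powr (\<beta> - 2))"
        using c by (simp add: ennreal_mult[symmetric] ennreal_leI)
      thus ?thesis using 3 \<epsilon> by (simp add: indicator_def)
    qed
  qed
  also have "\<dots> = ennreal (1 / \<epsilon>) * (\<integral>\<^sup>+t. ennreal (t powr (\<beta> - 1)) * indicator {0..x} t \<partial>lborel) + ennreal c * (\<integral>\<^sup>+t. ennreal (t powr (\<beta> - 2)) * indicator {x..} t \<partial>lborel)"
    by (simp add: nn_integral_add nn_integral_cmult)
  also have "(\<integral>\<^sup>+t. ennreal (t powr (\<beta> - 1)) * indicator {0..x} t \<partial>lborel) = ennreal (x powr ((\<beta> - 1) + 1) / ((\<beta> - 1) + 1))"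
    by (rule nn_integral_has_integral_lebesgue', simp, rule has_integral_powr_from_0) (use \<beta> \<epsilon> in auto)
  also have "(\<integral>\<^sup>+t. ennreal (t powr (\<beta> - 2)) * indicator {x..} t \<partial>lborel) = ennreal (- (x powr ((\<beta> - 2) + 1)) / ((\<beta> - 2) + 1))"
    by (rule nn_integral_has_integral_lebesgue', simp, rule has_integral_powr_to_inf) (use \<beta> \<epsilon> in auto)
  also have "ennreal (1 / \<epsilon>) * ennreal (x powr ((\<beta> - 1) + 1) / ((\<beta> - 1) + 1)) + ennreal c * ennreal (- (x powr ((\<beta> - 2) + 1)) / ((\<beta> - 2) + 1)) < \<infinity>"
    by (simp add: ennreal_mult_less_top)
  finally show ?thesis .
qed

text \<open>The reflection of \<open>t\<close> to \<open>2 * x - t\<close> preserves the punctured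
  window and reverses the sign of the kernel.\<close>

lemma odd_pv_zero:
  assumes \<epsilon>: "0 < \<epsilon>"
  shows "integrable lborel (\<lambda>t::real. indicator {t. \<epsilon> < \<bar>t - x\<bar> \<and> \<bar>t - x\<bar> \<le> \<delta>} t * (1 / (x - t)))"
    and "(\<integral>t. indicator {t. \<epsilon> < \<bar>t - x\<bar> \<and> \<bar>t - x\<bar> \<le> \<delta>} t * (1 / (x - t)) \<partial>lborel) = 0"
proof -
  let ?f = "\<lambda>t::real. indicator {t. \<epsilon> < \<bar>t - x\<bar> \<and> \<bar>t - x\<bar> \<le> \<delta>} t * (1 / (x - t))"
  show "integrable lborel ?f"
  proof (rule Bochner_Integration.integrable_bound)
    have "emeasure lborel {x - \<delta>..x + \<delta>} < \<infinity>" by (cases "\<delta> \<ge> 0") auto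
    hence "integrable lborel (indicator {x - \<delta>..x + \<delta>} :: real \<Rightarrow> real)"
      by (intro integrable_real_indicator) auto
    thus "integrable lborel (\<lambda>t. 1 / \<epsilon> * indicator {x - \<delta>..x + \<delta>} t)" by (rule integrable_mult_right)
    show "AE t in lborel. norm (?f t) \<le> norm (1 / \<epsilon> * indicator {x - \<delta>..x + \<delta>} t)"
    proof (rule AE_I2)
      fix t :: real
      show "norm (?f t) \<le> norm (1 / \<epsilon> * indicator {x - \<delta>..x + \<delta>} t)"
      proof (cases "\<epsilon> < \<bar>t - x\<bar> \<and> \<bar>t - x\<bar> \<le> \<delta>")
        case True
        hence "t \<in> {x - \<delta>..x + \<delta>}" by auto
        moreover have "1 / \<bar>x - t\<bar> \<le> 1 / \<epsilon>" using True \<epsilon> by (intro divide_left_mono) auto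
        ultimately show ?thesis using True \<epsilon> by simp
      qed simp
    qed
  qed simp
  have "(\<integral>t. ?f t \<partial>lborel) = \<bar>-1::real\<bar> *\<^sub>R (\<integral>t. ?f (2 * x + (-1) * t) \<partial>lborel)"
    by (rule lborel_integral_real_affine) simp
  also have "(\<integral>t. ?f (2 * x + (-1) * t) \<partial>lborel) = (\<integral>t. - ?f t \<partial>lborel)"
  proof (intro Bochner_Integration.integral_cong refl)
    fix t :: real
    have e: "x - (2 * x + (-1) * t) = - (x - t)" "\<bar>2 * x + (-1) * t - x\<bar> = \<bar>t - x\<bar>" by auto
    show "?f (2 * x + (-1) * t) = - ?f t"
      by (simp only: indicator_def mem_Collect_eq e divide_minus_right mult_minus_right)
  qed
  finally show "(\<integral>t. ?f t \<partial>lborel) = 0" by simp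
qed

text \<open>For a non-integrable \<open>g\<close> the integral is 0 by convention, so the bound
  persists.\<close>

lemma integral_norm_le_nn:
  fixes g :: "real \<Rightarrow> real"
  assumes "\<And>t. ennreal \<bar>g t\<bar> \<le> h t"
  shows "ennreal \<bar>\<integral>t. g t \<partial>lborel\<bar> \<le> (\<integral>\<^sup>+t. h t \<partial>lborel)"
proof (cases "integrable lborel g")
  case True
  have "ennreal \<bar>\<integral>t. g t \<partial>lborel\<bar> \<le> (\<integral>\<^sup>+t. ennreal \<bar>g t\<bar> \<partial>lborel)"
    using integral_norm_bound_ennreal[OF True] by simp
  also have "\<dots> \<le> (\<integral>\<^sup>+t. h t \<partial>lborel)" by (intro nn_integral_mono assms)
  finally show ?thesis .
qed (simp add: not_integrable_integral_eq)

text \<open>On the ring between \<epsilon> and \<delta> the kernel is odd, so subtracting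
  \<open>f x\<close> times it costs nothing and replaces \<open>f t\<close> by
  \<open>f t - f x\<close>. The resulting bound no longer mentions \<epsilon>.\<close>

lemma pv_trunc_bound:
  assumes \<epsilon>: "0 < \<epsilon>" "\<epsilon> < \<delta>" "\<delta> < x"
    and int: "integrable lborel (\<lambda>t. indicator (pv_dom x \<epsilon>) t * (f t / (x - t)))"
  shows "ennreal \<bar>pv_trunc f x \<epsilon>\<bar> \<le> (\<integral>\<^sup>+t. indicator (pv_dom x \<delta>) t * ennreal (\<bar>f t\<bar> / \<bar>x - t\<bar>)
      + indicator {x - \<delta>..x + \<delta>} t * ennreal (\<bar>f t - f x\<bar> / \<bar>x - t\<bar>) \<partial>lborel)"
proof -
  let ?i = "\<lambda>t::real. indicator {t. \<epsilon> < \<bar>t - x\<bar> \<and> \<bar>t - x\<bar> \<le> \<delta>} t * (1 / (x - t))"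
  have "pv_trunc f x \<epsilon> = (\<integral>t. indicator (pv_dom x \<epsilon>) t * (f t / (x - t)) \<partial>lborel) - f x * (\<integral>t. ?i t \<partial>lborel)"
    by (simp only: pv_trunc_eq odd_pv_zero(2)[OF \<epsilon>(1)])
  also have "\<dots> = (\<integral>t. indicator (pv_dom x \<epsilon>) t * (f t / (x - t)) - f x * ?i t \<partial>lborel)"
    unfolding Bochner_Integration.integral_diff[OF int integrable_mult_right[OF odd_pv_zero(1)[OF \<epsilon>(1)]]] integral_mult_right_zero ..
  finally show ?thesis
  proof (elim ssubst, intro integral_norm_le_nn)
    fix t :: real
    consider "t \<in> pv_dom x \<delta>" | "t \<notin> pv_dom x \<epsilon>" | "\<epsilon> < \<bar>t - x\<bar>" "\<bar>t - x\<bar> \<le> \<delta>" using \<epsilon> by force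
    thus "ennreal \<bar>indicator (pv_dom x \<epsilon>) t * (f t / (x - t)) - f x * ?i t\<bar>
       \<le> indicator (pv_dom x \<delta>) t * ennreal (\<bar>f t\<bar> / \<bar>x - t\<bar>) + indicator {x - \<delta>..x + \<delta>} t * ennreal (\<bar>f t - f x\<bar> / \<bar>x - t\<bar>)"
    proof cases
      case 1
      hence i: "t \<in> pv_dom x \<epsilon>" "t \<notin> {t. \<epsilon> < \<bar>t - x\<bar> \<and> \<bar>t - x\<bar> \<le> \<delta>}" using \<epsilon> by auto
      show ?thesis unfolding indicator_simps(1)[OF i(1)] indicator_simps(2)[OF i(2)] indicator_simps(1)[OF 1] by simp
    next
      case 2
      hence i: "t \<notin> {t. \<epsilon> < \<bar>t - x\<bar> \<and> \<bar>t - x\<bar> \<le> \<delta>}" using \<epsilon> by auto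
      show ?thesis unfolding indicator_simps(2)[OF i(1)] indicator_simps(2)[OF 2] by simp
    next
      case 3
      hence i: "t \<in> pv_dom x \<epsilon>" "t \<in> {x - \<delta>..x + \<delta>}" "t \<in> {t. \<epsilon> < \<bar>t - x\<bar> \<and> \<bar>t - x\<bar> \<le> \<delta>}" using \<epsilon> by auto
      have "f t / (x - t) - f x * (1 / (x - t)) = (f t - f x) / (x - t)" by (simp add: diff_divide_distrib)
      thus ?thesis unfolding indicator_simps(1)[OF i(1)] indicator_simps(1)[OF i(2)] indicator_simps(1)[OF i(3)] by simp
    qed
  qed
qed

text \<open>The two shifted integrals cancel up to end intervals of length
  \<open>2 * \<sigma>\<close>. The lower end enters with the favourable sign, and at the upper end
  \<open>g\<close> is at most \<open>g (b + \<sigma>)\<close>. The gained factor \<sigma> is what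
  later compensates a division by \<sigma>.\<close>

lemma nn_integral_mono_shift_diff:
  fixes g :: "real \<Rightarrow> real"
  assumes [measurable]: "g \<in> borel_measurable borel" and \<sigma>: "0 \<le> \<sigma>" and ab: "a \<le> b"
    and mono: "\<And>s t. a - \<sigma> \<le> s \<Longrightarrow> s \<le> t \<Longrightarrow> g s \<le> g t" and nn: "\<And>t. a - \<sigma> \<le> t \<Longrightarrow> 0 \<le> g t"
  shows "(\<integral>\<^sup>+x. indicator {a..b} x * ennreal (g (x + \<sigma>) - g (x - \<sigma>)) \<partial>lborel) \<le> ennreal (2 * \<sigma> * g (b + \<sigma>))"
proof -
  define A where "A = (\<integral>\<^sup>+x. indicator {a..b} x * ennreal (g (x + \<sigma>)) \<partial>lborel)"
  \<comment> \<open>\<open>B\<close> is added to both sides so that no subtraction of extended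
    nonnegative integrals occurs, and cancelled at the end because it is finite.\<close>
  define B where "B = (\<integral>\<^sup>+x. indicator {a..b} x * ennreal (g (x - \<sigma>)) \<partial>lborel)"
  have A: "A = (\<integral>\<^sup>+x. indicator {a + \<sigma>..b + \<sigma>} x * ennreal (g x) \<partial>lborel)"
    unfolding A_def using nn_integral_shift[of "\<lambda>x. indicator {a + \<sigma>..b + \<sigma>} x * ennreal (g x)" \<sigma>]
    by (simp add: indicator_def add.commute)
  have B: "B = (\<integral>\<^sup>+x. indicator {a - \<sigma>..b - \<sigma>} x * ennreal (g x) \<partial>lborel)"
    unfolding B_def using nn_integral_shift[of "\<lambda>x. indicator {a - \<sigma>..b - \<sigma>} x * ennreal (g x)" "- \<sigma>"]
    by (simp add: indicator_def add.commute)
  have "(\<integral>\<^sup>+x. indicator {a..b} x * ennreal (g (x + \<sigma>) - g (x - \<sigma>)) \<partial>lborel) + B =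
    (\<integral>\<^sup>+x. indicator {a..b} x * ennreal (g (x + \<sigma>) - g (x - \<sigma>)) + indicator {a..b} x * ennreal (g (x - \<sigma>)) \<partial>lborel)"
    unfolding B_def by (rule nn_integral_add[symmetric]) auto
  also have "\<dots> = A"
    unfolding A_def
  proof (intro nn_integral_cong)
    fix x
    show "indicator {a..b} x * ennreal (g (x + \<sigma>) - g (x - \<sigma>)) + indicator {a..b} x * ennreal (g (x - \<sigma>)) = indicator {a..b} x * ennreal (g (x + \<sigma>))"
      using mono[of "x - \<sigma>" "x + \<sigma>"] nn[of "x - \<sigma>"] \<sigma>
      by (cases "x \<in> {a..b}") (auto simp: ennreal_plus[symmetric] simp del: ennreal_plus)
  qed
  also have "A \<le> (\<integral>\<^sup>+x. indicator {a - \<sigma>..b - \<sigma>} x * ennreal (g x) + ennreal (g (b + \<sigma>)) * indicator {b - \<sigma>..b + \<sigma>} x \<partial>lborel)"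
    unfolding A
  proof (intro nn_integral_mono)
    fix x
    show "indicator {a + \<sigma>..b + \<sigma>} x * ennreal (g x) \<le> indicator {a - \<sigma>..b - \<sigma>} x * ennreal (g x) + ennreal (g (b + \<sigma>)) * indicator {b - \<sigma>..b + \<sigma>} x"
    proof (cases "x \<in> {a + \<sigma>..b + \<sigma>}")
      case True
      hence "g x \<le> g (b + \<sigma>)" using \<sigma> by (intro mono) auto
      hence "ennreal (g x) \<le> ennreal (g (b + \<sigma>))" by (rule ennreal_leI)
      thus ?thesis using True \<sigma> by (cases "x \<le> b - \<sigma>") (auto simp: indicator_def)
    qed simp
  qed
  also have "\<dots> = B + ennreal (g (b + \<sigma>)) * ennreal (2 * \<sigma>)"
    unfolding B using \<sigma> by (subst nn_integral_add) (auto simp: nn_integral_cmult)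
  also have "ennreal (g (b + \<sigma>)) * ennreal (2 * \<sigma>) = ennreal (2 * \<sigma> * g (b + \<sigma>))"
    using \<sigma> nn[of "b + \<sigma>"] ab by (simp add: ennreal_mult[symmetric] mult.commute)
  finally have le: "(\<integral>\<^sup>+x. indicator {a..b} x * ennreal (g (x + \<sigma>) - g (x - \<sigma>)) \<partial>lborel) + B \<le> B + ennreal (2 * \<sigma> * g (b + \<sigma>))" .
  have "B \<le> (\<integral>\<^sup>+x. ennreal (g (b - \<sigma>)) * indicator {a - \<sigma>..b - \<sigma>} x \<partial>lborel)"
    unfolding B by (intro nn_integral_mono) (auto simp: indicator_def intro!: ennreal_leI mono)
  also have "\<dots> < \<infinity>" using ab by (simp add: nn_integral_cmult ennreal_mult_less_top)
  finally have "B \<noteq> top" by simp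
  thus ?thesis using le by (simp add: add.commute[of _ B] ennreal_add_left_cancel_le)
qed

text \<open>The setting for exchanging principal value and integral: \<open>\<Psi> z\<close> stands
  for the distribution function of a signed kernel on the ray and \<open>V z\<close> for that of its
  total variation. The single homogeneous bound of order \<alpha> gives integrability in
  \<open>t\<close> at 0 and at infinity through \<open>k < \<alpha> < k + 1\<close>, and in
  \<open>z\<close> through the finite moment. \<open>G\<close> carries the measure and keeps
  \<open>z\<close> away from 0, where the bounds would fail.\<close>

locale pv_kernel = sigma_finite_measure \<nu> for \<nu> :: "complex measure" +
  fixes \<Psi> V :: "complex \<Rightarrow> real \<Rightarrow> real" and C \<alpha> :: real and k :: nat and G :: "complex set"
  assumes sets_nu [measurable_cong]: "sets \<nu> = sets borel"
    and G: "AE z in \<nu>. z \<in> G"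
    and meas: "(\<lambda>(z, t). \<Psi> z t) \<in> borel_measurable (borel \<Otimes>\<^sub>M borel)" "(\<lambda>(z, t). V z t) \<in> borel_measurable (borel \<Otimes>\<^sub>M borel)"
    and incr: "\<And>z s t. z \<in> G \<Longrightarrow> 0 < s \<Longrightarrow> s \<le> t \<Longrightarrow> \<bar>\<Psi> z t - \<Psi> z s\<bar> \<le> V z t - V z s"
    and absle: "\<And>z t. z \<in> G \<Longrightarrow> 0 < t \<Longrightarrow> \<bar>\<Psi> z t\<bar> \<le> V z t"
    and Vle: "\<And>z t. z \<in> G \<Longrightarrow> 0 < t \<Longrightarrow> V z t \<le> C * (t powr \<alpha> * cmod z powr (- \<alpha>))"
    and C: "C \<ge> 0"
    and fin: "(\<integral>\<^sup>+ z. ennreal (cmod z powr (- \<alpha>)) \<partial>\<nu>) < \<infinity>"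
    and \<alpha>: "real k < \<alpha>" "\<alpha> < real k + 1"
begin

lemma meas_comp [measurable]:
  assumes [measurable]: "f \<in> M \<rightarrow>\<^sub>M borel" "g \<in> M \<rightarrow>\<^sub>M borel"
  shows "(\<lambda>x. \<Psi> (f x) (g x)) \<in> borel_measurable M" "(\<lambda>x. V (f x) (g x)) \<in> borel_measurable M"
proof -
  have p: "(\<lambda>x. (f x, g x)) \<in> M \<rightarrow>\<^sub>M (borel \<Otimes>\<^sub>M borel)" by measurable
  show "(\<lambda>x. \<Psi> (f x) (g x)) \<in> borel_measurable M" "(\<lambda>x. V (f x) (g x)) \<in> borel_measurable M"
    using measurable_compose[OF p meas(1)] measurable_compose[OF p meas(2)] by simp_all
qed

lemma V_mono: "z \<in> G \<Longrightarrow> 0 < s \<Longrightarrow> s \<le> t \<Longrightarrow> V z s \<le> V z t"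
  using incr[of z s t] by linarith

lemma V_nonneg: "z \<in> G \<Longrightarrow> 0 < t \<Longrightarrow> 0 \<le> V z t"
  using absle[of z t] by linarith

lemma kernel_le:
  assumes "z \<in> G" "t > 0"
  shows "\<bar>\<Psi> z t / t ^ (k + 1)\<bar> / \<bar>x - t\<bar> \<le> C * cmod z powr (- \<alpha>) * (t powr ((\<alpha> - k) - 1) / \<bar>x - t\<bar>)"
proof -
  have "\<bar>\<Psi> z t\<bar> / t ^ (k + 1) \<le> (C * (t powr \<alpha> * cmod z powr (- \<alpha>))) / t ^ (k + 1)"
    using absle[OF assms] Vle[OF assms] assms(2) by (intro divide_right_mono) auto
  also have "\<dots> = C * cmod z powr (- \<alpha>) * (t powr \<alpha> / t powr real (k + 1))"
    using assms(2) by (simp only: powr_realpow) simp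
  also have "t powr \<alpha> / t powr real (k + 1) = t powr ((\<alpha> - k) - 1)"
    by (simp add: powr_diff[symmetric] algebra_simps)
  finally have "\<bar>\<Psi> z t / t ^ (k + 1)\<bar> \<le> C * cmod z powr (- \<alpha>) * t powr ((\<alpha> - k) - 1)"
    using assms(2) by (simp add: abs_divide)
  from divide_right_mono[OF this, of "\<bar>x - t\<bar>"] show ?thesis by simp
qed

lemma weight_fin:
  assumes "0 < \<epsilon>" "\<epsilon> < x"
  shows "(\<integral>\<^sup>+t. indicator (pv_dom x \<epsilon>) t * ennreal (t powr ((\<alpha> - k) - 1) / \<bar>x - t\<bar>) \<partial>lborel) < \<infinity>"
  by (rule pv_weight_finite) (use assms \<alpha> in auto)

lemma kernel_integrable:
  assumes z: "z \<in> G" and \<epsilon>: "0 < \<epsilon>" "\<epsilon> < x"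
  shows "integrable lborel (\<lambda>t. indicator (pv_dom x \<epsilon>) t * ((\<Psi> z t / t ^ (k + 1)) / (x - t)))"
proof (rule integrableI_bounded)
  have "(\<integral>\<^sup>+t. ennreal (norm (indicator (pv_dom x \<epsilon>) t * ((\<Psi> z t / t ^ (k + 1)) / (x - t)))) \<partial>lborel) \<le>
     (\<integral>\<^sup>+t. ennreal (C * cmod z powr (- \<alpha>)) * (indicator (pv_dom x \<epsilon>) t * ennreal (t powr ((\<alpha> - k) - 1) / \<bar>x - t\<bar>)) \<partial>lborel)"
  proof (rule nn_integral_mono)
    fix t :: real
    show "ennreal (norm (indicator (pv_dom x \<epsilon>) t * ((\<Psi> z t / t ^ (k + 1)) / (x - t)))) \<le>
       ennreal (C * cmod z powr (- \<alpha>)) * (indicator (pv_dom x \<epsilon>) t * ennreal (t powr ((\<alpha> - k) - 1) / \<bar>x - t\<bar>))"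
    proof (cases "t \<in> pv_dom x \<epsilon>")
      case True
      hence "t > 0" by auto
      from kernel_le[OF z this, of x] True C show ?thesis
        by (simp add: ennreal_mult[symmetric] ennreal_leI abs_mult abs_divide)
    qed simp
  qed
  also have "\<dots> = ennreal (C * cmod z powr (- \<alpha>)) * (\<integral>\<^sup>+t. (indicator (pv_dom x \<epsilon>) t * ennreal (t powr ((\<alpha> - k) - 1) / \<bar>x - t\<bar>)) \<partial>lborel)"
    by (rule nn_integral_cmult) simp
  also have "\<dots> < \<infinity>" using weight_fin[OF \<epsilon>] by (auto simp: ennreal_mult_less_top)
  finally show "(\<integral>\<^sup>+t. ennreal (norm (indicator (pv_dom x \<epsilon>) t * ((\<Psi> z t / t ^ (k + 1)) / (x - t)))) \<partial>lborel) < \<infinity>" .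
qed measurable

text \<open>With the window about \<open>x\<close> removed, the double integral is dominated by a
  product of a function of \<open>z\<close> and a weight in \<open>t\<close>, both
  integrable.\<close>

lemma pv_trunc_Fubini:
  assumes \<epsilon>: "0 < \<epsilon>" "\<epsilon> < x"
  shows "pv_trunc (\<lambda>t. (\<integral>z. \<Psi> z t \<partial>\<nu>) / t ^ (k + 1)) x \<epsilon> = (\<integral>z. pv_trunc (\<lambda>t. \<Psi> z t / t ^ (k + 1)) x \<epsilon> \<partial>\<nu>)"
proof -
  interpret P: pair_sigma_finite \<nu> "lborel :: real measure" ..
  let ?h = "\<lambda>z t. indicator (pv_dom x \<epsilon>) t * ((\<Psi> z t / t ^ (k + 1)) / (x - t))"
  have hm [measurable]: "case_prod ?h \<in> borel_measurable (\<nu> \<Otimes>\<^sub>M lborel)" by measurable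
  have "integrable (\<nu> \<Otimes>\<^sub>M lborel) (case_prod ?h)"
  proof (rule integrableI_bounded[OF hm])
    have "(\<integral>\<^sup>+zt. ennreal (norm (case_prod ?h zt)) \<partial>(\<nu> \<Otimes>\<^sub>M lborel)) = (\<integral>\<^sup>+z. \<integral>\<^sup>+t. ennreal (norm (?h z t)) \<partial>lborel \<partial>\<nu>)"
      by (subst lborel.nn_integral_fst[symmetric]) auto
    also have "\<dots> \<le> (\<integral>\<^sup>+z. ennreal (C * cmod z powr (- \<alpha>)) * (\<integral>\<^sup>+t. (indicator (pv_dom x \<epsilon>) t * ennreal (t powr ((\<alpha> - k) - 1) / \<bar>x - t\<bar>)) \<partial>lborel) \<partial>\<nu>)"
    proof (rule nn_integral_mono_AE, rule AE_mp[OF G], rule AE_I2, rule impI)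
      fix z assume z: "z \<in> G"
      have "(\<integral>\<^sup>+t. ennreal (norm (?h z t)) \<partial>lborel) \<le> (\<integral>\<^sup>+t. ennreal (C * cmod z powr (- \<alpha>)) * (indicator (pv_dom x \<epsilon>) t * ennreal (t powr ((\<alpha> - k) - 1) / \<bar>x - t\<bar>)) \<partial>lborel)"
      proof (rule nn_integral_mono)
        fix t :: real
        show "ennreal (norm (?h z t)) \<le> ennreal (C * cmod z powr (- \<alpha>)) * (indicator (pv_dom x \<epsilon>) t * ennreal (t powr ((\<alpha> - k) - 1) / \<bar>x - t\<bar>))"
        proof (cases "t \<in> pv_dom x \<epsilon>")
          case True
          hence "t > 0" by auto
          from kernel_le[OF z this, of x] True C show ?thesis
            by (simp add: ennreal_mult[symmetric] ennreal_leI abs_mult abs_divide)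
        qed simp
      qed
      also have "\<dots> = ennreal (C * cmod z powr (- \<alpha>)) * (\<integral>\<^sup>+t. (indicator (pv_dom x \<epsilon>) t * ennreal (t powr ((\<alpha> - k) - 1) / \<bar>x - t\<bar>)) \<partial>lborel)"
        by (rule nn_integral_cmult) simp
      finally show "(\<integral>\<^sup>+t. ennreal (norm (?h z t)) \<partial>lborel) \<le> ennreal (C * cmod z powr (- \<alpha>)) * (\<integral>\<^sup>+t. (indicator (pv_dom x \<epsilon>) t * ennreal (t powr ((\<alpha> - k) - 1) / \<bar>x - t\<bar>)) \<partial>lborel)" .
    qed
    also have "\<dots> = (\<integral>\<^sup>+z. ennreal (C * cmod z powr (- \<alpha>)) \<partial>\<nu>) * (\<integral>\<^sup>+t. (indicator (pv_dom x \<epsilon>) t * ennreal (t powr ((\<alpha> - k) - 1) / \<bar>x - t\<bar>)) \<partial>lborel)"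
      by (rule nn_integral_multc) measurable
    also have "(\<integral>\<^sup>+z. ennreal (C * cmod z powr (- \<alpha>)) \<partial>\<nu>) = ennreal C * (\<integral>\<^sup>+z. ennreal (cmod z powr (- \<alpha>)) \<partial>\<nu>)"
      using C by (subst nn_integral_cmult[symmetric]) (auto simp: ennreal_mult)
    also have "\<dots> * (\<integral>\<^sup>+t. (indicator (pv_dom x \<epsilon>) t * ennreal (t powr ((\<alpha> - k) - 1) / \<bar>x - t\<bar>)) \<partial>lborel) < \<infinity>"
      using weight_fin[OF \<epsilon>] fin by (auto simp: ennreal_mult_less_top)
    finally show "(\<integral>\<^sup>+zt. ennreal (norm (case_prod ?h zt)) \<partial>(\<nu> \<Otimes>\<^sub>M lborel)) < \<infinity>" .
  qed
  from P.Fubini_integral[OF this]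
  have "(\<integral>t. (\<integral>z. ?h z t \<partial>\<nu>) \<partial>lborel) = (\<integral>z. pv_trunc (\<lambda>t. \<Psi> z t / t ^ (k + 1)) x \<epsilon> \<partial>\<nu>)"
    by (simp only: pv_trunc_eq)
  moreover have "(\<integral>z. ?h z t \<partial>\<nu>) = indicator (pv_dom x \<epsilon>) t * (((\<integral>z. \<Psi> z t \<partial>\<nu>) / t ^ (k + 1)) / (x - t))" for t
    by simp
  ultimately show ?thesis by (simp only: pv_trunc_eq)
qed

text \<open>A Dini-type integral that dominates the difference quotient of \<open>\<Psi> z\<close>
  on the window about \<open>x\<close>. The increment is taken over the symmetric interval from
  \<open>x - \<bar>s\<bar>\<close> to \<open>x + \<bar>s\<bar>\<close>, so that it covers the
  increments to either side of \<open>x\<close> at once.\<close>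

definition osc :: "real \<Rightarrow> real \<Rightarrow> complex \<Rightarrow> ennreal" where
  "osc \<delta> x z = (\<integral>\<^sup>+s. indicator {-\<delta>..\<delta>} s * ennreal ((V z (x + \<bar>s\<bar>) - V z (x - \<bar>s\<bar>)) / \<bar>s\<bar>) \<partial>lborel)"

lemma osc_borel [measurable]: "(\<lambda>(x, z). osc \<delta> x z) \<in> borel_measurable (lborel \<Otimes>\<^sub>M \<nu>)"
  unfolding osc_def split_def by measurable

text \<open>At a given \<open>x\<close> the integral may diverge, but averaging over
  \<open>x\<close> in \<open>{a..b}\<close> makes the increment of the monotone \<open>V z\<close>
  of order \<open>\<bar>s\<bar>\<close>, which cancels the division by \<open>\<bar>s\<bar>\<close>.
  The window radius \<open>a / 2\<close> keeps all arguments of \<open>V z\<close> positive.\<close>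

lemma osc_finite_AE:
  assumes ab: "0 < a" "a \<le> b"
  shows "AE x in lborel. x \<in> {a..b} \<longrightarrow> (\<integral>\<^sup>+z. osc (a / 2) x z \<partial>\<nu>) < \<infinity>"
proof -
  interpret P: pair_sigma_finite "lborel :: real measure" \<nu> ..
  define \<delta> where "\<delta> = a / 2"
  have \<delta>: "\<delta> > 0" "\<delta> < a" using ab by (auto simp: \<delta>_def)
  have 1: "(\<integral>\<^sup>+x. indicator {a..b} x * osc \<delta> x z \<partial>lborel) \<le> ennreal (4 * \<delta> * C * (b + \<delta>) powr \<alpha>) * ennreal (cmod z powr (- \<alpha>))" if z: "z \<in> G" for z
  proof -
    have "(\<integral>\<^sup>+x. indicator {a..b} x * osc \<delta> x z \<partial>lborel) =
      (\<integral>\<^sup>+x. \<integral>\<^sup>+s. indicator {a..b} x * (indicator {-\<delta>..\<delta>} s * ennreal ((V z (x + \<bar>s\<bar>) - V z (x - \<bar>s\<bar>)) / \<bar>s\<bar>)) \<partial>lborel \<partial>lborel)"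
      unfolding osc_def by (intro nn_integral_cong nn_integral_cmult[symmetric]) measurable
    also have "\<dots> = (\<integral>\<^sup>+s. \<integral>\<^sup>+x. indicator {a..b} x * (indicator {-\<delta>..\<delta>} s * ennreal ((V z (x + \<bar>s\<bar>) - V z (x - \<bar>s\<bar>)) / \<bar>s\<bar>)) \<partial>lborel \<partial>lborel)"
      by (rule lborel_pair.Fubini') measurable
    also have "\<dots> \<le> (\<integral>\<^sup>+s. ennreal (2 * V z (b + \<delta>)) * indicator {-\<delta>..\<delta>} s \<partial>lborel)"
    proof (intro nn_integral_mono)
      fix s :: real
      show "(\<integral>\<^sup>+x. indicator {a..b} x * (indicator {-\<delta>..\<delta>} s * ennreal ((V z (x + \<bar>s\<bar>) - V z (x - \<bar>s\<bar>)) / \<bar>s\<bar>)) \<partial>lborel) \<le> ennreal (2 * V z (b + \<delta>)) * indicator {-\<delta>..\<delta>} s"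
      proof (cases "s \<in> {-\<delta>..\<delta>} \<and> s \<noteq> 0")
        case True
        define \<sigma> where "\<sigma> = \<bar>s\<bar>"
        have \<sigma>: "0 < \<sigma>" "\<sigma> \<le> \<delta>" using True by (auto simp: \<sigma>_def)
        have "(\<integral>\<^sup>+x. indicator {a..b} x * (indicator {-\<delta>..\<delta>} s * ennreal ((V z (x + \<bar>s\<bar>) - V z (x - \<bar>s\<bar>)) / \<bar>s\<bar>)) \<partial>lborel) =
          (\<integral>\<^sup>+x. ennreal (1 / \<sigma>) * (indicator {a..b} x * ennreal (V z (x + \<sigma>) - V z (x - \<sigma>))) \<partial>lborel)"
        proof (intro nn_integral_cong)
          fix x :: real
          show "indicator {a..b} x * (indicator {-\<delta>..\<delta>} s * ennreal ((V z (x + \<bar>s\<bar>) - V z (x - \<bar>s\<bar>)) / \<bar>s\<bar>)) = ennreal (1 / \<sigma>) * (indicator {a..b} x * ennreal (V z (x + \<sigma>) - V z (x - \<sigma>)))"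
          proof (cases "x \<in> {a..b}")
            case x: True
            have "0 \<le> V z (x + \<sigma>) - V z (x - \<sigma>)" using V_mono[OF z, of "x - \<sigma>" "x + \<sigma>"] x \<sigma> \<delta> by simp
            thus ?thesis using x True \<sigma> by (simp add: \<sigma>_def[symmetric] ennreal_mult[symmetric])
          qed simp
        qed
        also have "\<dots> = ennreal (1 / \<sigma>) * (\<integral>\<^sup>+x. indicator {a..b} x * ennreal (V z (x + \<sigma>) - V z (x - \<sigma>)) \<partial>lborel)"
          by (rule nn_integral_cmult) measurable
        also have "\<dots> \<le> ennreal (1 / \<sigma>) * ennreal (2 * \<sigma> * V z (b + \<sigma>))"
          by (intro mult_left_mono nn_integral_mono_shift_diff V_mono V_nonneg z) (use \<sigma> \<delta> ab in auto)
        also have "\<dots> = ennreal (2 * V z (b + \<sigma>))"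
          using \<sigma> V_nonneg[OF z, of "b + \<sigma>"] ab by (simp add: ennreal_mult[symmetric])
        also have "\<dots> \<le> ennreal (2 * V z (b + \<delta>))"
          using V_mono[OF z, of "b + \<sigma>" "b + \<delta>"] \<sigma> ab by (intro ennreal_leI) auto
        finally show ?thesis using True by simp
      next
        case False
        thus ?thesis by (auto simp: indicator_def)
      qed
    qed
    also have "\<dots> = ennreal (2 * V z (b + \<delta>)) * ennreal (2 * \<delta>)"
      using \<delta> by (simp add: nn_integral_cmult)
    also have "\<dots> = ennreal (4 * \<delta> * V z (b + \<delta>))"
      using \<delta> ab V_nonneg[OF z, of "b + \<delta>"] by (simp add: ennreal_mult[symmetric] mult_ac)
    also have "\<dots> \<le> ennreal (4 * \<delta> * (C * ((b + \<delta>) powr \<alpha> * cmod z powr (- \<alpha>))))"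
      using \<delta> ab by (intro ennreal_leI mult_left_mono Vle z) auto
    also have "\<dots> = ennreal (4 * \<delta> * C * (b + \<delta>) powr \<alpha>) * ennreal (cmod z powr (- \<alpha>))"
      using \<delta> C by (simp add: ennreal_mult[symmetric] mult_ac)
    finally show ?thesis .
  qed
  have "(\<integral>\<^sup>+x. indicator {a..b} x * (\<integral>\<^sup>+z. osc \<delta> x z \<partial>\<nu>) \<partial>lborel) = (\<integral>\<^sup>+x. \<integral>\<^sup>+z. indicator {a..b} x * osc \<delta> x z \<partial>\<nu> \<partial>lborel)"
    by (intro nn_integral_cong nn_integral_cmult[symmetric]) measurable
  also have "\<dots> = (\<integral>\<^sup>+z. \<integral>\<^sup>+x. indicator {a..b} x * osc \<delta> x z \<partial>lborel \<partial>\<nu>)"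
    by (rule P.Fubini'[symmetric]) measurable
  also have "\<dots> \<le> (\<integral>\<^sup>+z. ennreal (4 * \<delta> * C * (b + \<delta>) powr \<alpha>) * ennreal (cmod z powr (- \<alpha>)) \<partial>\<nu>)"
    by (rule nn_integral_mono_AE, rule AE_mp[OF G], rule AE_I2, rule impI, rule 1)
  also have "\<dots> = ennreal (4 * \<delta> * C * (b + \<delta>) powr \<alpha>) * (\<integral>\<^sup>+z. ennreal (cmod z powr (- \<alpha>)) \<partial>\<nu>)"
    by (rule nn_integral_cmult) measurable
  also have "\<dots> < \<infinity>" using fin by (auto simp: ennreal_mult_less_top)
  finally have "(\<integral>\<^sup>+x. indicator {a..b} x * (\<integral>\<^sup>+z. osc \<delta> x z \<partial>\<nu>) \<partial>lborel) \<noteq> \<infinity>" by simp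
  hence "AE x in lborel. indicator {a..b} x * (\<integral>\<^sup>+z. osc \<delta> x z \<partial>\<nu>) \<noteq> \<infinity>"
    by (intro nn_integral_PInf_AE) measurable
  thus ?thesis unfolding \<delta>_def[symmetric]
    by eventually_elim (auto simp: indicator_def less_top)
qed

end

lemma inverse_power_lipschitz:
  fixes s t \<delta> :: real
  assumes \<delta>: "0 < \<delta>" "\<delta> \<le> s" "\<delta> \<le> t"
  shows "\<bar>1 / t ^ n - 1 / s ^ n\<bar> \<le> real n / \<delta> ^ Suc n * \<bar>t - s\<bar>"
proof (induction n)
  case (Suc n)
  have st: "s > 0" "t > 0" using \<delta> by auto
  have "1 / t ^ Suc n - 1 / s ^ Suc n = (1 / t ^ n - 1 / s ^ n) * (1 / t) + (s - t) * (1 / (t * s * s ^ n))"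
    using st by (simp add: field_simps)
  hence "\<bar>1 / t ^ Suc n - 1 / s ^ Suc n\<bar> \<le> \<bar>1 / t ^ n - 1 / s ^ n\<bar> * (1 / t) + \<bar>s - t\<bar> * (1 / (t * s * s ^ n))"
    using abs_triangle_ineq[of "(1 / t ^ n - 1 / s ^ n) * (1 / t)" "(s - t) * (1 / (t * s * s ^ n))"] st by (simp add: abs_mult)
  also have "\<dots> \<le> (real n / \<delta> ^ Suc n * \<bar>t - s\<bar>) * (1 / \<delta>) + \<bar>s - t\<bar> * (1 / (\<delta> * \<delta> * \<delta> ^ n))"
    using \<delta> st by (intro add_mono mult_mono mult_left_mono Suc.IH divide_left_mono power_mono) auto
  also have "\<dots> = real (Suc n) / \<delta> ^ Suc (Suc n) * \<bar>t - s\<bar>"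
    using \<delta> by (simp add: abs_minus_commute field_simps)
  finally show ?case .
qed simp

context pv_kernel
begin

text \<open>Tonelli on the set of pairs with \<open>z = x\<close>: for each \<open>z\<close> it
  contains at most one \<open>x\<close>, so its product measure is 0.\<close>

lemma atoms_null: "AE x in lborel. emeasure \<nu> {complex_of_real x} = 0"
proof -
  interpret P: pair_sigma_finite "lborel :: real measure" \<nu> ..
  have [measurable]: "(\<lambda>(x, z). indicator {0} (z - complex_of_real x) :: ennreal) \<in> borel_measurable (lborel \<Otimes>\<^sub>M \<nu>)"
    by measurable
  have e: "(\<integral>\<^sup>+z. indicator {0} (z - complex_of_real x) \<partial>\<nu>) = emeasure \<nu> {complex_of_real x}" for x
  proof -
    have "(\<integral>\<^sup>+z. indicator {0} (z - complex_of_real x) \<partial>\<nu>) = (\<integral>\<^sup>+z. indicator {complex_of_real x} z \<partial>\<nu>)"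
      by (intro nn_integral_cong) (auto simp: indicator_def)
    thus ?thesis using sets_nu by simp
  qed
  have "(\<integral>\<^sup>+x. \<integral>\<^sup>+z. indicator {0} (z - complex_of_real x) \<partial>\<nu> \<partial>lborel) = (\<integral>\<^sup>+z. \<integral>\<^sup>+x. indicator {0} (z - complex_of_real x) \<partial>lborel \<partial>\<nu>)"
    by (rule P.Fubini'[symmetric]) simp
  also have "\<dots> = (\<integral>\<^sup>+z. 0 \<partial>\<nu>)"
  proof (intro nn_integral_cong)
    fix z
    have "(\<integral>\<^sup>+x. indicator {0} (z - complex_of_real x) \<partial>lborel) \<le> (\<integral>\<^sup>+x. indicator {Re z} x \<partial>lborel)"
      by (intro nn_integral_mono) (auto simp: indicator_def)
    thus "(\<integral>\<^sup>+x. indicator {0} (z - complex_of_real x) \<partial>lborel) = 0" by simp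
  qed
  finally have "(\<integral>\<^sup>+x. emeasure \<nu> {complex_of_real x} \<partial>lborel) = 0" by (simp add: e)
  moreover have "(\<lambda>x. \<integral>\<^sup>+z. indicator {0} (z - complex_of_real x) \<partial>\<nu>) \<in> borel_measurable lborel"
    by measurable
  ultimately show ?thesis unfolding e by (subst (asm) nn_integral_0_iff_AE) auto
qed

text \<open>The dominating function for the limit of vanishing truncation; \<epsilon> does not occur
  on the right. Its terms stand for the region outside the window, the oscillation of
  \<open>\<Psi> z\<close> inside it, and the variation of the factor \<open>1 / t ^ (k + 1)\<close>
  inside it.\<close>

lemma pv_dominated:
  assumes z: "z \<in> G" and x: "a \<le> x" "0 < a" and \<epsilon>: "0 < \<epsilon>" "\<epsilon> < a / 2"
  shows "ennreal \<bar>pv_trunc (\<lambda>t. \<Psi> z t / t ^ (k + 1)) x \<epsilon>\<bar> \<le>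
      ennreal (C * cmod z powr (- \<alpha>)) * (\<integral>\<^sup>+t. indicator (pv_dom x (a / 2)) t * ennreal (t powr ((\<alpha> - k) - 1) / \<bar>x - t\<bar>) \<partial>lborel)
    + (ennreal (1 / (a / 2) ^ (k + 1)) * osc (a / 2) x z
      + ennreal (real (k + 1) / (a / 2) ^ Suc (k + 1) * (C * x powr \<alpha>)) * ennreal a * ennreal (cmod z powr (- \<alpha>)))"
proof -
  define \<delta> where "\<delta> = a / 2"
  have \<delta>: "0 < \<delta>" "\<epsilon> < \<delta>" "\<delta> < x" using x \<epsilon> by (auto simp: \<delta>_def)
  define f where "f = (\<lambda>t. \<Psi> z t / t ^ (k + 1))"
  define L where "L = real (k + 1) / \<delta> ^ Suc (k + 1)"
  have L: "L \<ge> 0" using \<delta> by (simp add: L_def)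
  have [measurable]: "f \<in> borel_measurable borel" unfolding f_def by measurable
  define g where "g = (\<lambda>s. ennreal (1 / \<delta> ^ (k + 1)) * (indicator {-\<delta>..\<delta>} s * ennreal ((V z (x + \<bar>s\<bar>) - V z (x - \<bar>s\<bar>)) / \<bar>s\<bar>)))"
  have [measurable]: "g \<in> borel_measurable borel" unfolding g_def by measurable
  have "ennreal \<bar>pv_trunc f x \<epsilon>\<bar> \<le> (\<integral>\<^sup>+t. indicator (pv_dom x \<delta>) t * ennreal (\<bar>f t\<bar> / \<bar>x - t\<bar>)
      + indicator {x - \<delta>..x + \<delta>} t * ennreal (\<bar>f t - f x\<bar> / \<bar>x - t\<bar>) \<partial>lborel)"
    unfolding f_def by (rule pv_trunc_bound[OF \<epsilon>(1) \<delta>(2,3)], rule kernel_integrable[OF z]) (use \<epsilon> x in auto)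
  also have "\<dots> \<le> (\<integral>\<^sup>+t. ennreal (C * cmod z powr (- \<alpha>)) * (indicator (pv_dom x \<delta>) t * ennreal (t powr ((\<alpha> - k) - 1) / \<bar>x - t\<bar>))
     + (g (-x + t) + ennreal (L * (C * (x powr \<alpha> * cmod z powr (- \<alpha>)))) * indicator {x - \<delta>..x + \<delta>} t) \<partial>lborel)"
  proof (intro nn_integral_mono add_mono)
    fix t :: real
    show "indicator (pv_dom x \<delta>) t * ennreal (\<bar>f t\<bar> / \<bar>x - t\<bar>) \<le> ennreal (C * cmod z powr (- \<alpha>)) * (indicator (pv_dom x \<delta>) t * ennreal (t powr ((\<alpha> - k) - 1) / \<bar>x - t\<bar>))"
    proof (cases "t \<in> pv_dom x \<delta>")
      case True
      hence "t > 0" by auto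
      from kernel_le[OF z this, of x] True C show ?thesis
        by (simp add: ennreal_mult[symmetric] ennreal_leI f_def)
    qed simp
    show "indicator {x - \<delta>..x + \<delta>} t * ennreal (\<bar>f t - f x\<bar> / \<bar>x - t\<bar>) \<le> g (-x + t) + ennreal (L * (C * (x powr \<alpha> * cmod z powr (- \<alpha>)))) * indicator {x - \<delta>..x + \<delta>} t"
    proof (cases "t \<in> {x - \<delta>..x + \<delta>} \<and> t \<noteq> x")
      case True
      define s where "s = \<bar>t - x\<bar>"
      have s: "s > 0" "s \<le> \<delta>" using True by (auto simp: s_def)
      have t\<delta>: "\<delta> \<le> t" using True x by (auto simp: \<delta>_def)
      have xs: "0 < x - s" using s \<delta> by simp
      have \<Delta>: "\<bar>\<Psi> z t - \<Psi> z x\<bar> \<le> V z (x + s) - V z (x - s)"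
      proof (cases "t \<ge> x")
        case True
        hence e: "t = x + s" by (simp add: s_def)
        show ?thesis using incr[OF z, of x t] V_mono[OF z xs, of x] True s \<delta> unfolding e by simp
      next
        case False
        hence e: "t = x - s" by (simp add: s_def)
        show ?thesis using incr[OF z xs, of x] V_mono[OF z, of x "x + s"] s \<delta> unfolding e
          by (simp add: abs_minus_commute)
      qed
      \<comment> \<open>Product-rule splitting. The increment of \<open>\<Psi> z\<close> is absorbed
        by \<open>osc\<close>; the increment of the reciprocal power is Lipschitz, hence bounded
        after division by \<open>s\<close>.\<close>
      have f: "f t - f x = (\<Psi> z t - \<Psi> z x) / t ^ (k + 1) + \<Psi> z x * (1 / t ^ (k + 1) - 1 / x ^ (k + 1))"
        by (simp add: f_def diff_divide_distrib algebra_simps)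
      have "\<bar>\<Psi> z t - \<Psi> z x\<bar> / t ^ (k + 1) \<le> (V z (x + s) - V z (x - s)) / \<delta> ^ (k + 1)"
        using \<Delta> t\<delta> \<delta> by (intro frac_le power_mono) auto
      moreover have "\<bar>\<Psi> z x\<bar> * \<bar>1 / t ^ (k + 1) - 1 / x ^ (k + 1)\<bar> \<le> V z x * (L * s)"
        unfolding L_def s_def using t\<delta> \<delta> absle[OF z, of x] by (intro mult_mono inverse_power_lipschitz) auto
      moreover have "\<bar>(\<Psi> z t - \<Psi> z x) / t ^ (k + 1)\<bar> = \<bar>\<Psi> z t - \<Psi> z x\<bar> / t ^ (k + 1)"
        using t\<delta> \<delta> by (simp add: abs_divide)
      ultimately have "\<bar>f t - f x\<bar> \<le> (V z (x + s) - V z (x - s)) / \<delta> ^ (k + 1) + V z x * (L * s)"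
        unfolding f using abs_triangle_ineq[of "(\<Psi> z t - \<Psi> z x) / t ^ (k + 1)" "\<Psi> z x * (1 / t ^ (k + 1) - 1 / x ^ (k + 1))"]
        unfolding abs_mult[of "\<Psi> z x"] by linarith
      hence "\<bar>f t - f x\<bar> / s \<le> ((V z (x + s) - V z (x - s)) / \<delta> ^ (k + 1) + V z x * (L * s)) / s"
        using s by (intro divide_right_mono) auto
      also have "\<dots> = 1 / \<delta> ^ (k + 1) * ((V z (x + s) - V z (x - s)) / s) + L * V z x"
        using s by (simp add: add_divide_distrib)
      also have "L * V z x \<le> L * (C * (x powr \<alpha> * cmod z powr (- \<alpha>)))"
        using L \<delta> by (intro mult_left_mono Vle z) auto
      finally have "ennreal (\<bar>f t - f x\<bar> / s) \<le> ennreal (1 / \<delta> ^ (k + 1) * ((V z (x + s) - V z (x - s)) / s) + L * (C * (x powr \<alpha> * cmod z powr (- \<alpha>))))"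
        by (simp add: ennreal_leI)
      also have "\<dots> = ennreal (1 / \<delta> ^ (k + 1)) * ennreal ((V z (x + s) - V z (x - s)) / s) + ennreal (L * (C * (x powr \<alpha> * cmod z powr (- \<alpha>))))"
        using L C \<delta> s \<Delta> by (subst ennreal_plus) (auto simp: ennreal_mult[symmetric] intro!: mult_nonneg_nonneg divide_nonneg_nonneg)
      finally have fin: "ennreal (\<bar>f t - f x\<bar> / s) \<le> \<dots>" .
      have "\<bar>x - t\<bar> = s" "\<bar>- x + t\<bar> = s" "- x + t \<in> {-\<delta>..\<delta>}" using True by (auto simp: s_def)
      thus ?thesis using fin True by (simp add: g_def)
    next
      case False
      thus ?thesis by (auto simp: indicator_def)
    qed
  qed
  also have "\<dots> = (\<integral>\<^sup>+t. ennreal (C * cmod z powr (- \<alpha>)) * (indicator (pv_dom x \<delta>) t * ennreal (t powr ((\<alpha> - k) - 1) / \<bar>x - t\<bar>)) \<partial>lborel)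
     + ((\<integral>\<^sup>+t. g (-x + t) \<partial>lborel) + (\<integral>\<^sup>+t. ennreal (L * (C * (x powr \<alpha> * cmod z powr (- \<alpha>)))) * indicator {x - \<delta>..x + \<delta>} t \<partial>lborel))"
    by (simp add: nn_integral_add)
  also have "(\<integral>\<^sup>+t. ennreal (C * cmod z powr (- \<alpha>)) * (indicator (pv_dom x \<delta>) t * ennreal (t powr ((\<alpha> - k) - 1) / \<bar>x - t\<bar>)) \<partial>lborel)
     = ennreal (C * cmod z powr (- \<alpha>)) * (\<integral>\<^sup>+t. indicator (pv_dom x \<delta>) t * ennreal (t powr ((\<alpha> - k) - 1) / \<bar>x - t\<bar>) \<partial>lborel)"
    by (rule nn_integral_cmult) simp
  also have "(\<integral>\<^sup>+t. g (-x + t) \<partial>lborel) = (\<integral>\<^sup>+t. g t \<partial>lborel)"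
    by (rule nn_integral_shift) simp
  also have "\<dots> = ennreal (1 / \<delta> ^ (k + 1)) * osc \<delta> x z"
    unfolding g_def osc_def by (rule nn_integral_cmult) measurable
  also have "(\<integral>\<^sup>+t. ennreal (L * (C * (x powr \<alpha> * cmod z powr (- \<alpha>)))) * indicator {x - \<delta>..x + \<delta>} t \<partial>lborel) = ennreal (L * (C * (x powr \<alpha> * cmod z powr (- \<alpha>)))) * ennreal (2 * \<delta>)"
    using \<delta> by (simp add: nn_integral_cmult)
  also have "\<dots> = ennreal (L * (C * x powr \<alpha>)) * ennreal a * ennreal (cmod z powr (- \<alpha>))"
    using L C x by (simp add: ennreal_mult[symmetric] \<delta>_def mult_ac)
  finally show ?thesis unfolding f_def \<delta>_def L_def .
qed

text \<open>Dominated convergence in \<open>z\<close> along sequences of truncation radii. The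
  exceptional \<open>x\<close> are the atoms, where the pointwise limit is not assumed, and those
  with an infinite oscillation integral, where no dominating function is at hand.\<close>

theorem pv_AE:
  assumes \<kappa>: "\<And>x z. x > 0 \<Longrightarrow> z \<in> G \<Longrightarrow> z \<noteq> of_real x \<Longrightarrow> (pv_trunc (\<lambda>t. \<Psi> z t / t ^ (k + 1)) x \<longlongrightarrow> \<kappa> x z) (at_right 0)"
    and \<kappa>m [measurable]: "\<And>x. \<kappa> x \<in> borel_measurable borel"
  shows "AE x in lborel. x > 0 \<longrightarrow> emeasure \<nu> {of_real x} = 0 \<and> integrable \<nu> (\<kappa> x) \<and>
    (pv_trunc (\<lambda>t. (\<integral>z. \<Psi> z t \<partial>\<nu>) / t ^ (k + 1)) x \<longlongrightarrow> (\<integral>z. \<kappa> x z \<partial>\<nu>)) (at_right 0)"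
proof -
  \<comment> \<open>Countably many intervals exhaust the positive axis, so countably many null sets
    are discarded. For a given \<open>x\<close> any interval containing it provides a window of
    radius half its left end.\<close>
  define a b where "a = (\<lambda>n::nat. 1 / real (Suc n))" and "b = (\<lambda>n::nat. 1 + real n)"
  have ab: "0 < a n" "a n \<le> b n" for n
  proof -
    show "0 < a n" by (simp add: a_def)
    have "a n \<le> 1" by (simp add: a_def divide_le_eq)
    also have "1 \<le> b n" by (simp add: b_def)
    finally show "a n \<le> b n" .
  qed
  have "AE x in lborel. \<forall>n. x \<in> {a n..b n} \<longrightarrow> (\<integral>\<^sup>+z. osc (a n / 2) x z \<partial>\<nu>) < \<infinity>"
    unfolding AE_all_countable using osc_finite_AE[OF ab] by blast
  with atoms_null show ?thesis
  proof (eventually_elim, intro impI)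
    case (elim x)
    assume x: "x > 0"
    obtain n1 :: nat where n1: "x \<le> real n1" using real_arch_simple by blast
    obtain n2 where n2: "inverse (real (Suc n2)) < x" using reals_Archimedean[OF x] by blast
    define n where "n = max n1 n2"
    have "x \<le> b n" using n1 by (simp add: b_def n_def)
    moreover have "a n \<le> x"
    proof -
      have "a n \<le> inverse (real (Suc n2))" by (simp add: a_def n_def inverse_eq_divide divide_left_mono)
      thus ?thesis using n2 by simp
    qed
    ultimately have xn: "x \<in> {a n..b n}" by simp
    define A where "A = a n"
    have A: "0 < A" "A \<le> x" "(\<integral>\<^sup>+z. osc (A / 2) x z \<partial>\<nu>) < \<infinity>" using elim xn ab by (auto simp: A_def)
    define w where "w = (\<integral>\<^sup>+t. indicator (pv_dom x (A / 2)) t * ennreal (t powr ((\<alpha> - k) - 1) / \<bar>x - t\<bar>) \<partial>lborel)"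
    have w: "w < \<infinity>" unfolding w_def by (rule weight_fin) (use A in auto)
    define c1 c2 where "c1 = ennreal (1 / (A / 2) ^ (k + 1))" and "c2 = ennreal (real (k + 1) / (A / 2) ^ Suc (k + 1) * (C * x powr \<alpha>)) * ennreal A"
    define W where "W = (\<lambda>z. ennreal (C * cmod z powr (- \<alpha>)) * w + (c1 * osc (A / 2) x z + c2 * ennreal (cmod z powr (- \<alpha>))))"
    have o [measurable]: "osc (A / 2) x \<in> borel_measurable \<nu>"
      using measurable_compose_Pair1[OF _ osc_borel, of x] by simp
    have Wm [measurable]: "W \<in> borel_measurable \<nu>" unfolding W_def by measurable
    have "(\<integral>\<^sup>+z. W z \<partial>\<nu>) = (\<integral>\<^sup>+z. ennreal (C * cmod z powr (- \<alpha>)) * w \<partial>\<nu>) + ((\<integral>\<^sup>+z. c1 * osc (A / 2) x z \<partial>\<nu>) + (\<integral>\<^sup>+z. c2 * ennreal (cmod z powr (- \<alpha>)) \<partial>\<nu>))"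
      unfolding W_def by (simp add: nn_integral_add)
    also have "(\<integral>\<^sup>+z. ennreal (C * cmod z powr (- \<alpha>)) * w \<partial>\<nu>) = (\<integral>\<^sup>+z. ennreal C * ennreal (cmod z powr (- \<alpha>)) \<partial>\<nu>) * w"
      using C by (subst nn_integral_multc) (auto simp: ennreal_mult)
    also have "(\<integral>\<^sup>+z. ennreal C * ennreal (cmod z powr (- \<alpha>)) \<partial>\<nu>) = ennreal C * (\<integral>\<^sup>+z. ennreal (cmod z powr (- \<alpha>)) \<partial>\<nu>)"
      by (rule nn_integral_cmult) measurable
    also have "(\<integral>\<^sup>+z. c1 * osc (A / 2) x z \<partial>\<nu>) = c1 * (\<integral>\<^sup>+z. osc (A / 2) x z \<partial>\<nu>)"
      by (rule nn_integral_cmult) measurable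
    also have "(\<integral>\<^sup>+z. c2 * ennreal (cmod z powr (- \<alpha>)) \<partial>\<nu>) = c2 * (\<integral>\<^sup>+z. ennreal (cmod z powr (- \<alpha>)) \<partial>\<nu>)"
      by (rule nn_integral_cmult) measurable
    also have "ennreal C * (\<integral>\<^sup>+z. ennreal (cmod z powr (- \<alpha>)) \<partial>\<nu>) * w + (c1 * (\<integral>\<^sup>+z. osc (A / 2) x z \<partial>\<nu>) + c2 * (\<integral>\<^sup>+z. ennreal (cmod z powr (- \<alpha>)) \<partial>\<nu>)) < \<infinity>"
      using fin w A(3) by (auto simp: ennreal_mult_less_top c1_def c2_def)
    finally have Wfin: "(\<integral>\<^sup>+z. W z \<partial>\<nu>) < \<infinity>" .
    have WAE: "AE z in \<nu>. W z \<noteq> \<infinity>" by (rule nn_integral_PInf_AE[OF Wm]) (use Wfin in simp)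
    have aeq: "AE z in \<nu>. z \<noteq> of_real x"
      by (rule AE_I'[of "{of_real x}"]) (use elim sets_nu in \<open>auto simp: null_sets_def\<close>)
    have dom: "integrable \<nu> (\<kappa> x) \<and> (\<lambda>n. \<integral>z. pv_trunc (\<lambda>t. \<Psi> z t / t ^ (k + 1)) x (S n) \<partial>\<nu>) \<longlonglongrightarrow> (\<integral>z. \<kappa> x z \<partial>\<nu>)"
      if S: "\<And>n. 0 < S n" "\<And>n. S n < A / 2" "S \<longlonglongrightarrow> 0" for S
    proof -
      have 1: "\<kappa> x \<in> borel_measurable \<nu>" by measurable
      have 2: "(\<lambda>z. pv_trunc (\<lambda>t. \<Psi> z t / t ^ (k + 1)) x (S n)) \<in> borel_measurable \<nu>" for n
        unfolding pv_trunc_eq by measurable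
      have 3: "integrable \<nu> (\<lambda>z. enn2real (W z))" by (rule integral_enn2real[OF Wm Wfin])
      have 4: "AE z in \<nu>. (\<lambda>n. pv_trunc (\<lambda>t. \<Psi> z t / t ^ (k + 1)) x (S n)) \<longlonglongrightarrow> \<kappa> x z"
        using aeq G
      proof eventually_elim
        case (elim z)
        have "filterlim S (at_right 0) sequentially"
          unfolding filterlim_at using S(3) S(1) by (auto intro!: always_eventually simp: less_imp_neq[symmetric])
        thus ?case by (rule filterlim_compose[OF \<kappa>[OF x elim(2,1)]])
      qed
      have 5: "AE z in \<nu>. norm (pv_trunc (\<lambda>t. \<Psi> z t / t ^ (k + 1)) x (S n)) \<le> enn2real (W z)" for n
        using WAE G
      proof eventually_elim
        case (elim z)
        have "ennreal \<bar>pv_trunc (\<lambda>t. \<Psi> z t / t ^ (k + 1)) x (S n)\<bar> \<le> W z"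
          unfolding W_def w_def c1_def c2_def using pv_dominated[OF elim(2) A(2,1) S(1,2)[of n]] by simp
        hence "enn2real (ennreal \<bar>pv_trunc (\<lambda>t. \<Psi> z t / t ^ (k + 1)) x (S n)\<bar>) \<le> enn2real (W z)"
          using elim(1) by (intro enn2real_mono) (auto simp: less_top)
        thus ?case by simp
      qed
      show ?thesis using integrable_dominated_convergence[OF 1 2 3 4 5] integral_dominated_convergence[OF 1 2 3 4 5] by blast
    qed
    have "integrable \<nu> (\<kappa> x)"
    proof -
      define S where "S = (\<lambda>n. A / 3 / real (Suc n))"
      have "S \<longlonglongrightarrow> 0" unfolding S_def by (rule LIMSEQ_Suc, rule lim_const_over_n)
      moreover have "0 < S n" "S n < A / 2" for n
      proof -
        show "0 < S n" using A by (simp add: S_def)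
        have "S n \<le> A / 3 / 1" unfolding S_def using A by (intro divide_left_mono) auto
        thus "S n < A / 2" using A by simp
      qed
      ultimately show ?thesis using dom[of S] by blast
    qed
    moreover have "(pv_trunc (\<lambda>t. (\<integral>z. \<Psi> z t \<partial>\<nu>) / t ^ (k + 1)) x \<longlongrightarrow> (\<integral>z. \<kappa> x z \<partial>\<nu>)) (at_right 0)"
    proof (rule tendsto_at_right_sequentially[of 0 "A / 2"])
      show "0 < A / 2" using A by simp
      fix S :: "nat \<Rightarrow> real" assume S: "\<And>n. 0 < S n" "\<And>n. S n < A / 2" "S \<longlonglongrightarrow> 0"
      have "pv_trunc (\<lambda>t. (\<integral>z. \<Psi> z t \<partial>\<nu>) / t ^ (k + 1)) x (S n) = (\<integral>z. pv_trunc (\<lambda>t. \<Psi> z t / t ^ (k + 1)) x (S n) \<partial>\<nu>)" for n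
        by (rule pv_trunc_Fubini) (use S(1)[of n] S(2)[of n] A in linarith)+
      thus "(\<lambda>n. pv_trunc (\<lambda>t. (\<integral>z. \<Psi> z t \<partial>\<nu>) / t ^ (k + 1)) x (S n)) \<longlonglongrightarrow> (\<integral>z. \<kappa> x z \<partial>\<nu>)"
        using dom[OF S] by simp
    qed
    ultimately show "emeasure \<nu> {of_real x} = 0 \<and> integrable \<nu> (\<kappa> x) \<and>
      (pv_trunc (\<lambda>t. (\<integral>z. \<Psi> z t \<partial>\<nu>) / t ^ (k + 1)) x \<longlongrightarrow> (\<integral>z. \<kappa> x z \<partial>\<nu>)) (at_right 0)"
      using elim by blast
  qed
qed

end

section \<open>The balayage kernel\<close>

lemma Rplus_iff: "z \<in> Rplus \<longleftrightarrow> Im z = 0 \<and> Re z \<ge> 0"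
  by (auto simp: Rplus_def image_iff complex_eq_iff)

lemma Rplus_borel [measurable]: "Rplus \<in> sets borel"
proof -
  have "Rplus = {z. Im z = 0 \<and> Re z \<ge> 0}" using Rplus_iff by blast
  also have "\<dots> \<in> sets borel" by measurable
  finally show ?thesis .
qed

lemma sqrt_cut_sq: "(sqrt_cut z)\<^sup>2 = z"
  by (simp add: sqrt_cut_def power_mult_distrib)

lemma sqrt_cut_Im: "z \<notin> Rplus \<Longrightarrow> Im (sqrt_cut z) > 0"
proof -
  assume z: "z \<notin> Rplus"
  have "Re (csqrt (- z)) > 0"
  proof (rule ccontr)
    assume "\<not> Re (csqrt (- z)) > 0"
    hence "Re (csqrt (- z)) = 0" using Re_csqrt[of "- z"] by linarith
    hence "- z = - of_real ((Im (csqrt (- z)))\<^sup>2)"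
      using power2_csqrt[of "- z"] by (auto simp: complex_eq_iff power2_eq_square)
    hence "z = of_real ((Im (csqrt (- z)))\<^sup>2)" by simp
    thus False using z by (metis Rplus_iff Im_complex_of_real Re_complex_of_real zero_le_power2)
  qed
  thus ?thesis by (simp add: sqrt_cut_def)
qed

lemma sqrt_cut_norm: "(cmod (sqrt_cut z))\<^sup>2 = cmod z"
  using sqrt_cut_sq[of z] by (metis norm_power)

lemma sqrt_cut_borel [measurable]: "sqrt_cut \<in> borel_measurable borel"
proof -
  have "csqrt = (\<lambda>z. Complex (sqrt ((cmod z + Re z) / 2)) ((if Im z = 0 then 1 else sgn (Im z)) * sqrt ((cmod z - Re z) / 2)))"
    by (rule ext) (rule csqrt.code)
  moreover have "(\<lambda>z. Complex (sqrt ((cmod z + Re z) / 2)) ((if Im z = 0 then 1 else sgn (Im z)) * sqrt ((cmod z - Re z) / 2))) \<in> borel_measurable borel"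
    unfolding Complex_eq sgn_real_def by measurable
  ultimately have [measurable]: "csqrt \<in> borel_measurable borel" by simp
  show ?thesis unfolding sqrt_cut_def[abs_def] by measurable
qed

text \<open>The sum of the two integrands of \<open>Omega\<close>: with
  \<open>w = sqrt_cut z\<close>, adding \<open>1 / (\<tau> - w)\<close> to the genus correction
  collapses to this one fraction.\<close>

definition gq :: "nat \<Rightarrow> complex \<Rightarrow> real \<Rightarrow> complex" where
  "gq q z \<tau> = of_real \<tau> ^ q / (sqrt_cut z ^ q * (of_real \<tau> - sqrt_cut z))"

text \<open>The distribution function on the ray of the balayage of the unit mass at
  \<open>z\<close>; a mass already on the ray stays in place. \<open>psiV\<close> uses the total
  variation of the same kernel.\<close>

definition psi :: "nat \<Rightarrow> complex \<Rightarrow> real \<Rightarrow> real" where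
  "psi q z t = (if z \<in> Rplus then indicator {Re z..} t
     else 1 / pi * (\<integral>\<tau>. indicator {- sqrt t..sqrt t} \<tau> * Im (gq q z \<tau>) \<partial>lborel))"

definition psiV :: "nat \<Rightarrow> complex \<Rightarrow> real \<Rightarrow> real" where
  "psiV q z t = (if z \<in> Rplus then indicator {Re z..} t
     else 1 / pi * (\<integral>\<tau>. indicator {- sqrt t..sqrt t} \<tau> * \<bar>Im (gq q z \<tau>)\<bar> \<partial>lborel))"

lemma gq_borel [measurable]: "(\<lambda>x. gq q (f x) (g x)) \<in> borel_measurable M"
  if [measurable]: "f \<in> borel_measurable M" "g \<in> borel_measurable M"
  unfolding gq_def by measurable

lemma psi_meas:
  "(\<lambda>(z, t). psi q z t) \<in> borel_measurable (borel \<Otimes>\<^sub>M borel)"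
  "(\<lambda>(z, t). psiV q z t) \<in> borel_measurable (borel \<Otimes>\<^sub>M borel)"
proof -
  have [measurable]: "(\<lambda>x. indicat_real {- sqrt (snd (fst x))..sqrt (snd (fst x))} (snd x)) \<in> borel_measurable ((borel \<Otimes>\<^sub>M borel) \<Otimes>\<^sub>M lborel)"
    "(\<lambda>x. indicat_real {Re (fst x)..} (snd x)) \<in> borel_measurable (borel \<Otimes>\<^sub>M borel)"
    unfolding indicator_def atLeastAtMost_iff atLeast_iff by measurable
  show "(\<lambda>(z, t). psi q z t) \<in> borel_measurable (borel \<Otimes>\<^sub>M borel)"
    "(\<lambda>(z, t). psiV q z t) \<in> borel_measurable (borel \<Otimes>\<^sub>M borel)"
    unfolding psi_def psiV_def split_def by measurable
qed

lemma sub_ne: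
  assumes "z \<notin> Rplus" shows "of_real \<tau> - sqrt_cut z \<noteq> 0" "sqrt_cut z \<noteq> 0" "of_real \<tau> + sqrt_cut z \<noteq> 0"
  using sqrt_cut_Im[OF assms] by (auto simp: complex_eq_iff)

lemma gq_cont: "z \<notin> Rplus \<Longrightarrow> continuous_on A (gq q z)"
  unfolding gq_def using sub_ne by (intro continuous_intros) auto

lemma Icc_integrable:
  fixes g :: "real \<Rightarrow> real"
  assumes "continuous_on UNIV g"
  shows "integrable lborel (\<lambda>t. indicator {a..b} t * g t)"
  using borel_integrable_atLeastAtMost'[of a b g] continuous_on_subset[OF assms]
  by (auto simp: set_integrable_def)

text \<open>Separates the Cauchy kernel, whose imaginary part is a nonnegative Poisson kernel of
  total mass at most \<open>pi\<close>, from a correction that is polynomial in \<tau>.\<close>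

lemma gq_split:
  assumes "z \<notin> Rplus"
  shows "gq q z \<tau> = 1 / (of_real \<tau> - sqrt_cut z) + (\<Sum>i=1..q. of_real \<tau> ^ (i - 1) * (1 / sqrt_cut z ^ i))"
proof -
  have "sqrt_cut z \<noteq> of_real \<tau>" using sub_ne(1)[OF assms, of \<tau>] by auto
  from geometric_remainder[OF sub_ne(2)[OF assms] this, of q]
  have "gq q z \<tau> = - (1 / (sqrt_cut z - of_real \<tau>)) + (\<Sum>i=1..q. of_real \<tau> ^ (i - 1) * (1 / sqrt_cut z ^ i))"
    by (simp add: gq_def)
  also have "- (1 / (sqrt_cut z - of_real \<tau>)) = 1 / (of_real \<tau> - sqrt_cut z)"
    by (metis minus_diff_eq divide_minus_right)
  finally show ?thesis .
qed

lemma Omega_eq_psi: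
  assumes z: "z \<notin> Rplus" and t: "t \<ge> 0"
  shows "Omega q z (complex_of_real ` {0..t}) = psi q z t"
proof -
  define w where "w = sqrt_cut z"
  have "sqrt_set (complex_of_real ` {0..t}) = {- sqrt t..sqrt t}"
  proof (intro set_eqI iffI)
    fix s assume "s \<in> {- sqrt t..sqrt t}"
    hence "\<bar>s\<bar> \<le> sqrt t" by auto
    hence s2: "s\<^sup>2 \<le> t" using t by (metis real_sqrt_abs real_sqrt_le_iff)
    show "s \<in> sqrt_set (complex_of_real ` {0..t})"
      unfolding sqrt_set_def using s2 by (auto intro!: exI[of _ "s\<^sup>2"] simp: abs_real_def)
  qed (auto simp: sqrt_set_def intro: order_trans[of _ 0])
  hence "Omega q z (complex_of_real ` {0..t}) =
     1 / pi * (\<integral>\<tau>. indicator {- sqrt t..sqrt t} \<tau> * Im (1 / (of_real \<tau> - w)) \<partial>lborel) +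
     1 / pi * (\<integral>\<tau>. indicator {- sqrt t..sqrt t} \<tau> * Im ((of_real \<tau> ^ q - w ^ q) / (w ^ q * (of_real \<tau> - w))) \<partial>lborel)"
    by (simp add: Omega_def Let_def w_def set_lebesgue_integral_def)
  also have "\<dots> = 1 / pi * (\<integral>\<tau>. indicator {- sqrt t..sqrt t} \<tau> * Im (1 / (of_real \<tau> - w)) +
     indicator {- sqrt t..sqrt t} \<tau> * Im ((of_real \<tau> ^ q - w ^ q) / (w ^ q * (of_real \<tau> - w))) \<partial>lborel)"
    using sub_ne[OF z] unfolding w_def
    by (subst Bochner_Integration.integral_add) (auto intro!: Icc_integrable continuous_intros simp: distrib_left)
  also have "\<dots> = psi q z t"
  proof -
    have "1 / (of_real \<tau> - w) + (of_real \<tau> ^ q - w ^ q) / (w ^ q * (of_real \<tau> - w)) = gq q z \<tau>" for \<tau>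
    proof -
      have alg: "1 / a + (N - W) / (W * a) = N / (W * a)" if "a \<noteq> 0" "W \<noteq> 0" for a N W :: complex
        using that by (simp add: diff_divide_distrib)
      show ?thesis unfolding gq_def w_def by (rule alg) (use sub_ne[OF z] in auto)
    qed
    hence "Im (1 / (of_real \<tau> - w)) + Im ((of_real \<tau> ^ q - w ^ q) / (w ^ q * (of_real \<tau> - w))) = Im (gq q z \<tau>)" for \<tau>
      by (metis plus_complex.sel(2))
    thus ?thesis using z by (simp add: psi_def distrib_left[symmetric])
  qed
  finally show ?thesis .
qed

lemma psi_incr:
  assumes "0 < s" "s \<le> t"
  shows "\<bar>psi q z t - psi q z s\<bar> \<le> psiV q z t - psiV q z s"
proof (cases "z \<in> Rplus")
  case True
  thus ?thesis using assms by (auto simp: psi_def psiV_def indicator_def)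
next
  case False
  let ?I = "\<lambda>t \<tau>. indicator {- sqrt t..sqrt t} \<tau> :: real"
  have i: "integrable lborel (\<lambda>\<tau>. ?I t \<tau> * Im (gq q z \<tau>))" "integrable lborel (\<lambda>\<tau>. ?I t \<tau> * \<bar>Im (gq q z \<tau>)\<bar>)" for t
    by (rule Icc_integrable, intro continuous_intros gq_cont False)+
  have "psi q z t - psi q z s = 1 / pi * (\<integral>\<tau>. ?I t \<tau> * Im (gq q z \<tau>) - ?I s \<tau> * Im (gq q z \<tau>) \<partial>lborel)"
    using False i by (simp add: psi_def right_diff_distrib)
  moreover have "psiV q z t - psiV q z s = 1 / pi * (\<integral>\<tau>. ?I t \<tau> * \<bar>Im (gq q z \<tau>)\<bar> - ?I s \<tau> * \<bar>Im (gq q z \<tau>)\<bar> \<partial>lborel)"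
    using False i by (simp add: psiV_def right_diff_distrib)
  moreover have "\<bar>\<integral>\<tau>. ?I t \<tau> * Im (gq q z \<tau>) - ?I s \<tau> * Im (gq q z \<tau>) \<partial>lborel\<bar> \<le> (\<integral>\<tau>. ?I t \<tau> * \<bar>Im (gq q z \<tau>)\<bar> - ?I s \<tau> * \<bar>Im (gq q z \<tau>)\<bar> \<partial>lborel)"
  proof (rule order_trans[OF integral_abs_bound], rule integral_mono)
    have st: "sqrt s \<le> sqrt t" using assms by simp
    fix \<tau> :: real
    show "\<bar>?I t \<tau> * Im (gq q z \<tau>) - ?I s \<tau> * Im (gq q z \<tau>)\<bar> \<le> ?I t \<tau> * \<bar>Im (gq q z \<tau>)\<bar> - ?I s \<tau> * \<bar>Im (gq q z \<tau>)\<bar>"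
      using st by (auto simp: indicator_def simp del: real_sqrt_le_iff)
  qed (use i in auto)
  ultimately show ?thesis by (simp add: abs_mult divide_right_mono)
qed

lemma psi_abs: "\<bar>psi q z t\<bar> \<le> psiV q z t"
proof (cases "z \<in> Rplus")
  case False
  have "\<bar>\<integral>\<tau>. indicator {- sqrt t..sqrt t} \<tau> * Im (gq q z \<tau>) \<partial>lborel\<bar> \<le> (\<integral>\<tau>. \<bar>indicator {- sqrt t..sqrt t} \<tau> * Im (gq q z \<tau>)\<bar> \<partial>lborel)"
    by (rule integral_abs_bound)
  thus ?thesis using False by (simp add: psi_def psiV_def abs_mult divide_right_mono)
qed (simp add: psi_def psiV_def)

lemma poisson_le_pi:
  assumes w: "Im w > 0" and T: "T \<ge> 0"
  shows "(\<integral>\<tau>. indicator {- T..T} \<tau> * Im (1 / (of_real \<tau> - w)) \<partial>lborel) \<le> pi"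
proof -
  define F where "F = (\<lambda>\<tau>. arctan ((\<tau> - Re w) / Im w))"
  have "(\<integral>\<tau>. indicator {- T..T} \<tau> *\<^sub>R Im (1 / (of_real \<tau> - w)) \<partial>lborel) = F T - F (- T)"
  proof (rule integral_FTC_atLeastAtMost)
    show "- T \<le> T" using T by simp
    have ne: "of_real \<tau> - w \<noteq> 0" for \<tau> using w by (auto simp: complex_eq_iff)
    show "continuous_on {- T..T} (\<lambda>\<tau>. Im (1 / (of_real \<tau> - w)))"
      by (intro continuous_intros) (use ne in auto)
    fix \<tau> :: real
    have "(F has_real_derivative (1 / Im w) / (1 + ((\<tau> - Re w) / Im w)\<^sup>2)) (at \<tau>)"
      unfolding F_def using w by (auto intro!: derivative_eq_intros simp: divide_simps)
    moreover have "(1 / Im w) / (1 + ((\<tau> - Re w) / Im w)\<^sup>2) = Im (1 / (of_real \<tau> - w))"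
    proof -
      have p: "(\<tau> - Re w)\<^sup>2 + (Im w)\<^sup>2 > 0" using w by (simp add: add_nonneg_pos)
      have "Im (1 / (of_real \<tau> - w)) = Im w / ((\<tau> - Re w)\<^sup>2 + (Im w)\<^sup>2)"
        by (simp add: Im_divide)
      thus ?thesis using w p by (simp add: divide_simps power2_eq_square add.commute)
    qed
    ultimately show "(F has_vector_derivative Im (1 / (of_real \<tau> - w))) (at \<tau> within {- T..T})"
      by (simp add: has_real_derivative_iff_has_vector_derivative has_vector_derivative_at_within)
  qed
  also have "\<dots> \<le> pi / 2 - (- (pi / 2))"
    unfolding F_def using arctan_ubound[of "(T - Re w) / Im w"] arctan_lbound[of "(- T - Re w) / Im w"] by linarith
  finally show ?thesis by simp
qed

text \<open>By homogeneity everything depends on \<rho>, the square root of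
  \<open>t / cmod z\<close>. Up to \<open>\<rho> = 1 / 2\<close> the kernel has size
  \<open>\<rho> ^ (q + 1)\<close>, beyond that it grows no faster than \<open>\<rho> ^ q\<close>,
  and \<open>2 * \<alpha>\<close> lies between these two exponents.\<close>

lemma psiV_le:
  assumes z: "z \<noteq> 0" and t: "t > 0" and \<alpha>: "real q \<le> 2 * \<alpha>" "2 * \<alpha> \<le> real q + 1"
  shows "psiV q z t \<le> (2 + real q) * 4 powr \<alpha> * (t powr \<alpha> * cmod z powr (- \<alpha>))"
proof -
  define \<rho> where "\<rho> = sqrt t / sqrt (cmod z)"
  have \<rho>: "\<rho> > 0" using z t by (simp add: \<rho>_def)
  have eq: "t powr \<alpha> * cmod z powr (- \<alpha>) = \<rho> powr (2 * \<alpha>)"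
  proof -
    have "\<rho> powr (2 * \<alpha>) = (\<rho> powr 2) powr \<alpha>" by (simp add: powr_powr)
    also have "\<rho> powr 2 = t / cmod z" using \<rho> t z by (simp add: \<rho>_def power_divide)
    finally show ?thesis using t z by (simp add: powr_divide powr_minus_divide)
  qed
  have \<alpha>0: "\<alpha> \<ge> 0" using \<alpha> by linarith
  have four: "(4::real) powr \<alpha> = 2 powr (2 * \<alpha>)" using powr_powr[of 2 2 \<alpha>] by simp
  have four1: "1 \<le> (4::real) powr \<alpha>" using \<alpha>0 by (simp add: ge_one_powr_ge_zero)
  show ?thesis
  proof (cases "z \<in> Rplus")
    case True
    show ?thesis
    proof (cases "Re z \<le> t")
      case rt: True
      have "cmod z = Re z" using True by (simp add: Rplus_iff cmod_eq_Re)
      hence "sqrt (cmod z) \<le> sqrt t" using rt by simp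
      moreover have "sqrt (cmod z) > 0" using z by simp
      ultimately have "1 \<le> \<rho>" unfolding \<rho>_def using le_divide_eq_1_pos by blast
      hence "1 \<le> \<rho> powr (2 * \<alpha>)" using \<alpha>0 by (simp add: ge_one_powr_ge_zero)
      hence "1 * 1 * 1 \<le> (2 + real q) * 4 powr \<alpha> * \<rho> powr (2 * \<alpha>)"
        using four1 by (intro mult_mono) auto
      thus ?thesis using True rt by (simp add: psiV_def eq)
    qed (use True in \<open>simp add: psiV_def eq\<close>)
  next
    case False
    define w where "w = sqrt_cut z"
    define T r where "T = sqrt t" and "r = cmod w"
    have r: "r > 0" using sub_ne(2)[OF False] by (simp add: r_def w_def)
    have T: "T > 0" using t by (simp add: T_def)
    have "r = sqrt (cmod z)" using sqrt_cut_norm[of z] r by (simp add: r_def w_def real_sqrt_unique)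
    hence \<rho>': "\<rho> = T / r" by (simp add: \<rho>_def T_def)
    have int: "integrable lborel (\<lambda>\<tau>. indicator {- T..T} \<tau> * \<bar>Im (gq q z \<tau>)\<bar>)"
      by (intro Icc_integrable continuous_intros gq_cont False)
    have V: "psiV q z t = 1 / pi * (\<integral>\<tau>. indicator {- T..T} \<tau> * \<bar>Im (gq q z \<tau>)\<bar> \<partial>lborel)"
      using False by (simp add: psiV_def T_def)
    have ci: "integrable lborel (\<lambda>\<tau>. indicator {- T..T} \<tau> * c)" "(\<integral>\<tau>. indicator {- T..T} \<tau> * c \<partial>lborel) = 2 * T * c" for c :: real
      using T by (auto intro!: Icc_integrable)
    show ?thesis
    proof (cases "2 * T \<le> r")
      case small: True
      have "\<bar>Im (gq q z \<tau>)\<bar> \<le> T ^ q / (r ^ q * (r / 2))" if "\<tau> \<in> {- T..T}" for \<tau>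
      proof -
        have \<tau>: "\<bar>\<tau>\<bar> \<le> T" using that by auto
        have "\<bar>Im (gq q z \<tau>)\<bar> \<le> cmod (gq q z \<tau>)" by (rule abs_Im_le_cmod)
        also have "\<dots> = \<bar>\<tau>\<bar> ^ q / (r ^ q * cmod (of_real \<tau> - w))"
          by (simp add: gq_def norm_divide norm_mult norm_power r_def w_def)
        also have "\<dots> \<le> T ^ q / (r ^ q * (r / 2))"
        proof (intro frac_le mult_left_mono power_mono)
          show "r / 2 \<le> cmod (of_real \<tau> - w)"
            using norm_triangle_ineq2[of w "of_real \<tau>"] \<tau> small by (simp add: r_def norm_minus_commute)
        qed (use r \<tau> T in auto)
        finally show ?thesis .
      qed
      hence "(\<integral>\<tau>. indicator {- T..T} \<tau> * \<bar>Im (gq q z \<tau>)\<bar> \<partial>lborel) \<le> (\<integral>\<tau>. indicator {- T..T} \<tau> * (T ^ q / (r ^ q * (r / 2))) \<partial>lborel)"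
        by (intro integral_mono int ci) (auto simp: indicator_def)
      also have "\<dots> = 4 * \<rho> ^ Suc q" unfolding ci(2) \<rho>' using r by (simp add: power_divide)
      finally have "psiV q z t \<le> 1 / pi * (4 * \<rho> ^ Suc q)" unfolding V by (intro mult_left_mono) auto
      also have "\<dots> \<le> 2 * \<rho> ^ Suc q" using pi_gt3 \<rho> by (simp add: divide_le_eq)
      also have "\<rho> ^ Suc q = \<rho> powr (real q + 1)" using \<rho> by (simp only: powr_realpow[symmetric]) (simp add: add.commute)
      also have "\<dots> \<le> \<rho> powr (2 * \<alpha>)"
        using \<alpha> \<rho> small r by (intro powr_mono') (auto simp: \<rho>' divide_le_eq)
      finally have "psiV q z t \<le> 2 * \<rho> powr (2 * \<alpha>)" by simp
      also have "\<dots> \<le> ((2 + real q) * 4 powr \<alpha>) * \<rho> powr (2 * \<alpha>)"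
      proof (rule mult_right_mono)
        have "2 * 1 \<le> (2 + real q) * 4 powr \<alpha>" using four1 by (intro mult_mono) auto
        thus "2 \<le> (2 + real q) * 4 powr \<alpha>" by simp
      qed simp
      finally show ?thesis by (simp add: eq)
    next
      case False2: False
      \<comment> \<open>Powers of \<open>2 * \<rho>\<close>, unlike those of \<rho>, are now
        nondecreasing in the exponent. Passing to this base is the origin of the factor
        \<open>4 powr \<alpha>\<close>.\<close>
      hence \<rho>2: "1 \<le> 2 * \<rho>" using r by (simp add: \<rho>' le_divide_eq)
      have "\<bar>Im (gq q z \<tau>)\<bar> \<le> Im (1 / (of_real \<tau> - w)) + (\<Sum>i=1..q. T ^ (i - 1) / r ^ i)" if "\<tau> \<in> {- T..T}" for \<tau>
      proof -
        have \<tau>: "\<bar>\<tau>\<bar> \<le> T" using that by auto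
        have pos: "Im (1 / (of_real \<tau> - w)) \<ge> 0"
          using sqrt_cut_Im[OF False] by (simp add: Im_divide w_def)
        have "\<bar>Im (\<Sum>i=1..q. of_real \<tau> ^ (i - 1) * (1 / w ^ i))\<bar> \<le> cmod (\<Sum>i=1..q. of_real \<tau> ^ (i - 1) * (1 / w ^ i))"
          by (rule abs_Im_le_cmod)
        also have "\<dots> \<le> (\<Sum>i=1..q. T ^ (i - 1) / r ^ i)"
        proof (rule sum_norm_le)
          fix i
          have "cmod (of_real \<tau> ^ (i - 1) * (1 / w ^ i)) = \<bar>\<tau>\<bar> ^ (i - 1) / r ^ i"
            by (simp add: norm_mult norm_divide norm_power r_def)
          also have "\<dots> \<le> T ^ (i - 1) / r ^ i" using \<tau> r by (intro divide_right_mono power_mono) auto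
          finally show "cmod (of_real \<tau> ^ (i - 1) * (1 / w ^ i)) \<le> T ^ (i - 1) / r ^ i" .
        qed
        finally show ?thesis unfolding gq_split[OF False] w_def[symmetric] plus_complex.sel using pos by linarith
      qed
      hence "(\<integral>\<tau>. indicator {- T..T} \<tau> * \<bar>Im (gq q z \<tau>)\<bar> \<partial>lborel) \<le>
         (\<integral>\<tau>. indicator {- T..T} \<tau> * Im (1 / (of_real \<tau> - w)) + indicator {- T..T} \<tau> * (\<Sum>i=1..q. T ^ (i - 1) / r ^ i) \<partial>lborel)"
        using sub_ne[OF False] unfolding w_def
        by (intro integral_mono int Bochner_Integration.integrable_add ci Icc_integrable continuous_intros) (auto simp: indicator_def)
      also have "\<dots> = (\<integral>\<tau>. indicator {- T..T} \<tau> * Im (1 / (of_real \<tau> - w)) \<partial>lborel) + 2 * T * (\<Sum>i=1..q. T ^ (i - 1) / r ^ i)"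
        using sub_ne[OF False] unfolding w_def ci(2)[symmetric]
        by (intro Bochner_Integration.integral_add ci Icc_integrable continuous_intros) auto
      also have "\<dots> \<le> pi + 2 * (real q * (2 * \<rho>) ^ q)"
      proof (rule add_mono)
        show "(\<integral>\<tau>. indicator {- T..T} \<tau> * Im (1 / (of_real \<tau> - w)) \<partial>lborel) \<le> pi"
          using poisson_le_pi[of w T] sqrt_cut_Im[OF False] T by (simp add: w_def)
        have "T * (\<Sum>i=1..q. T ^ (i - 1) / r ^ i) = (\<Sum>i=1..q. \<rho> ^ i)"
          unfolding sum_distrib_left
        proof (rule sum.cong[OF refl])
          fix i assume "i \<in> {1..q}"
          hence "T ^ i = T * T ^ (i - 1)" by (cases i) auto
          thus "T * (T ^ (i - 1) / r ^ i) = \<rho> ^ i" by (simp add: \<rho>' power_divide)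
        qed
        also have "\<dots> \<le> (\<Sum>i=1..q. (2 * \<rho>) ^ q)"
        proof (rule sum_mono)
          fix i assume i: "i \<in> {1..q}"
          have "\<rho> ^ i \<le> (2 * \<rho>) ^ i" using \<rho> by (intro power_mono) auto
          also have "\<dots> \<le> (2 * \<rho>) ^ q" using \<rho>2 i by (intro power_increasing) auto
          finally show "\<rho> ^ i \<le> (2 * \<rho>) ^ q" .
        qed
        finally show "2 * T * (\<Sum>i=1..q. T ^ (i - 1) / r ^ i) \<le> 2 * (real q * (2 * \<rho>) ^ q)" by simp
      qed
      finally have "psiV q z t \<le> 1 / pi * (pi + 2 * (real q * (2 * \<rho>) ^ q))" unfolding V by (intro mult_left_mono) auto
      also have "\<dots> = 1 + (2 / pi) * (real q * (2 * \<rho>) ^ q)" by (simp add: distrib_left)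
      also have "(2 / pi) * (real q * (2 * \<rho>) ^ q) \<le> 1 * (real q * (2 * \<rho>) ^ q)"
        using pi_gt3 \<rho> by (intro mult_right_mono) auto
      also have "1 + 1 * (real q * (2 * \<rho>) ^ q) \<le> (2 + real q) * (2 * \<rho>) ^ q"
        using one_le_power[OF \<rho>2, of q] by (simp add: distrib_right)
      also have "(2 * \<rho>) ^ q = (2 * \<rho>) powr (real q)" using \<rho> by (simp add: powr_realpow)
      also have "(2 + real q) * (2 * \<rho>) powr (real q) \<le> (2 + real q) * (2 * \<rho>) powr (2 * \<alpha>)"
        using \<alpha> \<rho>2 by (intro mult_left_mono powr_mono) auto
      also have "(2 * \<rho>) powr (2 * \<alpha>) = 4 powr \<alpha> * \<rho> powr (2 * \<alpha>)" using \<rho> by (simp add: powr_mult four)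
      finally show ?thesis by (simp add: eq)
    qed
  qed
qed

section \<open>Principal values of the balayage kernel\<close>

lemma FTC_Ioo:
  fixes f F :: "real \<Rightarrow> 'a::euclidean_space"
  assumes "a < b" "\<And>t. a < t \<Longrightarrow> t < b \<Longrightarrow> (F has_vector_derivative f t) (at t)"
    "\<And>t. a < t \<Longrightarrow> t < b \<Longrightarrow> isCont f t" "integrable lborel (\<lambda>t. indicator {a<..<b} t *\<^sub>R f t)"
    "(F \<longlongrightarrow> A) (at_right a)" "(F \<longlongrightarrow> B) (at_left b)"
  shows "(\<integral>t. indicator {a<..<b} t *\<^sub>R f t \<partial>lborel) = B - A"
proof -
  have "(LBINT t=ereal a..ereal b. f t) = B - A"
    by (rule interval_integral_FTC_integrable)
      (use assms in \<open>simp_all add: set_integrable_def ereal_tendsto_simps1\<close>)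
  thus ?thesis using assms(1) by (simp add: interval_lebesgue_integral_le_eq set_lebesgue_integral_def)
qed

lemma FTC_Ioi:
  fixes f F :: "real \<Rightarrow> 'a::euclidean_space"
  assumes "\<And>t. a < t \<Longrightarrow> (F has_vector_derivative f t) (at t)"
    "\<And>t. a < t \<Longrightarrow> isCont f t" "integrable lborel (\<lambda>t. indicator {a<..} t *\<^sub>R f t)"
    "(F \<longlongrightarrow> A) (at_right a)" "(F \<longlongrightarrow> B) at_top"
  shows "(\<integral>t. indicator {a<..} t *\<^sub>R f t \<partial>lborel) = B - A"
proof -
  have "(LBINT t=ereal a..\<infinity>. f t) = B - A"
    by (rule interval_integral_FTC_integrable)
      (use assms in \<open>simp_all add: set_integrable_def ereal_tendsto_simps1\<close>)
  thus ?thesis by (simp add: interval_lebesgue_integral_le_eq set_lebesgue_integral_def)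
qed

text \<open>The primitive \<open>H\<close> may blow up at \<open>x\<close>, but its values at
  \<open>x - \<epsilon>\<close> and \<open>x + \<epsilon>\<close> differ by a quantity tending to 0,
  so only the limit at the left end \<open>l\<close> of the support survives. When \<open>l\<close>
  lies to the right of \<open>x\<close>, the singularity misses the support and the truncated
  integrals are eventually constant.\<close>

lemma pv_FTC:
  fixes f H :: "real \<Rightarrow> real"
  assumes l: "0 \<le> l" "l \<noteq> x" "0 < x" and f0: "\<And>t. 0 < t \<Longrightarrow> t < l \<Longrightarrow> f t = 0"
    and H: "\<And>t. l < t \<Longrightarrow> t \<noteq> x \<Longrightarrow> (H has_real_derivative f t / (x - t)) (at t)"
    and cont: "\<And>t. l < t \<Longrightarrow> t \<noteq> x \<Longrightarrow> isCont (\<lambda>t. f t / (x - t)) t"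
    and int: "\<And>\<epsilon>. 0 < \<epsilon> \<Longrightarrow> \<epsilon> < x \<Longrightarrow> integrable lborel (\<lambda>t. indicator (pv_dom x \<epsilon>) t * (f t / (x - t)))"
    and H0: "(H \<longlongrightarrow> H0) (at_right l)" and Hinf: "(H \<longlongrightarrow> 0) at_top"
    and Hx: "l < x \<Longrightarrow> ((\<lambda>\<epsilon>. H (x - \<epsilon>) - H (x + \<epsilon>)) \<longlongrightarrow> 0) (at_right 0)"
  shows "(pv_trunc f x \<longlongrightarrow> - H0) (at_right 0)"
proof (cases "l < x")
  case lx: True
  have "pv_trunc f x \<epsilon> = (H (x - \<epsilon>) - H (x + \<epsilon>)) - H0" if \<epsilon>: "0 < \<epsilon>" "\<epsilon> < x - l" for \<epsilon>
  proof -
    let ?g = "\<lambda>t. f t / (x - t)"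
    note i = int[of \<epsilon>]
    have i1: "integrable lborel (\<lambda>t. indicator {l<..<x - \<epsilon>} t *\<^sub>R ?g t)"
      and i2: "integrable lborel (\<lambda>t. indicator {x + \<epsilon><..} t *\<^sub>R ?g t)"
    proof -
      have j: "integrable lborel (\<lambda>t. indicator {l<..<x - \<epsilon>} t *\<^sub>R (indicator (pv_dom x \<epsilon>) t * ?g t))"
        "integrable lborel (\<lambda>t. indicator {x + \<epsilon><..} t *\<^sub>R (indicator (pv_dom x \<epsilon>) t * ?g t))"
        using i \<epsilon> l by (intro integrable_mult_indicator; simp)+
      have e: "indicator {l<..<x - \<epsilon>} t *\<^sub>R (indicator (pv_dom x \<epsilon>) t * ?g t) = indicator {l<..<x - \<epsilon>} t *\<^sub>R ?g t"
        "indicator {x + \<epsilon><..} t *\<^sub>R (indicator (pv_dom x \<epsilon>) t * ?g t) = indicator {x + \<epsilon><..} t *\<^sub>R ?g t" for t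
        using \<epsilon> l by (auto simp: indicator_def)
      show "integrable lborel (\<lambda>t. indicator {l<..<x - \<epsilon>} t *\<^sub>R ?g t)"
        "integrable lborel (\<lambda>t. indicator {x + \<epsilon><..} t *\<^sub>R ?g t)" using j unfolding e .
    qed
    have Hc: "isCont H t" if "l < t" "t \<noteq> x" for t using H[OF that] by (rule DERIV_isCont)
    have "pv_trunc f x \<epsilon> = (\<integral>t. indicator {l<..<x - \<epsilon>} t *\<^sub>R ?g t + indicator {x + \<epsilon><..} t *\<^sub>R ?g t \<partial>lborel)"
      unfolding pv_trunc_eq
    proof (rule integral_discrete_difference[of "{l}"])
      fix t assume t: "t \<notin> {l}"
      consider "t \<le> 0" | "0 < t" "t < l" | "l < t" "t < x - \<epsilon>" | "x - \<epsilon> \<le> t" "t \<le> x + \<epsilon>" "l < t" | "x + \<epsilon> < t" "l < t"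
        using t \<epsilon> by force
      thus "indicator (pv_dom x \<epsilon>) t * ?g t = indicator {l<..<x - \<epsilon>} t *\<^sub>R ?g t + indicator {x + \<epsilon><..} t *\<^sub>R ?g t"
        by cases (use l \<epsilon> f0[of t] in \<open>auto simp: indicator_def\<close>)
    qed auto
    also have "\<dots> = (\<integral>t. indicator {l<..<x - \<epsilon>} t *\<^sub>R ?g t \<partial>lborel) + (\<integral>t. indicator {x + \<epsilon><..} t *\<^sub>R ?g t \<partial>lborel)"
      by (rule Bochner_Integration.integral_add[OF i1 i2])
    also have "(\<integral>t. indicator {l<..<x - \<epsilon>} t *\<^sub>R ?g t \<partial>lborel) = H (x - \<epsilon>) - H0"
    proof (rule FTC_Ioo[OF _ _ _ i1])
      show "(H \<longlongrightarrow> H (x - \<epsilon>)) (at_left (x - \<epsilon>))"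
        using Hc[of "x - \<epsilon>"] \<epsilon> by (auto simp: isCont_def intro: filterlim_at_split[THEN iffD1, THEN conjunct1])
    qed (use \<epsilon> H cont H0 in \<open>auto simp: has_real_derivative_iff_has_vector_derivative[symmetric]\<close>)
    also have "(\<integral>t. indicator {x + \<epsilon><..} t *\<^sub>R ?g t \<partial>lborel) = 0 - H (x + \<epsilon>)"
    proof (rule FTC_Ioi[OF _ _ i2])
      show "(H \<longlongrightarrow> H (x + \<epsilon>)) (at_right (x + \<epsilon>))"
        using Hc[of "x + \<epsilon>"] \<epsilon> lx by (auto simp: isCont_def intro: filterlim_at_split[THEN iffD1, THEN conjunct2])
    qed (use \<epsilon> lx H cont Hinf in \<open>auto simp: has_real_derivative_iff_has_vector_derivative[symmetric]\<close>)
    finally show ?thesis by simp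
  qed
  hence "\<forall>\<^sub>F \<epsilon> in at_right 0. (H (x - \<epsilon>) - H (x + \<epsilon>)) - H0 = pv_trunc f x \<epsilon>"
    using eventually_at_right_less[of 0] eventually_at_right_real[of 0 "x - l"] lx by (auto elim!: eventually_mono)
  moreover have "((\<lambda>\<epsilon>. (H (x - \<epsilon>) - H (x + \<epsilon>)) - H0) \<longlongrightarrow> 0 - H0) (at_right 0)"
    by (intro tendsto_intros Hx lx)
  ultimately show ?thesis using Lim_transform_eventually by fastforce
next
  case False
  hence lx: "x < l" using l by simp
  have "pv_trunc f x \<epsilon> = - H0" if \<epsilon>: "0 < \<epsilon>" "\<epsilon> < min x (l - x)" for \<epsilon>
  proof -
    let ?g = "\<lambda>t. f t / (x - t)"
    have i1: "integrable lborel (\<lambda>t. indicator {l<..} t *\<^sub>R ?g t)"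
    proof -
      have j: "integrable lborel (\<lambda>t. indicator {l<..} t *\<^sub>R (indicator (pv_dom x \<epsilon>) t * ?g t))"
        using int[of \<epsilon>] \<epsilon> by (intro integrable_mult_indicator) auto
      have e: "indicator {l<..} t *\<^sub>R (indicator (pv_dom x \<epsilon>) t * ?g t) = indicator {l<..} t *\<^sub>R ?g t" for t
        using \<epsilon> lx l by (auto simp: indicator_def)
      show ?thesis using j unfolding e .
    qed
    have "pv_trunc f x \<epsilon> = (\<integral>t. indicator {l<..} t *\<^sub>R ?g t \<partial>lborel)"
      unfolding pv_trunc_eq
    proof (rule integral_discrete_difference[of "{l}"])
      fix t assume t: "t \<notin> {l}"
      consider "t \<le> 0" | "0 < t" "t < l" | "l < t" using t by force
      thus "indicator (pv_dom x \<epsilon>) t * ?g t = indicator {l<..} t *\<^sub>R ?g t"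
        by cases (use l lx \<epsilon> f0[of t] in \<open>auto simp: indicator_def\<close>)
    qed auto
    also have "\<dots> = 0 - H0"
      by (rule FTC_Ioi[OF _ _ i1 H0 Hinf]) (use lx H cont in \<open>auto simp: has_real_derivative_iff_has_vector_derivative[symmetric]\<close>)
    finally show ?thesis by simp
  qed
  hence "\<forall>\<^sub>F \<epsilon> in at_right 0. pv_trunc f x \<epsilon> = - H0"
    using eventually_at_right_real[of 0 "min x (l - x)"] lx l by (auto elim!: eventually_mono)
  thus ?thesis by (rule tendsto_eventually)
qed

lemma nn_bound_integrable:
  fixes f :: "real \<Rightarrow> real"
  assumes [measurable]: "f \<in> borel_measurable borel" and le: "\<And>t. t \<in> pv_dom x \<epsilon> \<Longrightarrow> norm (f t) \<le> c * t powr (- (1 / 2))" and c: "c \<ge> 0"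
    and \<epsilon>: "0 < \<epsilon>" "\<epsilon> < x"
  shows "integrable lborel (\<lambda>t. indicator (pv_dom x \<epsilon>) t * (f t / (x - t)))"
proof (rule integrableI_bounded)
  have "(\<integral>\<^sup>+t. ennreal (norm (indicator (pv_dom x \<epsilon>) t * (f t / (x - t)))) \<partial>lborel) \<le>
     (\<integral>\<^sup>+t. ennreal c * (indicator (pv_dom x \<epsilon>) t * ennreal (t powr (1 / 2 - 1) / \<bar>x - t\<bar>)) \<partial>lborel)"
  proof (rule nn_integral_mono)
    fix t :: real
    show "ennreal (norm (indicator (pv_dom x \<epsilon>) t * (f t / (x - t)))) \<le> ennreal c * (indicator (pv_dom x \<epsilon>) t * ennreal (t powr (1 / 2 - 1) / \<bar>x - t\<bar>))"
    proof (cases "t \<in> pv_dom x \<epsilon>")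
      case True
      have "norm (f t) / \<bar>x - t\<bar> \<le> c * t powr (- (1 / 2)) / \<bar>x - t\<bar>" using le[OF True] by (rule divide_right_mono) simp
      moreover have "norm (indicator (pv_dom x \<epsilon>) t * (f t / (x - t))) = norm (f t) / \<bar>x - t\<bar>"
        using True by (simp add: abs_divide)
      moreover have "ennreal c * (indicator (pv_dom x \<epsilon>) t * ennreal (t powr (1 / 2 - 1) / \<bar>x - t\<bar>)) = ennreal (c * t powr (- (1 / 2)) / \<bar>x - t\<bar>)"
        using True c by (simp add: ennreal_mult[symmetric])
      ultimately show ?thesis by (simp only: ennreal_leI)
    qed simp
  qed
  also have "\<dots> = ennreal c * (\<integral>\<^sup>+t. indicator (pv_dom x \<epsilon>) t * ennreal (t powr (1 / 2 - 1) / \<bar>x - t\<bar>) \<partial>lborel)"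
    by (rule nn_integral_cmult) measurable
  also have "\<dots> < \<infinity>"
    using pv_weight_finite[of "1 / 2" \<epsilon> x] \<epsilon> by (auto simp: ennreal_mult_less_top)
  finally show "(\<integral>\<^sup>+t. ennreal (norm (indicator (pv_dom x \<epsilon>) t * (f t / (x - t)))) \<partial>lborel) < \<infinity>" .
qed measurable

text \<open>For this power the primitive vanishes both at 0 and at infinity. The lemma later
  disposes of the term in which a smooth factor is frozen at \<open>t = x\<close>.\<close>

lemma pv_inverse_sqrt:
  assumes x: "x > 0"
  shows "(pv_trunc (\<lambda>t. t powr (- (1 / 2))) x \<longlongrightarrow> 0) (at_right 0)"
proof -
  define y where "y = sqrt x"
  have y: "y > 0" "y\<^sup>2 = x" using x by (auto simp: y_def)
  \<comment> \<open>Off \<open>t = x\<close> this is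
    \<open>ln ((y + sqrt t) / \<bar>y - sqrt t\<bar>) / y\<close>. Written with
    \<open>\<bar>x - t\<bar>\<close>, its singular part takes equal values at
    \<open>x - \<epsilon>\<close> and \<open>x + \<epsilon>\<close> and cancels exactly.\<close>
  define H where "H = (\<lambda>t. (2 * ln (y + sqrt t) - ln \<bar>x - t\<bar>) / y)"
  have yp: "y + sqrt t > 0" if "t \<ge> 0" for t using y that by (simp add: add_pos_nonneg)
  have "(pv_trunc (\<lambda>t. t powr (- (1 / 2))) x \<longlongrightarrow> - 0) (at_right 0)"
  proof (rule pv_FTC[where l = 0 and H = H])
    fix t :: real assume t: "0 < t" "t \<noteq> x"
    define s where "s = sqrt t"
    have s: "s > 0" "s\<^sup>2 = t" using t by (auto simp: s_def)
    have d1: "((\<lambda>t. ln (y + sqrt t)) has_real_derivative inverse s / 2 / (y + s)) (at t)"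
      using yp[of t] t unfolding s_def by (auto intro!: derivative_eq_intros)
    have d2: "((\<lambda>t. ln \<bar>x - t\<bar>) has_real_derivative - 1 / (x - t)) (at t)"
    proof (cases "t < x")
      case True
      have "((\<lambda>t. ln (x - t)) has_real_derivative - 1 / (x - t)) (at t)"
        using True by (auto intro!: derivative_eq_intros)
      thus ?thesis by (rule has_field_derivative_transform_within_open[of _ _ _ "{..<x}"]) (use True in auto)
    next
      case False
      have "((\<lambda>t. ln (t - x)) has_real_derivative - 1 / (x - t)) (at t)"
        using False t by (auto intro!: derivative_eq_intros simp: divide_simps)
      thus ?thesis by (rule has_field_derivative_transform_within_open[of _ _ _ "{x<..}"]) (use False t in auto)
    qed
    have "(H has_real_derivative (2 * (inverse s / 2 / (y + s)) - - 1 / (x - t)) / y) (at t)"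
      unfolding H_def by (intro DERIV_cdivide DERIV_diff DERIV_cmult d1 d2)
    moreover have "(2 * (inverse s / 2 / (y + s)) - - 1 / (x - t)) / y = t powr (- (1 / 2)) / (x - t)"
    proof -
      have xt: "x - t = (y - s) * (y + s)" using s y by (simp add: algebra_simps power2_eq_square)
      have ne: "y - s \<noteq> 0" "y + s \<noteq> 0" using s y t xt by auto
      have p: "t powr (- (1 / 2)) = inverse s" using t by (simp add: powr_minus powr_half_sqrt s_def)
      have "2 * (inverse s / 2 / b) - - 1 / (a * b) = (a + s) / (s * a * b)" if "a \<noteq> 0" "b \<noteq> 0" for a b
        using that s by (simp add: field_simps)
      note e = this[OF ne]
      have "y / (s * a * b) / y = inverse s / (a * b)" for a b
        using y by (simp add: inverse_eq_divide mult.assoc)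
      thus ?thesis unfolding xt p e diff_add_cancel .
    qed
    ultimately show "(H has_real_derivative t powr (- (1 / 2)) / (x - t)) (at t)" by simp
    show "isCont (\<lambda>t. t powr (- (1 / 2)) / (x - t)) t"
      using t by (intro continuous_intros) auto
  next
    fix \<epsilon> :: real assume "0 < \<epsilon>" "\<epsilon> < x"
    thus "integrable lborel (\<lambda>t. indicator (pv_dom x \<epsilon>) t * (t powr (- (1 / 2)) / (x - t)))"
      by (intro nn_bound_integrable[of _ x \<epsilon> 1]) auto
  next
    have "isCont H 0" unfolding H_def using y x by (intro continuous_intros) auto
    hence "(H \<longlongrightarrow> H 0) (at_right 0)" by (auto simp: isCont_def intro: filterlim_at_split[THEN iffD1, THEN conjunct2])
    moreover have "H 0 = 0" using y x by (simp add: H_def ln_realpow y(2)[symmetric])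
    ultimately show "(H \<longlongrightarrow> 0) (at_right 0)" by simp
  next
    have "((\<lambda>t. (2 * ln (y + sqrt t) - ln (t - x)) / y) \<longlongrightarrow> 0) at_top"
      using y by real_asymp
    moreover have "\<forall>\<^sub>F t in at_top. (2 * ln (y + sqrt t) - ln (t - x)) / y = H t"
      using eventually_gt_at_top[of x] by eventually_elim (simp add: H_def)
    ultimately show "(H \<longlongrightarrow> 0) at_top" by (rule Lim_transform_eventually)
  next
    have "((\<lambda>\<epsilon>. (2 * ln (y + sqrt (x - \<epsilon>)) - 2 * ln (y + sqrt (x + \<epsilon>))) / y) \<longlongrightarrow> (2 * ln (y + sqrt (x - 0)) - 2 * ln (y + sqrt (x + 0))) / y) (at_right 0)"
      using y yp[of x] x by (intro tendsto_intros) auto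
    moreover have "H (x - \<epsilon>) - H (x + \<epsilon>) = (2 * ln (y + sqrt (x - \<epsilon>)) - 2 * ln (y + sqrt (x + \<epsilon>))) / y" for \<epsilon>
      by (simp add: H_def diff_divide_distrib)
    ultimately show "((\<lambda>\<epsilon>. H (x - \<epsilon>) - H (x + \<epsilon>)) \<longlongrightarrow> 0) (at_right 0)" by simp
  qed (use x in auto)
  thus ?thesis by simp
qed

text \<open>Along the ray, the closed form of \<open>gKern\<close> says that
  \<open>- Kern k x t / x ^ (k + 1)\<close> is a primitive in \<open>t\<close> of
  \<open>1 / (t ^ (k + 1) * (x - t))\<close>, and it vanishes at infinity.\<close>

lemma pv_Rplus:
  assumes s: "s > 0" "x > 0" "s \<noteq> x"
  shows "(pv_trunc (\<lambda>t. indicator {s..} t / t ^ (k + 1)) x \<longlongrightarrow> Kern k x (of_real s) / x ^ (k + 1)) (at_right 0)"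
proof -
  define H where "H = (\<lambda>t. - (Kern k x (of_real t) / x ^ (k + 1)))"
  have dr: "((\<lambda>t. rest k x (of_real t)) has_real_derivative Re (grest k x (of_real t))) (at t)" if "t \<noteq> 0" for t
  proof -
    have "((\<lambda>t. rest k x (of_real t)) has_derivative (\<lambda>h. Re (grest k x (of_real t) * of_real h))) (at t)"
      by (rule has_derivative_compose[OF _ rest_derivative]) (use that in \<open>auto intro!: derivative_eq_intros\<close>)
    thus ?thesis by (rule has_derivative_imp_has_field_derivative) simp
  qed
  have dl: "((\<lambda>t. ln (cmod (of_real t - of_real x))) has_real_derivative Re (1 / (of_real t - of_real x))) (at t)" if "t \<noteq> x" for t
  proof -
    have "((\<lambda>t. ln (cmod (of_real t - of_real x))) has_derivative (\<lambda>h. Re (1 / (of_real t - of_real x) * of_real h))) (at t)"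
      by (rule has_derivative_compose[OF _ ln_cmod_derivative]) (use that in \<open>auto intro!: derivative_eq_intros\<close>)
    thus ?thesis by (rule has_derivative_imp_has_field_derivative) simp
  qed
  have dH: "(H has_real_derivative (1 / t ^ (k + 1)) / (x - t)) (at t)" if t: "t > 0" "t \<noteq> x" for t
  proof -
    have "(H has_real_derivative - ((Re (1 / (of_real t - of_real x)) + Re (grest k x (of_real t))) / x ^ (k + 1))) (at t)"
      unfolding H_def Kern_def by (intro DERIV_minus DERIV_cdivide DERIV_add dr dl) (use t in auto)
    also have "Re (1 / (of_real t - of_real x)) + Re (grest k x (of_real t)) = Re (gKern k x (of_real t))"
      by (simp add: gKern_def)
    also have "gKern k x (of_real t) = of_real (x ^ (k + 1) / (t ^ (k + 1) * (t - x)))"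
      by (subst gKern_eq) (use t in auto)
    also have "- (Re (of_real (x ^ (k + 1) / (t ^ (k + 1) * (t - x)))) / x ^ (k + 1)) = (1 / t ^ (k + 1)) / (x - t)"
    proof -
      have "- (X / (T * d) / X) = (1 / T) / (- d)" if "X \<noteq> 0" for X T d :: real using that by (simp add: field_simps)
      from this[of "x ^ (k + 1)" "t ^ (k + 1)" "t - x"] show ?thesis using s by simp
    qed
    finally show ?thesis .
  qed
  have isr: "isCont (\<lambda>t. rest k x (of_real t)) t" if "t \<noteq> 0" for t using dr[OF that] by (rule DERIV_isCont)
  have isH: "isCont H t" if "t > 0" "t \<noteq> x" for t using dH[OF that] by (rule DERIV_isCont)
  have eqo: "((\<lambda>t. indicator {s..} t / t ^ (k + 1) / (x - t)) has_real_derivative d) (at t) = ((\<lambda>t. 1 / t ^ (k + 1) / (x - t)) has_real_derivative d) (at t)" if "s < t" for t d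
    by (rule DERIV_cong_ev[OF refl _ refl]) (use eventually_nhds_in_open[of "{s<..}" t] that in \<open>auto elim!: eventually_mono\<close>)
  have "(pv_trunc (\<lambda>t. indicator {s..} t / t ^ (k + 1)) x \<longlongrightarrow> - H s) (at_right 0)"
  proof (rule pv_FTC[where l = s and H = H])
    fix t assume t: "s < t" "t \<noteq> x"
    show "(H has_real_derivative indicator {s..} t / t ^ (k + 1) / (x - t)) (at t)" using dH[of t] t s by simp
    have "isCont (\<lambda>t. 1 / t ^ (k + 1) / (x - t)) t" using t s by (intro continuous_intros) auto
    thus "isCont (\<lambda>t. indicator {s..} t / t ^ (k + 1) / (x - t)) t"
      by (rule isCont_cong[THEN iffD1, rotated])
        (use eventually_nhds_in_open[of "{s<..}" t] t in \<open>auto elim!: eventually_mono\<close>)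
  next
    fix \<epsilon> assume \<epsilon>: "0 < \<epsilon>" "\<epsilon> < x"
    \<comment> \<open>The support starts at \<open>s > 0\<close>, so the excess power
      \<open>t powr (- (k + 1 / 2))\<close> is bounded by its value at \<open>s\<close>.\<close>
    have "norm (indicator {s..} t / t ^ (k + 1)) \<le> s powr (- (real k + 1 / 2)) * t powr (- (1 / 2))" if t0: "t \<in> pv_dom x \<epsilon>" for t
    proof (cases "t \<ge> s")
      case True
      hence t: "t > 0" using s by simp
      have "t powr (- (real k + 1 / 2)) * t powr (- (1 / 2)) = t powr (- real (k + 1))"
        unfolding powr_add[symmetric] by (rule arg_cong[where f = "\<lambda>s. t powr s"]) simp
      also have "\<dots> = 1 / t ^ (k + 1)" using t by (simp only: powr_minus_divide powr_realpow)
      finally have "1 / t ^ (k + 1) = t powr (- (real k + 1 / 2)) * t powr (- (1 / 2))" by simp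
      also have "\<dots> \<le> s powr (- (real k + 1 / 2)) * t powr (- (1 / 2))"
        using True s t by (intro mult_right_mono powr_mono2') auto
      finally show ?thesis using True t by simp
    qed simp
    thus "integrable lborel (\<lambda>t. indicator (pv_dom x \<epsilon>) t * (indicator {s..} t / t ^ (k + 1) / (x - t)))"
      by (intro nn_bound_integrable[OF _ _ _ \<epsilon>, where c = "s powr (- (real k + 1 / 2))"]) auto
  next
    show "(H \<longlongrightarrow> H s) (at_right s)"
      using isH[of s] s by (auto simp: isCont_def intro: filterlim_at_split[THEN iffD1, THEN conjunct2])
  next
    have "((\<lambda>t. Kern k x (of_real t)) \<longlongrightarrow> 0) at_top"
    proof (rule Lim_null_comparison)
      show "\<forall>\<^sub>F t in at_top. norm (Kern k x (of_real t)) \<le> 2 * x ^ Suc k * inverse (t ^ Suc k)"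
        using eventually_ge_at_top[of "2 * x"]
      proof eventually_elim
        case (elim t)
        thus ?case using Kern_bound[of x "of_real t" k] s by (simp add: divide_inverse)
      qed
      have "((\<lambda>t::real. inverse (t ^ Suc k)) \<longlongrightarrow> 0) at_top"
        by (intro tendsto_inverse_0_at_top filterlim_pow_at_top filterlim_ident) simp
      thus "((\<lambda>t. 2 * x ^ Suc k * inverse (t ^ Suc k)) \<longlongrightarrow> 0) at_top" by (rule tendsto_mult_right_zero)
    qed
    hence "((\<lambda>t. - (Kern k x (of_real t) / x ^ (k + 1))) \<longlongrightarrow> - (0 / x ^ (k + 1))) at_top"
      by (intro tendsto_intros) (use s in auto)
    thus "(H \<longlongrightarrow> 0) at_top" by (simp add: H_def)
  next
    \<comment> \<open>The two logarithms of the distance to \<open>x\<close> are equal at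
      \<open>x - \<epsilon>\<close> and \<open>x + \<epsilon>\<close>; only the increment of the
      smooth part is left.\<close>
    have "((\<lambda>\<epsilon>. (rest k x (of_real (x + \<epsilon>)) - rest k x (of_real (x - \<epsilon>))) / x ^ (k + 1)) \<longlongrightarrow> (rest k x (of_real (x + 0)) - rest k x (of_real (x - 0))) / x ^ (k + 1)) (at_right 0)"
      by (intro tendsto_divide tendsto_diff isCont_tendsto_compose[OF isr] tendsto_intros) (use s in auto)
    moreover have "\<forall>\<^sub>F \<epsilon> in at_right 0. (rest k x (of_real (x + \<epsilon>)) - rest k x (of_real (x - \<epsilon>))) / x ^ (k + 1) = H (x - \<epsilon>) - H (x + \<epsilon>)"
      by (intro always_eventually allI) (simp add: H_def Kern_def diff_divide_distrib add_divide_distrib)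
    ultimately show "((\<lambda>\<epsilon>. H (x - \<epsilon>) - H (x + \<epsilon>)) \<longlongrightarrow> 0) (at_right 0)"
      by (simp add: Lim_transform_eventually)
  qed (use s in auto)
  thus ?thesis by (simp add: H_def)
qed

section \<open>The principal value for a point off the ray\<close>

lemma Rplus_distance:
  assumes "z \<notin> Rplus"
  obtains c where "c > 0" "\<And>s. s \<ge> 0 \<Longrightarrow> c * (1 + s) \<le> cmod (of_real s - z)"
proof -
  obtain d where d: "d > 0" "\<And>s. s \<ge> 0 \<Longrightarrow> d \<le> cmod (of_real s - z)"
  proof (cases "Im z = 0")
    case False
    have "\<bar>Im z\<bar> \<le> cmod (of_real s - z)" for s using abs_Im_le_cmod[of "of_real s - z"] by simp
    thus ?thesis using that[of "\<bar>Im z\<bar>"] False by simp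
  next
    case True
    hence "Re z < 0" using assms by (auto simp: Rplus_iff)
    moreover have "- Re z \<le> cmod (of_real s - z)" if "s \<ge> 0" for s
      using abs_Re_le_cmod[of "of_real s - z"] that by simp
    ultimately show ?thesis using that[of "- Re z"] by simp
  qed
  \<comment> \<open>With \<open>s \<le> m + cmod z\<close> and \<open>d \<le> m\<close> one gets
    \<open>d * (1 + s) \<le> m * (1 + cmod z) + d * m\<close>, and the right side is
    \<open>m * D\<close>.\<close>
  define D where "D = 1 + cmod z + d"
  have D: "D > 0" using d by (simp add: D_def add_pos_nonneg add_nonneg_pos)
  have "d / D * (1 + s) \<le> cmod (of_real s - z)" if s: "s \<ge> 0" for s
  proof -
    define m where "m = cmod (of_real s - z)"
    have m: "d \<le> m" using d(2)[OF s] by (simp add: m_def)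
    have "s \<le> m + cmod z" using norm_triangle_ineq[of "of_real s - z" z] s by (simp add: m_def)
    hence "d * (1 + s) \<le> d * (1 + (m + cmod z))" using d by (intro mult_left_mono) auto
    also have "\<dots> = d * (1 + cmod z) + d * m" by (simp add: algebra_simps)
    also have "\<dots> \<le> m * (1 + cmod z) + d * m" using m d by (intro add_mono mult_right_mono) auto
    also have "\<dots> = m * D" by (simp add: D_def algebra_simps)
    finally show ?thesis using D by (simp add: m_def divide_le_eq mult.commute)
  qed
  thus thesis using that[of "d / D"] d D by simp
qed

text \<open>Up to one factor \<open>sqrt_cut z\<close> the even part depends on
  \<open>y\<^sup>2\<close> and \<open>z\<close> only. For even \<open>q\<close> it comes from the
  difference of the simple fractions with poles at \<open>w\<close> and \<open>- w\<close>, for odd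
  \<open>q\<close> from their sum, which brings one more factor \<open>y\<close>; hence the common
  exponent \<open>(q + 1) div 2\<close>.\<close>

lemma gq_even_part:
  assumes z: "z \<notin> Rplus"
  shows "gq q z y + gq q z (- y) = 2 * (sqrt_cut z * of_real (y\<^sup>2) ^ ((q + 1) div 2) / (z ^ ((q + 1) div 2) * (of_real (y\<^sup>2) - z)))"
proof -
  define w where "w = sqrt_cut z"
  define a where "a = complex_of_real y"
  have w: "w \<noteq> 0" "a - w \<noteq> 0" "a + w \<noteq> 0" using sub_ne[OF z] by (auto simp: w_def a_def)
  have zw: "z = w\<^sup>2" by (simp add: w_def sqrt_cut_sq)
  have ne: "a\<^sup>2 - w\<^sup>2 = (a - w) * (a + w)" by (simp add: algebra_simps power2_eq_square)
  have d: "complex_of_real (y\<^sup>2) - z = (a - w) * (a + w)" "complex_of_real (y\<^sup>2) = a\<^sup>2" "sqrt_cut z = w"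
  proof -
    have "complex_of_real (y\<^sup>2) - z = a\<^sup>2 - w\<^sup>2" unfolding a_def w_def sqrt_cut_sq by simp
    thus "complex_of_real (y\<^sup>2) - z = (a - w) * (a + w)" unfolding ne .
  qed (simp_all add: a_def w_def)
  have pf: "1 / (a - w) - 1 / (a + w) = 2 * w / ((a - w) * (a + w))" "1 / (a - w) + 1 / (a + w) = 2 * a / ((a - w) * (a + w))"
    using w by (simp_all add: field_simps)
  have g1: "gq q z y = a ^ q / w ^ q * (1 / (a - w))" by (simp add: gq_def w_def a_def)
  have g2: "gq q z (- y) = - ((- a) ^ q / w ^ q * (1 / (a + w)))"
  proof -
    have "- a - w = - (a + w)" by simp
    thus ?thesis by (simp only: gq_def w_def[symmetric] a_def[symmetric] of_real_minus divide_minus_right mult_minus_right) simp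
  qed
  show ?thesis
  proof (cases "even q")
    case True
    then obtain m where m: "q = 2 * m" by blast
    have "gq q z y + gq q z (- y) = (a\<^sup>2) ^ m / (w\<^sup>2) ^ m * (1 / (a - w) - 1 / (a + w))"
    proof -
      have e: "(- a) ^ (2 * m) = a ^ (2 * m)" by simp
      show ?thesis unfolding g1 g2 unfolding m e unfolding power_mult right_diff_distrib by (rule add_uminus_conv_diff)
    qed
    also have "\<dots> = 2 * (w * (a\<^sup>2) ^ m / ((w\<^sup>2) ^ m * ((a - w) * (a + w))))" unfolding pf(1) by simp
    finally show ?thesis unfolding d(1,3) unfolding d(2) by (simp add: m zw[symmetric])
  next
    case False
    then obtain m where m: "q = 2 * m + 1" using oddE by blast
    have "gq q z y + gq q z (- y) = a * (a\<^sup>2) ^ m / (w * (w\<^sup>2) ^ m) * (1 / (a - w) + 1 / (a + w))"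
    proof -
      have e: "(- a) ^ (2 * m + 1) = - (a * (a\<^sup>2) ^ m)" "a ^ (2 * m + 1) = a * (a\<^sup>2) ^ m" "w ^ (2 * m + 1) = w * (w\<^sup>2) ^ m"
        by (simp_all add: power_mult)
      show ?thesis unfolding g1 g2 unfolding m e distrib_left minus_divide_left[symmetric] mult_minus_left minus_minus ..
    qed
    also have "\<dots> = 2 * (w * (a\<^sup>2) ^ Suc m / ((w\<^sup>2) ^ Suc m * ((a - w) * (a + w))))"
      unfolding pf(2) using w(1) by (simp add: power2_eq_square, simp add: mult_ac)
    finally show ?thesis unfolding d(1,3) unfolding d(2) by (simp add: m zw[symmetric])
  qed
qed

text \<open>The substitution \<open>\<tau> = sqrt t * u\<close> makes the domain independent of
  \<open>t\<close>. Then \<open>t\<close> enters through powers and a Cauchy kernel, and the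
  principal value in \<open>t\<close> can be computed for each \<open>u\<close> separately.\<close>

lemma psi_unit_integral:
  assumes z: "z \<notin> Rplus" and t: "t > 0"
  shows "psi q z t = 2 / pi * sqrt t * (\<integral>u. indicator {0..1} u * Im (sqrt_cut z * of_real (t * u\<^sup>2) ^ ((q + 1) div 2) / (z ^ ((q + 1) div 2) * (of_real (t * u\<^sup>2) - z))) \<partial>lborel)"
proof -
  define T where "T = sqrt t"
  have T: "T > 0" "T\<^sup>2 = t" using t by (auto simp: T_def)
  define h where "h = (\<lambda>u. Im (gq q z (T * u)))"
  have ch: "continuous_on UNIV h" unfolding h_def
    by (intro continuous_intros continuous_on_compose2[OF gq_cont[OF z, of UNIV]]) auto
  have "(\<integral>\<tau>. indicator {- T..T} \<tau> * Im (gq q z \<tau>) \<partial>lborel) = \<bar>T\<bar> *\<^sub>R (\<integral>u. indicator {- T..T} (0 + T * u) * Im (gq q z (0 + T * u)) \<partial>lborel)"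
    by (rule lborel_integral_real_affine) (use T in simp)
  also have "(\<integral>u. indicator {- T..T} (0 + T * u) * Im (gq q z (0 + T * u)) \<partial>lborel) = (\<integral>u. indicator {-1..1} u * h u \<partial>lborel)"
  proof (intro Bochner_Integration.integral_cong refl)
    fix u
    have "- T \<le> T * u \<longleftrightarrow> -1 \<le> u" "T * u \<le> T \<longleftrightarrow> u \<le> 1"
      using T mult_le_cancel_left_pos[of T "-1" u] mult_le_cancel_left_pos[of T u 1] by auto
    thus "indicator {- T..T} (0 + T * u) * Im (gq q z (0 + T * u)) = indicator {-1..1} u * h u"
      by (simp add: indicator_def h_def)
  qed
  also have "(\<integral>u. indicator {-1..1} u * h u \<partial>lborel) = (\<integral>u. indicator {0..1} u * h u + indicator {-1..0} u * h u \<partial>lborel)"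
    by (rule integral_discrete_difference[of "{0}"]) (auto simp: indicator_def)
  also have "\<dots> = (\<integral>u. indicator {0..1} u * h u \<partial>lborel) + (\<integral>u. indicator {-1..0} u * h u \<partial>lborel)"
    by (intro Bochner_Integration.integral_add Icc_integrable ch)
  also have "(\<integral>u. indicator {-1..0} u * h u \<partial>lborel) = \<bar>-1::real\<bar> *\<^sub>R (\<integral>u. indicator {-1..0} (0 + (-1) * u) * h (0 + (-1) * u) \<partial>lborel)"
    by (rule lborel_integral_real_affine) simp
  also have "\<dots> = (\<integral>u. indicator {0..1} u * h (- u) \<partial>lborel)"
    by (simp, intro Bochner_Integration.integral_cong refl) (auto simp: indicator_def)
  also have "(\<integral>u. indicator {0..1} u * h u \<partial>lborel) + \<dots> = (\<integral>u. indicator {0..1} u * h u + indicator {0..1} u * h (- u) \<partial>lborel)"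
    by (intro Bochner_Integration.integral_add[symmetric] Icc_integrable ch continuous_on_compose2[OF ch] continuous_intros) auto
  also have "\<dots> = (\<integral>u. 2 * (indicator {0..1} u * Im (sqrt_cut z * of_real (t * u\<^sup>2) ^ ((q + 1) div 2) / (z ^ ((q + 1) div 2) * (of_real (t * u\<^sup>2) - z)))) \<partial>lborel)"
  proof (intro Bochner_Integration.integral_cong refl)
    fix u
    have "h u + h (- u) = Im (gq q z (T * u) + gq q z (- (T * u)))" by (simp add: h_def)
    also have "\<dots> = 2 * Im (sqrt_cut z * of_real (t * u\<^sup>2) ^ ((q + 1) div 2) / (z ^ ((q + 1) div 2) * (of_real (t * u\<^sup>2) - z)))"
    proof -
      have "Im (2 * X) = 2 * Im X" for X by simp
      thus ?thesis unfolding gq_even_part[OF z] power_mult_distrib T(2) .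
    qed
    finally show "indicator {0..1} u * h u + indicator {0..1} u * h (- u) = 2 * (indicator {0..1} u * Im (sqrt_cut z * of_real (t * u\<^sup>2) ^ ((q + 1) div 2) / (z ^ ((q + 1) div 2) * (of_real (t * u\<^sup>2) - z))))"
      by (simp only: distrib_left[symmetric] mult.left_commute[of 2])
  qed
  finally show ?thesis using z T t by (simp add: psi_def T_def)
qed

lemma weight_integrable: "integrable lborel (\<lambda>t. indicator {0<..} t * (t powr (- (1 / 2)) / (1 + t)) :: real)"
proof (rule integrableI_bounded)
  have "(\<integral>\<^sup>+t. ennreal (norm (indicator {0<..} t * (t powr (- (1 / 2)) / (1 + t)) :: real)) \<partial>lborel) \<le>
    (\<integral>\<^sup>+t. ennreal (t powr (- (1 / 2))) * indicator {0..1} t + ennreal (t powr (- (3 / 2))) * indicator {1..} t \<partial>lborel)"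
  proof (rule nn_integral_mono)
    fix t :: real
    consider "t \<le> 0" | "0 < t" "t \<le> 1" | "t > 1" by linarith
    thus "ennreal (norm (indicator {0<..} t * (t powr (- (1 / 2)) / (1 + t)))) \<le> ennreal (t powr (- (1 / 2))) * indicator {0..1} t + ennreal (t powr (- (3 / 2))) * indicator {1..} t"
    proof cases
      case 2
      have "t powr (- (1 / 2)) / (1 + t) \<le> t powr (- (1 / 2)) / 1" using 2 by (intro divide_left_mono) auto
      thus ?thesis using 2 by (simp add: indicator_def ennreal_leI add_increasing2)
    next
      case 3
      have "t powr (- (1 / 2)) / (1 + t) \<le> t powr (- (1 / 2)) / t" using 3 by (intro divide_left_mono) auto
      also have "\<dots> = t powr (- (1 / 2)) * t powr (- 1)" using 3 by (simp add: powr_minus_divide)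
      also have "\<dots> = t powr (- (3 / 2))" unfolding powr_add[symmetric] by simp
      finally show ?thesis using 3 by (simp add: indicator_def ennreal_leI)
    qed simp
  qed
  also have "\<dots> = (\<integral>\<^sup>+t. ennreal (t powr (- (1 / 2))) * indicator {0..1} t \<partial>lborel) + (\<integral>\<^sup>+t. ennreal (t powr (- (3 / 2))) * indicator {1..} t \<partial>lborel)"
    by (rule nn_integral_add) measurable
  also have "(\<integral>\<^sup>+t. ennreal (t powr (- (1 / 2))) * indicator {0..1::real} t \<partial>lborel) = ennreal (1 powr (- (1 / 2) + 1) / (- (1 / 2) + 1))"
    by (rule nn_integral_has_integral_lebesgue', simp, rule has_integral_powr_from_0) auto
  also have "(\<integral>\<^sup>+t. ennreal (t powr (- (3 / 2))) * indicator {1::real..} t \<partial>lborel) = ennreal (- (1 powr (- (3 / 2) + 1)) / (- (3 / 2) + 1))"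
    by (rule nn_integral_has_integral_lebesgue', simp, rule has_integral_powr_to_inf) auto
  also have "ennreal (1 powr (- (1 / 2) + 1) / (- (1 / 2) + 1)) + ennreal (- (1 powr (- (3 / 2) + 1)) / (- (3 / 2) + 1)) < (\<infinity> :: ennreal)"
    by simp
  finally show "(\<integral>\<^sup>+t. ennreal (norm (indicator {0<..} t * (t powr (- (1 / 2)) / (1 + t)) :: real)) \<partial>lborel) < \<infinity>" .
qed measurable

text \<open>With \<open>s = sqrt t * u\<close>, a primitive is the logarithm of the Moebius map
  \<open>(w - s) / (w + s)\<close>, divided by \<open>w * u\<close>. For \<open>s > 0\<close> this
  map takes values in the upper half plane; the factor \<open>- \<i>\<close> in \<open>m\<close>
  turns them into the right half plane, away from the cut of \<open>Ln\<close>. The path runs from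
  \<open>- \<i>\<close> to \<open>\<i>\<close>, which gives the increment
  \<open>\<i> * pi\<close>.\<close>

lemma cauchy_kernel_integral:
  assumes z: "z \<notin> Rplus" and u: "u > 0" "u \<le> 1"
  shows "(\<integral>t. indicator {0<..} t *\<^sub>R (of_real (t powr (- (1 / 2))) / (of_real (t * u\<^sup>2) - z)) \<partial>lborel) = \<i> * of_real pi / (sqrt_cut z * of_real u)"
proof -
  define w where "w = sqrt_cut z"
  have w: "Im w > 0" "w \<noteq> 0" using sqrt_cut_Im[OF z] sub_ne(2)[OF z] by (auto simp: w_def)
  have zw: "z = w\<^sup>2" by (simp add: w_def sqrt_cut_sq)
  obtain c where c: "c > 0" "\<And>s. s \<ge> 0 \<Longrightarrow> c * (1 + s) \<le> cmod (of_real s - z)" using Rplus_distance[OF z] by metis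
  have ne: "of_real s - w \<noteq> 0" "of_real s + w \<noteq> 0" for s using sub_ne[OF z] by (auto simp: w_def)
  define m where "m = (\<lambda>s::real. - \<i> * ((w - of_real s) / (w + of_real s)))"
  have mpos: "Re (m s) > 0" if s: "s > 0" for s
  proof -
    have "Im ((w - of_real s) / (w + of_real s)) = (2 * s * Im w) / ((Re (w + of_real s))\<^sup>2 + (Im (w + of_real s))\<^sup>2)"
      by (simp add: Im_divide algebra_simps)
    moreover have "(Re (w + of_real s))\<^sup>2 + (Im (w + of_real s))\<^sup>2 > 0" using w by (simp add: add_nonneg_pos)
    ultimately have "Im ((w - of_real s) / (w + of_real s)) > 0" using s w by simp
    moreover have "Re (- \<i> * X) = Im X" for X by simp
    ultimately show ?thesis by (simp only: m_def)
  qed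
  define F where "F = (\<lambda>t. Ln (m (sqrt t * u)) / (w * of_real u))"
  have dF: "(F has_vector_derivative of_real (t powr (- (1 / 2))) / (of_real (t * u\<^sup>2) - z)) (at t)" if t: "t > 0" for t
  proof -
    define s where "s = sqrt t * u"
    have s: "s > 0" using t u by (simp add: s_def)
    have ds: "((\<lambda>t. complex_of_real (sqrt t * u)) has_vector_derivative of_real (inverse (sqrt t) / 2 * u)) (at t)"
      by (rule has_vector_derivative_of_real)
        (use t in \<open>auto intro!: derivative_eq_intros\<close>)
    have dm: "((\<lambda>s. - \<i> * ((w - s) / (w + s))) has_field_derivative - \<i> * (- 2 * w / (w + of_real s)\<^sup>2)) (at (of_real s))"
      using ne[of s] by (auto intro!: derivative_eq_intros simp: power2_eq_square add.commute algebra_simps)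
    have nn: "- \<i> * ((w - of_real s) / (w + of_real s)) \<notin> \<real>\<^sub>\<le>\<^sub>0"
      using mpos[OF s] unfolding m_def by (auto simp: complex_nonpos_Reals_iff)
    have dL: "((\<lambda>s. Ln (- \<i> * ((w - s) / (w + s)))) has_field_derivative (- \<i> * (- 2 * w / (w + of_real s)\<^sup>2)) / (- \<i> * ((w - of_real s) / (w + of_real s)))) (at (of_real s))"
      using DERIV_chain2[OF has_field_derivative_Ln[OF nn] dm] by (simp add: divide_inverse mult.commute)
    have e1: "(- \<i> * (- 2 * w / (w + of_real s)\<^sup>2)) / (- \<i> * ((w - of_real s) / (w + of_real s))) = 2 * w / (of_real (s\<^sup>2) - z)"
    proof -
      have "(w - of_real s) \<noteq> 0" "w + of_real s \<noteq> 0" using ne[of s] by (auto simp: add.commute)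
      moreover have "of_real (s\<^sup>2) - z = - ((w - of_real s) * (w + of_real s))" by (simp add: zw power2_eq_square algebra_simps)
      moreover have "(- \<i> * (- 2 * w / B\<^sup>2)) / (- \<i> * (A / B)) = 2 * w / (- (A * B))" if "A \<noteq> 0" "B \<noteq> 0" for A B
        using that by (simp add: field_simps power2_eq_square)
      ultimately show ?thesis by simp
    qed
    have "((\<lambda>t. Ln (- \<i> * ((w - of_real (sqrt t * u)) / (w + of_real (sqrt t * u))))) has_vector_derivative
        of_real (inverse (sqrt t) / 2 * u) * (2 * w / (of_real (s\<^sup>2) - z))) (at t)"
      using field_vector_diff_chain_at[OF ds, of "\<lambda>s. Ln (- \<i> * ((w - s) / (w + s)))" "2 * w / (of_real (s\<^sup>2) - z)"] dL[unfolded e1]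
      by (simp add: o_def s_def)
    hence "(F has_vector_derivative of_real (inverse (sqrt t) / 2 * u) * (2 * w / (of_real (s\<^sup>2) - z)) / (w * of_real u)) (at t)"
      unfolding F_def m_def by (rule has_vector_derivative_divide)
    moreover have "of_real (inverse (sqrt t) / 2 * u) * (2 * w / (of_real (s\<^sup>2) - z)) / (w * of_real u) = of_real (t powr (- (1 / 2))) / (of_real (t * u\<^sup>2) - z)"
    proof -
      have "s\<^sup>2 = t * u\<^sup>2" using t by (simp add: s_def power_mult_distrib)
      moreover have "inverse (sqrt t) = t powr (- (1 / 2))" using t by (simp add: powr_minus powr_half_sqrt)
      moreover have "of_real (p / 2 * u) * (2 * w / D) / (w * of_real u) = of_real p / D" for p D using w u by simp
      ultimately show ?thesis by simp
    qed
    ultimately show ?thesis by simp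
  qed
  have "(\<integral>t. indicator {0<..} t *\<^sub>R (of_real (t powr (- (1 / 2))) / (of_real (t * u\<^sup>2) - z)) \<partial>lborel) = (\<i> * of_real (pi / 2)) / (w * of_real u) - (- \<i> * of_real (pi / 2)) / (w * of_real u)"
  proof (rule FTC_Ioi[where F = F])
    show "(F has_vector_derivative of_real (t powr (- (1 / 2))) / (of_real (t * u\<^sup>2) - z)) (at t)" if "0 < t" for t
      using dF that .
    show "isCont (\<lambda>t. of_real (t powr (- (1 / 2))) / (of_real (t * u\<^sup>2) - z)) t" if t: "0 < t" for t
    proof -
      have "0 < c * (1 + t * u\<^sup>2)" using c t by (intro mult_pos_pos add_pos_nonneg) auto
      also have "\<dots> \<le> cmod (of_real (t * u\<^sup>2) - z)" using c(2)[of "t * u\<^sup>2"] t by simp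
      finally have "of_real (t * u\<^sup>2) - z \<noteq> 0" by auto
      thus ?thesis using t by (intro continuous_intros) auto
    qed
    have "Ln (- \<i>) = - \<i> * of_real (pi / 2)" by (simp add: Ln_minus_ii)
    have "((\<lambda>t. m (sqrt t * u)) \<longlongrightarrow> m (sqrt 0 * u)) (at_right 0)"
      unfolding m_def using w by (intro tendsto_intros) auto
    moreover have "m (sqrt 0 * u) = - \<i>" using w by (simp add: m_def)
    ultimately have "(F \<longlongrightarrow> Ln (- \<i>) / (w * of_real u)) (at_right 0)"
      unfolding F_def using w u by (intro tendsto_intros) (auto simp: complex_nonpos_Reals_iff)
    thus "(F \<longlongrightarrow> - \<i> * of_real (pi / 2) / (w * of_real u)) (at_right 0)" by (simp add: Ln_minus_ii)
    have inv: "((\<lambda>t. inverse (sqrt t * u)) \<longlongrightarrow> 0) at_top"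
      by (intro tendsto_inverse_0_at_top filterlim_at_top_mult_tendsto_pos[OF tendsto_const] sqrt_at_top u)
    have "((\<lambda>t. - \<i> * ((w * of_real (inverse (sqrt t * u)) - 1) / (w * of_real (inverse (sqrt t * u)) + 1))) \<longlongrightarrow> - \<i> * ((w * of_real 0 - 1) / (w * of_real 0 + 1))) at_top"
      by (intro tendsto_mult tendsto_divide tendsto_diff tendsto_add tendsto_const tendsto_of_real inv) simp
    moreover have "\<forall>\<^sub>F t in at_top. - \<i> * ((w * of_real (inverse (sqrt t * u)) - 1) / (w * of_real (inverse (sqrt t * u)) + 1)) = m (sqrt t * u)"
      using eventually_gt_at_top[of 0]
    proof eventually_elim
      case (elim t)
      define s where "s = sqrt t * u"
      have s: "s > 0" using elim u by (simp add: s_def)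
      have "w * of_real (inverse s) - 1 = (w - of_real s) * of_real (inverse s)" "w * of_real (inverse s) + 1 = (w + of_real s) * of_real (inverse s)"
        using s by (simp_all add: left_diff_distrib distrib_right)
      thus ?case using s unfolding s_def[symmetric] m_def by simp
    qed
    ultimately have "((\<lambda>t. m (sqrt t * u)) \<longlongrightarrow> \<i>) at_top" by (simp add: Lim_transform_eventually)
    hence "(F \<longlongrightarrow> Ln \<i> / (w * of_real u)) at_top"
      unfolding F_def using w u by (intro tendsto_intros) (auto simp: complex_nonpos_Reals_iff)
    thus "(F \<longlongrightarrow> \<i> * of_real (pi / 2) / (w * of_real u)) at_top" by (simp add: Ln_ii)
    show "integrable lborel (\<lambda>t. indicator {0<..} t *\<^sub>R (of_real (t powr (- (1 / 2))) / (of_real (t * u\<^sup>2) - z)))"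
    proof (rule Bochner_Integration.integrable_bound)
      show "integrable lborel (\<lambda>t. 1 / (c * u\<^sup>2) * (indicator {0<..} t * (t powr (- (1 / 2)) / (1 + t))))"
        by (intro integrable_mult_right weight_integrable)
      show "AE t in lborel. norm (indicator {0<..} t *\<^sub>R (of_real (t powr (- (1 / 2))) / (of_real (t * u\<^sup>2) - z))) \<le> norm (1 / (c * u\<^sup>2) * (indicator {0<..} t * (t powr (- (1 / 2)) / (1 + t))))"
      proof (rule AE_I2)
        fix t :: real
        show "norm (indicator {0<..} t *\<^sub>R (of_real (t powr (- (1 / 2))) / (of_real (t * u\<^sup>2) - z))) \<le> norm (1 / (c * u\<^sup>2) * (indicator {0<..} t * (t powr (- (1 / 2)) / (1 + t))))"
        proof (cases "t > 0")
          case True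
          have u2: "u\<^sup>2 \<le> 1" "u\<^sup>2 > 0" using u by (auto intro: power_le_one)
          have "u\<^sup>2 * (1 + t) \<le> 1 + t * u\<^sup>2" using u2 by (simp add: algebra_simps)
          hence "c * (u\<^sup>2 * (1 + t)) \<le> c * (1 + t * u\<^sup>2)" using c by (intro mult_left_mono) auto
          hence "c * u\<^sup>2 * (1 + t) \<le> c * (1 + t * u\<^sup>2)" by (simp only: mult.assoc)
          also have "\<dots> \<le> cmod (of_real (t * u\<^sup>2) - z)" using c(2)[of "t * u\<^sup>2"] True by simp
          finally have "t powr (- (1 / 2)) / cmod (of_real (t * u\<^sup>2) - z) \<le> t powr (- (1 / 2)) / (c * u\<^sup>2 * (1 + t))"
            using c u2 True by (intro frac_le) auto
          thus ?thesis using True c by (simp add: norm_divide)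
        qed simp
      qed
    qed measurable
  qed
  also have "\<dots> = \<i> * of_real pi / (sqrt_cut z * of_real u)" by (simp add: w_def diff_divide_distrib[symmetric])
  finally show ?thesis .
qed

text \<open>The derivative formula for \<open>Kern\<close> along the segment from 0 to
  \<open>x\<close>, with the parameter replaced by \<open>u\<^sup>2\<close>; the integral is the
  increment from the value 0 at \<open>u = 0\<close>.\<close>

lemma Kern_unit_integral:
  assumes z: "z \<notin> Rplus" and x: "x > 0"
  shows "(\<integral>u. indicator {0..1} u * Re (of_real (u ^ (2 * k + 1)) / (z ^ k * (of_real (x * u\<^sup>2) - z))) \<partial>lborel) = Kern k x z / (2 * x ^ (k + 1))"
proof -
  define f where "f = (\<lambda>u::real. Re (of_real (u ^ (2 * k + 1)) / (z ^ k * (of_real (x * u\<^sup>2) - z))))"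
  have z0: "z \<noteq> 0" using z by (auto simp: Rplus_iff)
  have ne: "of_real s - z \<noteq> 0" if "s \<ge> 0" for s using z that by (auto simp: Rplus_iff complex_eq_iff)
  have "(\<integral>u. indicator {0..1} u *\<^sub>R f u \<partial>lborel) = Kern k (1\<^sup>2 * x) z / (2 * x ^ (k + 1)) - Kern k (0\<^sup>2 * x) z / (2 * x ^ (k + 1))"
  proof (rule integral_FTC_atLeastAtMost)
    show "continuous_on {0..1} f" unfolding f_def
      using z0 x by (intro continuous_intros) (auto dest: ne[rotated] simp: ne[of "x * _\<^sup>2", simplified])
    fix u :: real
    have d2: "((\<lambda>u. u\<^sup>2) has_real_derivative 2 * u) (at u)" by (auto intro!: derivative_eq_intros)
    have "z \<noteq> of_real (u\<^sup>2 * x)" using ne[of "u\<^sup>2 * x"] x by auto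
    from DERIV_chain2[OF Kern_DERIV[OF z0 this] d2]
    have "((\<lambda>u. Kern k (u\<^sup>2 * x) z / (2 * x ^ (k + 1))) has_real_derivative Re (of_real (x * (u\<^sup>2 * x) ^ k) / (z ^ k * (of_real (u\<^sup>2 * x) - z))) * (2 * u) / (2 * x ^ (k + 1))) (at u)"
      by (rule DERIV_cdivide)
    also have "Re (of_real (x * (u\<^sup>2 * x) ^ k) / (z ^ k * (of_real (u\<^sup>2 * x) - z))) * (2 * u) / (2 * x ^ (k + 1)) = f u"
    proof -
      have "Re (of_real a / D) = a * Re (1 / D)" for a D using Re_of_real_mult(1)[of a "1 / D"] by simp
      moreover have "x * (u\<^sup>2 * x) ^ k * R * (2 * u) / (2 * x ^ (k + 1)) = u ^ (2 * k + 1) * R" for R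
      proof -
        have "(u\<^sup>2 * x) ^ k = u ^ (2 * k) * x ^ k" by (simp add: power_mult_distrib power_mult)
        thus ?thesis using x by (simp add: field_simps)
      qed
      ultimately show ?thesis unfolding f_def by (simp only: mult.commute[of x])
    qed
    finally show "((\<lambda>u. Kern k (u\<^sup>2 * x) z / (2 * x ^ (k + 1))) has_vector_derivative f u) (at u within {0..1})"
      by (simp add: has_real_derivative_iff_has_vector_derivative has_vector_derivative_at_within)
  qed simp
  thus ?thesis by (simp add: f_def)
qed

lemma Im_of_real_mult: "Im (of_real r * z) = r * Im z"
  by simp

lemma pv_off_Rplus:
  assumes z: "z \<notin> Rplus" and x: "x > 0" and q: "(q + 1) div 2 = k \<or> (q + 1) div 2 = k + 1"
  shows "(pv_trunc (\<lambda>t. psi q z t / t ^ (k + 1)) x \<longlongrightarrow> Kern k x z / x ^ (k + 1)) (at_right 0)"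
proof -
  define w where "w = sqrt_cut z"
  have w: "w \<noteq> 0" using sub_ne(2)[OF z] by (auto simp: w_def)
  have z0: "z \<noteq> 0" using z by (auto simp: Rplus_iff)
  obtain c where c: "c > 0" "\<And>s. s \<ge> 0 \<Longrightarrow> c * (1 + s) \<le> cmod (of_real s - z)" using Rplus_distance[OF z] by metis
  have ne: "of_real s - z \<noteq> 0" if "s \<ge> 0" for s using z that by (auto simp: Rplus_iff complex_eq_iff)
  define j where "j = (q + 1) div 2"
  have jk: "j = k \<or> j = k + 1" using q by (simp add: j_def)
  have nt: "complex_of_real (t * u\<^sup>2) - z \<noteq> 0" if "t \<ge> 0" for t u using ne[of "t * u\<^sup>2"] that by simp
  \<comment> \<open>\<open>t ^ (j - k)\<close> is 1 for \<open>j = k\<close> and \<open>t\<close>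
    for \<open>j = k + 1\<close>. Although \<open>P\<close> differs in the two cases, its difference
    quotient at \<open>x\<close> leads to the same \<open>Q\<close>.\<close>
  define P where "P = (\<lambda>t. \<integral>u. indicator {0..1} u * Im (w * of_real (u ^ (2 * j) * t ^ (j - k)) / (z ^ j * (of_real (t * u\<^sup>2) - z))) \<partial>lborel)"
  define N where "N = (\<lambda>u::real. w * of_real (u ^ (2 * k + 2)) / z ^ k)"
  define Q where "Q = (\<lambda>t u. N u / ((of_real (t * u\<^sup>2) - z) * (of_real (x * u\<^sup>2) - z)))"
  define R where "R = (\<lambda>t. \<integral>u. indicator {0..1} u * Im (Q t u) \<partial>lborel)"
  have psi_P: "psi q z t / t ^ (k + 1) = 2 / pi * (t powr (- (1 / 2)) * P t)" if t: "t > 0" for t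
  proof -
    have "psi q z t = 2 / pi * sqrt t * (\<integral>u. indicator {0..1} u * Im (w * of_real (t * u\<^sup>2) ^ j / (z ^ j * (of_real (t * u\<^sup>2) - z))) \<partial>lborel)"
      unfolding psi_unit_integral[OF z t] w_def j_def ..
    also have "(\<integral>u. indicator {0..1} u * Im (w * of_real (t * u\<^sup>2) ^ j / (z ^ j * (of_real (t * u\<^sup>2) - z))) \<partial>lborel) =
       (\<integral>u. t ^ k * (indicator {0..1} u * Im (w * of_real (u ^ (2 * j) * t ^ (j - k)) / (z ^ j * (of_real (t * u\<^sup>2) - z)))) \<partial>lborel)"
    proof (intro Bochner_Integration.integral_cong refl)
      fix u :: real
      have "(t * u\<^sup>2) ^ j = t ^ j * u ^ (2 * j)" by (simp only: power_mult_distrib power_mult)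
      also have "t ^ j = t ^ k * t ^ (j - k)" using jk by (auto simp: power_add[symmetric])
      finally have "(t * u\<^sup>2) ^ j = t ^ k * (u ^ (2 * j) * t ^ (j - k))" by (simp only: mult.assoc mult.commute[of "t ^ (j - k)"])
      hence e: "complex_of_real (t * u\<^sup>2) ^ j = of_real (t ^ k) * of_real (u ^ (2 * j) * t ^ (j - k))"
        by (simp only: of_real_power[symmetric] of_real_mult[symmetric])
      have "w * of_real (t * u\<^sup>2) ^ j / (z ^ j * (of_real (t * u\<^sup>2) - z)) = of_real (t ^ k) * (w * of_real (u ^ (2 * j) * t ^ (j - k)) / (z ^ j * (of_real (t * u\<^sup>2) - z)))"
        by (simp only: e mult.left_commute[of w] times_divide_eq_right[symmetric])
      hence "Im (w * of_real (t * u\<^sup>2) ^ j / (z ^ j * (of_real (t * u\<^sup>2) - z))) = t ^ k * Im (w * of_real (u ^ (2 * j) * t ^ (j - k)) / (z ^ j * (of_real (t * u\<^sup>2) - z)))"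
        by (simp only: Im_of_real_mult)
      thus "indicator {0..1} u * Im (w * of_real (t * u\<^sup>2) ^ j / (z ^ j * (of_real (t * u\<^sup>2) - z))) = t ^ k * (indicator {0..1} u * Im (w * of_real (u ^ (2 * j) * t ^ (j - k)) / (z ^ j * (of_real (t * u\<^sup>2) - z))))"
        by simp
    qed
    also have "\<dots> = t ^ k * P t" by (simp add: P_def)
    finally have "psi q z t / t ^ (k + 1) = 2 / pi * (sqrt t / t * P t)" using t by simp
    also have "sqrt t / t = inverse (sqrt t)" using t by (simp add: field_simps)
    also have "inverse (sqrt t) = t powr (- (1 / 2))" using t by (simp add: powr_minus powr_half_sqrt)
    finally show ?thesis .
  qed
  have cP: "integrable lborel (\<lambda>u. indicator {0..1} u * Im (w * of_real (u ^ (2 * j) * t ^ (j - k)) / (z ^ j * (of_real (t * u\<^sup>2) - z))))"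
    and cQ: "integrable lborel (\<lambda>u. indicator {0..1} u * Im (Q t u))" if "t \<ge> 0" for t
    unfolding Q_def N_def
    by (intro Icc_integrable continuous_intros ballI; simp only: mult_eq_0_iff power_eq_0_iff nt[OF that] nt[OF less_imp_le[OF x]] z0 simp_thms)+
  have PR: "P t = P x + (x - t) * R t" if t: "t > 0" for t
  proof -
    have "P t - P x = (\<integral>u. (x - t) * (indicator {0..1} u * Im (Q t u)) \<partial>lborel)"
      unfolding P_def Bochner_Integration.integral_diff[OF cP[OF less_imp_le[OF t]] cP[OF less_imp_le[OF x]], symmetric]
    proof (intro Bochner_Integration.integral_cong refl)
      fix u :: real
      define A B where "A = complex_of_real (t * u\<^sup>2) - z" and "B = complex_of_real (x * u\<^sup>2) - z"
      have AB: "A \<noteq> 0" "B \<noteq> 0" unfolding A_def B_def by (rule nt; use t x in simp)+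
      have "w * of_real (u ^ (2 * j) * t ^ (j - k)) / (z ^ j * A) - w * of_real (u ^ (2 * j) * x ^ (j - k)) / (z ^ j * B) = of_real (x - t) * Q t u"
        using jk
      proof
        assume j: "j = k"
        have al: "w * U / (Z * A) - w * U / (Z * B) = of_real (x - t) * (w * (U * of_real (u\<^sup>2)) / Z / (A * B))" if "Z \<noteq> 0" for U Z
        proof -
          have "w * U / (Z * A) - w * U / (Z * B) = w * U / Z * ((B - A) / (A * B))" using AB that by (simp add: field_simps)
          also have "B - A = of_real (x - t) * of_real (u\<^sup>2)" by (simp add: A_def B_def algebra_simps)
          finally show ?thesis by simp
        qed
        have "Q t u = w * (of_real (u ^ (2 * k)) * of_real (u\<^sup>2)) / z ^ k / (A * B)"
          unfolding Q_def N_def A_def B_def by (simp only: power_add of_real_mult)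
        thus ?thesis unfolding j diff_self_eq_0 power_0 mult_1_right using al[of "z ^ k" "of_real (u ^ (2 * k))"] z0 by simp
      next
        assume j: "j = k + 1"
        have al: "w * (U * of_real t) / (z * Z * A) - w * (U * of_real x) / (z * Z * B) = of_real (x - t) * (w * U / Z / (A * B))" if "Z \<noteq> 0" for U Z
        proof -
          have "w * (U * of_real t) / (z * Z * A) - w * (U * of_real x) / (z * Z * B) = w * U / (z * Z) * ((of_real t * B - of_real x * A) / (A * B))"
            using AB that z0 by (simp add: field_simps)
          also have "of_real t * B - of_real x * A = of_real (x - t) * z" by (simp add: A_def B_def algebra_simps)
          finally show ?thesis using z0 by simp
        qed
        have e: "Q t u = w * of_real (u ^ (2 * k + 2)) / z ^ k / (A * B)"
          unfolding Q_def N_def A_def B_def ..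
        have e2: "complex_of_real (u ^ (2 * j) * s ^ (j - k)) = of_real (u ^ (2 * k + 2)) * of_real s" for s by (simp add: j)
        show ?thesis unfolding e e2 unfolding j using al[of "z ^ k" "of_real (u ^ (2 * k + 2))"] z0 by simp
      qed
      hence "Im (w * of_real (u ^ (2 * j) * t ^ (j - k)) / (z ^ j * A)) - Im (w * of_real (u ^ (2 * j) * x ^ (j - k)) / (z ^ j * B)) = (x - t) * Im (Q t u)"
        by (simp only: minus_complex.sel[symmetric] Im_of_real_mult)
      thus "indicator {0..1} u * Im (w * of_real (u ^ (2 * j) * t ^ (j - k)) / (z ^ j * (of_real (t * u\<^sup>2) - z))) -
         indicator {0..1} u * Im (w * of_real (u ^ (2 * j) * x ^ (j - k)) / (z ^ j * (of_real (x * u\<^sup>2) - z))) = (x - t) * (indicator {0..1} u * Im (Q t u))"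
        unfolding A_def[symmetric] B_def[symmetric] by (simp only: right_diff_distrib[symmetric] mult.left_commute[of "x - t"])
    qed
    thus ?thesis by (simp add: R_def)
  qed
  define M where "M = cmod w / cmod z ^ k / (c * c)"
  have M: "M \<ge> 0" using c by (simp add: M_def)
  \<comment> \<open>The factor \<open>u ^ (2 * k + 2) \<le> u\<^sup>2\<close> pays for the loss of
    decay as \<open>u\<close> tends to 0: on the unit interval
    \<open>u\<^sup>2 * (1 + t) \<le> 1 + t * u\<^sup>2\<close>, so the bound is uniform in
    \<open>u\<close>.\<close>
  have Qb: "cmod (Q t u) \<le> M * (1 / (1 + t))" if t: "t > 0" and u: "u \<in> {0..1}" for t u
  proof -
    have u2: "u\<^sup>2 \<le> 1" using u by (auto intro: power_le_one)
    have "u ^ (2 * k + 2) = (u\<^sup>2) ^ k * u\<^sup>2" by (simp add: power_mult power2_eq_square)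
    also have "\<dots> \<le> 1 * u\<^sup>2" by (rule mult_right_mono[OF power_le_one[OF zero_le_power2 u2] zero_le_power2])
    finally have uk: "u ^ (2 * k + 2) \<le> u\<^sup>2" by simp
    have "c * (1 + 0) \<le> c * (1 + x * u\<^sup>2)" using c x by (intro mult_left_mono) auto
    also have "\<dots> \<le> cmod (of_real (x * u\<^sup>2) - z)" using c(2)[of "x * u\<^sup>2"] x by simp
    finally have cx: "c \<le> cmod (of_real (x * u\<^sup>2) - z)" by simp
    have ct: "c * (1 + t * u\<^sup>2) \<le> cmod (of_real (t * u\<^sup>2) - z)" using c(2)[of "t * u\<^sup>2"] t by simp
    have p: "1 + t * u\<^sup>2 > 0" using t by (simp add: add_pos_nonneg)
    have "cmod (Q t u) = (cmod w * u ^ (2 * k + 2) / cmod z ^ k) / (cmod (of_real (t * u\<^sup>2) - z) * cmod (of_real (x * u\<^sup>2) - z))"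
    proof -
      have "\<bar>u ^ (2 * k + 2)\<bar> = u ^ (2 * k + 2)" using u by simp
      thus ?thesis unfolding Q_def N_def by (simp only: norm_divide norm_mult norm_power[of z] norm_of_real)
    qed
    also have "\<dots> \<le> (cmod w * u\<^sup>2 / cmod z ^ k) / ((c * (1 + t * u\<^sup>2)) * c)"
      using c p cx ct uk u by (intro frac_le mult_mono divide_right_mono mult_left_mono) auto
    also have "\<dots> = M * (u\<^sup>2 / (1 + t * u\<^sup>2))" by (simp add: M_def)
    also have "u\<^sup>2 / (1 + t * u\<^sup>2) \<le> 1 / (1 + t)"
    proof -
      have "u\<^sup>2 * (1 + t) \<le> 1 + t * u\<^sup>2" using u2 by (simp add: algebra_simps)
      moreover have "1 + t > 0" using t by simp
      ultimately show ?thesis by (simp add: pos_divide_le_eq[OF p] pos_le_divide_eq)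
    qed
    finally show ?thesis using M by (simp add: mult_left_mono)
  qed
  define h where "h = (\<lambda>t u. indicator {0<..} t * (t powr (- (1 / 2)) * (indicator {0..1} u * Im (Q t u))))"
  define W where "W = (\<lambda>t. M * (indicator {0<..} t * (t powr (- (1 / 2)) / (1 + t))))"
  have Wi: "integrable lborel W" unfolding W_def by (intro integrable_mult_right weight_integrable)
  have W0: "W t \<ge> 0" for t using M by (auto simp: W_def indicator_def)
  have bnd: "indicator {0<..} t * (t powr (- (1 / 2)) * cmod (Q t u)) \<le> W t" if u: "u \<in> {0..1}" for t u
  proof (cases "t > 0")
    case True
    have "t powr (- (1 / 2)) * cmod (Q t u) \<le> t powr (- (1 / 2)) * (M * (1 / (1 + t)))"
      using Qb[OF True u] by (intro mult_left_mono) auto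
    thus ?thesis using True by (simp add: W_def mult.commute mult.left_commute)
  qed (use W0[of t] in simp)
  have hm [measurable]: "case_prod h \<in> borel_measurable (lborel \<Otimes>\<^sub>M lborel)"
    unfolding h_def Q_def N_def split_def by measurable
  have hb: "\<bar>h t u\<bar> \<le> W t * indicator {0..1} u" for t u
  proof (cases "u \<in> {0..1}")
    case True
    have "\<bar>h t u\<bar> = indicator {0<..} t * (t powr (- (1 / 2)) * \<bar>Im (Q t u)\<bar>)" using True by (simp add: h_def abs_mult)
    also have "\<dots> \<le> indicator {0<..} t * (t powr (- (1 / 2)) * cmod (Q t u))"
      by (intro mult_left_mono abs_Im_le_cmod) auto
    also have "\<dots> \<le> W t" by (rule bnd[OF True])
    finally show ?thesis using True by simp
  qed (simp add: h_def)
  have hi: "integrable (lborel \<Otimes>\<^sub>M lborel) (case_prod h)"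
  proof (rule integrableI_bounded[OF hm])
    have "(\<integral>\<^sup>+tu. ennreal (norm (case_prod h tu)) \<partial>(lborel \<Otimes>\<^sub>M lborel)) = (\<integral>\<^sup>+t. \<integral>\<^sup>+u. ennreal (norm (h t u)) \<partial>lborel \<partial>lborel)"
      by (subst lborel.nn_integral_fst[symmetric]) auto
    also have "\<dots> \<le> (\<integral>\<^sup>+t. \<integral>\<^sup>+u. ennreal (W t) * indicator {0..1::real} u \<partial>lborel \<partial>lborel)"
    proof (intro nn_integral_mono)
      fix t u :: real
      show "ennreal (norm (h t u)) \<le> ennreal (W t) * indicator {0..1} u"
        using ennreal_leI[OF hb[of t u]] by (cases "u \<in> {0..1}") auto
    qed
    also have "\<dots> = (\<integral>\<^sup>+t. ennreal (norm (W t)) \<partial>lborel)"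
      using W0 by (simp add: nn_integral_cmult)
    also have "\<dots> < \<infinity>" using Wi by (simp only: integrable_iff_bounded)
    finally show "(\<integral>\<^sup>+tu. ennreal (norm (case_prod h tu)) \<partial>(lborel \<Otimes>\<^sub>M lborel)) < \<infinity>" .
  qed
  define G where "G = (\<lambda>t. indicator {0<..} t * (t powr (- (1 / 2)) * R t))"
  have hG: "(\<integral>u. h t u \<partial>lborel) = G t" for t by (simp add: h_def G_def R_def)
  have Gi: "integrable lborel G" using lborel_pair.integrable_fst'[OF hi] by (simp add: hG)
  have "(\<integral>t. G t \<partial>lborel) = (\<integral>u. (\<integral>t. h t u \<partial>lborel) \<partial>lborel)"
    using lborel_pair.Fubini_integral[OF hi] by (simp add: hG)
  also have "\<dots> = (\<integral>u. pi * (indicator {0..1} u * Re (of_real (u ^ (2 * k + 1)) / (z ^ k * (of_real (x * u\<^sup>2) - z)))) \<partial>lborel)"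
  \<comment> \<open>The Cauchy kernel integral requires \<open>u > 0\<close>; the single point 0
    does not affect the outer integral.\<close>
  proof (rule integral_discrete_difference[of "{0}"])
    fix u :: real assume "u \<notin> {0}"
    show "(\<integral>t. h t u \<partial>lborel) = pi * (indicator {0..1} u * Re (of_real (u ^ (2 * k + 1)) / (z ^ k * (of_real (x * u\<^sup>2) - z))))"
    proof (cases "u \<in> {0..1}")
      case True
      hence u: "0 < u" "u \<le> 1" using \<open>u \<notin> {0}\<close> by auto
      define D where "D = complex_of_real (x * u\<^sup>2) - z"
      have D: "D \<noteq> 0" unfolding D_def by (rule nt) (use x in simp)
      define g where "g = (\<lambda>t. indicator {0<..} t *\<^sub>R (of_real (t powr (- (1 / 2))) * Q t u))"
      have gi: "integrable lborel g"
      proof (rule Bochner_Integration.integrable_bound[OF Wi])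
        show "g \<in> borel_measurable lborel" unfolding g_def Q_def N_def by measurable
        show "AE t in lborel. norm (g t) \<le> norm (W t)"
        proof (rule AE_I2)
          fix t :: real
          have "norm (g t) = indicator {0<..} t * (t powr (- (1 / 2)) * cmod (Q t u))" by (simp add: g_def norm_mult)
          thus "norm (g t) \<le> norm (W t)" using bnd[OF True, of t] W0[of t] by simp
        qed
      qed
      have "(\<integral>t. h t u \<partial>lborel) = (\<integral>t. Im (g t) \<partial>lborel)"
        using True by (intro Bochner_Integration.integral_cong refl) (simp add: h_def g_def)
      also have "\<dots> = Im (\<integral>t. g t \<partial>lborel)" by (rule integral_bounded_linear[OF bounded_linear_Im gi])
      also have "(\<integral>t. g t \<partial>lborel) = (\<integral>t. N u / D * (indicator {0<..} t *\<^sub>R (of_real (t powr (- (1 / 2))) / (of_real (t * u\<^sup>2) - z))) \<partial>lborel)"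
      proof (intro Bochner_Integration.integral_cong refl)
        fix t :: real
        have "p * (n / (A * D)) = n / D * (p / A)" for p n A by (simp add: mult.commute)
        thus "g t = N u / D * (indicator {0<..} t *\<^sub>R (of_real (t powr (- (1 / 2))) / (of_real (t * u\<^sup>2) - z)))"
          unfolding g_def Q_def D_def[symmetric] mult_scaleR_right by (simp only:)
      qed
      also have "\<dots> = N u / D * (\<i> * of_real pi / (w * of_real u))"
        unfolding integral_mult_right_zero cauchy_kernel_integral[OF z u] w_def ..
      also have "\<dots> = \<i> * (of_real pi * (of_real (u ^ (2 * k + 1)) / (z ^ k * D)))"
      proof -
        have Nu: "N u = w * of_real u * (of_real (u ^ (2 * k + 1)) / z ^ k)" by (simp add: N_def)
        have al: "w * of_real u * X / D * (\<i> * of_real pi / (w * of_real u)) = \<i> * (of_real pi * (X / D))" for X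
          using w u by simp
        show ?thesis unfolding Nu al divide_divide_eq_left ..
      qed
      also have "Im \<dots> = pi * Re (of_real (u ^ (2 * k + 1)) / (z ^ k * D))"
      proof -
        have "Im (\<i> * (of_real pi * X)) = pi * Re X" for X by simp
        thus ?thesis .
      qed
      finally show ?thesis using True by (simp add: D_def)
    qed (simp add: h_def)
  qed auto
  also have "\<dots> = pi * (Kern k x z / (2 * x ^ (k + 1)))"
    unfolding integral_mult_right_zero Kern_unit_integral[OF z x] ..
  finally have G_int: "2 / pi * (\<integral>t. G t \<partial>lborel) = Kern k x z / x ^ (k + 1)" by simp
  have pv_eq: "pv_trunc (\<lambda>t. psi q z t / t ^ (k + 1)) x \<epsilon> = 2 / pi * (P x * pv_trunc (\<lambda>t. t powr (- (1 / 2))) x \<epsilon> + (\<integral>t. indicator (pv_dom x \<epsilon>) t * G t \<partial>lborel))"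
    if \<epsilon>: "0 < \<epsilon>" "\<epsilon> < x" for \<epsilon>
  proof -
    have i1: "integrable lborel (\<lambda>t. P x * (indicator (pv_dom x \<epsilon>) t * (t powr (- (1 / 2)) / (x - t))))"
      by (intro integrable_mult_right nn_bound_integrable[of _ x \<epsilon> 1] \<epsilon>) auto
    have i2: "integrable lborel (\<lambda>t. indicator (pv_dom x \<epsilon>) t * G t)"
      using integrable_mult_indicator[OF _ Gi, of "pv_dom x \<epsilon>"] by simp
    have "pv_trunc (\<lambda>t. psi q z t / t ^ (k + 1)) x \<epsilon> = (\<integral>t. 2 / pi * (P x * (indicator (pv_dom x \<epsilon>) t * (t powr (- (1 / 2)) / (x - t))) + indicator (pv_dom x \<epsilon>) t * G t) \<partial>lborel)"
      unfolding pv_trunc_eq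
    proof (intro Bochner_Integration.integral_cong refl)
      fix t :: real
      show "indicator (pv_dom x \<epsilon>) t * (psi q z t / t ^ (k + 1) / (x - t)) = 2 / pi * (P x * (indicator (pv_dom x \<epsilon>) t * (t powr (- (1 / 2)) / (x - t))) + indicator (pv_dom x \<epsilon>) t * G t)"
      proof (cases "t \<in> pv_dom x \<epsilon>")
        case True
        hence t: "t > 0" "x - t \<noteq> 0" using \<epsilon> by auto
        have "2 / pi * (a * (p + d * r)) / d = 2 / pi * (p * (a / d) + a * r)" if "d \<noteq> 0" for a p d r :: real
          using that by (simp add: field_simps)
        from this[OF t(2), of "t powr (- (1 / 2))" "P x" "R t"] show ?thesis
          unfolding psi_P[OF t(1)] PR[OF t(1)] indicator_simps(1)[OF True] using t by (simp add: G_def)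
      qed simp
    qed
    also have "\<dots> = 2 / pi * (P x * pv_trunc (\<lambda>t. t powr (- (1 / 2))) x \<epsilon> + (\<integral>t. indicator (pv_dom x \<epsilon>) t * G t \<partial>lborel))"
      unfolding integral_mult_right_zero Bochner_Integration.integral_add[OF i1 i2] pv_trunc_eq ..
    finally show ?thesis .
  qed
  have lim: "((\<lambda>\<epsilon>. \<integral>t. indicator (pv_dom x \<epsilon>) t * G t \<partial>lborel) \<longlongrightarrow> (\<integral>t. G t \<partial>lborel)) (at_right 0)"
  proof (rule tendsto_at_right_sequentially[of 0 x])
    show "0 < x" by (rule x)
    fix S :: "nat \<Rightarrow> real" assume S: "\<And>n. 0 < S n" "S \<longlonglongrightarrow> 0"
    show "(\<lambda>n. \<integral>t. indicator (pv_dom x (S n)) t * G t \<partial>lborel) \<longlonglongrightarrow> (\<integral>t. G t \<partial>lborel)"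
    proof (rule integral_dominated_convergence[where w = "\<lambda>t. \<bar>G t\<bar>"])
      show Gm: "G \<in> borel_measurable lborel" using Gi by auto
      show "(\<lambda>t. indicator (pv_dom x (S n)) t * G t) \<in> borel_measurable lborel" for n
        by (intro borel_measurable_times Gm) auto
      show "integrable lborel (\<lambda>t. \<bar>G t\<bar>)" using Gi by (rule integrable_abs)
      show "AE t in lborel. norm (indicator (pv_dom x (S n)) t * G t) \<le> \<bar>G t\<bar>" for n
        by (rule AE_I2) (auto simp: indicator_def)
      have "AE t in lborel. t \<noteq> x" using AE_lborel_singleton by blast
      thus "AE t in lborel. (\<lambda>n. indicator (pv_dom x (S n)) t * G t) \<longlonglongrightarrow> G t"
      proof eventually_elim
        case (elim t)
        hence "\<forall>\<^sub>F n in sequentially. S n < \<bar>t - x\<bar>" by (intro order_tendstoD(2)[OF S(2)]) simp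
        hence "\<forall>\<^sub>F n in sequentially. indicator (pv_dom x (S n)) t * G t = G t"
        proof eventually_elim
          case (elim n)
          show ?case
          proof (cases "t > 0")
            case True
            have "t \<in> pv_dom x (S n)" using True elim by auto
            thus ?thesis by simp
          qed (simp add: G_def)
        qed
        thus ?case by (rule tendsto_eventually)
      qed
    qed
  qed
  have "((\<lambda>\<epsilon>. 2 / pi * (P x * pv_trunc (\<lambda>t. t powr (- (1 / 2))) x \<epsilon> + (\<integral>t. indicator (pv_dom x \<epsilon>) t * G t \<partial>lborel))) \<longlongrightarrow> 2 / pi * (P x * 0 + (\<integral>t. G t \<partial>lborel))) (at_right 0)"
    by (intro tendsto_intros lim pv_inverse_sqrt x)
  moreover have "\<forall>\<^sub>F \<epsilon> in at_right 0. 2 / pi * (P x * pv_trunc (\<lambda>t. t powr (- (1 / 2))) x \<epsilon> + (\<integral>t. indicator (pv_dom x \<epsilon>) t * G t \<partial>lborel)) = pv_trunc (\<lambda>t. psi q z t / t ^ (k + 1)) x \<epsilon>"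
    by (rule eventually_mono[OF eventually_at_right_real[OF x]]) (intro pv_eq[symmetric]; simp)
  ultimately have "(pv_trunc (\<lambda>t. psi q z t / t ^ (k + 1)) x \<longlongrightarrow> 2 / pi * (P x * 0 + (\<integral>t. G t \<partial>lborel))) (at_right 0)"
    by (rule Lim_transform_eventually)
  thus ?thesis by (simp only: mult_zero_right add_0_left G_int)
qed

section \<open>Completely regular growth\<close>

text \<open>\<open>psi\<close> merges the swept mass and the mass already on the ray into one
  integrand. Splitting the integral back needs both summands integrable, because a non-integrable
  one would silently count as 0; finiteness of the measure on the disc settles the second summand
  and, by subtraction, the first.\<close>

lemma bal_dist_eq:
  assumes sets [measurable_cong]: "sets \<nu> = sets borel" and t: "t \<ge> 0"
    and int: "integrable \<nu> (\<lambda>z. psi q z t)" and fin: "emeasure \<nu> (cball 0 t) < \<infinity>"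
  shows "bal_dist q \<nu> t = (\<integral>z. psi q z t \<partial>\<nu>)"
proof -
  define I where "I = complex_of_real ` {0..t}"
  have I_iff: "z \<in> I \<longleftrightarrow> z \<in> Rplus \<and> Re z \<le> t" for z
    unfolding I_def by (auto simp: Rplus_iff image_iff complex_eq_iff)
  have "I = Rplus \<inter> {z. Re z \<le> t}" using I_iff by blast
  also have "\<dots> \<in> sets borel" by measurable
  finally have [measurable]: "I \<in> sets borel" .
  have "I \<subseteq> cball 0 t" by (auto simp: I_def)
  hence "emeasure \<nu> I \<le> emeasure \<nu> (cball 0 t)" by (intro emeasure_mono) (auto simp: sets)
  hence fI: "emeasure \<nu> I < \<infinity>" using fin by (rule le_less_trans)
  have spl: "psi q z t = indicator (UNIV - Rplus) z *\<^sub>R Omega q z I + indicator I z" for z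
  proof (cases "z \<in> Rplus")
    case True
    thus ?thesis using I_iff[of z] by (auto simp: psi_def indicator_def)
  next
    case False
    thus ?thesis using I_iff[of z] Omega_eq_psi[OF False t] by (simp add: I_def)
  qed
  have i2: "integrable \<nu> (\<lambda>z. indicator I z :: real)" using fI by (intro integrable_real_indicator) (auto simp: sets)
  have "integrable \<nu> (\<lambda>z. psi q z t - indicator I z)" by (rule Bochner_Integration.integrable_diff[OF int i2])
  hence i1: "integrable \<nu> (\<lambda>z. indicator (UNIV - Rplus) z *\<^sub>R Omega q z I)" by (simp add: spl)
  have "I \<inter> Rplus = I" using I_iff by blast
  hence "bal_dist q \<nu> t = (\<integral>z. indicator (UNIV - Rplus) z *\<^sub>R Omega q z I \<partial>\<nu>) + (\<integral>z. indicator I z \<partial>\<nu>)"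
    using sets_eq_imp_space_eq[OF sets]
    by (simp add: bal_dist_def balayage_def I_def[symmetric] set_lebesgue_integral_def)
  also have "\<dots> = (\<integral>z. psi q z t \<partial>\<nu>)"
    unfolding spl by (rule Bochner_Integration.integral_add[OF i1 i2, symmetric])
  finally show ?thesis .
qed

theorem principal_value_representation:
  assumes v: "subharmonic v" "\<exists>z. v z \<noteq> -\<infinity>" "finite_type_order v p" "p > 0"
    and rm: "is_riesz_measure v \<nu>" and r0: "r0 > 0" "emeasure \<nu> (ball 0 r0) = 0"
  defines "k \<equiv> nat \<lfloor>p\<rfloor>" and "f \<equiv> (\<lambda>t. bal_dist (nat \<lfloor>2 * p\<rfloor>) \<nu> t / t ^ (nat \<lfloor>p\<rfloor> + 1))"
  obtains c :: "nat \<Rightarrow> real" where "AE x in lborel. x > 0 \<longrightarrow> pv_exists f x \<and>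
     v (of_real x) = ereal (x ^ (k + 1) * pv_int f x + (\<Sum>j\<le>k. x ^ j * c j))"
proof -
  define q where "q = nat \<lfloor>2 * p\<rfloor>"
  \<comment> \<open>The midpoint of \<open>p\<close> and \<open>(q + 1) / 2\<close>: above
    \<open>p\<close> for the moment of \<open>\<nu>\<close>, below
    \<open>(q + 1) / 2 \<le> k + 1\<close> for the kernel bound and the weight in
    \<open>t\<close>.\<close>
  define \<alpha> where "\<alpha> = (p + (real q + 1) / 2) / 2"
  have kp: "real k \<le> p" "p < real k + 1" using v(4) unfolding k_def by linarith+
  have qp: "real q \<le> 2 * p" "2 * p < real q + 1" using v(4) unfolding q_def by linarith+
  \<comment> \<open>So \<open>q\<close> is \<open>2 * k\<close> or \<open>2 * k + 1\<close>; this is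
    the only link needed between the two integer parts.\<close>
  have "q < 2 * k + 2" "2 * k < q + 1" using kp qp by linarith+
  hence qk: "(q + 1) div 2 = k \<or> (q + 1) div 2 = k + 1" by linarith+
  have q1: "real q + 1 \<le> 2 * (real k + 1)" using \<open>q < 2 * k + 2\<close> by simp
  have "4 * \<alpha> = 2 * p + (real q + 1)" by (simp add: \<alpha>_def)
  hence \<alpha>: "p < \<alpha>" "2 * \<alpha> < real q + 1" using qp by linarith+
  define G where "G = {z::complex. r0 \<le> cmod z}"
  define C where "C = (2 + real q) * 4 powr \<alpha>"
  note sets = riesz_sets(1)[OF rm]
  note [measurable_cong] = sets
  obtain B where B: "B \<ge> 0" "\<And>R. R \<ge> 1 \<Longrightarrow> emeasure \<nu> (cball 0 R) \<le> ennreal (B * R powr p)"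
    using riesz_growth[OF v rm] by metis
  have fin: "(\<integral>\<^sup>+ z. ennreal (cmod z powr (- \<alpha>)) \<partial>\<nu>) < \<infinity>"
    by (rule nn_integral_powr_finite[OF sets B(2) B(1) v(4) \<alpha>(1) r0])
  have GAE: "AE z in \<nu>. z \<in> G"
  proof (rule AE_I')
    show "ball 0 r0 \<in> null_sets \<nu>" by (rule null_setsI[OF r0(2)]) (simp add: sets)
    show "{z \<in> space \<nu>. z \<notin> G} \<subseteq> ball 0 r0" by (auto simp: G_def)
  qed
  have G0: "z \<noteq> 0" if "z \<in> G" for z using that r0 by (auto simp: G_def)
  have Vle: "psiV q z t \<le> C * (t powr \<alpha> * cmod z powr (- \<alpha>))" if "z \<in> G" "0 < t" for z t
    unfolding C_def using psiV_le[OF G0[OF that(1)] that(2)] qp \<alpha> by simp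
  interpret sigma_finite_measure \<nu> by (rule riesz_sigma_finite[OF rm])
  interpret pv_kernel \<nu> "psi q" "psiV q" C \<alpha> k G
  proof unfold_locales
    show "C \<ge> 0" by (simp add: C_def)
    show "real k < \<alpha>" using kp(1) \<alpha>(1) by simp
    have "2 * \<alpha> < 2 * (real k + 1)" using \<alpha>(2) q1 by (rule less_le_trans)
    thus "\<alpha> < real k + 1" by simp
  qed (rule sets GAE psi_meas psi_incr psi_abs Vle fin; assumption)+
  have Kern_lim: "(pv_trunc (\<lambda>t. psi q z t / t ^ (k + 1)) x \<longlongrightarrow> Kern k x z / x ^ (k + 1)) (at_right 0)"
    if "x > 0" "z \<in> G" "z \<noteq> of_real x" for x z
  proof (cases "z \<in> Rplus")
    case True
    hence z: "z = of_real (Re z)" "Re z \<ge> 0" by (auto simp: Rplus_iff complex_eq_iff)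
    have "Re z \<noteq> 0" using z(1) G0[OF that(2)] by (metis of_real_0)
    hence "Re z > 0" using z(2) by simp
    moreover have "Re z \<noteq> x" using that z by metis
    moreover have "psi q z = indicator {Re z..}" using True by (auto simp: psi_def)
    ultimately show ?thesis using pv_Rplus[of "Re z" x k] that z(1) by simp
  qed (use pv_off_Rplus that qk in blast)
  have ae: "AE x in lborel. x > 0 \<longrightarrow> emeasure \<nu> {of_real x} = 0 \<and> integrable \<nu> (\<lambda>z. Kern k x z / x ^ (k + 1)) \<and>
    (pv_trunc (\<lambda>t. (\<integral>z. psi q z t \<partial>\<nu>) / t ^ (k + 1)) x \<longlongrightarrow> (\<integral>z. Kern k x z / x ^ (k + 1) \<partial>\<nu>)) (at_right 0)"
    by (rule pv_AE[OF Kern_lim]) measurable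
  have bal: "bal_dist q \<nu> t = (\<integral>z. psi q z t \<partial>\<nu>)" if t: "t > 0" for t
  proof (rule bal_dist_eq[OF sets])
    show "integrable \<nu> (\<lambda>z. psi q z t)"
    proof (rule Bochner_Integration.integrable_bound)
      have "integrable \<nu> (\<lambda>z. cmod z powr (- \<alpha>))" by (rule integrableI_bounded) (use fin in auto)
      thus "integrable \<nu> (\<lambda>z. C * (t powr \<alpha> * cmod z powr (- \<alpha>)))" by (intro integrable_mult_right)
      show "(\<lambda>z. psi q z t) \<in> borel_measurable \<nu>" by measurable
      show "AE z in \<nu>. norm (psi q z t) \<le> norm (C * (t powr \<alpha> * cmod z powr (- \<alpha>)))"
        using GAE
      proof eventually_elim
        case (elim z)
        show ?case using order_trans[OF psi_abs Vle[OF elim t]] by (simp add: abs_le_iff)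
      qed
    qed
    show "emeasure \<nu> (cball 0 t) < \<infinity>" by (rule riesz_sets(3)[OF rm])
  qed (use t in simp)
  \<comment> \<open>The integral formula for \<open>bal_dist\<close> is at hand for
    \<open>t > 0\<close>, and truncated principal values see no other \<open>t\<close>.\<close>
  have pv_eq: "pv_trunc f x = pv_trunc (\<lambda>t. (\<integral>z. psi q z t \<partial>\<nu>) / t ^ (k + 1)) x" for x
  proof
    fix \<epsilon>
    show "pv_trunc f x \<epsilon> = pv_trunc (\<lambda>t. (\<integral>z. psi q z t \<partial>\<nu>) / t ^ (k + 1)) x \<epsilon>"
      unfolding pv_trunc_eq
    proof (intro Bochner_Integration.integral_cong refl)
      fix t
      show "indicator (pv_dom x \<epsilon>) t * (f t / (x - t)) = indicator (pv_dom x \<epsilon>) t * ((\<integral>z. psi q z t \<partial>\<nu>) / t ^ (k + 1) / (x - t))"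
        using bal[of t] by (cases "t > 0") (simp_all add: f_def k_def q_def)
    qed
  qed
  have "p < real (Suc k)" using kp by simp
  from representation[OF v rm r0 this] obtain c where
    c: "\<And>x. x > 0 \<Longrightarrow> integrable \<nu> (Kern k x) \<Longrightarrow> emeasure \<nu> {of_real x} = 0 \<Longrightarrow>
     v (of_real x) = ereal ((\<integral>z. Kern k x z \<partial>\<nu>) + (\<Sum>j\<le>k. x ^ j * c j))" by metis
  show thesis
  proof (rule that)
    show "AE x in lborel. x > 0 \<longrightarrow> pv_exists f x \<and>
     v (of_real x) = ereal (x ^ (k + 1) * pv_int f x + (\<Sum>j\<le>k. x ^ j * c j))"
      using ae
    proof (eventually_elim, intro impI)
      fix x :: real assume x: "x > 0"
      assume "x > 0 \<longrightarrow> emeasure \<nu> {of_real x} = 0 \<and> integrable \<nu> (\<lambda>z. Kern k x z / x ^ (k + 1)) \<and>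
        (pv_trunc (\<lambda>t. (\<integral>z. psi q z t \<partial>\<nu>) / t ^ (k + 1)) x \<longlongrightarrow> (\<integral>z. Kern k x z / x ^ (k + 1) \<partial>\<nu>)) (at_right 0)"
      with x have h: "emeasure \<nu> {of_real x} = 0" "integrable \<nu> (\<lambda>z. Kern k x z / x ^ (k + 1))"
        "(pv_trunc f x \<longlongrightarrow> (\<integral>z. Kern k x z / x ^ (k + 1) \<partial>\<nu>)) (at_right 0)" by (simp_all add: pv_eq)
      have xk: "x ^ (k + 1) \<noteq> 0" using x by simp
      have "integrable \<nu> (\<lambda>z. x ^ (k + 1) * (Kern k x z / x ^ (k + 1)))" by (intro integrable_mult_right h)
      hence "integrable \<nu> (Kern k x)" using xk by simp
      moreover have "pv_int f x = (\<integral>z. Kern k x z \<partial>\<nu>) / x ^ (k + 1)"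
        unfolding pv_int_def using tendsto_Lim[OF _ h(3)] by simp
      ultimately show "pv_exists f x \<and> v (of_real x) = ereal (x ^ (k + 1) * pv_int f x + (\<Sum>j\<le>k. x ^ j * c j))"
        using c[OF x _ h(1)] h(3) xk by (auto simp: pv_exists_def)
    qed
  qed
qed

section \<open>Exceptional sets and the polynomial part\<close>

lemma zero_rel_meas_Un_null:
  assumes E: "zero_rel_meas E" and N: "N \<in> null_sets lborel"
  shows "zero_rel_meas (E \<union> (N \<inter> {0..}))"
proof -
  have n: "N \<in> null_sets lebesgue" using N by (rule null_sets_completionI)
  have Es: "E \<in> sets lebesgue" "E \<subseteq> {0..}" using E by (simp_all add: zero_rel_meas_def)
  have "measure lebesgue ((E \<union> (N \<inter> {0..})) \<inter> {0..r}) = measure lebesgue (E \<inter> {0..r})" for r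
  proof -
    have "(E \<union> (N \<inter> {0..})) \<inter> {0..r} = (E \<inter> {0..r}) \<union> (N \<inter> {0..r})" by auto
    moreover have "N \<inter> {0..r} \<in> null_sets lebesgue" by (rule null_set_Int2[OF n]) auto
    moreover have "E \<inter> {0..r} \<in> sets lebesgue" using Es(1) by auto
    ultimately show ?thesis by (simp only: measure_Un_null_set)
  qed
  moreover have "N \<inter> {0..} \<in> sets lebesgue" using null_setsD2[OF n] by auto
  ultimately show ?thesis using E Es unfolding zero_rel_meas_def by auto
qed

text \<open>All degrees are at most \<open>k \<le> p\<close>, so a term survives only when
  \<open>p\<close> is an integer, and then it is the top one.\<close>

lemma polynomial_over_powr_tendsto:
  assumes "real k \<le> p"
  shows "((\<lambda>x. (\<Sum>j\<le>k. x ^ j * c j) / x powr p) \<longlongrightarrow> (\<Sum>j\<le>k. if real j = p then c j else 0)) at_top"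
proof -
  have "((\<lambda>x. x powr (real j - p) * c j) \<longlongrightarrow> (if real j = p then c j else 0)) at_top" if "j \<le> k" for j
  proof (cases "real j = p")
    case True
    have "\<forall>\<^sub>F x in at_top. x powr (real j - p) * c j = c j"
      using eventually_gt_at_top[of "0::real"] by eventually_elim (simp add: True)
    from tendsto_eventually[OF this] show ?thesis using True by simp
  next
    case False
    hence "real j - p < 0" using that assms by simp
    hence "((\<lambda>x. x powr (real j - p)) \<longlongrightarrow> 0) at_top" by (intro tendsto_neg_powr filterlim_ident)
    from tendsto_mult_right[OF this, of "c j"] show ?thesis using False by (simp add: mult.commute)
  qed
  hence "((\<lambda>x. \<Sum>j\<le>k. x powr (real j - p) * c j) \<longlongrightarrow> (\<Sum>j\<le>k. if real j = p then c j else 0)) at_top"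
    by (intro tendsto_sum) auto
  moreover have "\<forall>\<^sub>F x in at_top. (\<Sum>j\<le>k. x powr (real j - p) * c j) = (\<Sum>j\<le>k. x ^ j * c j) / x powr p"
    using eventually_gt_at_top[of "0::real"]
    by eventually_elim (simp add: sum_divide_distrib powr_diff powr_realpow)
  ultimately show ?thesis by (rule Lim_transform_eventually)
qed

theorem theorem9:
  fixes v :: "complex \<Rightarrow> ereal" and p :: real and \<nu> :: "complex measure"
  assumes "subharmonic v"
    and "\<exists>z. v z \<noteq> -\<infinity>"
    and "p > 0"
    and "finite_type_order v p"
    and "is_riesz_measure v \<nu>"
    and "0 \<notin> measure_support \<nu>"
  shows "crg_ray v p \<longleftrightarrow>
    (\<exists>E. zero_rel_meas E \<and>
       (let f = (\<lambda>t. bal_dist (nat \<lfloor>2 * p\<rfloor>) \<nu> t / t ^ (nat \<lfloor>p\<rfloor> + 1)) in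
         (\<forall>\<^sub>F x in inf at_top (principal (- E)). pv_exists f x) \<and>
         (\<exists>L::real. ((\<lambda>x. x powr (real (nat \<lfloor>p\<rfloor>) + 1 - p) * pv_int f x) \<longlongrightarrow> L)
                      (inf at_top (principal (- E))))))"
proof -
  define k where "k = nat \<lfloor>p\<rfloor>"
  define f where "f = (\<lambda>t. bal_dist (nat \<lfloor>2 * p\<rfloor>) \<nu> t / t ^ (nat \<lfloor>p\<rfloor> + 1))"
  define g where "g = (\<lambda>x. x powr (real k + 1 - p) * pv_int f x)"
  have kp: "real k \<le> p" using assms(3) unfolding k_def by linarith
  obtain r0 where r0: "r0 > 0" "emeasure \<nu> (ball 0 r0) = 0"
    using assms(6) by (auto simp: measure_support_def)
  obtain c where ae: "AE x in lborel. x > 0 \<longrightarrow> pv_exists f x \<and>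
     v (of_real x) = ereal (x ^ (k + 1) * pv_int f x + (\<Sum>j\<le>k. x ^ j * c j))"
    by (rule principal_value_representation[OF assms(1,2,4,3,5) r0, folded f_def, folded k_def])
  define S where "S = (\<lambda>x. (\<Sum>j\<le>k. x ^ j * c j) / x powr p)"
  obtain s where S: "(S \<longlongrightarrow> s) at_top" using polynomial_over_powr_tendsto[OF kp, of c] unfolding S_def by blast
  obtain N where N': "{x \<in> space lborel. \<not> (x > 0 \<longrightarrow> pv_exists f x \<and>
     v (of_real x) = ereal (x ^ (k + 1) * pv_int f x + (\<Sum>j\<le>k. x ^ j * c j)))} \<subseteq> N" "emeasure lborel N = 0" "N \<in> sets lborel"
    by (rule AE_E[OF ae])
  have N: "N \<in> null_sets lborel" using N'(2,3) by (rule null_setsI)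
  have Nx: "pv_exists f x \<and> v (of_real x) = ereal (x ^ (k + 1) * pv_int f x + (\<Sum>j\<le>k. x ^ j * c j))"
    if "x > 0" "x \<notin> N" for x
    using N'(1) that by auto
  \<comment> \<open>The filter at infinity off \<open>E\<close> enlarged by the null set
    \<open>N\<close>. It is finer than the filter off \<open>E\<close> and than
    \<open>at_top\<close>, so limits along either pass to it, and the enlarged set still has zero
    relative measure.\<close>
  define F where "F = (\<lambda>E. inf at_top (principal (- (E \<union> (N \<inter> {0..})))))"
  have F_le: "F E \<le> inf at_top (principal (- E))" and F_top: "F E \<le> at_top" for E :: "real set"
    unfolding F_def by (auto intro: le_infI2)
  have ev: "\<forall>\<^sub>F x in F E. pv_exists f x \<and> v (of_real x) / ereal (x powr p) = ereal (g x + S x)" for E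
    unfolding F_def eventually_inf_principal using eventually_gt_at_top[of "0::real"]
  proof (eventually_elim, intro impI)
    fix x :: real assume x: "x > 0" and "x \<in> - (E \<union> N \<inter> {0..})"
    hence n: "x \<notin> N" by auto
    have "x powr (real k + 1 - p) = x ^ (k + 1) / x powr p"
      using x powr_realpow[OF x, of "k + 1"] by (simp add: powr_diff add.commute)
    hence "(x ^ (k + 1) * pv_int f x + (\<Sum>j\<le>k. x ^ j * c j)) / x powr p = g x + S x"
      by (simp add: g_def S_def add_divide_distrib)
    thus "pv_exists f x \<and> v (of_real x) / ereal (x powr p) = ereal (g x + S x)"
      using Nx[OF x n] x by simp
  qed
  have "crg_ray v p \<longleftrightarrow> (\<exists>E. zero_rel_meas E \<and> (\<forall>\<^sub>F x in inf at_top (principal (- E)). pv_exists f x) \<and>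
         (\<exists>L. (g \<longlongrightarrow> L) (inf at_top (principal (- E)))))"
  proof
    assume "crg_ray v p"
    then obtain E L where E: "zero_rel_meas E"
      and L: "((\<lambda>x. v (complex_of_real x) / ereal (x powr p)) \<longlongrightarrow> ereal L) (inf at_top (principal (- E)))"
      unfolding crg_ray_def by blast
    have "((\<lambda>x. ereal (g x + S x)) \<longlongrightarrow> ereal L) (F E)"
      by (rule Lim_transform_eventually[OF tendsto_mono[OF F_le L]]) (use ev[of E] in \<open>auto elim: eventually_mono\<close>)
    hence "((\<lambda>x. g x + S x - S x) \<longlongrightarrow> L - s) (F E)"
      by (intro tendsto_diff tendsto_mono[OF F_top S]) simp
    hence "(g \<longlongrightarrow> L - s) (F E)" by simp
    \<comment> \<open>Regular growth of \<open>v\<close> says nothing about principal values; their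
      existence is gained by discarding \<open>N\<close>.\<close>
    moreover have "\<forall>\<^sub>F x in F E. pv_exists f x" using ev[of E] by (auto elim: eventually_mono)
    ultimately show "\<exists>E. zero_rel_meas E \<and> (\<forall>\<^sub>F x in inf at_top (principal (- E)). pv_exists f x) \<and>
         (\<exists>L. (g \<longlongrightarrow> L) (inf at_top (principal (- E))))"
      using zero_rel_meas_Un_null[OF E N] unfolding F_def by blast
  next
    assume "\<exists>E. zero_rel_meas E \<and> (\<forall>\<^sub>F x in inf at_top (principal (- E)). pv_exists f x) \<and>
         (\<exists>L. (g \<longlongrightarrow> L) (inf at_top (principal (- E))))"
    then obtain E L where E: "zero_rel_meas E" and L: "(g \<longlongrightarrow> L) (inf at_top (principal (- E)))" by blast
    have "((\<lambda>x. g x + S x) \<longlongrightarrow> L + s) (F E)"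
      by (intro tendsto_add tendsto_mono[OF F_le L] tendsto_mono[OF F_top S])
    hence "((\<lambda>x. ereal (g x + S x)) \<longlongrightarrow> ereal (L + s)) (F E)" by simp
    moreover have "\<forall>\<^sub>F x in F E. ereal (g x + S x) = v (of_real x) / ereal (x powr p)"
      using ev[of E] by (auto elim: eventually_mono)
    ultimately have "((\<lambda>x. v (of_real x) / ereal (x powr p)) \<longlongrightarrow> ereal (L + s)) (F E)"
      by (rule Lim_transform_eventually)
    thus "crg_ray v p" using zero_rel_meas_Un_null[OF E N] unfolding crg_ray_def F_def by blast
  qed
  thus ?thesis unfolding g_def f_def k_def Let_def .
qed

end
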